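(* Let $a$ satisfy the standing assumptions (i)-(iii) of the context and let $\beta>0$ be given. Then for any $(u_0,u_1)\in\mathcal H_\beta$, the solution $u$ of the boundary-damped degenerate wave problem described in the context satisfies the uniform exponential decay $$E_u(t)\leqslant E_u(0)\,e^{1-t/M_{a,\beta}}\qquad\forall\,t\in[M_{a,\beta},+\infty),$$ where $M_{a,\beta}>0$ is independent of $(u_0,u_1)$ and is given by $$M_{a,\beta}=\frac2{2-\mu_a}\Big[2C_a''+\frac{\eta_1}{a(1)}+\frac{\eta_2^2\big(1+\frac1{\beta^3}\big)}{2-\mu_a}\Big(1+\frac1{\beta\alpha_a}\Big)+\frac{2\eta_2}{\beta\sqrt{\alpha_a}}\Big],$$ with $$\eta_1=1+\tfrac32a(1),\qquad \eta_2=\beta(1+\beta-\mu_a)+\tfrac12\Big(2\beta-\frac{\mu_a}2\Big)^2,\qquad C_a'=\frac1{a(1)}\min\Big\{4,\frac2{2-\mu_a}\Big\},$$ $$\alpha_a=\min\Big\{\frac1{C_a'},\frac{\beta a(1)}2\Big\},\qquad C_a''=2\max\Big\{1+\frac{\mu_a}4,\ \frac1{a(1)}+\frac{\mu_a}4C_a',\ \frac{\mu_a}{2\beta a(1)}\Big\}.$$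
   Context: Standing assumptions on $a$: $a\in C([0,1])\cap C^1(]0,1])$ and (i) $a(x)>0$ for all $x\in]0,1]$, $a(0)=0$; (ii) $\mu_a:=\sup_{0<x\leqslant 1}\frac{x|a'(x)|}{a(x)}<2$; (iii) $a\in C^{[\mu_a]}([0,1])$, where $[\cdot]$ is the integer part. Problem: $u_{tt}-(a(x)u_x)_x=0$ for $t>0$, $x\in]0,1[$, with $u_t(t,1)+u_x(t,1)+\beta u(t,1)=0$; $u(t,0)=0$ if $\mu_a\in[0,1[$, $\lim_{x\downarrow0}a(x)u_x(t,x)=0$ if $\mu_a\in[1,2[$; $u(0,x)=u_0(x)$, $u_t(0,x)=u_1(x)$. Spaces: $V^1_a(0,1)$ is the space of $u\in L^2(0,1)$ locally absolutely continuous in $]0,1]$ with $\sqrt a\,u'\in L^2(0,1)$. $W^1_a(0,1)=V^1_a(0,1)$ if $\mu_a\in[1,2[$, and $W^1_a(0,1)=\{u\in V^1_a(0,1):u(0)=0\}$ if $\mu_a\in[0,1[$. $W^2_a(0,1)=\{u\in W^1_a(0,1):au'\in H^1(0,1)\}$. $\mathcal H_\beta=W^1_a(0,1)\times L^2(0,1)$ with scalar product $\langle(u,v),(\tilde u,\tilde v)\rangle=\int_0^1(v\tilde v+au'\tilde u')dx+a(1)\beta u(1)\tilde u(1)$. Solution: $A_\beta(u,v)=(v,(au')')$ with $D(A_\beta)=\{(u,v)\in W^2_a(0,1)\times W^1_a(0,1):u'(1)+v(1)+\beta u(1)=0\}$ generates a contraction semigroup on $\mathcal H_\beta$; the solution $u$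 for data $(u_0,u_1)\in\mathcal H_\beta$ is the first component of $e^{tA_\beta}(u_0,u_1)$, the second component being $u_t$. Energy: $E_u(t)=\frac12\Big[\int_0^1(u_t^2+au_x^2)dx+\beta a(1)u^2(t,1)\Big]$. *)

theory Defs
  imports "HOL-Analysis.Analysis"
begin

subsection \<open>The coefficient\<close>

primrec C_on :: "nat \<Rightarrow> real set \<Rightarrow> (real \<Rightarrow> real) \<Rightarrow> bool" where
  "C_on 0 S f \<longleftrightarrow> continuous_on S f"
| "C_on (Suc k) S f \<longleftrightarrow>
     (\<exists>f'. (\<forall>x\<in>S. (f has_real_derivative f' x) (at x within S)) \<and> C_on k S f')"

text \<open>The derivative on \<open>]0,1]\<close>: two-sided at interior points, one-sided at \<open>1\<close>.
  All functions are of type \<open>real \<Rightarrow> real\<close>, but only their values on \<open>]0,1]\<close> matter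
  (and on \<open>[0,1]\<close> for the coefficient).\<close>

definition D :: "(real \<Rightarrow> real) \<Rightarrow> real \<Rightarrow> real" where
  "D f x = vector_derivative f (at x within {0<..1})"

definition mu :: "(real \<Rightarrow> real) \<Rightarrow> real" where
  "mu a = (SUP x\<in>{0<..1}. x * \<bar>D a x\<bar> / a x)"

text \<open>The boundedness clause says that the supremum defining \<open>\<mu>\<^sub>a\<close> is finite; a real
  \<open>SUP\<close> of an unbounded family would be a junk value.\<close>

definition admissible :: "(real \<Rightarrow> real) \<Rightarrow> bool" where
  "admissible a \<longleftrightarrow>
     C_on 0 {0..1} a \<and> C_on 1 {0<..1} a \<and>
     (\<forall>x\<in>{0<..1}. a x > 0) \<and> a 0 = 0 \<and>
     bdd_above ((\<lambda>x. x * \<bar>D a x\<bar> / a x) ` {0<..1}) \<and> mu a < 2 \<and>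
     C_on (nat \<lfloor>mu a\<rfloor>) {0..1} a"

subsection \<open>Function spaces\<close>

text \<open>Elements of the spaces are represented by functions; \<open>eqH\<close> below is equality
  of the elements represented.\<close>

abbreviation I01 :: "real measure" where
  "I01 \<equiv> lebesgue_on {0<..<1}"

definition L2 :: "(real \<Rightarrow> real) \<Rightarrow> bool" where
  "L2 f \<longleftrightarrow> f \<in> borel_measurable I01 \<and> integrable I01 (\<lambda>x. (f x)\<^sup>2)"

definition abs_cont_on :: "real \<Rightarrow> real \<Rightarrow> (real \<Rightarrow> real) \<Rightarrow> bool" where
  "abs_cont_on c d f \<longleftrightarrow>
     (\<forall>\<epsilon>>0. \<exists>\<delta>>0. \<forall>(n::nat) l r.
        (\<forall>i<n. c \<le> l i \<and> l i \<le> r i \<and> r i \<le> d) \<and>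
        (\<forall>i<n. \<forall>j<n. i \<noteq> j \<longrightarrow> {l i<..<r i} \<inter> {l j<..<r j} = {}) \<and>
        (\<Sum>i<n. r i - l i) < \<delta>
        \<longrightarrow> (\<Sum>i<n. \<bar>f (r i) - f (l i)\<bar>) < \<epsilon>)"

definition V1 :: "(real \<Rightarrow> real) \<Rightarrow> (real \<Rightarrow> real) set" where
  "V1 a = {u. L2 u \<and> (\<forall>c\<in>{0<..1}. abs_cont_on c 1 u) \<and> L2 (\<lambda>x. sqrt (a x) * D u x)}"

text \<open>For \<open>\<mu>\<^sub>a < 1\<close> a member of \<open>V1 a\<close> has a limit at \<open>0\<close>; the condition \<open>u(0) = 0\<close>
  refers to this limit and not to the value of the representative at \<open>0\<close>.\<close>

definition W1 :: "(real \<Rightarrow> real) \<Rightarrow> (real \<Rightarrow> real) set" where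
  "W1 a = {u \<in> V1 a. mu a < 1 \<longrightarrow> (u \<longlongrightarrow> 0) (at_right 0)}"

definition test_fun :: "(real \<Rightarrow> real) \<Rightarrow> bool" where
  "test_fun \<phi> \<longleftrightarrow> C_on 1 UNIV \<phi> \<and> compact (closure {x. \<phi> x \<noteq> 0}) \<and>
     closure {x. \<phi> x \<noteq> 0} \<subseteq> {0<..<1}"

text \<open>\<open>g\<close> is the weak derivative of \<open>w\<close> in \<open>L\<^sup>2(0,1)\<close>, so that \<open>H\<^sup>1(0,1)\<close> is the set of
  those \<open>w\<close> which have one.\<close>

definition weak_deriv :: "(real \<Rightarrow> real) \<Rightarrow> (real \<Rightarrow> real) \<Rightarrow> bool" where
  "weak_deriv w g \<longleftrightarrow> L2 g \<and>
     (\<forall>\<phi>. test_fun \<phi> \<longrightarrow> (LINT x|I01. w x * deriv \<phi> x) = - (LINT x|I01. g x * \<phi> x))"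

definition H1 :: "(real \<Rightarrow> real) set" where
  "H1 = {w. L2 w \<and> (\<exists>g. weak_deriv w g)}"

definition wD :: "(real \<Rightarrow> real) \<Rightarrow> real \<Rightarrow> real" where
  "wD w = (SOME g. weak_deriv w g)"

definition W2 :: "(real \<Rightarrow> real) \<Rightarrow> (real \<Rightarrow> real) set" where
  "W2 a = {u \<in> W1 a. (\<lambda>x. a x * D u x) \<in> H1}"

subsection \<open>The energy space\<close>

type_synonym state = "(real \<Rightarrow> real) \<times> (real \<Rightarrow> real)"

definition Hsp :: "(real \<Rightarrow> real) \<Rightarrow> state set" where
  "Hsp a = W1 a \<times> {v. L2 v}"

text \<open>Two functions continuous on \<open>]0,1]\<close> that agree almost everywhere agree on \<open>]0,1]\<close>,
  so the first components are compared pointwise there.\<close>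

definition eqH :: "state \<Rightarrow> state \<Rightarrow> bool" where
  "eqH U W \<longleftrightarrow> (\<forall>x\<in>{0<..1}. fst U x = fst W x) \<and> (AE x in I01. snd U x = snd W x)"

definition lincomb :: "real \<Rightarrow> state \<Rightarrow> real \<Rightarrow> state \<Rightarrow> state" where
  "lincomb r U s W = (\<lambda>x. r * fst U x + s * fst W x, \<lambda>x. r * snd U x + s * snd W x)"

definition ipH :: "(real \<Rightarrow> real) \<Rightarrow> real \<Rightarrow> state \<Rightarrow> state \<Rightarrow> real" where
  "ipH a \<beta> U W =
     (LINT x|I01. snd U x * snd W x + a x * D (fst U) x * D (fst W) x)
     + a 1 * \<beta> * fst U 1 * fst W 1"

definition normH :: "(real \<Rightarrow> real) \<Rightarrow> real \<Rightarrow> state \<Rightarrow> real" where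
  "normH a \<beta> U = sqrt (ipH a \<beta> U U)"

subsection \<open>The operator and its semigroup\<close>

definition domA :: "(real \<Rightarrow> real) \<Rightarrow> real \<Rightarrow> state set" where
  "domA a \<beta> = {(u, v). u \<in> W2 a \<and> v \<in> W1 a \<and> D u 1 + v 1 + \<beta> * u 1 = 0}"

definition opA :: "(real \<Rightarrow> real) \<Rightarrow> state \<Rightarrow> state" where
  "opA a U = (snd U, wD (\<lambda>x. a x * D (fst U) x))"

definition contraction_semigroup ::
    "(real \<Rightarrow> real) \<Rightarrow> real \<Rightarrow> (real \<Rightarrow> state \<Rightarrow> state) \<Rightarrow> bool" where
  "contraction_semigroup a \<beta> S \<longleftrightarrow>
     (\<forall>t\<ge>0. \<forall>U\<in>Hsp a. S t U \<in> Hsp a) \<and>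
     (\<forall>t\<ge>0. \<forall>U\<in>Hsp a. \<forall>W\<in>Hsp a. \<forall>r s.
        eqH (S t (lincomb r U s W)) (lincomb r (S t U) s (S t W))) \<and>
     (\<forall>t\<ge>0. \<forall>U\<in>Hsp a. normH a \<beta> (S t U) \<le> normH a \<beta> U) \<and>
     (\<forall>U\<in>Hsp a. eqH (S 0 U) U) \<and>
     (\<forall>t\<ge>0. \<forall>s\<ge>0. \<forall>U\<in>Hsp a. eqH (S (t + s) U) (S t (S s U))) \<and>
     (\<forall>U\<in>Hsp a. ((\<lambda>t. normH a \<beta> (lincomb 1 (S t U) (-1) U)) \<longlongrightarrow> 0) (at_right 0))"

text \<open>The infinitesimal generator of \<open>S\<close>, with its domain, is \<open>A\<^sub>\<beta>\<close>: the difference quotient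
  \<open>(S(h)U - U)/h\<close> converges to \<open>F\<close> as \<open>h \<down> 0\<close> iff \<open>U \<in> D(A\<^sub>\<beta>)\<close> and \<open>A\<^sub>\<beta> U = F\<close>.  The
  representative \<open>W\<close> is needed because membership in \<open>domA\<close> is a condition on
  representatives (continuity of the second component).\<close>

definition generated_by_A ::
    "(real \<Rightarrow> real) \<Rightarrow> real \<Rightarrow> (real \<Rightarrow> state \<Rightarrow> state) \<Rightarrow> bool" where
  "generated_by_A a \<beta> S \<longleftrightarrow>
     (\<forall>U\<in>Hsp a. \<forall>F\<in>Hsp a.
        ((\<lambda>h. normH a \<beta> (lincomb 1 (lincomb (1/h) (S h U) (-1/h) U) (-1) F)) \<longlongrightarrow> 0) (at_right 0)
        \<longleftrightarrow> (\<exists>W\<in>domA a \<beta>. eqH W U \<and> eqH (opA a W) F))"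

text \<open>\<open>u t\<close> and \<open>v t\<close> represent \<open>u(t,\<cdot>)\<close> and \<open>u\<^sub>t(t,\<cdot>)\<close>.\<close>

definition is_solution ::
    "(real \<Rightarrow> real) \<Rightarrow> real \<Rightarrow> (real \<Rightarrow> real) \<Rightarrow> (real \<Rightarrow> real) \<Rightarrow>
     (real \<Rightarrow> real \<Rightarrow> real) \<Rightarrow> (real \<Rightarrow> real \<Rightarrow> real) \<Rightarrow> bool" where
  "is_solution a \<beta> u0 u1 u v \<longleftrightarrow>
     (\<exists>S. contraction_semigroup a \<beta> S \<and> generated_by_A a \<beta> S \<and>
          (\<forall>t\<ge>0. (u t, v t) = S t (u0, u1)))"

definition energy ::
    "(real \<Rightarrow> real) \<Rightarrow> real \<Rightarrow> (real \<Rightarrow> real \<Rightarrow> real) \<Rightarrow> (real \<Rightarrow> real \<Rightarrow> real) \<Rightarrow> real \<Rightarrow> real" where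
  "energy a \<beta> u v t =
     1/2 * ((LINT x|I01. (v t x)\<^sup>2 + a x * (D (u t) x)\<^sup>2) + \<beta> * a 1 * (u t 1)\<^sup>2)"

subsection \<open>The constants\<close>

definition eta1 :: "(real \<Rightarrow> real) \<Rightarrow> real" where
  "eta1 a = 1 + 3/2 * a 1"

definition eta2 :: "(real \<Rightarrow> real) \<Rightarrow> real \<Rightarrow> real" where
  "eta2 a \<beta> = \<beta> * (1 + \<beta> - mu a) + 1/2 * (2 * \<beta> - mu a / 2)\<^sup>2"

definition C1 :: "(real \<Rightarrow> real) \<Rightarrow> real" where
  "C1 a = 1 / a 1 * min 4 (2 / (2 - mu a))"

definition alpha :: "(real \<Rightarrow> real) \<Rightarrow> real \<Rightarrow> real" where
  "alpha a \<beta> = min (1 / C1 a) (\<beta> * a 1 / 2)"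

definition C2 :: "(real \<Rightarrow> real) \<Rightarrow> real \<Rightarrow> real" where
  "C2 a \<beta> = 2 * Max {1 + mu a / 4, 1 / a 1 + mu a / 4 * C1 a, mu a / (2 * \<beta> * a 1)}"

definition M :: "(real \<Rightarrow> real) \<Rightarrow> real \<Rightarrow> real" where
  "M a \<beta> = 2 / (2 - mu a) *
     (2 * C2 a \<beta> + eta1 a / a 1
      + (eta2 a \<beta>)\<^sup>2 * (1 + 1 / \<beta>^3) / (2 - mu a) * (1 + 1 / (\<beta> * alpha a \<beta>))
      + 2 * eta2 a \<beta> / (\<beta> * sqrt (alpha a \<beta>)))"

end

theory Submission
  imports Defs
begin

text \<open>
  Along a regular orbit \<open>(u, v)\<close> the energy satisfies \<open>E' = - a(1) v(1)\<^sup>2\<close>.  Testing the equation with the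
  multiplier \<open>x u\<^sub>x + \<mu>/4 u + \<eta>/2 u(1) \<zeta>\<close>, where \<open>\<zeta>\<close> solves \<open>(a \<zeta>')' = 0\<close> with the boundary condition of the
  problem at \<open>0\<close> and \<open>\<zeta>'(1) + \<beta> \<zeta>(1) = 1\<close>, gives a quadratic form \<open>b\<close>, bounded by a multiple of the
  energy, whose derivative is at most \<open>-(2 - \<mu>)/2 E\<close> up to boundary terms: a multiple of \<open>v(1)\<^sup>2\<close>, which
  is controlled by \<open>-E'\<close>, and the term \<open>a(1) (eta2 - \<eta>)/2 u(1)\<^sup>2\<close>, which \<open>\<eta> = eta2\<close> removes at the price
  of one product that is split by Young's inequality.  If \<open>eta2 < 0\<close>, then \<open>\<eta> = 0\<close> already works.  Hence
  the integral of \<open>E\<close> over \<open>[s, t]\<close> is at most \<open>M E(s)\<close> for all \<open>s \<le> t\<close>, which for a nonincreasing \<open>E\<close> is the asserted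
  decay.  Data in the domain of the generator are dense in the energy space.

  Integration by parts for functions that are only absolutely continuous rests on Lebesgue's
  theorem that they are differentiable almost everywhere and are the integral of their derivative.
\<close>

subsection \<open>Absolutely continuous functions\<close>

text \<open>The feedback dissipates \<open>v(1)^2\<close> only, while the multiplier
  \<open>x u_x\<close> also leaves a multiple of \<open>u(1)^2\<close>. The flux of
  \<open>\<zeta>\<close> is the constant \<open>a(1) (1 - \<beta> \<zeta>(1))\<close>; Green's
  formula and the boundary condition therefore turn the \<open>\<zeta>\<close>-term into
  \<open>- a(1) u(1)^2\<close> plus products with \<open>v(1)\<close>. The summand
  \<open>\<mu>/4 u\<close> gives kinetic and elastic energy the same coefficient
  \<open>-(2 - \<mu>)/4\<close>. Young's inequality is weighted so that it costs exactly half of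
  this rate, and \<open>M\<close> is what then comes out. Near 0 nothing is known beyond
  integrability. Boundary terms there are shown to have a limit, and the limit is 0 by the condition
  at 0 or because \<open>1/x\<close> is not integrable. In time, no derivative of the energy or of
  \<open>b\<close> is ever formed. For data in the domain the error of the difference quotient at
  time \<open>t\<close> is at most the one at time 0, since the semigroup consists of contractions.
  So increments over a step \<open>h\<close> are known up to an error \<open>h * R h\<close> uniform
  in \<open>t\<close>, with \<open>R h\<close> tending to 0, and these errors add up to 0 as an
  interval is subdivided.\<close>

lemma abs_cont_on_indexed:
  assumes "abs_cont_on a b f" "\<epsilon> > 0"
  shows "\<exists>\<delta>>0. \<forall>(P::'i set) l r. finite P \<and> (\<forall>i\<in>P. a \<le> l i \<and> l i \<le> r i \<and> r i \<le> b) \<and>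
       (\<forall>i\<in>P. \<forall>j\<in>P. i \<noteq> j \<longrightarrow> {l i<..<r i} \<inter> {l j<..<r j} = {}) \<and>
       (\<Sum>i\<in>P. r i - l i) < \<delta> \<longrightarrow> (\<Sum>i\<in>P. \<bar>f (r i) - f (l i)\<bar>) < \<epsilon>"
proof -
  obtain \<delta> where "\<delta> > 0" and d: "\<forall>(n::nat) l r.
        (\<forall>i<n. a \<le> l i \<and> l i \<le> r i \<and> r i \<le> b) \<and>
        (\<forall>i<n. \<forall>j<n. i \<noteq> j \<longrightarrow> {l i<..<r i} \<inter> {l j<..<r j} = {}) \<and>
        (\<Sum>i<n. r i - l i) < \<delta>
        \<longrightarrow> (\<Sum>i<n. \<bar>f (r i) - f (l i)\<bar>) < \<epsilon>"
    using assms(1)[unfolded abs_cont_on_def, THEN spec, THEN mp, OF assms(2)] by (elim exE conjE) (rule that)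
  show ?thesis
  proof (intro exI[of _ \<delta>] conjI allI impI \<open>\<delta> > 0\<close>)
    fix P :: "'i set" and l r
    assume P: "finite P \<and> (\<forall>i\<in>P. a \<le> l i \<and> l i \<le> r i \<and> r i \<le> b) \<and>
       (\<forall>i\<in>P. \<forall>j\<in>P. i \<noteq> j \<longrightarrow> {l i<..<r i} \<inter> {l j<..<r j} = {}) \<and>
       (\<Sum>i\<in>P. r i - l i) < \<delta>"
    then obtain h where h: "bij_betw h {..<card P} P"
      using ex_bij_betw_nat_finite[of P] atLeast0LessThan by auto
    have s: "(\<Sum>i\<in>P. g i) = (\<Sum>i<card P. g (h i))" for g :: "'i \<Rightarrow> real"
      using sum.reindex_bij_betw[OF h, of g] by simp
    have hP: "h i \<in> P" if "i < card P" for i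
      using h that by (auto simp: bij_betw_def)
    have hinj: "h i \<noteq> h j" if "i < card P" "j < card P" "i \<noteq> j" for i j
      using h that by (auto simp: bij_betw_def inj_on_def)
    show "(\<Sum>i\<in>P. \<bar>f (r i) - f (l i)\<bar>) < \<epsilon>"
      unfolding s
      by (rule d[rule_format, of "card P" "l \<circ> h" "r \<circ> h", unfolded comp_def])
         (use P hP hinj s in auto)
  qed
qed

lemma abs_cont_on_subset:
  assumes "abs_cont_on a b f" "a \<le> c" "d \<le> b"
  shows "abs_cont_on c d f"
  unfolding abs_cont_on_def
proof (intro allI impI)
  fix \<epsilon> :: real assume e: "\<epsilon> > 0"
  obtain \<delta> where "\<delta> > 0" and d: "\<forall>(n::nat) l r.
        (\<forall>i<n. a \<le> l i \<and> l i \<le> r i \<and> r i \<le> b) \<and>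
        (\<forall>i<n. \<forall>j<n. i \<noteq> j \<longrightarrow> {l i<..<r i} \<inter> {l j<..<r j} = {}) \<and>
        (\<Sum>i<n. r i - l i) < \<delta>
        \<longrightarrow> (\<Sum>i<n. \<bar>f (r i) - f (l i)\<bar>) < \<epsilon>"
    using assms(1)[unfolded abs_cont_on_def, THEN spec, THEN mp, OF e] by (elim exE conjE) (rule that)
  have *: "\<forall>i<n. a \<le> l i \<and> l i \<le> r i \<and> r i \<le> b" if "\<forall>i<n. c \<le> l i \<and> l i \<le> r i \<and> r i \<le> d"
    for n :: nat and l r :: "nat \<Rightarrow> real"
    using that assms(2,3) by force
  show "\<exists>\<delta>>0. \<forall>(n::nat) l r.
        (\<forall>i<n. c \<le> l i \<and> l i \<le> r i \<and> r i \<le> d) \<and>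
        (\<forall>i<n. \<forall>j<n. i \<noteq> j \<longrightarrow> {l i<..<r i} \<inter> {l j<..<r j} = {}) \<and>
        (\<Sum>i<n. r i - l i) < \<delta>
        \<longrightarrow> (\<Sum>i<n. \<bar>f (r i) - f (l i)\<bar>) < \<epsilon>"
  proof (intro exI[of _ \<delta>] conjI[OF \<open>\<delta> > 0\<close>] allI impI)
    fix n :: nat and l r :: "nat \<Rightarrow> real"
    assume A: "(\<forall>i<n. c \<le> l i \<and> l i \<le> r i \<and> r i \<le> d) \<and>
        (\<forall>i<n. \<forall>j<n. i \<noteq> j \<longrightarrow> {l i<..<r i} \<inter> {l j<..<r j} = {}) \<and>
        (\<Sum>i<n. r i - l i) < \<delta>"
    then show "(\<Sum>i<n. \<bar>f (r i) - f (l i)\<bar>) < \<epsilon>"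
      by (intro d[THEN spec, THEN spec, THEN spec, THEN mp] conjI *) (elim conjE, assumption)+
  qed
qed

text \<open>Tagging each piece \<open>K\<close> with \<open>Inf K\<close> makes the division a
  tagged division, for which increments telescope.\<close>

lemma division_increment:
  fixes f :: "real \<Rightarrow> real"
  assumes "q division_of {l..r}" "l \<le> r"
  shows "(\<Sum>K\<in>q. f (Sup K) - f (Inf K)) = f r - f l"
proof -
  note q = division_ofD[OF assms(1)]
  have I: "Inf K \<in> K" if Kq: "K \<in> q" for K
  proof -
    obtain u v where "K = {u..v}" "K \<noteq> {}" using q(3)[OF Kq] q(4)[OF Kq] by (auto simp: box_real)
    then show ?thesis by auto
  qed
  have "(\<lambda>K. (Inf K, K)) ` q tagged_division_of {l..r}"
    unfolding tagged_division_of
  proof (intro conjI allI impI)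
    show "finite ((\<lambda>K. (Inf K, K)) ` q)" using q(1) by simp
    have "{K. \<exists>x. (x, K) \<in> (\<lambda>K. (Inf K, K)) ` q} = q" by auto
    then show "\<Union> {K. \<exists>x. (x, K) \<in> (\<lambda>K. (Inf K, K)) ` q} = {l..r}" using q(6) by simp
    fix x1 K1 x2 K2
    assume "(x1, K1) \<in> (\<lambda>K. (Inf K, K)) ` q \<and> (x2, K2) \<in> (\<lambda>K. (Inf K, K)) ` q \<and> (x1, K1) \<noteq> (x2, K2)"
    then have "K1 \<in> q" "K2 \<in> q" "K1 \<noteq> K2" by auto
    then show "interior K1 \<inter> interior K2 = {}" by (rule q(5))
  qed (use I q(2,4) in auto)
  from additive_tagged_division_1[OF assms(2) this, of f]
  show ?thesis by (subst (asm) sum.reindex) (auto simp: inj_on_def)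
qed

lemma division_interval:
  fixes a b :: real
  assumes "a \<le> b" "q division_of {a..b}" "K \<in> q"
  shows "a \<le> Inf K \<and> Inf K \<le> Sup K \<and> Sup K \<le> b \<and> K = {Inf K..Sup K} \<and> interior K = {Inf K<..<Sup K}"
proof -
  obtain l r where K: "K = {l..r}" "K \<noteq> {}" "K \<subseteq> {a..b}"
    using division_ofD(2,3,4)[OF assms(2,3)] by (metis (no_types) box_real(2))
  then have "l \<le> r" by auto
  then show ?thesis using K by (auto simp: interior_atLeastAtMost_real)
qed

section \<open>Outer measure and Vitali covers by intervals\<close>

lemma measure_disjoint_intervals:
  fixes l r :: "'i \<Rightarrow> real"
  assumes "finite P" "\<And>i. i \<in> P \<Longrightarrow> l i \<le> r i"
    "\<And>i j. \<lbrakk>i \<in> P; j \<in> P; i \<noteq> j\<rbrakk> \<Longrightarrow> {l i<..<r i} \<inter> {l j<..<r j} = {}"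
  shows "measure lebesgue (\<Union>i\<in>P. {l i<..<r i}) = (\<Sum>i\<in>P. r i - l i)"
proof -
  have d: "pairwise (\<lambda>i j. AE x in lebesgue. x \<notin> {l i<..<r i} \<or> x \<notin> {l j<..<r j}) P"
    using assms(3) by (intro pairwiseI AE_I2) blast
  have "measure lebesgue (\<Union>i\<in>P. {l i<..<r i}) = (\<Sum>i\<in>P. measure lebesgue {l i<..<r i})"
    using d assms(1) by (intro measure_UNION_AE) auto
  also have "\<dots> = (\<Sum>i\<in>P. r i - l i)"
    using assms by (intro sum.cong) (auto simp: measure_def emeasure_lborel_Ioo)
  finally show ?thesis .
qed

text \<open>Lebesgue outer measure, for bounded sets, so that the infimum is over a nonempty family.
  The exceptional sets of slopes below are not known to be measurable beforehand.\<close>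

definition outer :: "real set \<Rightarrow> real" where
  "outer S = Inf (measure lebesgue ` {T. S \<subseteq> T \<and> T \<in> lmeasurable})"

lemma outer_le: "S \<subseteq> T \<Longrightarrow> T \<in> lmeasurable \<Longrightarrow> outer S \<le> measure lebesgue T"
  unfolding outer_def by (rule cInf_lower) (auto intro!: bdd_belowI[of _ 0])

lemma outer_open_cover:
  assumes "S \<subseteq> {a<..<b}" "e > 0"
  obtains G where "open G" "S \<subseteq> G" "G \<subseteq> {a<..<b}" "G \<in> lmeasurable"
    "measure lebesgue G < outer S + e"
proof -
  have ne: "measure lebesgue ` {T. S \<subseteq> T \<and> T \<in> lmeasurable} \<noteq> {}"
    using assms(1) by (auto intro!: exI[of _ "{a<..<b}"])
  obtain T where T: "S \<subseteq> T" "T \<in> lmeasurable" "measure lebesgue T < outer S + e/2"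
    using cInf_lessD[OF ne, of "outer S + e/2"] assms(2) unfolding outer_def by auto
  obtain H where H: "open H" "T \<subseteq> H" "H - T \<in> lmeasurable" "emeasure lebesgue (H - T) < ennreal (e/2)"
    using sets_lebesgue_outer_open[of T "e/2"] T(2) assms(2) by (auto simp: fmeasurableD)
  have mH: "measure lebesgue (H - T) < e/2"
    using H(3,4) assms(2) by (simp add: emeasure_eq_measure2 ennreal_less_iff)
  have HT: "H = T \<union> (H - T)" using H(2) by auto
  have HM: "H \<in> lmeasurable" by (subst HT) (use T H in blast)
  have "measure lebesgue H \<le> measure lebesgue T + measure lebesgue (H - T)"
    by (subst HT) (intro measure_Un_le, use T H in auto)
  then have "measure lebesgue H < outer S + e" using mH T(3) by simp
  moreover have "measure lebesgue (H \<inter> {a<..<b}) \<le> measure lebesgue H"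
    using HM by (intro measure_mono_fmeasurable) auto
  ultimately show ?thesis
    using H HM T assms by (intro that[of "H \<inter> {a<..<b}"]) (auto intro: fmeasurable_Int_fmeasurable)
qed

lemma negligible_outer_zero:
  assumes "S \<subseteq> {a<..<b}" "outer S \<le> 0"
  shows "negligible S"
  unfolding negligible_outer
proof (intro allI impI)
  fix e :: real assume "e > 0"
  then obtain G where "S \<subseteq> G" "G \<in> lmeasurable" "measure lebesgue G < outer S + e"
    using outer_open_cover[OF assms(1)] by metis
  then show "\<exists>T. S \<subseteq> T \<and> T \<in> lmeasurable \<and> measure lebesgue T < e"
    using assms(2) by (intro exI[of _ G]) auto
qed

text \<open>Closed intervals are the closed balls of the line, so Vitali's theorem gives a countable
  disjoint family that covers \<open>S\<close> up to a null set. Its union lies in \<open>G\<close>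
  and has finite measure, hence finitely many members already exhaust it up to
  \<open>\<epsilon>\<close>.\<close>

lemma Vitali_interval_cover:
  fixes S G :: "real set"
  assumes "open G" "G \<in> lmeasurable" "S \<subseteq> G" "\<epsilon> > 0"
    and cover: "\<And>x d. \<lbrakk>x \<in> S; d > 0\<rbrakk> \<Longrightarrow> \<exists>l r. l \<le> x \<and> x \<le> r \<and> l < r \<and> r - l < d \<and> P l r"
  obtains C T where "finite C" "\<And>l r. (l, r) \<in> C \<Longrightarrow> l < r \<and> {l..r} \<subseteq> G \<and> P l r"
    "\<And>l r l' r'. \<lbrakk>(l, r) \<in> C; (l', r') \<in> C; (l, r) \<noteq> (l', r')\<rbrakk> \<Longrightarrow> {l..r} \<inter> {l'..r'} = {}"
    "T \<in> lmeasurable" "measure lebesgue T < \<epsilon>" "S \<subseteq> T \<union> (\<Union>(l, r)\<in>C. {l..r})"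
    "(\<Sum>(l, r)\<in>C. r - l) \<le> measure lebesgue G"
proof -
  define K where "K = {(l, r). l < r \<and> {l..r} \<subseteq> G \<and> P l r}"
  define c where "c = (\<lambda>(l::real, r::real). (l + r) / 2)"
  define \<rho> where "\<rho> = (\<lambda>(l::real, r::real). (r - l) / 2)"
  have cb: "cball (c i) (\<rho> i) = {fst i..snd i}" for i
    by (cases i) (auto simp: c_def \<rho>_def cball_eq_atLeastAtMost field_simps)
  have 1: "0 < \<rho> i" if "i \<in> K" for i using that by (auto simp: K_def \<rho>_def)
  have 2: "\<exists>i. i \<in> K \<and> x \<in> cball (c i) (\<rho> i) \<and> \<rho> i < d" if xd: "x \<in> S" "0 < d" for x d
  proof -
    obtain e where e: "e > 0" "cball x e \<subseteq> G"
      using assms(1,3) \<open>x \<in> S\<close> open_contains_cball by blast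
    obtain l r where lr: "l \<le> x" "x \<le> r" "l < r" "r - l < min d e" "P l r"
      using cover[of x "min d e"] xd e by force
    have "{l..r} \<subseteq> cball x e" using lr by (auto simp: dist_real_def)
    then show ?thesis
      using lr e cb[of "(l, r)"] by (intro exI[of _ "(l, r)"]) (auto simp: K_def \<rho>_def)
  qed
  obtain C where C: "countable C" "C \<subseteq> K"
     "pairwise (\<lambda>i j. disjnt (cball (c i) (\<rho> i)) (cball (c j) (\<rho> j))) C"
     "negligible (S - (\<Union>i \<in> C. cball (c i) (\<rho> i)))"
    by (rule Vitali_covering_theorem_cballs[of K \<rho> S c, OF 1 2])
  define F where "F = (\<lambda>i::real\<times>real. {fst i..snd i})"
  have FG: "F i \<subseteq> G" if "i \<in> C" for i using subsetD[OF C(2) that] by (auto simp: K_def F_def)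
  have Fm: "F i \<in> lmeasurable" for i unfolding F_def by (simp flip: box_real(2))
  have UG: "measure lebesgue (\<Union>D) \<le> measure lebesgue G" if "D \<subseteq> F ` C" "finite D" for D
  proof (intro measure_mono_fmeasurable sets.finite_Union)
    show "\<Union>D \<subseteq> G" using that(1) FG by blast
    show "D \<subseteq> sets lebesgue" using that(1) Fm by (auto simp: fmeasurableD)
  qed (use that assms(2) in auto)
  obtain D where D: "D \<subseteq> F ` C" "finite D" "measure lebesgue (\<Union>(F ` C)) - \<epsilon> < measure lebesgue (\<Union>D)"
    using measure_countable_Union_approachable[of "F ` C" \<epsilon> "measure lebesgue G"] C(1) UG Fm assms(4)
    by (metis countable_image imageE)
  obtain C' where C': "C' \<subseteq> C" "finite C'" "D = F ` C'"
    using D(1,2) by (meson finite_subset_image)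
  have UC: "\<Union>(F ` C) \<in> lmeasurable"
    using C(1) FG assms(2) Fm
    by (intro fmeasurableI2[OF assms(2)]) (auto intro!: sets.countable_UN' simp: fmeasurableD)
  have UC': "\<Union>D \<in> lmeasurable" using D(2) C'(3) Fm by (auto intro!: fmeasurable.finite_Union)
  define N where "N = S - \<Union>(F ` C)"
  have N: "negligible N" using C(4) unfolding N_def by (simp add: cb F_def)
  \<comment> \<open>The uncovered rest: the Vitali null set and the tail of the countable
    family.\<close>
  define T where "T = N \<union> (\<Union>(F ` C) - \<Union>D)"
  have Tm: "T \<in> lmeasurable"
    unfolding T_def using N UC UC' by (auto intro!: fmeasurable.Un fmeasurable.Diff negligible_imp_measurable[OF N])
  have "measure lebesgue T \<le> measure lebesgue N + measure lebesgue (\<Union>(F ` C) - \<Union>D)"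
    unfolding T_def using N UC UC' by (intro measure_Un_le) (auto simp: negligible_imp_sets fmeasurableD)
  also have "measure lebesgue N = 0" using N by (rule negligible_imp_measure0)
  also have "measure lebesgue (\<Union>(F ` C) - \<Union>D) = measure lebesgue (\<Union>(F ` C)) - measure lebesgue (\<Union>D)"
    using D(1) UC UC' by (intro measurable_measure_Diff) (auto simp: fmeasurableD)
  finally have Te: "measure lebesgue T < \<epsilon>" using D(3) by simp
  have disj: "F i \<inter> F j = {}" if "i \<in> C'" "j \<in> C'" "i \<noteq> j" for i j
    using C(3) that C'(1) unfolding pairwise_def by (auto simp: disjnt_def cb F_def)
  have C'K: "fst i < snd i" if "i \<in> C'" for i using that C' C by (auto simp: K_def)
  show ?thesis
  proof (rule that[of C' T])
    show "finite C'" by fact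
    show "\<And>l r. (l, r) \<in> C' \<Longrightarrow> l < r \<and> {l..r} \<subseteq> G \<and> P l r" using C' C by (auto simp: K_def)
    show "T \<in> lmeasurable" "measure lebesgue T < \<epsilon>" by fact+
    show "S \<subseteq> T \<union> (\<Union>(l, r)\<in>C'. {l..r})"
      unfolding T_def N_def C'(3) F_def by (auto simp: case_prod_beta')
    show "{l..r} \<inter> {l'..r'} = {}" if "(l, r) \<in> C'" "(l', r') \<in> C'" "(l, r) \<noteq> (l', r')" for l r l' r'
      using disj[OF that] by (simp add: F_def)
    have "(\<Sum>(l, r)\<in>C'. r - l) = measure lebesgue (\<Union>i\<in>C'. {fst i<..<snd i})"
    proof (subst measure_disjoint_intervals)
      show "{fst i<..<snd i} \<inter> {fst j<..<snd j} = {}" if "i \<in> C'" "j \<in> C'" "i \<noteq> j" for i j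
        using disj[OF that] unfolding F_def by force
    qed (use C' C'K in \<open>auto simp: case_prod_beta' less_imp_le\<close>)
    also have "\<dots> \<le> measure lebesgue G"
    proof (intro measure_mono_fmeasurable)
      show "(\<Union>i\<in>C'. {fst i<..<snd i}) \<subseteq> G" using FG C'(1) unfolding F_def by force
      show "(\<Union>i\<in>C'. {fst i<..<snd i}) \<in> sets lebesgue" using C'(2) by (intro sets.finite_UN) auto
    qed (use assms(2) in auto)
    finally show "(\<Sum>(l, r)\<in>C'. r - l) \<le> measure lebesgue G" .
  qed
qed

section \<open>Lebesgue's theorem: differentiability almost everywhere\<close>

text \<open>Cover the set, of outer measure \<open>m\<close>, by disjoint intervals of slope \<open>< p\<close>, and these again by
  disjoint intervals of slope \<open>> q\<close> inside them.  The gaps have small total length, so by absolute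
  continuity they contribute little to the increment of \<open>f\<close>, and comparing the two bounds forces \<open>m = 0\<close>.\<close>

lemma negligible_oscillating_slopes:
  fixes f :: "real \<Rightarrow> real"
  assumes AC: "abs_cont_on a b f" and pq: "p < q"
  shows "negligible {x\<in>{a<..<b}.
     (\<forall>d>0. \<exists>l r. l \<le> x \<and> x \<le> r \<and> l < r \<and> r - l < d \<and> f r - f l < p * (r - l)) \<and>
     (\<forall>d>0. \<exists>l r. l \<le> x \<and> x \<le> r \<and> l < r \<and> r - l < d \<and> f r - f l > q * (r - l))}"
    (is "negligible ?S")
proof (rule negligible_outer_zero)
  show "?S \<subseteq> {a<..<b}" by auto
  show "outer ?S \<le> 0"
  proof (rule ccontr)
    define m where "m = outer ?S"
    assume "\<not> outer ?S \<le> 0"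
    then have m: "m > 0" by (simp add: m_def)
    define \<epsilon> where "\<epsilon> = (q - p) * m / 4"
    have "\<epsilon> > 0" using m pq by (simp add: \<epsilon>_def)
    from abs_cont_on_indexed[OF AC this]
    obtain \<delta> where "\<delta> > 0" and dd: "\<forall>(P::((real \<times> real) \<times> real set) set) l r. finite P \<and> (\<forall>i\<in>P. a \<le> l i \<and> l i \<le> r i \<and> r i \<le> b) \<and>
       (\<forall>i\<in>P. \<forall>j\<in>P. i \<noteq> j \<longrightarrow> {l i<..<r i} \<inter> {l j<..<r j} = {}) \<and>
       (\<Sum>i\<in>P. r i - l i) < \<delta> \<longrightarrow> (\<Sum>i\<in>P. \<bar>f (r i) - f (l i)\<bar>) < \<epsilon>"
      by (elim exE conjE) (rule that)
  note \<delta> = dd[THEN spec, THEN spec, THEN spec, THEN mp]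
    \<comment> \<open>The three bounds serve, in turn, to make the total gap length
      \<open>3 * \<eta>\<close> admissible for absolute continuity, to keep the inner intervals
      longer than \<open>m / 2\<close> in total, and to keep \<open>p\<close> times the gap length
      below \<open>\<epsilon>\<close>.\<close>
    define \<eta> where "\<eta> = min (\<delta>/3) (min (m/8) (\<epsilon> / (3 * (\<bar>p\<bar> + 1))))"
    have \<eta>: "\<eta> > 0" "3 * \<eta> \<le> \<delta>" "\<eta> \<le> m/8" "3 * (\<bar>p\<bar> + 1) * \<eta> \<le> \<epsilon>"
    proof -
      show "\<eta> > 0" using \<open>\<delta> > 0\<close> m \<open>\<epsilon> > 0\<close> by (auto simp: \<eta>_def)
      show "3 * \<eta> \<le> \<delta>" "\<eta> \<le> m/8" by (simp_all add: \<eta>_def min_def)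
      have "\<eta> \<le> \<epsilon> / (3 * (\<bar>p\<bar> + 1))" by (auto simp: \<eta>_def)
      then show "3 * (\<bar>p\<bar> + 1) * \<eta> \<le> \<epsilon>" by (subst (asm) pos_le_divide_eq) (auto simp: mult_ac)
    qed
    obtain G where G: "open G" "?S \<subseteq> G" "G \<subseteq> {a<..<b}" "G \<in> lmeasurable" "measure lebesgue G < m + \<eta>"
      unfolding m_def by (rule outer_open_cover[of ?S a b \<eta>]) (use \<eta>(1) in auto)
    obtain C1 T1 where C1: "finite C1" "\<And>l r. (l, r) \<in> C1 \<Longrightarrow> l < r \<and> {l..r} \<subseteq> G \<and> f r - f l < p * (r - l)"
      "\<And>l r l' r'. \<lbrakk>(l, r) \<in> C1; (l', r') \<in> C1; (l, r) \<noteq> (l', r')\<rbrakk> \<Longrightarrow> {l..r} \<inter> {l'..r'} = {}"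
      and T1: "T1 \<in> lmeasurable" "measure lebesgue T1 < \<eta>" "?S \<subseteq> T1 \<union> (\<Union>(l, r)\<in>C1. {l..r})"
      and L1: "(\<Sum>(l, r)\<in>C1. r - l) \<le> measure lebesgue G"
      by (rule Vitali_interval_cover[OF G(1,4,2) \<eta>(1), of "\<lambda>l r. f r - f l < p * (r - l)"]) (auto)
    define G2 where "G2 = (\<Union>(l, r)\<in>C1. {l<..<r})"
    \<comment> \<open>Each interval of the second cover is required to lie strictly inside one
      interval of the first, so that the second family splits along the first.\<close>
    define P2 where "P2 = (\<lambda>l r. f r - f l > q * (r - l) \<and> (\<exists>(l', r')\<in>C1. l' < l \<and> r < r'))"
    have G2: "open G2" "G2 \<in> lmeasurable" "?S \<inter> G2 \<subseteq> G2"
      using C1(1) by (auto simp: G2_def intro!: fmeasurable.finite_Union)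
    have cov2: "\<exists>l r. l \<le> x \<and> x \<le> r \<and> l < r \<and> r - l < d \<and> P2 l r" if "x \<in> ?S \<inter> G2" "d > 0" for x d
    proof -
      obtain l' r' where lr': "(l', r') \<in> C1" "l' < x" "x < r'" using \<open>x \<in> ?S \<inter> G2\<close> by (auto simp: G2_def)
      define d' where "d' = min d (min (x - l') (r' - x))"
      have "d' > 0" using lr' \<open>d > 0\<close> by (auto simp: d'_def)
      then obtain l r where lr: "l \<le> x" "x \<le> r" "l < r" "r - l < d'" "f r - f l > q * (r - l)"
        using \<open>x \<in> ?S \<inter> G2\<close> by blast
      moreover have "r - l < d" "l' < l" "r < r'" using lr by (auto simp: d'_def)
      ultimately show ?thesis using lr' unfolding P2_def by blast
    qed
    obtain C2 T2 where C2: "finite C2" "\<And>l r. (l, r) \<in> C2 \<Longrightarrow> l < r \<and> {l..r} \<subseteq> G2 \<and> P2 l r"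
      "\<And>l r l' r'. \<lbrakk>(l, r) \<in> C2; (l', r') \<in> C2; (l, r) \<noteq> (l', r')\<rbrakk> \<Longrightarrow> {l..r} \<inter> {l'..r'} = {}"
      and T2: "T2 \<in> lmeasurable" "measure lebesgue T2 < \<eta>" "?S \<inter> G2 \<subseteq> T2 \<union> (\<Union>(l, r)\<in>C2. {l..r})"
      by (rule Vitali_interval_cover[OF G2 \<eta>(1), of P2, OF cov2]) auto
    \<comment> \<open>\<open>G2\<close> consists of open intervals, so the finitely many end points
      have to be covered separately.\<close>
    define E where "E = fst ` C1 \<union> snd ` C1"
    define U2 where "U2 = (\<Union>k\<in>C2. {fst k..snd k})"
    have "negligible E" using C1(1) by (auto simp: E_def)
    then have E: "E \<in> lmeasurable" "measure lebesgue E = 0" by (auto simp: negligible_imp_measurable negligible_imp_measure0)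
    have U2: "U2 \<in> lmeasurable" using C2(1) by (auto simp: U2_def intro!: fmeasurable.finite_Union)
    have lt1: "fst i < snd i" if "i \<in> C1" for i using C1(2)[of "fst i" "snd i"] that by auto
    have lt2: "fst i < snd i" if "i \<in> C2" for i using C2(2)[of "fst i" "snd i"] that by auto
    have "?S \<subseteq> (T1 \<union> T2) \<union> (E \<union> U2)"
    proof
      fix x assume x: "x \<in> ?S"
      show "x \<in> (T1 \<union> T2) \<union> (E \<union> U2)"
      proof (cases "x \<in> T1 \<or> x \<in> E")
        case False
        moreover have "x \<in> T1 \<union> (\<Union>(l, r)\<in>C1. {l..r})" using x T1(3) by (rule subsetD[rotated])
        ultimately obtain l r where lr: "(l, r) \<in> C1" "l \<le> x" "x \<le> r" by auto
        then have "l \<in> E" "r \<in> E" unfolding E_def by force+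
        then have "x \<noteq> l" "x \<noteq> r" using False by auto
        then have "x \<in> {l<..<r}" using lr by auto
        then have "x \<in> G2" unfolding G2_def using lr(1) by blast
        then have "x \<in> T2 \<union> (\<Union>(l, r)\<in>C2. {l..r})" using x T2(3) by blast
        then show ?thesis by (force simp: U2_def)
      qed auto
    qed
    then have "m \<le> measure lebesgue ((T1 \<union> T2) \<union> (E \<union> U2))"
      unfolding m_def using T1(1) T2(1) E U2 by (intro outer_le) auto
    also have "\<dots> \<le> (measure lebesgue T1 + measure lebesgue T2) + (measure lebesgue E + measure lebesgue U2)"
      using T1(1) T2(1) E U2 by (intro order_trans[OF measure_Un_le] add_mono measure_Un_le) (auto simp: fmeasurableD)
    also have "measure lebesgue U2 \<le> (\<Sum>k\<in>C2. measure lebesgue {fst k..snd k})"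
      unfolding U2_def using C2(1) by (intro measure_UNION_le) auto
    also have "\<dots> = (\<Sum>k\<in>C2. snd k - fst k)"
      using lt2 by (intro sum.cong) (auto simp: less_imp_le)
    finally have L2: "m - 2 * \<eta> < (\<Sum>k\<in>C2. snd k - fst k)" using T1(2) T2(2) E(2) by simp
    define J where "J = (\<lambda>i. {k\<in>C2. fst i < fst k \<and> snd k < snd i})"
    define I where "I = (\<lambda>k::real\<times>real. {fst k..snd k})"
    have dis1: "I i \<inter> I j = {}" if "i \<in> C1" "j \<in> C1" "i \<noteq> j" for i j
      using C1(3)[of "fst i" "snd i" "fst j" "snd j"] that by (simp add: I_def)
    have dis2: "I i \<inter> I j = {}" if "i \<in> C2" "j \<in> C2" "i \<noteq> j" for i j
      using C2(3)[of "fst i" "snd i" "fst j" "snd j"] that by (simp add: I_def)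
    have ne2: "I k \<noteq> {}" if "k \<in> C2" for k using lt2[OF that] by (auto simp: I_def)
    have injI: "inj_on I C2"
      using dis2 ne2 by (metis inf.idem inj_onI)
    \<comment> \<open>The inner intervals are completed to a division of the surrounding interval;
      the added pieces \<open>R i\<close> are the gaps.\<close>
    have "\<exists>q. I ` J i \<subseteq> q \<and> q division_of {fst i..snd i}" if "i \<in> C1" for i
    proof -
      have "I ` J i division_of \<Union>(I ` J i)"
      proof (rule division_ofI)
        show "interior K1 \<inter> interior K2 = {}" if "K1 \<in> I ` J i" "K2 \<in> I ` J i" "K1 \<noteq> K2" for K1 K2
          using dis2 that interior_subset unfolding J_def by blast
        show "finite (I ` J i)" using C2(1) by (simp add: J_def)
        fix K assume "K \<in> I ` J i"
        then show "K \<subseteq> \<Union>(I ` J i)" "K \<noteq> {}" "\<exists>a b. K = cbox a b"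
          using ne2 by (auto simp: J_def I_def box_real)
      qed auto
      moreover have "\<Union>(I ` J i) \<subseteq> cbox (fst i) (snd i)" by (auto simp: J_def I_def)
      ultimately show ?thesis
        by (rule partial_division_extend_interval) (auto simp: box_real)
    qed
    then obtain Q where Q: "\<And>i. i \<in> C1 \<Longrightarrow> I ` J i \<subseteq> Q i" "\<And>i. i \<in> C1 \<Longrightarrow> Q i division_of {fst i..snd i}"
      by metis
    define R where "R = (\<lambda>i. Q i - I ` J i)"
    have finQ: "finite (Q i)" if "i \<in> C1" for i using Q(2)[OF that] by (rule division_ofD)
    have SI: "Sup (I k) = snd k" "Inf (I k) = fst k" if "k \<in> C2" for k
      using lt2[OF that] by (auto simp: I_def)
    have gap: "(\<Sum>K\<in>R i. g (Sup K) - g (Inf K)) = g (snd i) - g (fst i) - (\<Sum>k\<in>J i. g (snd k) - g (fst k))"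
      if "i \<in> C1" for i and g :: "real \<Rightarrow> real"
    proof -
      have "(\<Sum>K\<in>Q i. g (Sup K) - g (Inf K)) = g (snd i) - g (fst i)"
        using lt1[OF that] by (intro division_increment Q(2) that) auto
      moreover have "(\<Sum>K\<in>I ` J i. g (Sup K) - g (Inf K)) = (\<Sum>k\<in>J i. g (snd k) - g (fst k))"
        by (subst sum.reindex) (use injI SI in \<open>auto simp: J_def inj_on_def intro!: sum.cong\<close>)
      ultimately show ?thesis unfolding R_def
        by (subst sum_diff) (use finQ Q(1) that in auto)
    qed
    have sumC2: "(\<Sum>k\<in>C2. g k) = (\<Sum>i\<in>C1. \<Sum>k\<in>J i. g k)" for g :: "real \<times> real \<Rightarrow> real"
    proof -
      have "C2 = (\<Union>i\<in>C1. J i)" using C2(2) unfolding J_def P2_def by fastforce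
      moreover have "J i \<inter> J j = {}" if "i \<in> C1" "j \<in> C1" "i \<noteq> j" for i j
        using dis1[OF that] lt2 unfolding J_def I_def by fastforce
      moreover have "finite (J i)" for i using C2(1) by (simp add: J_def)
      ultimately show ?thesis using C1(1) by (simp add: sum.UNION_disjoint)
    qed
    have gaps: "(\<Sum>(i, K)\<in>Sigma C1 R. g (Sup K) - g (Inf K)) =
        (\<Sum>i\<in>C1. g (snd i) - g (fst i)) - (\<Sum>k\<in>C2. g (snd k) - g (fst k))" for g :: "real \<Rightarrow> real"
    proof -
      have "(\<Sum>(i, K)\<in>Sigma C1 R. g (Sup K) - g (Inf K)) = (\<Sum>i\<in>C1. \<Sum>K\<in>R i. g (Sup K) - g (Inf K))"
        using C1(1) finQ by (subst sum.Sigma) (auto simp: R_def)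
      also have "\<dots> = (\<Sum>i\<in>C1. g (snd i) - g (fst i) - (\<Sum>k\<in>J i. g (snd k) - g (fst k)))"
        by (intro sum.cong refl gap)
      finally show ?thesis by (simp add: sum_subtractf sumC2)
    qed
    have RQ: "fst i \<le> Inf K \<and> Inf K \<le> Sup K \<and> Sup K \<le> snd i \<and> K = {Inf K..Sup K} \<and> interior K = {Inf K<..<Sup K}"
      if "i \<in> C1" "K \<in> R i" for i K
      using lt1[OF that(1)] that Q(2)[OF that(1)] by (intro division_interval) (auto simp: R_def)
    have len: "(\<Sum>i\<in>C1. snd i - fst i) < m + \<eta>" using L1 G(5) by (simp add: case_prod_beta')
    \<comment> \<open>The first family is shorter than \<open>m + \<eta>\<close> and the second
      longer than \<open>m - 2 * \<eta>\<close>, so the gaps have total length below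
      \<open>3 * \<eta> \<le> \<delta>\<close>.\<close>
    have small: "(\<Sum>x\<in>Sigma C1 R. \<bar>f (Sup (snd x)) - f (Inf (snd x))\<bar>) < \<epsilon>"
    proof (intro \<delta> conjI ballI impI)
      show "finite (Sigma C1 R)" using C1(1) finQ by (auto simp: R_def)
      show "{Inf (snd x)<..<Sup (snd x)} \<inter> {Inf (snd y)<..<Sup (snd y)} = {}"
        if "x \<in> Sigma C1 R" "y \<in> Sigma C1 R" "x \<noteq> y" for x y
      proof (cases "fst x = fst y")
        case True
        then have "interior (snd x) \<inter> interior (snd y) = {}"
          using that by (intro division_ofD(5)[OF Q(2)[of "fst x"]]) (auto simp: R_def)
        then show ?thesis using RQ[of "fst x" "snd x"] RQ[of "fst y" "snd y"] that by auto
      next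
        case False
        then have "I (fst x) \<inter> I (fst y) = {}" using that by (intro dis1) auto
        moreover have "{Inf (snd x)<..<Sup (snd x)} \<subseteq> I (fst x)" "{Inf (snd y)<..<Sup (snd y)} \<subseteq> I (fst y)"
          using RQ[of "fst x" "snd x"] RQ[of "fst y" "snd y"] that by (auto simp: I_def)
        ultimately show ?thesis by blast
      qed
      have "(\<Sum>x\<in>Sigma C1 R. Sup (snd x) - Inf (snd x)) = (\<Sum>i\<in>C1. snd i - fst i) - (\<Sum>k\<in>C2. snd k - fst k)"
        using gaps[of "\<lambda>x. x"] by (simp add: case_prod_beta')
      then show "(\<Sum>x\<in>Sigma C1 R. Sup (snd x) - Inf (snd x)) < \<delta>" using len L2 \<eta>(2) by simp
      fix x assume "x \<in> Sigma C1 R"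
      then have x: "fst x \<in> C1" "snd x \<in> R (fst x)" by auto
      have "{fst (fst x)..snd (fst x)} \<subseteq> {a<..<b}" using C1(2)[of "fst (fst x)" "snd (fst x)"] G(3) x by auto
      then have "fst (fst x) \<in> {a<..<b}" "snd (fst x) \<in> {a<..<b}"
        using lt1[OF x(1)] by (intro subsetD[OF \<open>{fst (fst x)..snd (fst x)} \<subseteq> {a<..<b}\<close>]; simp)+
      then have "a \<le> fst (fst x)" "snd (fst x) \<le> b" by auto
      then show "a \<le> Inf (snd x)" "Inf (snd x) \<le> Sup (snd x)" "Sup (snd x) \<le> b"
        using RQ[OF x] by auto
    qed
    have "\<bar>\<Sum>x\<in>Sigma C1 R. f (Sup (snd x)) - f (Inf (snd x))\<bar> < \<epsilon>"
      using small by (rule order.strict_trans1[OF sum_abs])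
    then have A: "(\<Sum>k\<in>C2. f (snd k) - f (fst k)) < (\<Sum>i\<in>C1. f (snd i) - f (fst i)) + \<epsilon>"
      using gaps[of f] by (simp add: case_prod_beta')
    have B: "(\<Sum>i\<in>C1. f (snd i) - f (fst i)) \<le> p * (\<Sum>i\<in>C1. snd i - fst i)"
      unfolding sum_distrib_left using C1(2) by (intro sum_mono) (auto simp: less_imp_le)
    have C: "q * (\<Sum>k\<in>C2. snd k - fst k) \<le> (\<Sum>k\<in>C2. f (snd k) - f (fst k))"
      unfolding sum_distrib_left using C2(2) by (intro sum_mono) (auto simp: less_imp_le P2_def)
    define x y where "x = (\<Sum>i\<in>C1. snd i - fst i)" and "y = (\<Sum>k\<in>C2. snd k - fst k)"
    have xy: "0 \<le> x - y"
    proof -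
      have "0 \<le> (\<Sum>(i, K)\<in>Sigma C1 R. Sup K - Inf K)" using RQ by (intro sum_nonneg) auto
      then show ?thesis using gaps[of "\<lambda>x. x"] by (simp add: x_def y_def)
    qed
    \<comment> \<open>The increments over the inner intervals are at least \<open>q * y\<close> and,
      up to the gaps, at most \<open>p * x\<close>. Both error terms are at most
      \<open>\<epsilon>\<close>, and \<open>2 * \<epsilon> = (q - p) * (m / 2)\<close>, whereas
      \<open>y\<close> exceeds \<open>m / 2\<close>.\<close>
    have "(q - p) * y \<le> p * (x - y) + \<epsilon>" using A B C by (simp add: x_def y_def algebra_simps)
    also have "p * (x - y) \<le> (\<bar>p\<bar> + 1) * (3 * \<eta>)"
      using xy len L2 \<eta>(1) by (intro mult_mono) (auto simp: x_def y_def)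
    also have "\<dots> \<le> \<epsilon>" using \<eta>(4) by (simp add: mult_ac)
    finally have "(q - p) * y \<le> (q - p) * (m / 2)" by (simp add: \<epsilon>_def mult.commute)
    then have "y \<le> m / 2" using pq by (simp only: mult_le_cancel_left_pos)
    then show False using L2 \<eta>(3) m by (simp add: y_def)
  qed
qed

text \<open>If the set had outer measure \<open>m > 0\<close>, disjoint intervals of slope above
  \<open>2 / m\<close> and total length above \<open>m / 2\<close> would give increments above 1.
  Absolute continuity excludes this only for families of total length below \<open>\<delta>\<close>,
  which is why the statement is confined to intervals shorter than \<open>\<delta>\<close>.\<close>

lemma negligible_infinite_slope_aux:
  fixes f :: "real \<Rightarrow> real"
  assumes AC: "abs_cont_on a b f"
  shows "\<exists>\<delta>>0. \<forall>c d. a \<le> c \<and> d \<le> b \<and> d - c < \<delta> \<longrightarrow> negligible {x\<in>{c<..<d}.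
     \<forall>K. \<forall>d>0. \<exists>l r. l \<le> x \<and> x \<le> r \<and> l < r \<and> r - l < d \<and> f r - f l > K * (r - l)}"
proof -
  from abs_cont_on_indexed[OF AC zero_less_one]
  obtain \<delta> where "\<delta> > 0" and dd: "\<forall>(P::(real \<times> real) set) l r. finite P \<and> (\<forall>i\<in>P. a \<le> l i \<and> l i \<le> r i \<and> r i \<le> b) \<and>
       (\<forall>i\<in>P. \<forall>j\<in>P. i \<noteq> j \<longrightarrow> {l i<..<r i} \<inter> {l j<..<r j} = {}) \<and>
       (\<Sum>i\<in>P. r i - l i) < \<delta> \<longrightarrow> (\<Sum>i\<in>P. \<bar>f (r i) - f (l i)\<bar>) < 1"
    by (elim exE conjE) (rule that)
  note \<delta> = dd[THEN spec, THEN spec, THEN spec, THEN mp]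
  show ?thesis
  proof (intro exI[of _ \<delta>] conjI \<open>\<delta> > 0\<close> allI impI)
    fix c d assume cd: "a \<le> c \<and> d \<le> b \<and> d - c < \<delta>"
    let ?S = "{x\<in>{c<..<d}. \<forall>K. \<forall>d>0. \<exists>l r. l \<le> x \<and> x \<le> r \<and> l < r \<and> r - l < d \<and> f r - f l > K * (r - l)}"
    show "negligible ?S"
    proof (cases "c < d")
      case True
      show ?thesis
      proof (rule negligible_outer_zero)
        show "?S \<subseteq> {c<..<d}" by auto
        show "outer ?S \<le> 0"
        proof (rule ccontr)
          define m where "m = outer ?S"
          assume "\<not> outer ?S \<le> 0"
          then have m: "m > 0" by (simp add: m_def)
          obtain C T where C: "finite C" "\<And>l r. (l, r) \<in> C \<Longrightarrow> l < r \<and> {l..r} \<subseteq> {c<..<d} \<and> f r - f l > 2/m * (r - l)"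
            "\<And>l r l' r'. \<lbrakk>(l, r) \<in> C; (l', r') \<in> C; (l, r) \<noteq> (l', r')\<rbrakk> \<Longrightarrow> {l..r} \<inter> {l'..r'} = {}"
            and T: "T \<in> lmeasurable" "measure lebesgue T < m/2" "?S \<subseteq> T \<union> (\<Union>(l, r)\<in>C. {l..r})"
            and L: "(\<Sum>(l, r)\<in>C. r - l) \<le> measure lebesgue {c<..<d}"
          proof (rule Vitali_interval_cover[of "{c<..<d}" ?S "m/2" "\<lambda>l r. f r - f l > 2/m * (r - l)"])
            show "\<exists>l r. l \<le> x \<and> x \<le> r \<and> l < r \<and> r - l < e \<and> f r - f l > 2/m * (r - l)"
              if "x \<in> ?S" "e > 0" for x e
              using that by blast
          qed (use m in auto)
          define U where "U = (\<Union>k\<in>C. {fst k..snd k})"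
          have U: "U \<in> lmeasurable" using C(1) by (auto simp: U_def intro!: fmeasurable.finite_Union)
          have lt: "fst i < snd i" if "i \<in> C" for i using C(2)[of "fst i" "snd i"] that by auto
          have "m \<le> measure lebesgue (T \<union> U)"
            unfolding m_def using T U by (intro outer_le) (auto simp: U_def case_prod_beta')
          also have "\<dots> \<le> measure lebesgue T + measure lebesgue U"
            using T U by (intro measure_Un_le) (auto simp: fmeasurableD)
          also have "measure lebesgue U \<le> (\<Sum>k\<in>C. measure lebesgue {fst k..snd k})"
            unfolding U_def using C(1) by (intro measure_UNION_le) auto
          also have "\<dots> = (\<Sum>k\<in>C. snd k - fst k)"
            using lt by (intro sum.cong) (auto simp: less_imp_le)
          finally have "m/2 < (\<Sum>k\<in>C. snd k - fst k)" using T(2) by simp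
          then have "1 < 2/m * (\<Sum>k\<in>C. snd k - fst k)" using m by (simp add: field_simps)
          also have "\<dots> \<le> (\<Sum>k\<in>C. \<bar>f (snd k) - f (fst k)\<bar>)"
            unfolding sum_distrib_left using C(2) by (intro sum_mono order_trans[OF _ abs_ge_self]) (auto simp: less_imp_le)
          also have "\<dots> < 1"
          proof (intro \<delta> conjI ballI impI)
            show "finite C" by fact
            show "{fst x<..<snd x} \<inter> {fst y<..<snd y} = {}" if "x \<in> C" "y \<in> C" "x \<noteq> y" for x y
              using C(3)[of "fst x" "snd x" "fst y" "snd y"] that by force
            show "(\<Sum>k\<in>C. snd k - fst k) < \<delta>" using L cd True by (simp add: case_prod_beta')
            fix k assume k: "k \<in> C"
            have "{fst k..snd k} \<subseteq> {c<..<d}" using C(2)[of "fst k" "snd k"] k by auto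
            then have "fst k \<in> {c<..<d}" "snd k \<in> {c<..<d}" using lt[OF k] by (intro subsetD[OF \<open>{fst k..snd k} \<subseteq> {c<..<d}\<close>]; simp)+
            then show "a \<le> fst k" "fst k \<le> snd k" "snd k \<le> b" using lt[OF k] cd by auto
          qed
          finally show False .
        qed
      qed
    qed auto
  qed
qed

text \<open>Countably many intervals with rational end points and length below
  \<open>\<delta>\<close> cover \<open>]a,b[\<close>.\<close>

lemma negligible_infinite_slope:
  fixes f :: "real \<Rightarrow> real"
  assumes AC: "abs_cont_on a b f"
  shows "negligible {x\<in>{a<..<b}.
     \<forall>K. \<forall>d>0. \<exists>l r. l \<le> x \<and> x \<le> r \<and> l < r \<and> r - l < d \<and> f r - f l > K * (r - l)}"
    (is "negligible ?S")
proof -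
  let ?N = "\<lambda>c d. {x\<in>{c<..<d}.
     \<forall>K. \<forall>d>0. \<exists>l r. l \<le> x \<and> x \<le> r \<and> l < r \<and> r - l < d \<and> f r - f l > K * (r - l)}"
  from negligible_infinite_slope_aux[OF AC]
  obtain \<delta> where "\<delta> > 0" and \<delta>: "\<forall>c d. a \<le> c \<and> d \<le> b \<and> d - c < \<delta> \<longrightarrow> negligible (?N c d)"
    by (elim exE conjE) (rule that)
  let ?Q = "{(c, d). c \<in> \<rat> \<and> d \<in> \<rat> \<and> a \<le> c \<and> d \<le> b \<and> d - c < \<delta>}"
  have "?S \<subseteq> (\<Union>(c, d)\<in>?Q. ?N c d)"
  proof
    fix x assume x: "x \<in> ?S"
    obtain c where c: "c \<in> \<rat>" "max a (x - \<delta>/2) < c" "c < x"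
      using Rats_dense_in_real[of "max a (x - \<delta>/2)" x] x \<open>\<delta> > 0\<close> by auto
    obtain d where d: "d \<in> \<rat>" "x < d" "d < min b (x + \<delta>/2)"
      using Rats_dense_in_real[of x "min b (x + \<delta>/2)"] x \<open>\<delta> > 0\<close> by auto
    have "(c, d) \<in> ?Q" using c d by auto
    moreover have "x \<in> ?N c d" using x c d by auto
    ultimately show "x \<in> (\<Union>(c, d)\<in>?Q. ?N c d)" by blast
  qed
  moreover have "countable ?Q"
    by (rule countable_subset[of _ "\<rat> \<times> \<rat>"]) (auto simp: countable_rat)
  then have "negligible (\<Union>(c, d)\<in>?Q. ?N c d)"
  proof (intro negligible_countable_Union)
    fix X assume "X \<in> (\<lambda>(c, d). ?N c d) ` ?Q"
    then obtain c d where "(c, d) \<in> ?Q" and X: "X = ?N c d" by auto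
    then have "a \<le> c \<and> d \<le> b \<and> d - c < \<delta>" by simp
    with \<delta> have "negligible (?N c d)" by simp
    then show "negligible X" unfolding X .
  qed auto
  ultimately show ?thesis by (rule negligible_subset[rotated])
qed

lemma abs_cont_on_uminus:
  "abs_cont_on a b f \<Longrightarrow> abs_cont_on a b (\<lambda>x. - f x)"
  unfolding abs_cont_on_def by (simp add: abs_minus_commute)

text \<open>At a point outside the exceptional sets the slopes over small intervals containing it
  are bounded from both sides, and they cannot oscillate across two rational levels. Hence their
  upper limit is a limit.\<close>

theorem abs_cont_on_AE_differentiable:
  fixes f :: "real \<Rightarrow> real"
  assumes AC: "abs_cont_on a b f"
  obtains N where "negligible N"
    "\<And>x. x \<in> {a<..<b} - N \<Longrightarrow> \<exists>L. (f has_real_derivative L) (at x)"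
proof -
  define st where "st = (\<lambda>(x::real) l r d. l \<le> x \<and> x \<le> r \<and> l < r \<and> r - l < (d::real))"
  define S where "S = (\<lambda>p q. {x\<in>{a<..<b}.
     (\<forall>d>0. \<exists>l r. l \<le> x \<and> x \<le> r \<and> l < r \<and> r - l < d \<and> f r - f l < p * (r - l)) \<and>
     (\<forall>d>0. \<exists>l r. l \<le> x \<and> x \<le> r \<and> l < r \<and> r - l < d \<and> f r - f l > q * (r - l))})"
  define T where "T = (\<lambda>f::real\<Rightarrow>real. {x\<in>{a<..<b}.
     \<forall>K. \<forall>d>0. \<exists>l r. l \<le> x \<and> x \<le> r \<and> l < r \<and> r - l < d \<and> f r - f l > K * (r - l)})"
  define Q where "Q = {(p::real, q). p \<in> \<rat> \<and> q \<in> \<rat> \<and> p < q}"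
  define N where "N = (\<Union>(p, q)\<in>Q. S p q) \<union> T f \<union> T (\<lambda>x. - f x)"
  have "countable Q"
    unfolding Q_def by (rule countable_subset[of _ "\<rat> \<times> \<rat>"]) (auto simp: countable_rat)
  then have "negligible (\<Union>(p, q)\<in>Q. S p q)"
    using negligible_oscillating_slopes[OF AC] by (intro negligible_countable_Union) (auto simp: Q_def S_def)
  moreover have "negligible (T f)" "negligible (T (\<lambda>x. - f x))"
    unfolding T_def using negligible_infinite_slope[OF AC] negligible_infinite_slope[OF abs_cont_on_uminus[OF AC]] by auto
  ultimately have "negligible N" unfolding N_def by (intro negligible_Un)
  then show ?thesis
  proof (rule that)
    fix x assume x: "x \<in> {a<..<b} - N"
    obtain K d1 where K: "d1 > 0" "\<And>l r. st x l r d1 \<Longrightarrow> f r - f l \<le> K * (r - l)"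
    proof -
      have "x \<notin> T f" using x by (simp add: N_def)
      then have "\<not> (\<forall>K. \<forall>d>0. \<exists>l r. st x l r d \<and> f r - f l > K * (r - l))"
        using x unfolding T_def st_def by blast
      then show ?thesis by (auto simp: not_less intro: that)
    qed
    obtain K' d2 where K': "d2 > 0" "\<And>l r. st x l r d2 \<Longrightarrow> f l - f r \<le> K' * (r - l)"
    proof -
      have "x \<notin> T (\<lambda>x. - f x)" using x by (simp add: N_def)
      then have "\<not> (\<forall>K. \<forall>d>0. \<exists>l r. st x l r d \<and> - f r - - f l > K * (r - l))"
        using x unfolding T_def st_def by blast
      then show ?thesis by (auto simp: not_less intro: that)
    qed
    \<comment> \<open>The eventual upper bounds of the slopes at \<open>x\<close>; the infimum is
      the candidate for the derivative.\<close>
    define A where "A = {q. \<exists>d>0. \<forall>l r. st x l r d \<longrightarrow> f r - f l \<le> q * (r - l)}"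
    have "K \<in> A" using K unfolding A_def by blast
    have low: "- K' \<le> q" if "q \<in> A" for q
    proof -
      obtain d where d: "d > 0" "\<And>l r. st x l r d \<Longrightarrow> f r - f l \<le> q * (r - l)"
        using \<open>q \<in> A\<close> unfolding A_def by blast
      define h where "h = min d d2 / 2"
      have h: "h > 0" "st x x (x + h) d" "st x x (x + h) d2" using d(1) K'(1) by (auto simp: st_def h_def)
      have "(- K') * h \<le> q * h" using d(2)[OF h(2)] K'(2)[OF h(3)] by simp
      then show ?thesis using h(1) by (simp only: mult_le_cancel_right_pos)
    qed
    have bdd: "bdd_below A" using low by (rule bdd_belowI)
    define L where "L = Inf A"
    have up: "\<exists>d>0. \<forall>l r. st x l r d \<longrightarrow> f r - f l \<le> (L + e) * (r - l)" if "e > 0" for e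
    proof -
      obtain q where "q \<in> A" "q < L + e"
        using cInf_lessD[of A "L + e"] \<open>K \<in> A\<close> \<open>e > 0\<close> unfolding L_def by auto
      then obtain d where d: "d > 0" "\<And>l r. st x l r d \<Longrightarrow> f r - f l \<le> q * (r - l)"
        unfolding A_def by blast
      have "q * (r - l) \<le> (L + e) * (r - l)" if "st x l r d" for l r
        using that \<open>q < L + e\<close> by (intro mult_right_mono) (auto simp: st_def)
      then show ?thesis using d by (meson order_trans)
    qed
    have down: "\<exists>d>0. \<forall>l r. st x l r d \<longrightarrow> f r - f l \<ge> (L - e) * (r - l)" if "e > 0" for e
    proof (rule ccontr)
      assume H: "\<not> ?thesis"
      \<comment> \<open>The levels are taken rational, because only a countable union of the null
        sets \<open>S p q\<close> is removed. Above level \<open>q\<close> there are always slopes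
        since \<open>q < L = Inf A\<close>, below level \<open>p\<close> there are slopes by
        assumption.\<close>
      obtain p where p: "p \<in> \<rat>" "L - e < p" "p < L - e/2" using Rats_dense_in_real[of "L - e" "L - e/2"] \<open>e > 0\<close> by auto
      obtain q where q: "q \<in> \<rat>" "L - e/2 < q" "q < L" using Rats_dense_in_real[of "L - e/2" "L"] \<open>e > 0\<close> by auto
      have "q \<notin> A" using cInf_lower[OF _ bdd] q(3) unfolding L_def by force
      then have 1: "\<forall>d>0. \<exists>l r. l \<le> x \<and> x \<le> r \<and> l < r \<and> r - l < d \<and> f r - f l > q * (r - l)"
        unfolding A_def st_def by (auto simp: not_le)
      have 2: "\<exists>l r. l \<le> x \<and> x \<le> r \<and> l < r \<and> r - l < d \<and> f r - f l < p * (r - l)" if "d > 0" for d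
      proof -
        obtain l r where lr: "st x l r d" "f r - f l < (L - e) * (r - l)"
          using H \<open>d > 0\<close> by (auto simp: not_le)
        have "(L - e) * (r - l) \<le> p * (r - l)" using lr(1) p(2) by (intro mult_right_mono) (auto simp: st_def)
        then have "f r - f l < p * (r - l)" using lr(2) by linarith
        then show ?thesis using lr(1) unfolding st_def by blast
      qed
      have "x \<in> S p q" unfolding S_def using x 1 2 by auto
      moreover have "(p, q) \<in> Q" using p q by (auto simp: Q_def)
      ultimately show False using x unfolding N_def by blast
    qed
    have "((\<lambda>y. (f y - f x) / (y - x)) \<longlongrightarrow> L) (at x)"
    proof (rule tendstoI)
      fix e :: real assume "e > 0"
      then have "e/2 > 0" by simp
      obtain d where d: "d > 0" "\<forall>l r. st x l r d \<longrightarrow> f r - f l \<le> (L + e/2) * (r - l)"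
        using up[OF \<open>e/2 > 0\<close>] by blast
      obtain d' where d': "d' > 0" "\<forall>l r. st x l r d' \<longrightarrow> f r - f l \<ge> (L - e/2) * (r - l)"
        using down[OF \<open>e/2 > 0\<close>] by blast
      have "dist ((f y - f x) / (y - x)) L < e" if y: "y \<noteq> x" "dist y x < min d d'" for y
      proof -
        define l r where "l = min x y" and "r = max x y"
        have "st x l r d" "st x l r d'" and lr: "l < r" using y by (auto simp: st_def l_def r_def dist_real_def)
        then have "f r - f l \<le> (L + e/2) * (r - l)" "f r - f l \<ge> (L - e/2) * (r - l)"
          using d d' by blast+
        then have "(f r - f l) / (r - l) \<le> L + e/2" "L - e/2 \<le> (f r - f l) / (r - l)"
          using lr by (auto simp: pos_divide_le_eq pos_le_divide_eq)
        moreover have "(f y - f x) / (y - x) = (f r - f l) / (r - l)"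
          using minus_divide_divide[of "f y - f x" "y - x"] by (auto simp: l_def r_def min_def max_def)
        ultimately show ?thesis using \<open>e > 0\<close> by (auto simp: dist_real_def abs_if)
      qed
      then show "\<forall>\<^sub>F y in at x. dist ((f y - f x) / (y - x)) L < e"
        unfolding eventually_at using d(1) d'(1) by (intro exI[of _ "min d d'"]) auto
    qed
    then show "\<exists>L. (f has_real_derivative L) (at x)"
      unfolding has_field_derivative_iff by blast
  qed
qed

section \<open>The fundamental theorem of calculus for absolutely continuous functions\<close>

text \<open>On tags in the exceptional null set the gauge is a thin open set, where the increments of \<open>f\<close> are
  small by absolute continuity.\<close>

lemma abs_cont_on_FTC:
  fixes f g :: "real \<Rightarrow> real"
  assumes AC: "abs_cont_on a b f" and "a \<le> b" and N: "negligible N"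
    and der: "\<And>x. x \<in> {a<..<b} - N \<Longrightarrow> (f has_real_derivative g x) (at x)"
  shows "(g has_integral (f b - f a)) {a..b}"
proof -
  \<comment> \<open>The end points are thrown into the null set, as no derivative is available
    there. With \<open>g' = 0\<close> on \<open>N'\<close>, a piece tagged in \<open>N'\<close>
    contributes nothing but the increment of \<open>f\<close>; the values of \<open>g\<close> are
    restored at the end by changing a function on a null set.\<close>
  define N' where "N' = N \<union> {a, b}"
  define g' where "g' = (\<lambda>x. if x \<in> N' then 0 else g x)"
  have N': "negligible N'" using N by (simp add: N'_def negligible_Un)
  have "(g' has_integral (f b - f a)) {a..b}"
    unfolding has_integral_factor_content_real
  proof (intro allI impI)
    fix e :: real assume "e > 0"
    show "\<exists>d. gauge d \<and> (\<forall>p. p tagged_division_of {a..b} \<and> d fine p \<longrightarrow>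
      norm ((\<Sum>(x, k)\<in>p. measure lborel k *\<^sub>R g' x) - (f b - f a)) \<le> e * measure lborel {a..b})"
    proof (cases "a < b")
      case True
      \<comment> \<open>Half of the admissible error goes to the pieces tagged in \<open>N'\<close>;
        the factor \<open>e/2\<close> in the choice of \<open>s\<close> leaves the other half for
        the remaining pieces.\<close>
      define e' where "e' = e * (b - a) / 2"
      have "e' > 0" using True \<open>e > 0\<close> by (simp add: e'_def)
      from abs_cont_on_indexed[OF AC this]
      obtain \<delta> where "\<delta> > 0" and dd: "\<forall>(P::(real \<times> real set) set) l r. finite P \<and> (\<forall>i\<in>P. a \<le> l i \<and> l i \<le> r i \<and> r i \<le> b) \<and>
           (\<forall>i\<in>P. \<forall>j\<in>P. i \<noteq> j \<longrightarrow> {l i<..<r i} \<inter> {l j<..<r j} = {}) \<and>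
           (\<Sum>i\<in>P. r i - l i) < \<delta> \<longrightarrow> (\<Sum>i\<in>P. \<bar>f (r i) - f (l i)\<bar>) < e'"
        by (elim exE conjE) (rule that)
      note \<delta> = dd[THEN spec, THEN spec, THEN spec, THEN mp]
      obtain G where G: "open G" "N' \<subseteq> G" "G - N' \<in> lmeasurable" "emeasure lebesgue (G - N') < ennreal \<delta>"
        using sets_lebesgue_outer_open[OF negligible_imp_sets[OF N'] \<open>\<delta> > 0\<close>] by metis
      have Gm: "G \<in> lmeasurable"
        using fmeasurable.Un[OF G(3) negligible_imp_measurable[OF N']] G(2) by (simp add: Un_absorb2)
      have "measure lebesgue G \<le> measure lebesgue (G - N') + measure lebesgue N'"
        using measure_Un_le[of "G - N'" lebesgue N'] G(2,3) N' by (simp add: Un_absorb2 negligible_imp_sets fmeasurableD)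
      also have "\<dots> < \<delta>"
        using G(3,4) N' \<open>\<delta> > 0\<close> by (simp add: emeasure_eq_measure2 ennreal_less_iff negligible_imp_measure0)
      finally have mG: "measure lebesgue G < \<delta>" .
      have "\<exists>s>0. \<forall>y. \<bar>y - x\<bar> < s \<longrightarrow> \<bar>f y - f x - g x * (y - x)\<bar> \<le> e/2 * \<bar>y - x\<bar>" if "x \<in> {a<..<b} - N'" for x
      proof -
        have "(f has_derivative (*) (g x)) (at x)"
          using der[of x] that by (auto simp: N'_def has_field_derivative_def)
        then show ?thesis
          unfolding has_derivative_within_alt using \<open>e > 0\<close> by (metis UNIV_I half_gt_zero real_norm_def)
      qed
      then obtain s where s: "\<And>x. x \<in> {a<..<b} - N' \<Longrightarrow> s x > 0"
        "\<And>x y. \<lbrakk>x \<in> {a<..<b} - N'; \<bar>y - x\<bar> < s x\<rbrakk> \<Longrightarrow> \<bar>f y - f x - g x * (y - x)\<bar> \<le> e/2 * \<bar>y - x\<bar>"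
        by metis
      define d where "d = (\<lambda>x. if x \<in> N' then G else if x \<in> {a<..<b} then ball x (s x) else ball x 1)"
      have "gauge d" using G(1,2) s(1) unfolding gauge_def d_def by auto
      moreover have "norm ((\<Sum>(x, k)\<in>p. measure lborel k *\<^sub>R g' x) - (f b - f a)) \<le> e * measure lborel {a..b}"
        if p: "p tagged_division_of {a..b}" "d fine p" for p
      proof -
        note pD = tagged_division_ofD[OF p(1)]
        have pK: "x \<in> {a..b} \<and> a \<le> Inf k \<and> Inf k \<le> x \<and> x \<le> Sup k \<and> Sup k \<le> b \<and> k = {Inf k..Sup k} \<and> measure lborel k = Sup k - Inf k \<and> interior k = {Inf k<..<Sup k}"
          if xk: "(x, k) \<in> p" for x k
        proof -
          obtain l r where lr: "k = {l..r}" using pD(4)[OF xk] by (auto simp: box_real)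
          have "x \<in> k" "k \<subseteq> {a..b}" using pD(2,3)[OF xk] by auto
          then show ?thesis using lr by (auto simp: interior_atLeastAtMost_real)
        qed
        have eq: "(\<Sum>(x, k)\<in>p. measure lborel k *\<^sub>R g' x) - (f b - f a) = (\<Sum>(x, k)\<in>p. measure lborel k *\<^sub>R g' x - (f (Sup k) - f (Inf k)))"
          unfolding additive_tagged_division_1[OF \<open>a \<le> b\<close> p(1), of f, symmetric]
          by (simp add: sum_subtractf case_prod_beta')
        define P where "P = {xk\<in>p. fst xk \<in> N'}"
        have finp: "finite p" by (rule pD(1))
        have int: "{Inf (snd x)<..<Sup (snd x)} \<inter> {Inf (snd y)<..<Sup (snd y)} = {}"
          if "x \<in> p" "y \<in> p" "x \<noteq> y" for x y
          using pD(5)[of "fst x" "snd x" "fst y" "snd y"] pK[of "fst x" "snd x"] pK[of "fst y" "snd y"] that by simp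
        have small: "(\<Sum>x\<in>P. \<bar>f (Sup (snd x)) - f (Inf (snd x))\<bar>) < e'"
        proof (intro \<delta> conjI ballI impI)
          show "finite P" using finp by (simp add: P_def)
          show "{Inf (snd x)<..<Sup (snd x)} \<inter> {Inf (snd y)<..<Sup (snd y)} = {}"
            if "x \<in> P" "y \<in> P" "x \<noteq> y" for x y
            using int that by (simp add: P_def)
          show "a \<le> Inf (snd x)" "Inf (snd x) \<le> Sup (snd x)" "Sup (snd x) \<le> b" if "x \<in> P" for x
            using pK[of "fst x" "snd x"] that by (auto simp: P_def)
          have "(\<Sum>x\<in>P. Sup (snd x) - Inf (snd x)) = measure lebesgue (\<Union>x\<in>P. {Inf (snd x)<..<Sup (snd x)})"
          proof (intro measure_disjoint_intervals[symmetric])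
            show "Inf (snd x) \<le> Sup (snd x)" if "x \<in> P" for x
              using pK[of "fst x" "snd x"] that by (auto simp: P_def)
            show "{Inf (snd x)<..<Sup (snd x)} \<inter> {Inf (snd y)<..<Sup (snd y)} = {}"
              if "x \<in> P" "y \<in> P" "x \<noteq> y" for x y
              using int that by (simp add: P_def)
          qed (use finp in \<open>simp add: P_def\<close>)
          also have "\<dots> \<le> measure lebesgue G"
          proof (intro measure_mono_fmeasurable)
            show "(\<Union>x\<in>P. {Inf (snd x)<..<Sup (snd x)}) \<subseteq> G"
            proof clarify
              fix x k y assume xk: "(x, k) \<in> P" and y: "y \<in> {Inf (snd (x, k))<..<Sup (snd (x, k))}"
              have "k \<subseteq> G" using xk p(2) unfolding P_def fine_def d_def by force
              moreover have "y \<in> {Inf k..Sup k}" using y by auto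
              then have "y \<in> k" using pK[of x k] xk by (metis (no_types, lifting) P_def mem_Collect_eq)
              ultimately show "y \<in> G" by blast
            qed
            show "(\<Union>x\<in>P. {Inf (snd x)<..<Sup (snd x)}) \<in> sets lebesgue"
              using finp by (intro sets.finite_UN) (auto simp: P_def)
          qed (use Gm in auto)
          finally show "(\<Sum>x\<in>P. Sup (snd x) - Inf (snd x)) < \<delta>" using mG by simp
        qed
        \<comment> \<open>Straddle estimate: the tag lies in the piece, so the linearisation errors
          at the two ends add up to \<open>e/2\<close> times the length.\<close>
        have b1: "\<bar>measure lborel k *\<^sub>R g' x - (f (Sup k) - f (Inf k))\<bar> \<le> e/2 * measure lborel k" if xk: "(x, k) \<in> p - P" for x k
        proof -
          have xk': "(x, k) \<in> p" "x \<notin> N'" using xk by (auto simp: P_def)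
          then have x: "x \<in> {a<..<b} - N'" using pK[OF xk'(1)] by (force simp: N'_def)
          have "k \<subseteq> ball x (s x)" using p(2) xk' x unfolding fine_def d_def by force
          moreover have "Inf k \<in> k" "Sup k \<in> k" using pK[OF xk'(1)] by (metis atLeastAtMost_iff order_refl order_trans)+
          ultimately have "\<bar>Inf k - x\<bar> < s x" "\<bar>Sup k - x\<bar> < s x" by (auto simp: dist_real_def)
          from s(2)[OF x this(1)] s(2)[OF x this(2)]
          have "\<bar>f (Inf k) - f x - g x * (Inf k - x)\<bar> \<le> e/2 * \<bar>Inf k - x\<bar>"
            "\<bar>f (Sup k) - f x - g x * (Sup k - x)\<bar> \<le> e/2 * \<bar>Sup k - x\<bar>" .
          moreover have "\<bar>Inf k - x\<bar> = x - Inf k" "\<bar>Sup k - x\<bar> = Sup k - x" "measure lborel k = Sup k - Inf k" "g' x = g x"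
            using pK[OF xk'(1)] xk'(2) by (auto simp: g'_def)
          moreover define A B where "A = f (Inf k) - f x - g x * (Inf k - x)" and "B = f (Sup k) - f x - g x * (Sup k - x)"
          ultimately have AB: "\<bar>A\<bar> \<le> e/2 * (x - Inf k)" "\<bar>B\<bar> \<le> e/2 * (Sup k - x)" and
            k: "measure lborel k = Sup k - Inf k" "g' x = g x" by simp_all
          have "\<bar>A - B\<bar> \<le> e/2 * (x - Inf k) + e/2 * (Sup k - x)" using AB by linarith
          moreover have "measure lborel k *\<^sub>R g' x - (f (Sup k) - f (Inf k)) = A - B"
            unfolding k by (simp add: A_def B_def algebra_simps)
          moreover have "e/2 * (x - Inf k) + e/2 * (Sup k - x) = e/2 * measure lborel k"
            unfolding k by (simp add: field_simps)
          ultimately show ?thesis by simp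
        qed
        have "norm ((\<Sum>(x, k)\<in>p. measure lborel k *\<^sub>R g' x) - (f b - f a)) \<le> (\<Sum>x\<in>p. \<bar>measure lborel (snd x) *\<^sub>R g' (fst x) - (f (Sup (snd x)) - f (Inf (snd x)))\<bar>)"
          unfolding eq real_norm_def by (rule order_trans[OF sum_abs]) (simp add: case_prod_beta')
        also have "\<dots> = (\<Sum>x\<in>p - P. \<bar>measure lborel (snd x) *\<^sub>R g' (fst x) - (f (Sup (snd x)) - f (Inf (snd x)))\<bar>)
            + (\<Sum>x\<in>P. \<bar>measure lborel (snd x) *\<^sub>R g' (fst x) - (f (Sup (snd x)) - f (Inf (snd x)))\<bar>)"
          by (rule sum.subset_diff[OF _ finp]) (auto simp: P_def)
        also have "\<dots> \<le> (\<Sum>x\<in>p - P. e/2 * measure lborel (snd x)) + (\<Sum>x\<in>P. \<bar>f (Sup (snd x)) - f (Inf (snd x))\<bar>)"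
          using b1 by (intro add_mono sum_mono) (auto simp: P_def g'_def)
        also have "\<dots> \<le> (\<Sum>x\<in>p. e/2 * measure lborel (snd x)) + e'"
          using small \<open>e > 0\<close> finp by (intro add_mono sum_mono2) auto
        also have "(\<Sum>x\<in>p. e/2 * measure lborel (snd x)) = e/2 * measure lborel {a..b}"
        proof -
          have "(\<Sum>x\<in>p. measure lborel (snd x)) = measure lborel {a..b}"
            using additive_content_tagged_division[of p a b] p(1) by (simp add: case_prod_beta' box_real)
          then show ?thesis by (metis (no_types) sum_distrib_left)
        qed
        finally show ?thesis using True by (simp add: e'_def field_simps)
      qed
      ultimately show ?thesis by (intro exI[of _ d] conjI allI impI) (elim conjE, assumption | simp)+
    next
      case False
      then have "a = b" using \<open>a \<le> b\<close> by simp
      then have "(g' has_integral (f b - f a)) {a..b}" by (simp add: has_integral_refl)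
      from this[unfolded has_integral_factor_content_real, THEN spec, THEN mp, OF \<open>e > 0\<close>]
      show ?thesis .
    qed
  qed
  then show ?thesis
    by (rule has_integral_spike[OF N', rotated]) (auto simp: g'_def)
qed

subsection \<open>Integration on the unit interval\<close>

lemma AE_I01_iff: "(AE x in I01. P x) \<longleftrightarrow> (\<exists>N. negligible N \<and> (\<forall>x\<in>{0<..<1} - N. P x))"
proof -
  have "(AE x in I01. P x) \<longleftrightarrow> (AE x in lebesgue. x \<in> {0<..<1::real} \<longrightarrow> P x)"
    by (subst AE_restrict_space_iff) auto
  also have "\<dots> \<longleftrightarrow> (\<exists>N\<in>null_sets lebesgue. {x. \<not> (x \<in> {0<..<1::real} \<longrightarrow> P x)} \<subseteq> N)"
    by (simp add: eventually_ae_filter)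
  also have "\<dots> \<longleftrightarrow> (\<exists>N. negligible N \<and> (\<forall>x\<in>{0<..<1} - N. P x))"
    unfolding negligible_iff_null_sets by blast
  finally show ?thesis .
qed

lemma has_integral_I01:
  fixes h :: "real \<Rightarrow> real"
  assumes "integrable I01 h"
  shows "(h has_integral (LINT x|I01. h x)) {0..1}"
  using has_integral_integral_lebesgue_on[OF assms] has_integral_Icc_iff_Ioo[of h _ 0 1] by simp

lemma integrable_on_I01_subinterval:
  fixes h :: "real \<Rightarrow> real"
  assumes "integrable I01 h" "0 \<le> c" "d \<le> 1"
  shows "h integrable_on {c..d}"
  by (rule integrable_on_subinterval[OF has_integral_integrable[OF has_integral_I01[OF assms(1)]]])
     (use assms in auto)

section \<open>Closure properties of absolute continuity\<close>

lemma abs_cont_on_dominated: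
  assumes "abs_cont_on a b f" "abs_cont_on a b g" "K \<ge> 0"
    and dom: "\<And>x y. \<lbrakk>a \<le> x; x \<le> y; y \<le> b\<rbrakk> \<Longrightarrow> \<bar>h y - h x\<bar> \<le> K * (\<bar>f y - f x\<bar> + \<bar>g y - g x\<bar>)"
  shows "abs_cont_on a b h"
  unfolding abs_cont_on_def
proof (intro allI impI)
  fix \<epsilon> :: real assume e: "\<epsilon> > 0"
  define \<epsilon>' where "\<epsilon>' = \<epsilon> / (2 * (K + 1))"
  have e': "\<epsilon>' > 0" using e assms(3) by (simp add: \<epsilon>'_def)
  obtain \<delta>1 where d1: "\<delta>1 > 0" and f: "\<forall>(n::nat) l r.
        (\<forall>i<n. a \<le> l i \<and> l i \<le> r i \<and> r i \<le> b) \<and>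
        (\<forall>i<n. \<forall>j<n. i \<noteq> j \<longrightarrow> {l i<..<r i} \<inter> {l j<..<r j} = {}) \<and>
        (\<Sum>i<n. r i - l i) < \<delta>1
        \<longrightarrow> (\<Sum>i<n. \<bar>f (r i) - f (l i)\<bar>) < \<epsilon>'"
    using assms(1)[unfolded abs_cont_on_def, THEN spec, THEN mp, OF e'] by (elim exE conjE) (rule that)
  obtain \<delta>2 where d2: "\<delta>2 > 0" and g: "\<forall>(n::nat) l r.
        (\<forall>i<n. a \<le> l i \<and> l i \<le> r i \<and> r i \<le> b) \<and>
        (\<forall>i<n. \<forall>j<n. i \<noteq> j \<longrightarrow> {l i<..<r i} \<inter> {l j<..<r j} = {}) \<and>
        (\<Sum>i<n. r i - l i) < \<delta>2
        \<longrightarrow> (\<Sum>i<n. \<bar>g (r i) - g (l i)\<bar>) < \<epsilon>'"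
    using assms(2)[unfolded abs_cont_on_def, THEN spec, THEN mp, OF e'] by (elim exE conjE) (rule that)
  show "\<exists>\<delta>>0. \<forall>(n::nat) l r.
        (\<forall>i<n. a \<le> l i \<and> l i \<le> r i \<and> r i \<le> b) \<and>
        (\<forall>i<n. \<forall>j<n. i \<noteq> j \<longrightarrow> {l i<..<r i} \<inter> {l j<..<r j} = {}) \<and>
        (\<Sum>i<n. r i - l i) < \<delta>
        \<longrightarrow> (\<Sum>i<n. \<bar>h (r i) - h (l i)\<bar>) < \<epsilon>"
  proof (intro exI[of _ "min \<delta>1 \<delta>2"] conjI allI impI)
    show "min \<delta>1 \<delta>2 > 0" using d1 d2 by simp
    fix n :: nat and l r :: "nat \<Rightarrow> real"
    assume A: "(\<forall>i<n. a \<le> l i \<and> l i \<le> r i \<and> r i \<le> b) \<and>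
        (\<forall>i<n. \<forall>j<n. i \<noteq> j \<longrightarrow> {l i<..<r i} \<inter> {l j<..<r j} = {}) \<and>
        (\<Sum>i<n. r i - l i) < min \<delta>1 \<delta>2"
    have F: "(\<Sum>i<n. \<bar>f (r i) - f (l i)\<bar>) < \<epsilon>'"
      by (rule f[THEN spec, THEN spec, THEN spec, THEN mp]) (use A in simp)
    have G: "(\<Sum>i<n. \<bar>g (r i) - g (l i)\<bar>) < \<epsilon>'"
      by (rule g[THEN spec, THEN spec, THEN spec, THEN mp]) (use A in simp)
    have "(\<Sum>i<n. \<bar>h (r i) - h (l i)\<bar>) \<le> (\<Sum>i<n. K * (\<bar>f (r i) - f (l i)\<bar> + \<bar>g (r i) - g (l i)\<bar>))"
      using A by (intro sum_mono dom) auto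
    also have "\<dots> = K * ((\<Sum>i<n. \<bar>f (r i) - f (l i)\<bar>) + (\<Sum>i<n. \<bar>g (r i) - g (l i)\<bar>))"
      by (simp add: sum_distrib_left[symmetric] sum.distrib)
    also have "\<dots> \<le> K * (\<epsilon>' + \<epsilon>')" using F G assms(3) by (intro mult_left_mono) auto
    also have "\<dots> < (K + 1) * (\<epsilon>' + \<epsilon>')" using e' by (intro mult_strict_right_mono) auto
    also have "\<dots> = \<epsilon>"
    proof -
      have "2 * (K + 1) \<noteq> 0" using assms(3) by simp
      then have "2 * (K + 1) * \<epsilon> / (2 * (K + 1)) = \<epsilon>" by (rule nonzero_mult_div_cancel_left)
      then show ?thesis unfolding \<epsilon>'_def mult_2[symmetric] by (simp only: mult.assoc[symmetric] mult.commute[of "K + 1" 2] times_divide_eq_right)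
    qed
    finally show "(\<Sum>i<n. \<bar>h (r i) - h (l i)\<bar>) < \<epsilon>" .
  qed
qed

lemma abs_cont_on_ident: "abs_cont_on a b (\<lambda>x. x)"
  unfolding abs_cont_on_def
proof (intro allI impI)
  fix \<epsilon> :: real assume e: "\<epsilon> > 0"
  show "\<exists>\<delta>>0. \<forall>(n::nat) l r.
        (\<forall>i<n. a \<le> l i \<and> l i \<le> r i \<and> r i \<le> b) \<and>
        (\<forall>i<n. \<forall>j<n. i \<noteq> j \<longrightarrow> {l i<..<r i} \<inter> {l j<..<r j} = {}) \<and>
        (\<Sum>i<n. r i - l i) < \<delta>
        \<longrightarrow> (\<Sum>i<n. \<bar>r i - l i\<bar>) < \<epsilon>"
    using e by (intro exI[of _ \<epsilon>]) auto
qed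

lemma abs_cont_on_Lipschitz:
  assumes "\<And>x y. \<lbrakk>a \<le> x; x \<le> y; y \<le> b\<rbrakk> \<Longrightarrow> \<bar>h y - h x\<bar> \<le> K * (y - x)"
  shows "abs_cont_on a b h"
proof (rule abs_cont_on_dominated[OF abs_cont_on_ident abs_cont_on_ident, where K = "\<bar>K\<bar>"])
  fix x y assume xy: "a \<le> x" "x \<le> y" "y \<le> b"
  have "\<bar>h y - h x\<bar> \<le> K * (y - x)" using assms xy .
  also have "\<dots> \<le> \<bar>K\<bar> * (\<bar>y - x\<bar> + \<bar>y - x\<bar>)" using xy by (intro mult_mono) auto
  finally show "\<bar>h y - h x\<bar> \<le> \<bar>K\<bar> * (\<bar>y - x\<bar> + \<bar>y - x\<bar>)" .
qed auto

lemma abs_cont_on_continuous: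
  assumes "abs_cont_on a b f"
  shows "continuous_on {a..b} f"
  unfolding continuous_on_iff
proof (intro ballI allI impI)
  fix x e :: real assume x: "x \<in> {a..b}" and e: "0 < e"
  obtain \<delta> where d: "\<delta> > 0" and f: "\<forall>(n::nat) l r.
        (\<forall>i<n. a \<le> l i \<and> l i \<le> r i \<and> r i \<le> b) \<and>
        (\<forall>i<n. \<forall>j<n. i \<noteq> j \<longrightarrow> {l i<..<r i} \<inter> {l j<..<r j} = {}) \<and>
        (\<Sum>i<n. r i - l i) < \<delta>
        \<longrightarrow> (\<Sum>i<n. \<bar>f (r i) - f (l i)\<bar>) < e"
    using assms[unfolded abs_cont_on_def, THEN spec, THEN mp, OF e] by (elim exE conjE) (rule that)
  have "dist (f y) (f x) < e" if y: "y \<in> {a..b}" "dist y x < \<delta>" for y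
    using f[THEN spec, THEN spec, THEN spec, THEN mp, of 1 "\<lambda>_. min x y" "\<lambda>_. max x y"] x y
    by (cases "x \<le> y") (auto simp: dist_real_def abs_minus_commute min_def max_def split: if_splits)
  then show "\<exists>d>0. \<forall>y\<in>{a..b}. dist y x < d \<longrightarrow> dist (f y) (f x) < e" using d by blast
qed

lemma abs_cont_on_add:
  assumes "abs_cont_on a b f" "abs_cont_on a b g"
  shows "abs_cont_on a b (\<lambda>x. f x + g x)"
  by (rule abs_cont_on_dominated[OF assms, of 1]) auto

lemma abs_cont_on_mult:
  assumes "abs_cont_on a b f" "abs_cont_on a b g"
  shows "abs_cont_on a b (\<lambda>x. f x * g x)"
proof -
  have bd: "\<exists>B\<ge>0. \<forall>x\<in>{a..b}. \<bar>h x\<bar> \<le> B" if "abs_cont_on a b h" for h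
  proof -
    have "compact (h ` {a..b})"
      using abs_cont_on_continuous[OF that] by (intro compact_continuous_image) auto
    from compact_imp_bounded[OF this] obtain B where "\<forall>x\<in>{a..b}. \<bar>h x\<bar> \<le> B"
      by (auto simp: bounded_iff)
    then show ?thesis by (intro exI[of _ "\<bar>B\<bar>"]) force
  qed
  obtain B1 where B1: "B1 \<ge> 0" "\<forall>x\<in>{a..b}. \<bar>f x\<bar> \<le> B1" using bd[OF assms(1)] by blast
  obtain B2 where B2: "B2 \<ge> 0" "\<forall>x\<in>{a..b}. \<bar>g x\<bar> \<le> B2" using bd[OF assms(2)] by blast
  show ?thesis
  proof (rule abs_cont_on_dominated[OF assms, of "B1 + B2"])
    fix x y assume xy: "a \<le> x" "x \<le> y" "y \<le> b"
    have "f y * g y - f x * g x = f y * (g y - g x) + (f y - f x) * g x" by (simp add: algebra_simps)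
    then have "\<bar>f y * g y - f x * g x\<bar> \<le> \<bar>f y\<bar> * \<bar>g y - g x\<bar> + \<bar>f y - f x\<bar> * \<bar>g x\<bar>"
      by (metis abs_mult abs_triangle_ineq)
    also have "\<dots> \<le> (B1 + B2) * \<bar>g y - g x\<bar> + \<bar>f y - f x\<bar> * (B1 + B2)"
    proof (intro add_mono mult_right_mono mult_left_mono)
      show "\<bar>f y\<bar> \<le> B1 + B2" using B1 B2 xy by (smt (verit) atLeastAtMost_iff)
      show "\<bar>g x\<bar> \<le> B1 + B2" using B1 B2 xy by (smt (verit) atLeastAtMost_iff)
    qed auto
    finally show "\<bar>f y * g y - f x * g x\<bar> \<le> (B1 + B2) * (\<bar>f y - f x\<bar> + \<bar>g y - g x\<bar>)"
      by (simp add: algebra_simps)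
  qed (use B1 B2 in auto)
qed

lemma abs_cont_on_C1:
  fixes f :: "real \<Rightarrow> real"
  assumes "\<And>x. x \<in> {a..b} \<Longrightarrow> (f has_real_derivative f' x) (at x within {a..b})" "continuous_on {a..b} f'"
  shows "abs_cont_on a b f"
proof -
  have "compact (f' ` {a..b})" using assms(2) by (intro compact_continuous_image) auto
  from compact_imp_bounded[OF this] obtain B where B: "\<forall>x\<in>{a..b}. \<bar>f' x\<bar> \<le> B"
    by (auto simp: bounded_iff)
  have "\<bar>f y - f x\<bar> \<le> B * (y - x)" if "a \<le> x" "x \<le> y" "y \<le> b" for x y
    using field_differentiable_bound[of "{a..b}" f f' B y x] assms(1) B that by (auto simp: real_norm_def)
  then show ?thesis by (rule abs_cont_on_Lipschitz)
qed

section \<open>The derivative \<open>D\<close> and local absolute continuity on ]0,1]\<close>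

lemma D_eq:
  assumes "(f has_real_derivative d) (at x within {0<..1})" "x \<in> {0<..1}"
  shows "D f x = d"
proof -
  have "at x within {0<..1} \<noteq> bot"
  proof (cases "x = 1")
    case True
    have "x islimpt {0<..<1}" using True by (simp add: islimpt_greaterThanLessThan2)
    then have "x islimpt {0<..1}" by (rule islimpt_subset) auto
    then show ?thesis by (simp add: trivial_limit_within)
  next
    case False
    then have "at x within {0<..1} = at x" using assms(2) by (intro at_within_nhd[of _ "{0<..<1}", where U = UNIV, simplified]) auto
    then show ?thesis by simp
  qed
  then show ?thesis
    unfolding D_def using assms(1) by (intro vector_derivative_within) (auto simp: has_real_derivative_iff_has_vector_derivative)
qed

lemma D_eq_at:
  assumes "(f has_real_derivative d) (at x)" "x \<in> {0<..<1}"
  shows "D f x = d"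
  by (rule D_eq[OF has_field_derivative_at_within[OF assms(1)]]) (use assms(2) in auto)

lemma D_cong:
  assumes "\<And>y. y \<in> {0<..1} \<Longrightarrow> f y = g y" "x \<in> {0<..1}"
  shows "D f x = D g x"
  unfolding D_def using assms by (intro vector_derivative_cong_eq always_eventually) auto

text \<open>The regularity clause of \<open>V1\<close> on its own. It says nothing near 0, so every
  boundary term at 0 must be identified by a separate argument.\<close>

definition AC01 :: "(real \<Rightarrow> real) \<Rightarrow> bool" where
  "AC01 f \<longleftrightarrow> (\<forall>c\<in>{0<..1}. abs_cont_on c 1 f)"

lemma AC01_add: "AC01 f \<Longrightarrow> AC01 g \<Longrightarrow> AC01 (\<lambda>x. f x + g x)"
  by (simp add: AC01_def abs_cont_on_add)

lemma AC01_mult: "AC01 f \<Longrightarrow> AC01 g \<Longrightarrow> AC01 (\<lambda>x. f x * g x)"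
  by (simp add: AC01_def abs_cont_on_mult)

lemma AC01_const: "AC01 (\<lambda>x. c)"
  unfolding AC01_def by (auto intro!: abs_cont_on_Lipschitz[where K = 0])

lemma AC01_ident: "AC01 (\<lambda>x. x)"
  unfolding AC01_def by (auto intro!: abs_cont_on_ident)

lemma AC01_continuous:
  assumes "AC01 f"
  shows "continuous_on {0<..1} f"
  unfolding continuous_on_eq_continuous_within
proof
  fix x :: real assume x: "x \<in> {0<..1}"
  have "continuous_on {x/2..1} f" using assms x by (intro abs_cont_on_continuous) (auto simp: AC01_def)
  then have "continuous (at x within {x/2..1}) f"
    using x by (auto simp: continuous_on_eq_continuous_within)
  moreover have "at x within {x/2..1} = at x within {0<..1}"
    by (rule at_within_nhd[of _ "{x/2<..}"]) (use x in auto)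
  ultimately show "continuous (at x within {0<..1}) f" by simp
qed

lemma continuous_measurable_I01:
  "continuous_on {0<..1} f \<Longrightarrow> f \<in> borel_measurable I01"
  by (rule continuous_imp_measurable_on_sets_lebesgue) (auto intro: continuous_on_subset)

lemma AC01_AE_D:
  assumes "AC01 f"
  shows "AE x in I01. (f has_real_derivative D f x) (at x)"
proof -
  have "\<exists>N. negligible N \<and> (\<forall>x\<in>{1 / real (n + 2)<..<1} - N. \<exists>L. (f has_real_derivative L) (at x))" for n
    by (rule abs_cont_on_AE_differentiable[of "1 / real (n + 2)" 1 f]) (use assms in \<open>auto simp: AC01_def\<close>)
  then obtain N where N: "\<And>n. negligible (N n)"
    "\<And>n x. x \<in> {1 / real (n + 2)<..<1} - N n \<Longrightarrow> \<exists>L. (f has_real_derivative L) (at x)"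
    by metis
  show ?thesis
    unfolding AE_I01_iff
  proof (intro exI[of _ "\<Union>n. N n"] conjI ballI)
    show "negligible (\<Union>n. N n)" using N(1) by (intro negligible_countable_Union) auto
    fix x assume x: "x \<in> {0<..<1} - (\<Union>n. N n)"
    then obtain n where "1 / real (Suc n) < x" using nat_approx_posE[of x] by auto
    moreover have "1 / real (n + 2) \<le> 1 / real (Suc n)" by (simp add: field_simps)
    ultimately have "x \<in> {1 / real (n + 2)<..<1} - N n" using x by auto
    from N(2)[OF this] show "(f has_real_derivative D f x) (at x)"
      using D_eq_at x by auto
  qed
qed

lemma AC01_FTC:
  assumes "AC01 F" "AE x in I01. (F has_real_derivative h x) (at x)" "0 < c" "c \<le> d" "d \<le> 1"
  shows "(h has_integral (F d - F c)) {c..d}"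
proof -
  obtain N where N: "negligible N" "\<forall>x\<in>{0<..<1} - N. (F has_real_derivative h x) (at x)"
    using assms(2) unfolding AE_I01_iff by blast
  show ?thesis
  proof (rule abs_cont_on_FTC[OF _ \<open>c \<le> d\<close> N(1)])
    have "abs_cont_on c 1 F" using assms(1,3,4,5) by (simp add: AC01_def)
    then show "abs_cont_on c d F" by (rule abs_cont_on_subset) (use assms(5) in auto)
    fix x assume "x \<in> {c<..<d} - N"
    then have "x \<in> {0<..<1} - N" using assms(3-5) by auto
    then show "(F has_real_derivative h x) (at x)" using N(2) by blast
  qed
qed

text \<open>An integrable derivative forces a limit at 0, although \<open>F\<close> itself is only
  controlled on ]0,1]. Integration by parts thus reduces to recognising this limit.\<close>

lemma AC01_FTC_limit:
  assumes "AC01 F" "AE x in I01. (F has_real_derivative h x) (at x)" "integrable I01 h"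
  shows "(F \<longlongrightarrow> F 1 - (LINT x|I01. h x)) (at_right 0)"
proof -
  let ?I = "LINT x|I01. h x"
  have H: "(h has_integral ?I) {0..1}" by (rule has_integral_I01[OF assms(3)])
  have "continuous_on {0..1} (\<lambda>c. integral {0..c} h)"
    by (rule indefinite_integral_continuous_1) (use H in blast)
  then have "((\<lambda>c. integral {0..c} h) \<longlongrightarrow> integral {0..0} h) (at 0 within {0..1})"
    unfolding continuous_on_def by (rule bspec) simp
  then have L: "((\<lambda>c. integral {0..c} h) \<longlongrightarrow> 0) (at_right 0)"
    by (simp add: at_within_Icc_at_right)
  have "F c = F 1 - ?I + integral {0..c} h" if c: "0 < c" "c < 1" for c
  proof -
    have "integral {c..1} h = F 1 - F c"
      using AC01_FTC[OF assms(1,2), of c 1] c by (intro integral_unique) auto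
    moreover have "integral {0..c} h + integral {c..1} h = integral {0..1} h"
      using c H by (intro Henstock_Kurzweil_Integration.integral_combine) auto
    ultimately show ?thesis using integral_unique[OF H] by simp
  qed
  then have "\<forall>\<^sub>F c in at_right 0. F 1 - ?I + integral {0..c} h = F c"
    unfolding eventually_at_right_field by (intro exI[of _ 1]) auto
  moreover have "((\<lambda>c. F 1 - ?I + integral {0..c} h) \<longlongrightarrow> F 1 - ?I + 0) (at_right 0)"
    by (intro tendsto_intros L)
  ultimately show ?thesis using Lim_transform_eventually by fastforce
qed

text \<open>Otherwise \<open>\<bar>f x\<bar>\<close> exceeds \<open>\<bar>L\<bar> / (2 x)\<close>
  near 0, and the integral of \<open>1/x\<close> diverges there.\<close>

lemma integrable_limit_zero:
  assumes "integrable I01 f" "((\<lambda>x. x * f x) \<longlongrightarrow> L) (at_right 0)"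
  shows "L = 0"
proof (rule ccontr)
  assume "L \<noteq> 0"
  then have "\<bar>L\<bar> / 2 < \<bar>L\<bar>" by simp
  moreover have "((\<lambda>x. \<bar>x * f x\<bar>) \<longlongrightarrow> \<bar>L\<bar>) (at_right 0)" by (intro tendsto_intros assms)
  ultimately have "\<forall>\<^sub>F x in at_right 0. \<bar>L\<bar> / 2 < \<bar>x * f x\<bar>" by (rule order_tendstoD(1)[rotated])
  then obtain b where b: "b > 0" "\<And>y. 0 < y \<Longrightarrow> y < b \<Longrightarrow> \<bar>L\<bar> / 2 < \<bar>y * f y\<bar>"
    unfolding eventually_at_right_field by blast
  define d where "d = min b 1 / 2"
  have d: "0 < d" "d < b" "d < 1" using b(1) by (auto simp: d_def)
  have int: "integrable I01 (\<lambda>x. \<bar>f x\<bar>)" using assms(1) by simp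
  define B where "B = (LINT x|I01. \<bar>f x\<bar>)"
  have bound: "\<bar>L\<bar> / 2 * (ln d - ln c) \<le> B" if c: "0 < c" "c < d" for c
  proof -
    have "((\<lambda>x. \<bar>L\<bar> / 2 * (1 / x)) has_integral (\<bar>L\<bar> / 2 * (ln d - ln c))) {c..d}"
    proof (intro has_integral_mult_right fundamental_theorem_of_calculus)
      fix x assume "x \<in> {c..d}"
      then show "(ln has_vector_derivative 1 / x) (at x within {c..d})"
        using c by (auto intro!: derivative_eq_intros simp: has_real_derivative_iff_has_vector_derivative[symmetric])
    qed (use c in auto)
    moreover have fi: "(\<lambda>x. \<bar>f x\<bar>) integrable_on {c..d}"
      using c d by (intro integrable_on_I01_subinterval int) auto
    then have "((\<lambda>x. \<bar>f x\<bar>) has_integral integral {c..d} (\<lambda>x. \<bar>f x\<bar>)) {c..d}" by blast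
    ultimately have "\<bar>L\<bar> / 2 * (ln d - ln c) \<le> integral {c..d} (\<lambda>x. \<bar>f x\<bar>)"
    proof (rule has_integral_le)
      fix x assume x: "x \<in> {c..d}"
      then have "\<bar>L\<bar> / 2 < x * \<bar>f x\<bar>" using b(2)[of x] c d by (auto simp: abs_mult)
      then show "\<bar>L\<bar> / 2 * (1 / x) \<le> \<bar>f x\<bar>" using x c by (simp add: field_simps)
    qed
    also have "\<dots> \<le> integral {0..1} (\<lambda>x. \<bar>f x\<bar>)"
      using c d fi has_integral_I01[OF int] by (intro integral_subset_le) auto
    also have "\<dots> = B" unfolding B_def by (rule integral_unique[OF has_integral_I01[OF int]])
    finally show ?thesis .
  qed
  \<comment> \<open>Chosen so that the logarithmic lower bound equals
    \<open>\<bar>B\<bar> + 1\<close>, more than \<open>B\<close>.\<close>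
  define c where "c = exp (ln d - 2 * (\<bar>B\<bar> + 1) / \<bar>L\<bar>)"
  have "c < exp (ln d)" using \<open>L \<noteq> 0\<close> unfolding c_def exp_less_cancel_iff by (simp add: divide_pos_pos)
  then have "c < d" using d by simp
  moreover have "c > 0" by (simp add: c_def)
  ultimately have "\<bar>L\<bar> / 2 * (2 * (\<bar>B\<bar> + 1) / \<bar>L\<bar>) \<le> B" using bound[of c] by (simp add: c_def)
  moreover have "\<bar>L\<bar> / 2 * (2 * (\<bar>B\<bar> + 1) / \<bar>L\<bar>) = \<bar>B\<bar> + 1" using \<open>L \<noteq> 0\<close> by simp
  ultimately show False by linarith
qed

text \<open>Common core of the two Cauchy-Schwarz inequalities, in L2 and in the energy space. The
  forms are only semidefinite on representatives, hence the case \<open>C = 0\<close>.\<close>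

lemma quadratic_nonneg_discriminant:
  fixes A B C :: real
  assumes "C \<ge> 0" "\<And>t. A + 2 * t * B + t\<^sup>2 * C \<ge> 0"
  shows "B\<^sup>2 \<le> A * C"
proof (cases "C = 0")
  case True
  have "B = 0"
  proof (rule ccontr)
    assume "B \<noteq> 0"
    then show False using assms(2)[of "- (A + 1) / (2 * B)"] True by (simp add: field_simps)
  qed
  then show ?thesis using True by simp
next
  case False
  then show ?thesis using assms(1) assms(2)[of "- B / C"] by (simp add: field_simps power2_eq_square)
qed

section \<open>Square-integrable functions on the unit interval\<close>

lemma L2_measurable: "L2 f \<Longrightarrow> f \<in> borel_measurable I01"
  by (simp add: L2_def)

lemma L2_mult:
  assumes "L2 f" "L2 g"
  shows "integrable I01 (\<lambda>x. f x * g x)"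
proof (rule Bochner_Integration.integrable_bound)
  show "integrable I01 (\<lambda>x. (f x)\<^sup>2 + (g x)\<^sup>2)" using assms by (auto simp: L2_def)
  show "(\<lambda>x. f x * g x) \<in> borel_measurable I01" using assms by (auto simp: L2_def)
  have "\<bar>f x * g x\<bar> \<le> (f x)\<^sup>2 + (g x)\<^sup>2" for x
  proof -
    have "0 \<le> (\<bar>f x\<bar> - \<bar>g x\<bar>)\<^sup>2" by simp
    then have "2 * \<bar>f x * g x\<bar> \<le> (f x)\<^sup>2 + (g x)\<^sup>2" by (simp add: power2_diff abs_mult)
    then show ?thesis by linarith
  qed
  then show "AE x in I01. norm (f x * g x) \<le> norm ((f x)\<^sup>2 + (g x)\<^sup>2)" by simp
qed

lemma L2_lincomb:
  assumes "L2 f" "L2 g"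
  shows "L2 (\<lambda>x. r * f x + s * g x)"
proof -
  have "integrable I01 (\<lambda>x. r\<^sup>2 * (f x)\<^sup>2 + s\<^sup>2 * (g x)\<^sup>2 + (2 * r * s) * (f x * g x))"
    using assms L2_mult[OF assms] by (intro Bochner_Integration.integrable_add integrable_mult_right) (auto simp: L2_def)
  then have "integrable I01 (\<lambda>x. (r * f x + s * g x)\<^sup>2)"
    by (rule Bochner_Integration.integrable_cong[THEN iffD1, rotated 2]) (auto simp: power2_eq_square algebra_simps)
  then show ?thesis using assms by (auto simp: L2_def)
qed

lemma L2_bounded_mult:
  assumes "L2 f" "g \<in> borel_measurable I01" "AE x in I01. \<bar>g x\<bar> \<le> K"
  shows "L2 (\<lambda>x. g x * f x)"
proof -
  have "integrable I01 (\<lambda>x. (g x * f x)\<^sup>2)"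
  proof (rule Bochner_Integration.integrable_bound)
    show "integrable I01 (\<lambda>x. K\<^sup>2 * (f x)\<^sup>2)" using assms(1) by (simp add: L2_def)
    show "(\<lambda>x. (g x * f x)\<^sup>2) \<in> borel_measurable I01" using assms by (auto simp: L2_def)
    show "AE x in I01. norm ((g x * f x)\<^sup>2) \<le> norm (K\<^sup>2 * (f x)\<^sup>2)"
      using assms(3)
    proof eventually_elim
      case (elim x)
      then have "(g x)\<^sup>2 \<le> K\<^sup>2" by (metis abs_ge_zero power2_abs power_mono)
      then show ?case by (simp add: power_mult_distrib mult_right_mono)
    qed
  qed
  then show ?thesis using assms by (auto simp: L2_def)
qed

text \<open>Completeness of Lebesgue measure. It is what makes \<open>D u\<close> measurable for
  functions that are differentiable only almost everywhere.\<close>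

lemma measurable_I01_cong_AE:
  assumes "f \<in> borel_measurable I01" "AE x in I01. f x = (g x::real)"
  shows "g \<in> borel_measurable I01"
proof -
  obtain N where N: "negligible N" "\<forall>x\<in>{0<..<1} - N. f x = g x" using assms(2) unfolding AE_I01_iff by blast
  have "(\<lambda>x. if x \<in> {0<..<1} then f x else 0) \<in> borel_measurable lebesgue"
    using assms(1) borel_measurable_if[of "{0<..<1::real}" f] by simp
  moreover have "AE x in lebesgue. (if x \<in> {0<..<1} then f x else 0) = (if x \<in> {0<..<1} then g x else 0)"
    using N unfolding completion.AE_iff_null_sets negligible_iff_null_sets eventually_ae_filter
    by (intro bexI[of _ N]) auto
  ultimately have "(\<lambda>x. if x \<in> {0<..<1} then g x else 0) \<in> borel_measurable lebesgue"
    by (rule borel_measurable_AE)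
  then show ?thesis using borel_measurable_if[of "{0<..<1::real}" g] by simp
qed

lemma L2_cong_AE:
  assumes "L2 f" "AE x in I01. f x = g x"
  shows "L2 g"
proof -
  have "integrable I01 (\<lambda>x. (g x)\<^sup>2)"
  proof (rule integrable_cong_AE_imp)
    show "integrable I01 (\<lambda>x. (f x)\<^sup>2)" using assms(1) by (simp add: L2_def)
    show "(\<lambda>x. (g x)\<^sup>2) \<in> borel_measurable I01"
      using measurable_I01_cong_AE[OF L2_measurable[OF assms(1)] assms(2)] by simp
    show "AE x in I01. (f x)\<^sup>2 = (g x)\<^sup>2" using assms(2) by eventually_elim simp
  qed
  then show ?thesis using measurable_I01_cong_AE[OF L2_measurable[OF assms(1)] assms(2)] by (simp add: L2_def)
qed

lemma finite_measure_I01: "finite_measure I01"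
  by (rule finite_measure_lebesgue_on) simp

lemma L2_const: "L2 (\<lambda>x. c)"
  using finite_measure.integrable_const[OF finite_measure_I01] by (simp add: L2_def)

lemma L2_integrable: "L2 f \<Longrightarrow> integrable I01 f"
  using L2_mult[OF _ L2_const[of 1]] by simp

lemma L2_Cauchy_Schwarz:
  assumes "L2 f" "L2 g"
  shows "(LINT x|I01. f x * g x)\<^sup>2 \<le> (LINT x|I01. (f x)\<^sup>2) * (LINT x|I01. (g x)\<^sup>2)"
proof (rule quadratic_nonneg_discriminant)
  fix t
  have "0 \<le> (LINT x|I01. (f x + t * g x)\<^sup>2)" by simp
  also have "\<dots> = (LINT x|I01. ((f x)\<^sup>2 + (2 * t) * (f x * g x)) + t\<^sup>2 * (g x)\<^sup>2)"
    by (intro Bochner_Integration.integral_cong) (auto simp: power2_eq_square algebra_simps)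
  also have "\<dots> = (LINT x|I01. (f x)\<^sup>2) + 2 * t * (LINT x|I01. f x * g x) + t\<^sup>2 * (LINT x|I01. (g x)\<^sup>2)"
    using assms L2_mult[OF assms] by (simp add: L2_def)
  finally show "0 \<le> (LINT x|I01. (f x)\<^sup>2) + 2 * t * (LINT x|I01. f x * g x) + t\<^sup>2 * (LINT x|I01. (g x)\<^sup>2)" .
qed simp

lemma integral_indicator_I01:
  fixes h :: "real \<Rightarrow> real"
  assumes "integrable I01 h" "0 \<le> l" "r \<le> 1"
  shows "integrable I01 (\<lambda>x. indicat_real {l<..<r} x * h x)"
    "(LINT x|I01. indicat_real {l<..<r} x * h x) = integral {l..r} h"
proof -
  show i: "integrable I01 (\<lambda>x. indicat_real {l<..<r} x * h x)"
  proof (rule Bochner_Integration.integrable_bound[OF assms(1)])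
    show "(\<lambda>x. indicat_real {l<..<r} x * h x) \<in> borel_measurable I01"
      using assms(1) by (intro borel_measurable_times[OF measurable_restrict_space1[OF borel_measurable_indicator]])
        (auto intro: borel_measurable_integrable)
  qed (auto simp: indicator_def)
  have "((\<lambda>x. indicat_real {l<..<r} x * h x) has_integral (LINT x|I01. indicat_real {l<..<r} x * h x)) {0..1}"
    by (rule has_integral_I01[OF i])
  moreover have "(\<lambda>x. indicat_real {l<..<r} x * h x) = (\<lambda>x. if x \<in> {l<..<r} then h x else 0)"
    by (auto simp: indicator_def)
  moreover have "{l<..<r} \<subseteq> {0..1}" using assms(2,3) by auto
  ultimately have "(h has_integral (LINT x|I01. indicat_real {l<..<r} x * h x)) {l<..<r}"
    using has_integral_restrict[of "{l<..<r}" "{0..1}" h] by metis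
  then show "(LINT x|I01. indicat_real {l<..<r} x * h x) = integral {l..r} h"
    by (simp add: has_integral_Icc_iff_Ioo[symmetric] integral_unique)
qed

lemma indefinite_integral_diff:
  fixes h :: "real \<Rightarrow> real"
  assumes "integrable I01 h" "0 \<le> l" "l \<le> r" "r \<le> 1"
  shows "integral {0..r} h - integral {0..l} h = integral {l..r} h"
proof -
  have "integral {0..l} h + integral {l..r} h = integral {0..r} h"
    using assms by (intro Henstock_Kurzweil_Integration.integral_combine integrable_on_I01_subinterval) auto
  then show ?thesis by simp
qed

text \<open>Pointwise \<open>\<bar>g\<bar> \<le> \<kappa> g^2 + 1/\<kappa>\<close>. The free weight
  replaces Cauchy-Schwarz: a small fixed \<open>\<kappa>\<close> gives absolute continuity of the
  primitive, \<open>\<kappa> = sqrt x\<close> its growth at 0.\<close>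

lemma L2_integral_bound:
  assumes "L2 g" "0 \<le> l" "l \<le> r" "r \<le> 1" "\<kappa> > 0"
  shows "\<bar>integral {l..r} g\<bar> \<le> \<kappa> * integral {l..r} (\<lambda>x. (g x)\<^sup>2) + (r - l) / \<kappa>"
proof -
  have g2: "integrable I01 (\<lambda>x. (g x)\<^sup>2)" using assms(1) by (simp add: L2_def)
  have i2: "((\<lambda>x. (g x)\<^sup>2) has_integral integral {l..r} (\<lambda>x. (g x)\<^sup>2)) {l..r}"
    using integrable_on_I01_subinterval[OF g2 assms(2,4)] by blast
  have "((\<lambda>x. \<kappa> * (g x)\<^sup>2 + 1 / \<kappa>) has_integral (\<kappa> * integral {l..r} (\<lambda>x. (g x)\<^sup>2) + measure lborel {l..r} *\<^sub>R (1 / \<kappa>))) {l..r}"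
    by (intro has_integral_add has_integral_mult_right i2 has_integral_const_real)
  then have H: "((\<lambda>x. \<kappa> * (g x)\<^sup>2 + 1 / \<kappa>) has_integral (\<kappa> * integral {l..r} (\<lambda>x. (g x)\<^sup>2) + (r - l) / \<kappa>)) {l..r}"
    using assms(3) by simp
  have "norm (integral {l..r} g) \<le> integral {l..r} (\<lambda>x. \<kappa> * (g x)\<^sup>2 + 1 / \<kappa>)"
  proof (rule integral_norm_bound_integral)
    show "g integrable_on {l..r}" using L2_integrable[OF assms(1)] assms by (intro integrable_on_I01_subinterval)
    show "(\<lambda>x. \<kappa> * (g x)\<^sup>2 + 1 / \<kappa>) integrable_on {l..r}" using H by blast
    fix x
    have "0 \<le> \<kappa> * (\<bar>g x\<bar> - 1 / \<kappa>)\<^sup>2" using assms(5) by simp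
    also have "\<dots> = \<kappa> * (g x)\<^sup>2 - 2 * \<bar>g x\<bar> + 1 / \<kappa>" using assms(5)
      by (simp add: power2_diff field_simps power2_eq_square)
    finally show "norm (g x) \<le> \<kappa> * (g x)\<^sup>2 + 1 / \<kappa>" by simp
  qed
  then show ?thesis using integral_unique[OF H] by simp
qed

lemma abs_cont_on_indefinite_integral:
  assumes "L2 g"
  shows "abs_cont_on 0 1 (\<lambda>x. integral {0..x} g)"
  unfolding abs_cont_on_def
proof (intro allI impI)
  fix \<epsilon> :: real assume e: "\<epsilon> > 0"
  define B where "B = (LINT x|I01. (g x)\<^sup>2)"
  have g2: "integrable I01 (\<lambda>x. (g x)\<^sup>2)" using assms(1) by (simp add: L2_def)
  have B: "B \<ge> 0" by (simp add: B_def)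
  define \<kappa> where "\<kappa> = \<epsilon> / (2 * (B + 1))"
  have \<kappa>: "\<kappa> > 0" "\<kappa> * B < \<epsilon> / 2"
  proof -
    show "\<kappa> > 0" using e B by (simp add: \<kappa>_def)
    then have "\<kappa> * B < \<kappa> * (B + 1)" by simp
    also have "\<dots> = \<epsilon> / 2" using B by (simp add: \<kappa>_def divide_simps)
    finally show "\<kappa> * B < \<epsilon> / 2" .
  qed
  show "\<exists>\<delta>>0. \<forall>(n::nat) l r.
        (\<forall>i<n. 0 \<le> l i \<and> l i \<le> r i \<and> r i \<le> 1) \<and>
        (\<forall>i<n. \<forall>j<n. i \<noteq> j \<longrightarrow> {l i<..<r i} \<inter> {l j<..<r j} = {}) \<and>
        (\<Sum>i<n. r i - l i) < \<delta>
        \<longrightarrow> (\<Sum>i<n. \<bar>integral {0..r i} g - integral {0..l i} g\<bar>) < \<epsilon>"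
  proof (intro exI[of _ "\<kappa> * \<epsilon> / 2"] conjI allI impI)
    show "\<kappa> * \<epsilon> / 2 > 0" using \<kappa> e by simp
    fix n :: nat and l r :: "nat \<Rightarrow> real"
    assume A: "(\<forall>i<n. 0 \<le> l i \<and> l i \<le> r i \<and> r i \<le> 1) \<and>
        (\<forall>i<n. \<forall>j<n. i \<noteq> j \<longrightarrow> {l i<..<r i} \<inter> {l j<..<r j} = {}) \<and>
        (\<Sum>i<n. r i - l i) < \<kappa> * \<epsilon> / 2"
    have lr: "0 \<le> l i" "l i \<le> r i" "r i \<le> 1" if "i < n" for i using A that by auto
    have dis: "{l i<..<r i} \<inter> {l j<..<r j} = {}" if "i < n" "j < n" "i \<noteq> j" for i j using A that by blast
    have "(\<Sum>i<n. \<bar>integral {0..r i} g - integral {0..l i} g\<bar>) \<le> (\<Sum>i<n. \<kappa> * integral {l i..r i} (\<lambda>x. (g x)\<^sup>2) + (r i - l i) / \<kappa>)"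
      using lr indefinite_integral_diff[OF L2_integrable[OF assms]] \<kappa>(1)
      by (intro sum_mono) (simp add: L2_integral_bound[OF assms])
    also have "\<dots> = \<kappa> * (\<Sum>i<n. integral {l i..r i} (\<lambda>x. (g x)\<^sup>2)) + (\<Sum>i<n. r i - l i) / \<kappa>"
      by (simp add: sum.distrib sum_distrib_left sum_divide_distrib)
    also have "(\<Sum>i<n. integral {l i..r i} (\<lambda>x. (g x)\<^sup>2)) = (\<Sum>i<n. LINT x|I01. indicat_real {l i<..<r i} x * (g x)\<^sup>2)"
      using lr by (intro sum.cong refl integral_indicator_I01(2)[symmetric] g2) auto
    also have "\<dots> = (LINT x|I01. (\<Sum>i<n. indicat_real {l i<..<r i} x * (g x)\<^sup>2))"
      using lr by (intro Bochner_Integration.integral_sum[symmetric] integral_indicator_I01(1) g2) auto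
    also have "\<dots> \<le> B" unfolding B_def
    proof (intro integral_mono g2)
      show "integrable I01 (\<lambda>x. \<Sum>i<n. indicat_real {l i<..<r i} x * (g x)\<^sup>2)"
        using lr by (intro Bochner_Integration.integrable_sum integral_indicator_I01(1) g2) auto
      fix x
      \<comment> \<open>Disjointness of the open intervals: at most one indicator is nonzero at
        \<open>x\<close>, so the local energies of \<open>g\<close> sum to at most
        \<open>B\<close>.\<close>
      have "(\<Sum>i<n. indicat_real {l i<..<r i} x) \<le> 1"
      proof (cases "\<exists>i<n. x \<in> {l i<..<r i}")
        case True
        then obtain i where i: "i < n" "x \<in> {l i<..<r i}" by blast
        have z: "indicat_real {l j<..<r j} x = 0" if "j \<in> {..<n} - {i}" for j
          using dis[of i j] i that by (auto simp: indicator_def)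
        have "(\<Sum>i<n. indicat_real {l i<..<r i} x) = indicat_real {l i<..<r i} x + (\<Sum>j\<in>{..<n} - {i}. indicat_real {l j<..<r j} x)"
          using i by (intro sum.remove) auto
        also have "\<dots> = indicat_real {l i<..<r i} x" using z by simp
        finally show ?thesis using i by simp
      next
        case False
        then have "(\<Sum>i<n. indicat_real {l i<..<r i} x) = 0" by (intro sum.neutral) (auto simp: indicator_def)
        then show ?thesis by simp
      qed
      then show "(\<Sum>i<n. indicat_real {l i<..<r i} x * (g x)\<^sup>2) \<le> (g x)\<^sup>2"
        unfolding sum_distrib_right[symmetric] by (intro mult_left_le_one_le sum_nonneg) auto
    qed
    finally have "(\<Sum>i<n. \<bar>integral {0..r i} g - integral {0..l i} g\<bar>) \<le> \<kappa> * B + (\<Sum>i<n. r i - l i) / \<kappa>"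
      using \<kappa>(1) by simp
    also have "(\<Sum>i<n. r i - l i) / \<kappa> < \<epsilon> / 2" using A \<kappa>(1) by (simp add: divide_simps mult_ac)
    finally show "(\<Sum>i<n. \<bar>integral {0..r i} g - integral {0..l i} g\<bar>) < \<epsilon>" using \<kappa>(2) by simp
  qed
qed

text \<open>The weight \<open>\<kappa> = sqrt x\<close> balances the two terms. A flux that vanishes
  at 0 is thereby of order \<open>sqrt x\<close>, which will compensate for test functions unbounded
  at 0.\<close>

lemma indefinite_integral_sqrt_bound:
  assumes "L2 g" "0 < x" "x \<le> 1"
  shows "\<bar>integral {0..x} g\<bar> \<le> ((LINT x|I01. (g x)\<^sup>2) + 1) * sqrt x"
proof -
  have g2: "integrable I01 (\<lambda>x. (g x)\<^sup>2)" using assms(1) by (simp add: L2_def)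
  have "\<bar>integral {0..x} g\<bar> \<le> sqrt x * integral {0..x} (\<lambda>x. (g x)\<^sup>2) + (x - 0) / sqrt x"
    using assms by (intro L2_integral_bound) auto
  also have "(x - 0) / sqrt x = sqrt x" using assms by (simp add: real_div_sqrt)
  also have "integral {0..x} (\<lambda>x. (g x)\<^sup>2) \<le> integral {0..1} (\<lambda>x. (g x)\<^sup>2)"
    using assms integrable_on_I01_subinterval[OF g2, of 0] by (intro integral_subset_le) auto
  also have "\<dots> = (LINT x|I01. (g x)\<^sup>2)" by (rule integral_unique[OF has_integral_I01[OF g2]])
  finally show ?thesis using assms by (simp add: algebra_simps)
qed

subsection \<open>Indefinite integrals and weak derivatives\<close>

text \<open>Half-open intervals form a generator of the Borel sets that is stable under
  intersection, so the vanishing of the integral spreads by Dynkin's argument to Borel sets, then to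
  Lebesgue sets, which differ from Borel supersets by null sets. A function whose integral over
  every measurable set is 0 vanishes almost everywhere.\<close>

lemma integral_zero_imp_AE_zero:
  fixes k :: "real \<Rightarrow> real"
  assumes k: "integrable I01 k" and zero: "\<And>l r. \<lbrakk>0 < l; l \<le> r; r < 1\<rbrakk> \<Longrightarrow> integral {l..r} k = 0"
  shows "AE x in I01. k x = 0"
proof -
  define k' where "k' = (\<lambda>x. indicat_real {0<..<1} x * k x)"
  have k': "integrable lebesgue k'"
    using k unfolding k'_def by (subst (asm) integrable_restrict_space) auto
  have kset: "set_integrable lebesgue A k'" if "A \<in> sets lebesgue" for A
    unfolding set_integrable_def using k' that by (intro integrable_mult_indicator)
  define P where "P = (\<lambda>A. (LINT x:A|lebesgue. k' x) = 0)"
  \<comment> \<open>The hypothesis stays away from 0 and 1; continuity of the primitive extends it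
    to intervals that touch the end points.\<close>
  have zero01: "integral {l..r} k = 0" if "0 \<le> l" "l \<le> r" "r \<le> 1" for l r
  proof -
    define F where "F = (\<lambda>x. integral {0..x} k)"
    have cont: "continuous_on {0..1} F"
      unfolding F_def by (intro indefinite_integral_continuous_1 integrable_on_I01_subinterval k) auto
    have F01: "F x = F (1/2)" if "x \<in> {0<..<1}" for x
      using indefinite_integral_diff[OF k, of x "1/2"] indefinite_integral_diff[OF k, of "1/2" x] zero[of x "1/2"] zero[of "1/2" x] that
      unfolding F_def by (cases "x \<le> 1/2") auto
    have cl: "closure {0<..<1::real} = {0..1}" by simp
    have F0: "F x = F (1/2)" if "x \<in> {0..1}" for x
      by (rule continuous_constant_on_closure[of "{0<..<1}" F "F (1/2)" x, unfolded cl, OF cont F01 that])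
    have "F l = F r" using F0[of l] F0[of r] that by simp
    then show ?thesis using indefinite_integral_diff[OF k that] unfolding F_def by simp
  qed
  have PIoc: "P {a<..b}" for a b
  proof -
    have "(LINT x:{a<..b}|lebesgue. k' x) = integral {a<..b} k'"
      by (rule set_lebesgue_integral_eq_integral[OF kset]) auto
    also have "\<dots> = integral {a<..b} (\<lambda>x. if x \<in> {0<..<1} then k x else 0)"
      by (intro Henstock_Kurzweil_Integration.integral_cong) (auto simp: k'_def indicator_def)
    also have "\<dots> = integral ({0<..<1} \<inter> {a<..b}) k" by (rule integral_restrict_Int)
    also have "\<dots> = integral {max a 0..min b 1} k"
    proof (rule integral_spike_set)
      show "negligible {x \<in> {0<..<1} \<inter> {a<..b} - {max a 0..min b 1}. k x \<noteq> 0}"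
        by (rule negligible_subset[of "{0}"]) auto
      show "negligible {x \<in> {max a 0..min b 1} - {0<..<1} \<inter> {a<..b}. k x \<noteq> 0}"
        by (rule negligible_subset[of "{0, 1, a}"]) auto
    qed
    also have "\<dots> = 0" using zero01[of "max a 0" "min b 1"] by (cases "max a 0 \<le> min b 1") auto
    finally show ?thesis by (simp add: P_def)
  qed
  have tot: "(LINT x|lebesgue. k' x) = 0"
  proof -
    have "(LINT x|lebesgue. k' x) = (LINT x:{-1<..2}|lebesgue. k' x)"
      unfolding set_lebesgue_integral_def by (intro Bochner_Integration.integral_cong) (auto simp: k'_def indicator_def)
    then show ?thesis using PIoc[of "-1" 2] by (simp add: P_def)
  qed
  have Pborel: "P A" if "A \<in> sets borel" for A
  proof -
    let ?G = "range (\<lambda>(a, b). {a<..b::real})"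
    have A: "A \<in> sigma_sets UNIV ?G" using that unfolding borel_sigma_sets_Ioc by simp
    have Int: "Int_stable ?G"
    proof (rule Int_stableI_image)
      fix i j :: "real \<times> real"
      show "\<exists>k\<in>UNIV. (case i of (a, b) \<Rightarrow> {a<..b}) \<inter> (case j of (a, b) \<Rightarrow> {a<..b}) = (case k of (a, b) \<Rightarrow> {a<..b})"
        by (cases i; cases j) (auto intro!: bexI[of _ "(max (fst i) (fst j), min (snd i) (snd j))"])
    qed
    have bor: "B \<in> sets lebesgue" if "B \<in> sigma_sets UNIV ?G" for B
      using that borel_sigma_sets_Ioc by (metis sets_completionI_sets sets_lborel sets_measure_of subset_UNIV Pow_UNIV)
    have G: "?G \<subseteq> Pow UNIV" by simp
    from Int G A show ?thesis
    proof (induction rule: sigma_sets_induct_disjoint)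
      case (compl A)
      have "(LINT x:UNIV - A|lebesgue. k' x) = (LINT x|lebesgue. k' x - indicat_real A x *\<^sub>R k' x)"
        unfolding set_lebesgue_integral_def by (intro Bochner_Integration.integral_cong) (auto simp: indicator_def)
      also have "\<dots> = (LINT x|lebesgue. k' x) - (LINT x|lebesgue. indicat_real A x *\<^sub>R k' x)"
        using k' kset[OF bor[OF compl(1)]] unfolding set_integrable_def by (intro Bochner_Integration.integral_diff)
      finally show ?case using compl(2) tot by (simp add: P_def set_lebesgue_integral_def)
    next
      case (union A)
      have "(LINT x:(\<Union>i. A i)|lebesgue. k' x) = (\<Sum>i. (LINT x:(A i)|lebesgue. k' x))"
      proof (rule lebesgue_integral_countable_add)
        show Ai: "A i \<in> sets lebesgue" for i using bor[of "A i"] union(2) by blast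
        then show "set_integrable lebesgue (\<Union>i. A i) k'" by (intro kset sets.countable_UN) auto
        show "A i \<inter> A j = {}" if "i \<noteq> j" for i j
          using union(1) that by (auto simp: disjoint_family_on_def)
      qed
      then show ?case using union(3) by (simp add: P_def)
    qed (use PIoc in \<open>auto simp: P_def set_lebesgue_integral_def\<close>)
  qed
  have "(LINT x:A|lebesgue. k' x) = 0" if A: "A \<in> sets lebesgue" for A
  proof -
    obtain B where B: "A \<subseteq> B" "B \<in> sets lborel" "B - A \<in> null_sets lebesgue"
      by (rule completion_upper[OF A])
    have "(LINT x:A|lebesgue. k' x) = (LINT x:B|lebesgue. k' x)"
      unfolding set_lebesgue_integral_def
    proof (rule integral_cong_AE)
      have B': "B \<in> sets lebesgue" using B(2) by auto
      show "(\<lambda>x. indicat_real A x *\<^sub>R k' x) \<in> borel_measurable lebesgue"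
        using kset[OF A] unfolding set_integrable_def by (rule borel_measurable_integrable)
      show "(\<lambda>x. indicat_real B x *\<^sub>R k' x) \<in> borel_measurable lebesgue"
        using kset[OF B'] unfolding set_integrable_def by (rule borel_measurable_integrable)
      have "AE x in lebesgue. x \<notin> B - A" using B(3) by (rule AE_not_in)
      then show "AE x in lebesgue. indicat_real A x *\<^sub>R k' x = indicat_real B x *\<^sub>R k' x"
        by eventually_elim (use B(1) in \<open>auto simp: indicator_def\<close>)
    qed
    then show ?thesis using Pborel[of B] B(2) by (simp add: P_def)
  qed
  note Pleb = this
  show ?thesis
  proof (rule sigma_finite_measure.density_zero[OF finite_measure.axioms(1)[OF finite_measure_I01] k])
    fix A assume A: "A \<in> sets I01"
    then have "A \<in> sets lebesgue" by (auto simp: sets_restrict_space)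
    have "(LINT x:A|I01. k x) = (LINT x|lebesgue. indicat_real {0<..<1} x *\<^sub>R (indicat_real A x *\<^sub>R k x))"
      unfolding set_lebesgue_integral_def by (rule integral_restrict_space) auto
    also have "\<dots> = (LINT x:A|lebesgue. k' x)"
      unfolding set_lebesgue_integral_def k'_def by (intro Bochner_Integration.integral_cong) auto
    finally show "(LINT x:A|I01. k x) = 0" using Pleb[OF \<open>A \<in> sets lebesgue\<close>] by simp
  qed
qed

text \<open>The derivative of \<open>F\<close> exists almost everywhere and has the same integrals
  over intervals as \<open>g\<close>, so the two agree almost everywhere.\<close>

lemma abs_cont_integral_derivative:
  fixes F g :: "real \<Rightarrow> real"
  assumes AC: "abs_cont_on 0 1 F" and g: "integrable I01 g"
    and F: "\<And>x y. \<lbrakk>0 \<le> x; x \<le> y; y \<le> 1\<rbrakk> \<Longrightarrow> F y - F x = integral {x..y} g"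
  shows "AE x in I01. (F has_real_derivative g x) (at x)"
proof -
  have "\<exists>N. negligible N \<and> (\<forall>x\<in>{0<..<1} - N. \<exists>L. (F has_real_derivative L) (at x))"
    by (rule abs_cont_on_AE_differentiable[OF AC]) blast
  then obtain N where N: "negligible N" "\<And>x. x \<in> {0<..<1} - N \<Longrightarrow> \<exists>L. (F has_real_derivative L) (at x)"
    by blast
  have DN: "(F has_real_derivative D F x) (at x)" if "x \<in> {0<..<1} - N" for x
    using N(2)[OF that] D_eq_at that by auto
  have int: "(D F has_integral (F y - F x)) {x..y}" if "0 \<le> x" "x \<le> y" "y \<le> 1" for x y
    by (rule abs_cont_on_FTC[OF abs_cont_on_subset[OF AC] _ N(1) DN]) (use that in auto)
  have gi: "g integrable_on {x..y}" "(\<lambda>x. \<bar>g x\<bar>) integrable_on {x..y}" if "0 \<le> x" "y \<le> 1" for x y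
    using g that by (auto intro!: integrable_on_I01_subinterval)
  \<comment> \<open>The fundamental theorem yields only gauge integrability of \<open>D F\<close>.
    Its integrals over the pieces of a division are those of \<open>g\<close>, so their variation is
    bounded by the integral of \<open>\<bar>g\<bar>\<close>, which upgrades this to Lebesgue
    integrability.\<close>
  have "D F absolutely_integrable_on cbox 0 1"
  proof (rule bounded_variation_absolutely_integrable_interval)
    show "D F integrable_on cbox 0 1" using int[of 0 1] by (auto simp: box_real)
    fix d :: "real set set" assume d: "d division_of cbox 0 1"
    have "(\<Sum>K\<in>d. norm (integral K (D F))) \<le> (\<Sum>K\<in>d. integral K (\<lambda>x. \<bar>g x\<bar>))"
    proof (rule sum_mono)
      fix K assume K: "K \<in> d"
      obtain l r where lr: "K = {l..r}" using division_ofD(4)[OF d K] by (auto simp: box_real)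
      have "{l..r} \<subseteq> {0..1}" "{l..r} \<noteq> {}" using division_ofD(2,3)[OF d K] lr by (auto simp: box_real)
      then have b: "0 \<le> l" "l \<le> r" "r \<le> 1" by auto
      have "integral K (D F) = integral K g"
        using integral_unique[OF int[OF b]] F[OF b] lr by simp
      also have "norm \<dots> \<le> integral K (\<lambda>x. \<bar>g x\<bar>)"
        unfolding lr using gi b by (intro integral_norm_bound_integral) auto
      finally show "norm (integral K (D F)) \<le> integral K (\<lambda>x. \<bar>g x\<bar>)" .
    qed
    also have "\<dots> = integral (cbox 0 1) (\<lambda>x. \<bar>g x\<bar>)"
      using gi(2)[of 0 1] d by (intro integral_combine_division_topdown[symmetric]) (auto simp: box_real)
    finally show "(\<Sum>K\<in>d. norm (integral K (D F))) \<le> integral (cbox 0 1) (\<lambda>x. \<bar>g x\<bar>)" .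
  qed
  then have "D F absolutely_integrable_on {0<..<1}"
    by (simp add: absolutely_integrable_on_Icc_iff_Ioo[symmetric] box_real)
  then have DF: "integrable I01 (D F)" by (rule absolutely_integrable_imp_integrable) auto
  have "AE x in I01. D F x - g x = 0"
  proof (rule integral_zero_imp_AE_zero)
    show "integrable I01 (\<lambda>x. D F x - g x)" using DF g by simp
    fix l r :: real assume lr: "0 < l" "l \<le> r" "r < 1"
    have "integral {l..r} (\<lambda>x. D F x - g x) = integral {l..r} (D F) - integral {l..r} g"
      using int[of l r] gi(1)[of l r] lr by (intro Henstock_Kurzweil_Integration.integral_diff) auto
    then show "integral {l..r} (\<lambda>x. D F x - g x) = 0"
      using integral_unique[OF int[of l r]] F[of l r] lr by simp
  qed
  moreover have "AE x in I01. (F has_real_derivative D F x) (at x)"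
    unfolding AE_I01_iff using N(1) DN by blast
  ultimately show ?thesis by eventually_elim simp
qed

lemma indefinite_integral_AE_derivative:
  assumes "L2 g"
  shows "AE x in I01. ((\<lambda>x. integral {0..x} g) has_real_derivative g x) (at x)"
  using abs_cont_on_indefinite_integral[OF assms] L2_integrable[OF assms]
  by (rule abs_cont_integral_derivative) (use indefinite_integral_diff[OF L2_integrable[OF assms]] in auto)

section \<open>The lemma of du Bois-Reymond: functions with a weak derivative\<close>

lemma abs_cont_on_imp_AC01: "abs_cont_on 0 1 f \<Longrightarrow> AC01 f"
  unfolding AC01_def by (auto intro: abs_cont_on_subset)

text \<open>Mean zero is what makes the primitive vanish again to the right of the support.\<close>

lemma test_fun_antiderivative:
  fixes \<psi> :: "real \<Rightarrow> real"
  assumes cont: "continuous_on UNIV \<psi>" and lr: "0 < l" "l \<le> r" "r < 1"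
    and supp: "\<And>x. x \<notin> {l..r} \<Longrightarrow> \<psi> x = 0" and zero: "integral {0..1} \<psi> = 0"
  obtains \<phi> where "test_fun \<phi>" "\<And>x. (\<phi> has_real_derivative \<psi> x) (at x)"
    "\<And>x. x \<notin> {l..r} \<Longrightarrow> \<phi> x = 0"
proof -
  \<comment> \<open>Integration starts at -1, outside the support, so that the primitive is
    differentiable from both sides on the whole line.\<close>
  define \<phi> where "\<phi> = (\<lambda>x. integral {-1..x} \<psi>)"
  have int: "\<psi> integrable_on {a..b}" for a b
    by (rule integrable_continuous_real) (rule continuous_on_subset[OF cont], simp)
  have low: "\<phi> x = 0" if "x < l" for x
  proof -
    have "integral {-1..x} \<psi> = integral {-1..x} (\<lambda>_. 0)"
      using supp that by (intro Henstock_Kurzweil_Integration.integral_cong) auto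
    then show ?thesis by (simp add: \<phi>_def)
  qed
  have sup: "(\<psi> has_integral (integral {l..r} \<psi>)) T" if "{l..r} \<subseteq> T" for T
    by (rule has_integral_on_superset[OF integrable_integral[OF int] supp that])
  have "integral {l..r} \<psi> = 0" using integral_unique[OF sup[of "{0..1}"]] zero lr by simp
  then have high: "\<phi> x = 0" if "x > r" for x
    using integral_unique[OF sup[of "{-1..x}"]] that lr by (simp add: \<phi>_def)
  have der: "(\<phi> has_real_derivative \<psi> x) (at x)" for x
  proof (cases "x < l")
    case True
    have "((\<lambda>_. 0) has_real_derivative 0) (at x)" by simp
    then have "(\<phi> has_real_derivative 0) (at x)"
      by (rule has_field_derivative_transform_within_open[of _ _ _ "{..<l}"]) (use True low in auto)
    then show ?thesis using supp True by simp
  next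
    case False
    have "(\<phi> has_real_derivative \<psi> x) (at x within {-1..x + 1})"
      unfolding \<phi>_def
      by (rule integral_has_real_derivative) (use False lr in \<open>auto intro: continuous_on_subset[OF cont]\<close>)
    moreover have "at x within {-1..x + 1} = at x"
      using False lr by (intro at_within_interior) (auto simp: interior_atLeastAtMost_real)
    ultimately show ?thesis by simp
  qed
  have out: "\<phi> x = 0" if "x \<notin> {l..r}" for x
    using low high that by (metis atLeastAtMost_iff not_le)
  have cl: "closure {x. \<phi> x \<noteq> 0} \<subseteq> {l..r}"
    using out by (intro closure_minimal subsetI) (blast, simp)
  have "test_fun \<phi>"
    unfolding test_fun_def
  proof (intro conjI)
    show "C_on 1 UNIV \<phi>" using der cont by auto
    show "compact (closure {x. \<phi> x \<noteq> 0})"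
      using cl by (meson bounded_closed_interval bounded_subset closed_closure compact_eq_bounded_closed)
    show "closure {x. \<phi> x \<noteq> 0} \<subseteq> {0<..<1}" using cl lr by (auto dest!: subsetD)
  qed
  then show ?thesis using that der out by blast
qed

lemma L2_continuous:
  assumes "continuous_on {0..1} f"
  shows "L2 f"
proof -
  have "compact (f ` {0..1})" using assms by (intro compact_continuous_image) auto
  from compact_imp_bounded[OF this] obtain B where B: "\<forall>x\<in>{0..1}. \<bar>f x\<bar> \<le> B"
    by (auto simp: bounded_iff)
  have "L2 (\<lambda>x. f x * 1)"
  proof (rule L2_bounded_mult[OF L2_const])
    show "f \<in> borel_measurable I01"
      by (rule continuous_measurable_I01) (rule continuous_on_subset[OF assms], auto)
    show "AE x in I01. \<bar>f x\<bar> \<le> B" by (rule AE_I2) (use B in auto)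
  qed
  then show ?thesis by simp
qed

text \<open>Du Bois-Reymond: \<open>w\<close> minus the primitive of \<open>g\<close> is orthogonal
  to all continuous functions of mean zero with support in the open interval, hence almost
  everywhere constant.\<close>

lemma weak_deriv_absolutely_continuous:
  assumes w: "L2 w" and wd: "weak_deriv w g"
  obtains p where "abs_cont_on 0 1 p" "AE x in I01. w x = p x"
    "AE x in I01. (p has_real_derivative g x) (at x)" "\<forall>x. p x = p 0 + integral {0..x} g"
proof -
  have g: "L2 g" using wd by (simp add: weak_deriv_def)
  define G where "G = (\<lambda>x. integral {0..x} g)"
  have G: "abs_cont_on 0 1 G" "AE x in I01. (G has_real_derivative g x) (at x)"
    unfolding G_def using abs_cont_on_indefinite_integral[OF g] indefinite_integral_AE_derivative[OF g] by auto
  have GL2: "L2 G" using abs_cont_on_continuous[OF G(1)] by (rule L2_continuous)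
  define k where "k = (\<lambda>x. w x - G x)"
  have k: "L2 k" unfolding k_def using L2_lincomb[OF w GL2, of 1 "-1"] by simp
  \<comment> \<open>Such a \<open>\<psi>\<close> is the derivative of a test function
    \<open>\<phi>\<close>. The weak derivative moves it from \<open>w\<close> to \<open>g\<close>,
    integration by parts does the same for \<open>G\<close>, and the two results cancel.\<close>
  have orth: "(LINT x|I01. k x * \<psi> x) = 0"
    if \<psi>: "continuous_on UNIV \<psi>" "\<And>x. x \<notin> {l..r} \<Longrightarrow> \<psi> x = 0" "integral {0..1} \<psi> = 0"
      and lr: "0 < l" "l \<le> r" "r < 1" for \<psi> l r
  proof -
    obtain \<phi> where \<phi>: "test_fun \<phi>" "\<And>x. (\<phi> has_real_derivative \<psi> x) (at x)" "\<And>x. x \<notin> {l..r} \<Longrightarrow> \<phi> x = 0"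
      by (rule test_fun_antiderivative[OF \<psi>(1) lr \<psi>(2,3)]) auto
    have \<phi>c: "continuous_on {0..1} \<phi>" using \<phi>(2) by (intro continuous_at_imp_continuous_on) (auto intro: DERIV_isCont)
    have \<psi>c: "continuous_on {0..1} \<psi>" by (rule continuous_on_subset[OF \<psi>(1)]) simp
    have L: "L2 \<phi>" "L2 \<psi>" using \<phi>c \<psi>c by (auto intro: L2_continuous)
    have "deriv \<phi> = \<psi>" using \<phi>(2) by (intro ext DERIV_imp_deriv)
    then have 1: "(LINT x|I01. w x * \<psi> x) = - (LINT x|I01. g x * \<phi> x)"
      using wd \<phi>(1) unfolding weak_deriv_def by metis
    have "abs_cont_on 0 1 \<phi>"
      by (rule abs_cont_on_C1[where f' = \<psi>]) (use \<phi>(2) \<psi>c in \<open>auto intro: has_field_derivative_at_within\<close>)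
    then have AC: "AC01 (\<lambda>x. G x * \<phi> x)" using G(1) by (intro AC01_mult abs_cont_on_imp_AC01)
    have "AE x in I01. ((\<lambda>x. G x * \<phi> x) has_real_derivative (g x * \<phi> x + G x * \<psi> x)) (at x)"
      using G(2) by eventually_elim (auto intro!: derivative_eq_intros \<phi>(2))
    moreover have int: "integrable I01 (\<lambda>x. g x * \<phi> x)" "integrable I01 (\<lambda>x. G x * \<psi> x)"
      using L GL2 g by (auto intro: L2_mult)
    ultimately have "((\<lambda>x. G x * \<phi> x) \<longlongrightarrow> G 1 * \<phi> 1 - (LINT x|I01. g x * \<phi> x + G x * \<psi> x)) (at_right 0)"
      using AC by (intro AC01_FTC_limit) auto
    moreover have "\<forall>\<^sub>F x in at_right 0. 0 = G x * \<phi> x"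
      unfolding eventually_at_right_field using lr \<phi>(3) by (intro exI[of _ l]) auto
    then have "((\<lambda>x. G x * \<phi> x) \<longlongrightarrow> 0) (at_right 0)" by (rule Lim_transform_eventually[OF tendsto_const])
    ultimately have "G 1 * \<phi> 1 - (LINT x|I01. g x * \<phi> x + G x * \<psi> x) = 0"
      by (rule tendsto_unique[rotated]) simp
    then have "(LINT x|I01. G x * \<psi> x) = - (LINT x|I01. g x * \<phi> x)"
      using \<phi>(3)[of 1] lr int by simp
    then show ?thesis using 1 L2_mult[OF w L(2)] int by (simp add: k_def left_diff_distrib)
  qed
  \<comment> \<open>A fixed bump with nonzero integral. Subtracting a multiple of it turns any
    admissible \<open>\<psi>\<close> into one of mean zero, and its pairing with \<open>k\<close>
    yields the constant \<open>C\<close>.\<close>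
  define \<psi>0 where "\<psi>0 = (\<lambda>x::real. max 0 ((x - 1/4) * (3/4 - x)))"
  have \<psi>0: "continuous_on UNIV \<psi>0" unfolding \<psi>0_def by (intro continuous_intros)
  have s0: "\<psi>0 x = 0" if "x \<notin> {1/4..3/4}" for x
  proof -
    have "(x - 1/4) * (3/4 - x) \<le> 0" using that by (auto simp: mult_le_0_iff)
    then show ?thesis by (simp add: \<psi>0_def)
  qed
  define J where "J = integral {0..1} \<psi>0"
  have "J \<noteq> 0"
  proof
    assume "J = 0"
    have "\<forall>x\<in>{0..1}. \<psi>0 x = 0"
      using integral_eq_0_iff[of 0 1 \<psi>0] \<open>J = 0\<close> \<psi>0 by (auto simp: J_def \<psi>0_def intro: continuous_on_subset)
    then have "\<psi>0 (1/2) = 0" by simp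
    then show False by (simp add: \<psi>0_def)
  qed
  define C where "C = (LINT x|I01. k x * \<psi>0 x) / J"
  have int\<psi>: "\<psi> integrable_on {0..1}" if "continuous_on UNIV \<psi>" for \<psi> :: "real \<Rightarrow> real"
    by (rule integrable_continuous_real) (rule continuous_on_subset[OF that], simp)
  have L\<psi>: "L2 \<psi>" if "continuous_on UNIV \<psi>" for \<psi> :: "real \<Rightarrow> real"
    by (rule L2_continuous) (rule continuous_on_subset[OF that], simp)
  have Jint: "(LINT x|I01. \<psi> x) = integral {0..1} \<psi>" if "continuous_on UNIV \<psi>" for \<psi> :: "real \<Rightarrow> real"
    using integral_unique[OF has_integral_I01[OF L2_integrable[OF L\<psi>[OF that]]]] by simp
  have kC: "(LINT x|I01. (k x - C) * \<psi> x) = 0"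
    if \<psi>: "continuous_on UNIV \<psi>" "\<And>x. x \<notin> {l..r} \<Longrightarrow> \<psi> x = 0"
      and lr: "0 < l" "l \<le> r" "r < 1" for \<psi> l r
  proof -
    define c where "c = integral {0..1} \<psi> / J"
    have "(LINT x|I01. k x * (\<psi> x - c * \<psi>0 x)) = 0"
    proof (rule orth)
      show "continuous_on UNIV (\<lambda>x. \<psi> x - c * \<psi>0 x)" by (intro continuous_intros \<psi> \<psi>0)
      show "\<psi> x - c * \<psi>0 x = 0" if "x \<notin> {min l (1/4)..max r (3/4)}" for x
      proof -
        have "x \<notin> {l..r}" "x \<notin> {1/4..3/4}" using that by auto
        then show ?thesis using \<psi>(2) s0 by simp
      qed
      have "integral {0..1} (\<lambda>x. \<psi> x - c * \<psi>0 x) = integral {0..1} \<psi> - integral {0..1} (\<lambda>x. c * \<psi>0 x)"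
        using int\<psi>[OF \<psi>(1)] integrable_cmul[OF int\<psi>[OF \<psi>0], of c]
        by (intro Henstock_Kurzweil_Integration.integral_diff) auto
      then show "integral {0..1} (\<lambda>x. \<psi> x - c * \<psi>0 x) = 0"
        using \<open>J \<noteq> 0\<close> by (simp add: c_def J_def)
    qed (use lr in auto)
    moreover have "(LINT x|I01. k x * (\<psi> x - c * \<psi>0 x)) = (LINT x|I01. k x * \<psi> x - c * (k x * \<psi>0 x))"
      by (intro Bochner_Integration.integral_cong) (auto simp: algebra_simps)
    ultimately have "(LINT x|I01. k x * \<psi> x) = c * (LINT x|I01. k x * \<psi>0 x)"
      using L2_mult[OF k L\<psi>[OF \<psi>(1)]] L2_mult[OF k L\<psi>[OF \<psi>0]] by simp
    also have "\<dots> = C * (LINT x|I01. \<psi> x)" unfolding Jint[OF \<psi>(1)] by (simp add: c_def C_def)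
    finally show ?thesis
      using L2_mult[OF k L\<psi>[OF \<psi>(1)]] L2_integrable[OF L\<psi>[OF \<psi>(1)]] by (simp add: left_diff_distrib)
  qed
  have kCi: "integrable I01 (\<lambda>x. k x - C)"
    using L2_integrable[OF L2_lincomb[OF k L2_const, of 1 "-1" C]] by simp
  have "AE x in I01. k x - C = 0"
  proof (rule integral_zero_imp_AE_zero[OF kCi])
    fix l r :: real assume lr: "0 < l" "l \<le> r" "r < 1"
    \<comment> \<open>Continuous trapezoids that increase to the indicator of \<open>]l,r[\<close>;
      dominated convergence passes from them to integrals over intervals.\<close>
    define \<psi> where "\<psi> = (\<lambda>n x. max 0 (min 1 (real n * min (x - l) (r - x))))"
    have c: "continuous_on UNIV (\<psi> n)" for n unfolding \<psi>_def by (intro continuous_intros)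
    have s: "\<psi> n x = 0" if "x \<notin> {l..r}" for n x
    proof -
      have "real n * min (x - l) (r - x) \<le> 0" using that by (intro mult_nonneg_nonpos) auto
      then show ?thesis by (simp add: \<psi>_def)
    qed
    have lim: "(\<lambda>n. \<psi> n x) \<longlonglongrightarrow> indicat_real {l<..<r} x" for x
    proof (cases "x \<in> {l<..<r}")
      case True
      define e where "e = min (x - l) (r - x)"
      have "e > 0" using True by (simp add: e_def)
      then obtain N where N: "1 < real N * e" using ex_less_of_nat_mult by blast
      have "\<psi> n x = 1" if "n \<ge> N" for n
      proof -
        have "real N * e \<le> real n * e" using that \<open>e > 0\<close> by simp
        then show ?thesis using N by (simp add: \<psi>_def e_def)
      qed
      then have "\<forall>\<^sub>F n in sequentially. \<psi> n x = 1" unfolding eventually_sequentially by blast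
      then show ?thesis using True by (simp add: tendsto_eventually)
    next
      case False
      have "\<psi> n x = 0" for n
      proof -
        have "real n * min (x - l) (r - x) \<le> 0" using False by (intro mult_nonneg_nonpos) auto
        then show ?thesis by (simp add: \<psi>_def)
      qed
      then show ?thesis using False by simp
    qed
    have "(\<lambda>n. LINT x|I01. (k x - C) * \<psi> n x) \<longlonglongrightarrow> (LINT x|I01. (k x - C) * indicat_real {l<..<r} x)"
    proof (rule integral_dominated_convergence[where w = "\<lambda>x. \<bar>k x - C\<bar>"])
      show "(\<lambda>x. (k x - C) * indicat_real {l<..<r} x) \<in> borel_measurable I01"
        using borel_measurable_integrable[OF integral_indicator_I01(1)[OF kCi, of l r]] lr
        by (simp add: mult.commute)
      show "(\<lambda>x. (k x - C) * \<psi> n x) \<in> borel_measurable I01" for n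
        using L2_measurable[OF L\<psi>[OF c[of n]]] borel_measurable_integrable[OF kCi] by simp
      show "integrable I01 (\<lambda>x. \<bar>k x - C\<bar>)" using kCi by simp
      show "AE x in I01. (\<lambda>n. (k x - C) * \<psi> n x) \<longlonglongrightarrow> (k x - C) * indicat_real {l<..<r} x"
        using lim by (intro AE_I2 tendsto_intros)
      show "AE x in I01. norm ((k x - C) * \<psi> n x) \<le> \<bar>k x - C\<bar>" for n
      proof (rule AE_I2)
        fix x
        have "\<bar>\<psi> n x\<bar> \<le> 1" by (simp add: \<psi>_def)
        then show "norm ((k x - C) * \<psi> n x) \<le> \<bar>k x - C\<bar>" by (simp add: abs_mult mult_left_le)
      qed
    qed
    moreover have "(LINT x|I01. (k x - C) * \<psi> n x) = 0" for n by (rule kC[OF c s lr])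
    ultimately have "(LINT x|I01. (k x - C) * indicat_real {l<..<r} x) = 0"
      by (simp add: LIMSEQ_const_iff)
    then show "integral {l..r} (\<lambda>x. k x - C) = 0"
      using integral_indicator_I01(2)[OF kCi, of l r] lr by (simp add: mult.commute)
  qed
  then have ae: "AE x in I01. w x = G x + C" by eventually_elim (simp add: k_def)
  show ?thesis
  proof (rule that[OF _ ae])
    show "abs_cont_on 0 1 (\<lambda>x. G x + C)"
      by (rule abs_cont_on_add[OF G(1)]) (rule abs_cont_on_Lipschitz[where K = 0], simp)
    show "AE x in I01. ((\<lambda>x. G x + C) has_real_derivative g x) (at x)"
      using G(2) by eventually_elim (auto intro!: derivative_eq_intros)
    show "\<forall>x. G x + C = G 0 + C + integral {0..x} g" by (simp add: G_def)
  qed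
qed

text \<open>Here \<open>F x / x\<close> is dominated by an integrable function, so a nonzero limit
  of \<open>F\<close> is impossible.\<close>

lemma limit_zero_dominated:
  assumes "AC01 F" "(F \<longlongrightarrow> L) (at_right 0)" "integrable I01 q"
    and dom: "\<And>x. \<lbrakk>0 < x; x < 1\<rbrakk> \<Longrightarrow> \<bar>F x\<bar> \<le> x * q x"
  shows "L = 0"
proof (rule integrable_limit_zero)
  show "integrable I01 (\<lambda>x. F x / x)"
  proof (rule Bochner_Integration.integrable_bound[OF assms(3)])
    show "(\<lambda>x. F x / x) \<in> borel_measurable I01"
      by (rule continuous_measurable_I01) (use AC01_continuous[OF assms(1)] in \<open>auto intro!: continuous_intros\<close>)
    show "AE x in I01. norm (F x / x) \<le> norm (q x)"
    proof (rule AE_I2)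
      fix x assume "x \<in> space I01"
      then have "0 < x" "x < 1" by auto
      then have "\<bar>F x\<bar> / x \<le> q x" using dom[of x] by (simp add: pos_divide_le_eq mult.commute)
      then show "norm (F x / x) \<le> norm (q x)" using \<open>0 < x\<close> by simp
    qed
  qed
  show "((\<lambda>x. x * (F x / x)) \<longlongrightarrow> L) (at_right 0)"
    by (rule Lim_transform_eventually[OF assms(2)]) (auto simp: eventually_at_right_field intro!: exI[of _ 1])
qed

text \<open>Integration of a derivative without a boundary term at 0. In the applications
  \<open>F\<close> carries a factor \<open>x\<close> and \<open>q\<close> is a quadratic quantity of
  finite energy.\<close>

lemma AC01_integral_boundary:
  assumes "AC01 F" "AE x in I01. (F has_real_derivative h x) (at x)" "integrable I01 h" "integrable I01 q"
    and "\<And>x. \<lbrakk>0 < x; x < 1\<rbrakk> \<Longrightarrow> \<bar>F x\<bar> \<le> x * q x"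
  shows "(LINT x|I01. h x) = F 1"
  using limit_zero_dominated[OF assms(1) AC01_FTC_limit[OF assms(1-3)] assms(4,5)] by simp

lemma AC01_C1:
  assumes "\<And>x. x \<in> {0<..1} \<Longrightarrow> (f has_real_derivative f' x) (at x within {0<..1})" "continuous_on {0<..1} f'"
  shows "AC01 f"
  unfolding AC01_def
proof
  fix c :: real assume c: "c \<in> {0<..1}"
  show "abs_cont_on c 1 f"
  proof (rule abs_cont_on_C1)
    show "(f has_real_derivative f' x) (at x within {c..1})" if "x \<in> {c..1}" for x
      by (rule has_field_derivative_subset[OF assms(1)]) (use c that in auto)
    show "continuous_on {c..1} f'" by (rule continuous_on_subset[OF assms(2)]) (use c in auto)
  qed
qed

lemma within_01_interior: "x \<in> {0<..<1::real} \<Longrightarrow> at x within {0<..1} = at x"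
  by (rule at_within_nhd[of _ "{0<..<1}", where U = UNIV, simplified]) auto

subsection \<open>The degenerate coefficient\<close>

locale degenerate_coefficient =
  fixes a :: "real \<Rightarrow> real"
  assumes adm: "admissible a"
begin

abbreviation \<mu> where "\<mu> \<equiv> mu a"

lemma a_pos: "x \<in> {0<..1} \<Longrightarrow> a x > 0" and a_zero: "a 0 = 0" and mu_less_2: "\<mu> < 2"
  and a_continuous: "continuous_on {0..1} a"
  using adm by (auto simp: admissible_def)

lemma a1_pos: "a 1 > 0" by (rule a_pos) simp

lemma a_C1:
  shows a_deriv: "x \<in> {0<..1} \<Longrightarrow> (a has_real_derivative D a x) (at x within {0<..1})"
    and Da_continuous: "continuous_on {0<..1} (D a)"
proof -
  have "C_on 1 {0<..1} a" using adm by (simp add: admissible_def)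
  then obtain a' where a': "\<forall>x\<in>{0<..1}. (a has_real_derivative a' x) (at x within {0<..1})" "continuous_on {0<..1} a'"
    by auto
  then have eq: "D a x = a' x" if "x \<in> {0<..1}" for x using D_eq[of a "a' x" x] that by blast
  show "x \<in> {0<..1} \<Longrightarrow> (a has_real_derivative D a x) (at x within {0<..1})" using a'(1) eq by simp
  show "continuous_on {0<..1} (D a)" by (rule iffD2[OF continuous_on_cong[OF refl eq] a'(2)])
qed

lemma mu_bound: "x \<in> {0<..1} \<Longrightarrow> x * \<bar>D a x\<bar> \<le> \<mu> * a x"
proof -
  assume x: "x \<in> {0<..1}"
  have "x * \<bar>D a x\<bar> / a x \<le> \<mu>"
    unfolding mu_def using adm x by (intro cSUP_upper) (auto simp: admissible_def)
  then show ?thesis using a_pos[OF x] by (simp add: pos_divide_le_eq)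
qed

lemma mu_nonneg: "0 \<le> \<mu>"
proof -
  have "0 \<le> 1 * \<bar>D a 1\<bar>" by simp
  also have "\<dots> \<le> \<mu> * a 1" by (rule mu_bound) simp
  finally show ?thesis using a1_pos by (simp add: zero_le_mult_iff)
qed

text \<open>The bound \<open>x a' \<le> \<mu> a\<close> says that \<open>ln a - \<mu> ln x\<close>
  is nonincreasing, so it is smallest at 1.\<close>

lemma a_lower: "x \<in> {0<..1} \<Longrightarrow> a 1 * x powr \<mu> \<le> a x"
proof -
  assume x: "x \<in> {0<..1}"
  have "ln (a 1) - \<mu> * ln 1 \<le> ln (a x) - \<mu> * ln x"
  proof (rule DERIV_nonpos_imp_decreasing_open[where f = "\<lambda>x. ln (a x) - \<mu> * ln x" and a = x and b = 1])
    show "x \<le> 1" using x by simp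
    show "\<exists>y. ((\<lambda>x. ln (a x) - \<mu> * ln x) has_real_derivative y) (at s) \<and> y \<le> 0" if "x < s" "s < 1" for s
    proof -
      have s: "s \<in> {0<..<1}" "s \<in> {0<..1}" "0 < a s" using that x a_pos[of s] by auto
      have "(a has_real_derivative D a s) (at s)" using a_deriv[OF s(2)] within_01_interior[OF s(1)] by simp
      then have "((\<lambda>x. ln (a x)) has_real_derivative (1 / a s * D a s)) (at s)"
        by (rule DERIV_chain2[where f = ln and g = a, OF DERIV_ln_divide[OF s(3)]])
      moreover have "(ln has_real_derivative 1 / s) (at s)" using s by (intro DERIV_ln_divide) simp
      ultimately have "((\<lambda>x. ln (a x) - \<mu> * ln x) has_real_derivative (1 / a s * D a s - \<mu> * (1 / s))) (at s)"
        by (rule DERIV_diff[OF _ DERIV_cmult])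
      then have 1: "((\<lambda>x. ln (a x) - \<mu> * ln x) has_real_derivative (D a s / a s - \<mu> / s)) (at s)"
        by (rule DERIV_cong) simp
      have "s * D a s \<le> \<mu> * a s"
      proof -
        have "s * D a s \<le> s * \<bar>D a s\<bar>" using s(1) by (intro mult_left_mono) auto
        then show ?thesis using mu_bound[OF s(2)] by simp
      qed
      then have "D a s / a s - \<mu> / s \<le> 0" using s by (simp add: field_simps)
      with 1 show ?thesis by (intro exI conjI)
    qed
    have ca: "continuous_on {x..1} a" by (rule continuous_on_subset[OF a_continuous]) (use x in auto)
    show "continuous_on {x..1} (\<lambda>x. ln (a x) - \<mu> * ln x)"
    proof (intro continuous_intros ca)
      have "a s \<noteq> 0 \<and> s \<noteq> 0" if "s \<in> {x..1}" for s using a_pos[of s] that x by auto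
      then show "\<forall>s\<in>{x..1}. a s \<noteq> 0" "\<forall>s\<in>{x..1}. s \<noteq> 0" by blast+
    qed
  qed
  then have "ln (a 1) + \<mu> * ln x \<le> ln (a x)" by simp
  then have "exp (ln (a 1) + \<mu> * ln x) \<le> exp (ln (a x))" by simp
  then show ?thesis using x a_pos[OF x] a1_pos by (simp add: exp_add powr_def)
qed

lemma a_lower_square: "x \<in> {0<..1} \<Longrightarrow> a 1 * x\<^sup>2 \<le> a x"
proof -
  assume x: "x \<in> {0<..1}"
  have "x powr 2 \<le> x powr \<mu>" using x mu_less_2 by (intro powr_mono') auto
  then have "a 1 * x\<^sup>2 \<le> a 1 * x powr \<mu>" using x a1_pos by simp
  then show ?thesis using a_lower[OF x] by simp
qed

text \<open>For \<open>1 \<le> \<mu> < 2\<close> the integer part is 1, so \<open>a\<close> is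
  continuously differentiable up to 0. Together with \<open>a 0 = 0\<close> this is a Lipschitz
  bound.\<close>

lemma a_upper_linear: "\<mu> \<ge> 1 \<Longrightarrow> \<exists>K>0. \<forall>x\<in>{0<..1}. a x \<le> K * x"
proof -
  assume mu: "\<mu> \<ge> 1"
  then have "\<lfloor>\<mu>\<rfloor> = 1" using mu_less_2 by linarith
  then have "C_on 1 {0..1} a" using adm by (simp add: admissible_def)
  then obtain a' where a': "\<forall>x\<in>{0..1}. (a has_real_derivative a' x) (at x within {0..1})" "continuous_on {0..1} a'"
    by auto
  have "compact (a' ` {0..1})" using a'(2) by (intro compact_continuous_image) auto
  from compact_imp_bounded[OF this] obtain B where B: "\<forall>x\<in>{0..1}. \<bar>a' x\<bar> \<le> B"
    by (auto simp: bounded_iff)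
  have "a x \<le> (\<bar>B\<bar> + 1) * x" if "x \<in> {0<..1}" for x
  proof -
    have "norm (a x - a 0) \<le> B * norm (x - 0)"
      by (rule field_differentiable_bound[of "{0..1}" a a' B]) (use a'(1) B that in auto)
    moreover have "B * x \<le> (\<bar>B\<bar> + 1) * x" using that by (intro mult_right_mono) auto
    moreover have "norm (x - 0) = x" "norm (a x - a 0) = \<bar>a x\<bar>" using that a_zero by auto
    ultimately show ?thesis by (metis abs_ge_self order_trans)
  qed
  then show ?thesis by (intro exI[of _ "\<bar>B\<bar> + 1"]) auto
qed

lemma measurable_a: "a \<in> borel_measurable I01"
  by (rule continuous_measurable_I01) (rule continuous_on_subset[OF a_continuous], auto)

lemma measurable_Da: "D a \<in> borel_measurable I01"
  by (rule continuous_measurable_I01[OF Da_continuous])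

lemma measurable_ident_I01: "(\<lambda>x. x) \<in> borel_measurable I01"
  by (rule continuous_measurable_I01) (intro continuous_intros)

lemma inverse_a_deriv:
  "x \<in> {0<..1} \<Longrightarrow> ((\<lambda>x. 1 / a x) has_real_derivative (- D a x / (a x)\<^sup>2)) (at x within {0<..1})"
  using a_pos[of x] by (auto intro!: derivative_eq_intros a_deriv simp: power2_eq_square)

lemma AC01_inverse_a: "AC01 (\<lambda>x. 1 / a x)"
proof (rule AC01_C1[OF inverse_a_deriv])
  have "continuous_on {0<..1} a" by (rule continuous_on_subset[OF a_continuous]) auto
  then show "continuous_on {0<..1} (\<lambda>x. - D a x / (a x)\<^sup>2)"
    using a_pos by (intro continuous_intros Da_continuous) (force simp: less_imp_neq)+
qed

section \<open>The weighted spaces \<open>V1\<close> and \<open>W1\<close>\<close>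

lemma V1_iff: "u \<in> V1 a \<longleftrightarrow> L2 u \<and> AC01 u \<and> L2 (\<lambda>x. sqrt (a x) * D u x)"
  by (auto simp: V1_def AC01_def)

lemma V1_D:
  assumes "u \<in> V1 a"
  shows "L2 u" "AC01 u" "L2 (\<lambda>x. sqrt (a x) * D u x)" "AE x in I01. (u has_real_derivative D u x) (at x)"
  using assms AC01_AE_D by (auto simp: V1_iff)

lemma W1_V1: "u \<in> W1 a \<Longrightarrow> u \<in> V1 a" by (simp add: W1_def)

lemma I01_ae_pos: "AE x in I01. 0 < x \<and> x < 1 \<and> a x > 0"
  using a_pos by (intro AE_I2) auto

lemma D_lincomb_AE:
  assumes "u \<in> V1 a" "v \<in> V1 a"
  shows "AE x in I01. D (\<lambda>x. r * u x + s * v x) x = r * D u x + s * D v x"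
  using V1_D(4)[OF assms(1)] V1_D(4)[OF assms(2)] I01_ae_pos
proof eventually_elim
  case (elim x)
  then show ?case by (intro D_eq_at) (auto intro!: derivative_eq_intros)
qed

lemma V1_lincomb:
  assumes "u \<in> V1 a" "v \<in> V1 a"
  shows "(\<lambda>x. r * u x + s * v x) \<in> V1 a"
  unfolding V1_iff
proof (intro conjI)
  show "L2 (\<lambda>x. r * u x + s * v x)" using assms by (intro L2_lincomb V1_D)
  show "AC01 (\<lambda>x. r * u x + s * v x)" using assms by (intro AC01_add AC01_mult AC01_const V1_D)
  have "L2 (\<lambda>x. r * (sqrt (a x) * D u x) + s * (sqrt (a x) * D v x))"
    using assms by (intro L2_lincomb V1_D)
  then show "L2 (\<lambda>x. sqrt (a x) * D (\<lambda>x. r * u x + s * v x) x)"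
    by (rule L2_cong_AE) (use D_lincomb_AE[OF assms, of r s] in \<open>eventually_elim, simp add: algebra_simps\<close>)
qed

lemma W1_lincomb:
  assumes "u \<in> W1 a" "v \<in> W1 a"
  shows "(\<lambda>x. r * u x + s * v x) \<in> W1 a"
proof -
  have "((\<lambda>x. r * u x + s * v x) \<longlongrightarrow> r * 0 + s * 0) (at_right 0)" if "\<mu> < 1"
    using assms that unfolding W1_def by (intro tendsto_intros) auto
  then show ?thesis using V1_lincomb[of u v] assms unfolding W1_def by simp
qed

lemma integrable_flux:
  assumes "u \<in> V1 a" "v \<in> V1 a"
  shows "integrable I01 (\<lambda>x. a x * D u x * D v x)"
proof -
  have "integrable I01 (\<lambda>x. (sqrt (a x) * D u x) * (sqrt (a x) * D v x))"
    using assms by (intro L2_mult V1_D)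
  then show ?thesis
  proof (rule Bochner_Integration.integrable_cong[THEN iffD1, rotated 2])
    fix x assume "x \<in> space I01"
    then have "a x > 0" by (intro a_pos) auto
    then show "(sqrt (a x) * D u x) * (sqrt (a x) * D v x) = a x * D u x * D v x" by simp
  qed simp
qed

section \<open>Hardy and Poincare inequalities\<close>

lemma weight_div_sqrt_bound: "x \<in> {0<..1} \<Longrightarrow> x / sqrt (a x) \<le> 1 / sqrt (a 1)"
proof -
  assume x: "x \<in> {0<..1}"
  have "sqrt (a 1 * x\<^sup>2) \<le> sqrt (a x)" using a_lower_square[OF x] by simp
  then have "sqrt (a 1) * x \<le> sqrt (a x)" using x by (simp add: real_sqrt_mult)
  then show ?thesis using a_pos[OF x] a1_pos by (simp add: field_simps)
qed

lemma L2_weight_div: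
  assumes "L2 f"
  shows "L2 (\<lambda>x. x / sqrt (a x) * f x)"
proof (rule L2_bounded_mult[OF assms])
  show "(\<lambda>x. x / sqrt (a x)) \<in> borel_measurable I01"
    using measurable_a measurable_ident_I01 by simp
  show "AE x in I01. \<bar>x / sqrt (a x)\<bar> \<le> 1 / sqrt (a 1)"
    using weight_div_sqrt_bound a_pos by (intro AE_I2) (auto simp: less_imp_le)
qed

text \<open>Since \<open>\<mu> < 2\<close>, the weight \<open>x^2\<close> is at most
  \<open>a / a(1)\<close>. This makes \<open>x u_x\<close> an admissible multiplier for every
  element of the energy space.\<close>

lemma L2_x_D:
  assumes "u \<in> V1 a"
  shows "L2 (\<lambda>x. x * D u x)"
  by (rule L2_cong_AE[OF L2_weight_div[OF V1_D(3)[OF assms]]])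
     (use I01_ae_pos in \<open>eventually_elim, auto\<close>)

lemma x_D_norm_le:
  assumes "u \<in> V1 a"
  shows "(LINT x|I01. (x * D u x)\<^sup>2) \<le> (LINT x|I01. a x * D u x * D u x) / a 1"
proof -
  have "(LINT x|I01. (x * D u x)\<^sup>2) \<le> (LINT x|I01. a x * D u x * D u x / a 1)"
  proof (rule integral_mono)
    show "integrable I01 (\<lambda>x. (x * D u x)\<^sup>2)" using L2_x_D[OF assms] by (simp add: L2_def)
    show "integrable I01 (\<lambda>x. a x * D u x * D u x / a 1)" using integrable_flux[OF assms assms] by simp
    fix x assume "x \<in> space I01"
    then have "a 1 * x\<^sup>2 \<le> a x" by (intro a_lower_square) auto
    then have "x\<^sup>2 * (D u x)\<^sup>2 \<le> a x / a 1 * (D u x)\<^sup>2" using a1_pos by (intro mult_right_mono) (auto simp: field_simps)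
    then show "(x * D u x)\<^sup>2 \<le> a x * D u x * D u x / a 1" by (simp add: power2_eq_square mult_ac)
  qed
  then show ?thesis by simp
qed

text \<open>Integrate \<open>(x v^2)'\<close>; at 0 the term \<open>x v^2\<close> disappears because
  \<open>v^2\<close> is integrable. Applied to displacements it gives Hardy's inequality, applied to
  velocities the kinetic part of the multiplier identity.\<close>

lemma integral_x_D_self:
  assumes "v \<in> V1 a"
  shows "(LINT x|I01. (x * D v x) * v x) = (v 1)\<^sup>2 / 2 - (LINT x|I01. (v x)\<^sup>2) / 2"
proof -
  note v = V1_D[OF assms]
  have v2: "integrable I01 (\<lambda>x. (v x)\<^sup>2)" using v(1) by (simp add: L2_def)
  have xv: "integrable I01 (\<lambda>x. (x * D v x) * v x)" by (rule L2_mult[OF L2_x_D[OF assms] v(1)])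
  have "(LINT x|I01. (v x)\<^sup>2 + 2 * ((x * D v x) * v x)) = 1 * (v 1 * v 1)"
  proof (rule AC01_integral_boundary)
    show "AC01 (\<lambda>x. x * (v x * v x))" using v by (intro AC01_mult AC01_ident)
    show "AE x in I01. ((\<lambda>x. x * (v x * v x)) has_real_derivative ((v x)\<^sup>2 + 2 * ((x * D v x) * v x))) (at x)"
      using v(4) by eventually_elim (auto intro!: derivative_eq_intros simp: power2_eq_square algebra_simps)
    show "integrable I01 (\<lambda>x. (v x)\<^sup>2 + 2 * ((x * D v x) * v x))" using v2 xv by simp
    show "\<bar>x * (v x * v x)\<bar> \<le> x * (v x)\<^sup>2" if "0 < x" "x < 1" for x
      using that by (simp add: power2_eq_square abs_mult)
  qed (rule v2)
  then show ?thesis using v2 xv by (simp add: power2_eq_square)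
qed

text \<open>In the integral of \<open>(x u^2)'\<close> the mixed term is split as
  \<open>u^2 / 2 + 2 (x u')^2\<close>, and the first half is absorbed on the left. This accounts for
  the factors 2 and 4.\<close>

lemma Poincare_Hardy:
  assumes "u \<in> V1 a"
  shows "(LINT x|I01. (u x)\<^sup>2) \<le> 2 * (u 1)\<^sup>2 + 4 / a 1 * (LINT x|I01. a x * D u x * D u x)"
proof -
  note u = V1_D[OF assms]
  have u2: "integrable I01 (\<lambda>x. (u x)\<^sup>2)" using u(1) by (simp add: L2_def)
  have xu: "integrable I01 (\<lambda>x. (x * D u x)\<^sup>2)" using L2_x_D[OF assms] by (simp add: L2_def)
  have xuu: "integrable I01 (\<lambda>x. (x * D u x) * u x)" by (rule L2_mult[OF L2_x_D[OF assms] u(1)])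
  have "(LINT x|I01. - 2 * ((x * D u x) * u x)) \<le> (LINT x|I01. (u x)\<^sup>2 / 2 + 2 * (x * D u x)\<^sup>2)"
  proof (rule integral_mono)
    fix x
    have "0 \<le> (u x + 2 * (x * D u x))\<^sup>2 / 2" by simp
    then show "- 2 * ((x * D u x) * u x) \<le> (u x)\<^sup>2 / 2 + 2 * (x * D u x)\<^sup>2"
      by (simp add: power2_eq_square algebra_simps)
  qed (use u2 xu xuu in auto)
  also have "\<dots> = (LINT x|I01. (u x)\<^sup>2) / 2 + 2 * (LINT x|I01. (x * D u x)\<^sup>2)" using u2 xu by simp
  also have "\<dots> \<le> (LINT x|I01. (u x)\<^sup>2) / 2 + 2 * ((LINT x|I01. a x * D u x * D u x) / a 1)"
    using x_D_norm_le[OF assms] by simp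
  finally show ?thesis using integral_x_D_self[OF assms] xuu by simp
qed

text \<open>With \<open>\<nu> = 2 - \<mu>\<close>, the function \<open>\<phi> = \<nu> x / (2 - x\<^bsup>\<nu>\<^esup>)\<close> solves the Riccati equation
  \<open>\<phi>' = \<nu> / (2 - x\<^bsup>\<nu>\<^esup>) + \<phi>\<^sup>2 / x\<^bsup>\<mu>\<^esup>\<close>, so that integrating \<open>(\<phi> u\<^sup>2)'\<close> and completing the square with weight \<open>x\<^bsup>\<mu>\<^esup>\<close>
  yields exactly the constant \<open>2/(2 - \<mu>)\<close> of \<open>C1\<close>.\<close>

lemma Poincare_power:
  assumes "u \<in> V1 a"
  shows "(LINT x|I01. (u x)\<^sup>2) \<le> 2 * (u 1)\<^sup>2 + 1 / a 1 * (2 / (2 - \<mu>)) * (LINT x|I01. a x * D u x * D u x)"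
proof -
  note u = V1_D[OF assms]
  define \<nu> where "\<nu> = 2 - \<mu>"
  have \<nu>: "\<nu> > 0" using mu_less_2 by (simp add: \<nu>_def)
  define w where "w = (\<lambda>x::real. 2 - x powr \<nu>)"
  define \<phi> where "\<phi> = (\<lambda>x. \<nu> * x / w x)"
  have w: "1 \<le> w x" "w x \<le> 2" if "x \<in> {0<..1}" for x
    using that \<nu> powr_le1[of \<nu> x] by (auto simp: w_def)
  define \<phi>' where "\<phi>' = (\<lambda>x. \<nu> / w x + \<nu>\<^sup>2 * x powr \<nu> / (w x)\<^sup>2)"
  have d\<phi>: "(\<phi> has_real_derivative \<phi>' x) (at x within {0<..1})" if x: "x \<in> {0<..1}" for x
  proof -
    have w0: "w x \<noteq> 0" using w[OF x] by simp
    have "(w has_real_derivative (- (\<nu> * x powr (\<nu> - 1)))) (at x within {0<..1})"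
      unfolding w_def using x \<nu> by (auto intro!: derivative_eq_intros)
    then have "(\<phi> has_real_derivative (\<nu> * w x - \<nu> * x * (- (\<nu> * x powr (\<nu> - 1)))) / (w x * w x)) (at x within {0<..1})"
      unfolding \<phi>_def using w0 by (auto intro!: derivative_eq_intros)
    moreover have "x * x powr (\<nu> - 1) = x powr \<nu>" using x by (simp add: powr_mult_base)
    then have "(\<nu> * w x - \<nu> * x * (- (\<nu> * x powr (\<nu> - 1)))) / (w x * w x) = \<phi>' x"
      using w0 by (simp add: \<phi>'_def power2_eq_square field_simps)
    ultimately show ?thesis by simp
  qed
  have c\<phi>': "continuous_on {0<..1} \<phi>'"
    unfolding \<phi>'_def w_def using w by (intro continuous_intros) (force simp: w_def)+
  have ub: "\<bar>\<phi>' x\<bar> \<le> \<nu> + \<nu>\<^sup>2" if x: "x \<in> {0<..1}" for x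
  proof -
    have "\<nu> / w x \<le> \<nu> / 1" using w[OF x] \<nu> by (intro divide_left_mono) auto
    moreover have "\<nu>\<^sup>2 * x powr \<nu> / (w x)\<^sup>2 \<le> \<nu>\<^sup>2 * 1 / 1"
      using w[OF x] x \<nu> powr_le1[of \<nu> x] by (intro frac_le mult_left_mono) (auto simp: one_le_power)
    moreover have "0 \<le> \<phi>' x" using w[OF x] \<nu> by (auto simp: \<phi>'_def)
    ultimately show ?thesis by (simp add: \<phi>'_def)
  qed
  have L\<phi>'u: "L2 (\<lambda>x. \<phi>' x * u x)"
    by (rule L2_bounded_mult[OF u(1) continuous_measurable_I01[OF c\<phi>'], of "\<nu> + \<nu>\<^sup>2"]) (use ub in \<open>auto intro!: AE_I2\<close>)
  have AC\<phi>: "AC01 \<phi>" by (rule AC01_C1[OF d\<phi> c\<phi>'])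
  have L\<phi>D: "L2 (\<lambda>x. \<nu> / w x * (x * D u x))"
  proof (rule L2_bounded_mult[OF L2_x_D[OF assms]])
    have "continuous_on {0<..1} w" unfolding w_def by (intro continuous_intros) auto
    then show "(\<lambda>x. \<nu> / w x) \<in> borel_measurable I01"
      by (intro continuous_measurable_I01 continuous_intros) (assumption | metis not_one_le_zero w(1))+
    show "AE x in I01. \<bar>\<nu> / w x\<bar> \<le> \<nu>"
    proof (rule AE_I2)
      fix x assume "x \<in> space I01"
      then have "1 \<le> w x" using w[of x] by auto
      then show "\<bar>\<nu> / w x\<bar> \<le> \<nu>" using \<nu> by (simp add: divide_simps)
    qed
  qed
  have i1: "integrable I01 (\<lambda>x. \<phi>' x * u x * u x)" by (rule L2_mult[OF L\<phi>'u u(1)])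
  have i2: "integrable I01 (\<lambda>x. (\<nu> / w x * (x * D u x)) * u x)" by (rule L2_mult[OF L\<phi>D u(1)])
  have u2: "integrable I01 (\<lambda>x. (u x)\<^sup>2)" using u(1) by (simp add: L2_def)
  have iaD: "integrable I01 (\<lambda>x. a x * D u x * D u x / a 1)" using integrable_flux[OF assms assms] by simp
  have I: "(LINT x|I01. \<phi>' x * u x * u x + 2 * ((\<nu> / w x * (x * D u x)) * u x)) = \<phi> 1 * (u 1 * u 1)"
  proof (rule AC01_integral_boundary)
    show "AC01 (\<lambda>x. \<phi> x * (u x * u x))" using AC\<phi> u by (intro AC01_mult)
    have d\<phi>': "AE x in I01. (\<phi> has_real_derivative \<phi>' x) (at x)"
      using d\<phi> within_01_interior by (intro AE_I2) force
    show "AE x in I01. ((\<lambda>x. \<phi> x * (u x * u x)) has_real_derivative (\<phi>' x * u x * u x + 2 * ((\<nu> / w x * (x * D u x)) * u x))) (at x)"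
      using u(4) d\<phi>'
    proof eventually_elim
      case (elim x)
      from DERIV_mult[OF elim(2) DERIV_mult[OF elim(1) elim(1)]]
      show ?case by (rule DERIV_cong) (simp add: \<phi>_def algebra_simps)
    qed
    show "integrable I01 (\<lambda>x. \<phi>' x * u x * u x + 2 * ((\<nu> / w x * (x * D u x)) * u x))"
      by (rule Bochner_Integration.integrable_add[OF i1 integrable_mult_right[OF i2]])
    show "integrable I01 (\<lambda>x. \<nu> * (u x)\<^sup>2)" using u2 by simp
    show "\<bar>\<phi> x * (u x * u x)\<bar> \<le> x * (\<nu> * (u x)\<^sup>2)" if "0 < x" "x < 1" for x
    proof -
      have "1 \<le> w x" using w[of x] that by simp
      then have "\<nu> * x / w x \<le> \<nu> * x / 1" using that \<nu> by (intro divide_left_mono) auto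
      then have "\<bar>\<phi> x\<bar> \<le> \<nu> * x" using that \<nu> \<open>1 \<le> w x\<close> by (simp add: \<phi>_def)
      then have "\<bar>\<phi> x\<bar> * (u x)\<^sup>2 \<le> \<nu> * x * (u x)\<^sup>2" by (intro mult_right_mono) auto
      then show ?thesis by (simp add: abs_mult power2_eq_square mult_ac)
    qed
  qed
  have "(LINT x|I01. \<nu> / 2 * (u x)\<^sup>2 - a x * D u x * D u x / a 1) \<le>
      (LINT x|I01. \<phi>' x * u x * u x + 2 * ((\<nu> / w x * (x * D u x)) * u x))"
  proof (rule integral_mono)
    show "integrable I01 (\<lambda>x. \<phi>' x * u x * u x + 2 * ((\<nu> / w x * (x * D u x)) * u x))"
      by (rule Bochner_Integration.integrable_add[OF i1 integrable_mult_right[OF i2]])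
    show "integrable I01 (\<lambda>x. \<nu> / 2 * (u x)\<^sup>2 - a x * D u x * D u x / a 1)" using iaD u2 by simp
    fix x assume "x \<in> space I01"
    then have x: "x \<in> {0<..1}" "0 < x" by auto
    have wx: "1 \<le> w x" "w x \<le> 2" using w[OF x(1)] .
    \<comment> \<open>The weight \<open>x powr \<mu>\<close>, below \<open>a x / a 1\<close> by
      \<open>a_lower\<close>; in terms of it \<open>x powr \<nu> = x^2 / y\<close>.\<close>
    define y where "y = x powr \<mu>"
    have y: "y > 0" "x powr \<nu> = x\<^sup>2 / y" using x by (auto simp: y_def \<nu>_def powr_diff)
    have yD: "y * (D u x)\<^sup>2 \<le> a x * D u x * D u x / a 1"
    proof -
      have "y * (D u x)\<^sup>2 \<le> a x / a 1 * (D u x)\<^sup>2"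
        using a_lower[OF x(1)] a1_pos by (intro mult_right_mono) (auto simp: y_def field_simps)
      then show ?thesis by (simp add: power2_eq_square)
    qed
    \<comment> \<open>The completed square is \<open>(\<phi> u + y u')^2 / y\<close>; its first part
      is exactly the second summand of \<open>\<phi>'\<close>.\<close>
    have "0 \<le> (\<nu> * x / w x * u x + y * D u x)\<^sup>2 / y" using y by simp
    also have "\<dots> = \<nu>\<^sup>2 * x powr \<nu> / (w x)\<^sup>2 * (u x)\<^sup>2 + 2 * ((\<nu> / w x * (x * D u x)) * u x) + y * (D u x)\<^sup>2"
      using y wx by (simp add: power2_eq_square field_simps)
    finally have "- a x * D u x * D u x / a 1 \<le> \<nu>\<^sup>2 * x powr \<nu> / (w x)\<^sup>2 * (u x)\<^sup>2 + 2 * ((\<nu> / w x * (x * D u x)) * u x)"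
      using yD by simp
    \<comment> \<open>The first summand of \<open>\<phi>'\<close> survives and is at least
      \<open>\<nu> / 2\<close> because \<open>w \<le> 2\<close>. Since
      \<open>\<phi> 1 = \<nu>\<close>, division by \<open>\<nu> / 2\<close> produces the coefficient
      2 of the trace.\<close>
    moreover have "\<nu> / 2 * (u x)\<^sup>2 \<le> \<nu> / w x * (u x)\<^sup>2"
      using wx \<nu> by (intro mult_right_mono divide_left_mono) auto
    moreover have "\<phi>' x * u x * u x = \<nu> / w x * (u x)\<^sup>2 + \<nu>\<^sup>2 * x powr \<nu> / (w x)\<^sup>2 * (u x)\<^sup>2"
      by (simp add: \<phi>'_def power2_eq_square distrib_right)
    ultimately show "\<nu> / 2 * (u x)\<^sup>2 - a x * D u x * D u x / a 1 \<le> \<phi>' x * u x * u x + 2 * ((\<nu> / w x * (x * D u x)) * u x)"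
      by linarith
  qed
  then have "\<nu> / 2 * (LINT x|I01. (u x)\<^sup>2) - (LINT x|I01. a x * D u x * D u x) / a 1 \<le> \<nu> * (u 1)\<^sup>2"
    using I iaD u2 integrable_flux[OF assms assms] by (simp add: \<phi>_def w_def power2_eq_square)
  then have "(LINT x|I01. (u x)\<^sup>2) \<le> (\<nu> * (u 1)\<^sup>2 + (LINT x|I01. a x * D u x * D u x) / a 1) / (\<nu> / 2)"
    using \<nu> by (simp add: field_simps)
  moreover have "(\<nu> * s + X / a 1) / (\<nu> / 2) = 2 * s + 1 / a 1 * (2 / \<nu>) * X" for s X
    using \<nu> a1_pos by (simp add: field_simps)
  ultimately show ?thesis by (simp add: \<nu>_def)
qed

lemma flux_nonneg: "0 \<le> (LINT x|I01. a x * D u x * D u x)"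
proof (rule integral_nonneg_AE)
  show "AE x in I01. 0 \<le> a x * D u x * D u x" using I01_ae_pos by eventually_elim (simp add: mult.assoc)
qed

lemma C1_pos: "C1 a > 0"
  using a1_pos mu_less_2 by (simp add: C1_def)

text \<open>The two entries of the minimum in \<open>C1\<close> come from Hardy's inequality and
  from the Riccati argument.\<close>

lemma Poincare:
  assumes "u \<in> V1 a"
  shows "(LINT x|I01. (u x)\<^sup>2) \<le> 2 * (u 1)\<^sup>2 + C1 a * (LINT x|I01. a x * D u x * D u x)"
proof (cases "4 \<le> 2 / (2 - \<mu>)")
  case True
  then have "C1 a = 4 / a 1" by (simp add: C1_def min_def)
  then show ?thesis using Poincare_Hardy[OF assms] by simp
next
  case False
  then have "C1 a = 1 / a 1 * (2 / (2 - \<mu>))" unfolding C1_def min_def by simp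
  then show ?thesis using Poincare_power[OF assms] by simp
qed

end

section \<open>Fluxes and their behaviour at the degenerate end point\<close>

lemma indefinite_integral_deriv:
  assumes h: "integrable I01 h" and c: "continuous_on {0<..1} h" and x: "x \<in> {0<..1}"
  shows "((\<lambda>x. integral {0..x} h) has_real_derivative h x) (at x within {0<..1})"
proof -
  have eq: "{0..1} - {0} = {0<..1::real}" by auto
  have "((\<lambda>u. integral {0..u} h) has_vector_derivative h x) (at x within ({0..1} - {0}))"
    by (rule integral_has_vector_derivative_continuous_at)
       (use x c integrable_on_I01_subinterval[OF h, of 0 1] in \<open>auto simp: eq continuous_on_eq_continuous_within\<close>)
  then show ?thesis by (simp add: eq has_real_derivative_iff_has_vector_derivative)
qed

lemma indefinite_integral_at_right_0:
  fixes h :: "real \<Rightarrow> real"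
  assumes h: "integrable I01 h"
  shows "((\<lambda>x. integral {0..x} h) \<longlongrightarrow> 0) (at_right 0)"
proof -
  have "continuous_on {0..1} (\<lambda>c. integral {0..c} h)"
    by (intro indefinite_integral_continuous_1 integrable_on_I01_subinterval h) auto
  then have "((\<lambda>c. integral {0..c} h) \<longlongrightarrow> integral {0..0} h) (at 0 within {0..1})"
    unfolding continuous_on_def by (rule bspec) simp
  then show ?thesis by (simp add: at_within_Icc_at_right)
qed

lemma abs_cont_on_at_right_0:
  assumes "abs_cont_on 0 1 p"
  shows "(p \<longlongrightarrow> p 0) (at_right 0)"
proof -
  have "(p \<longlongrightarrow> p 0) (at 0 within {0..1})"
    using abs_cont_on_continuous[OF assms] unfolding continuous_on_def by (rule bspec) simp
  then show ?thesis by (simp add: at_within_Icc_at_right)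
qed

lemma divide_sqrt_eq:
  fixes t c :: real
  assumes "t > 0"
  shows "t * c / sqrt t = sqrt t * c" "sqrt t * (c / t) = c / sqrt t"
proof -
  define s where "s = sqrt t"
  have s: "t = s * s" "s > 0" using assms by (auto simp: s_def)
  show "t * c / sqrt t = sqrt t * c" "sqrt t * (c / t) = c / sqrt t"
    using s(2) unfolding s(1) by (auto simp: real_sqrt_mult_self)
qed

context degenerate_coefficient
begin

lemma V1_D_measurable:
  assumes "u \<in> V1 a"
  shows "D u \<in> borel_measurable I01"
proof (rule measurable_I01_cong_AE)
  have "(\<lambda>x. sqrt (a x)) \<in> borel_measurable I01" using measurable_a by measurable
  then show "(\<lambda>x. sqrt (a x) * D u x / sqrt (a x)) \<in> borel_measurable I01"
    by (rule borel_measurable_divide[OF L2_measurable[OF V1_D(3)[OF assms]]])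
  show "AE x in I01. sqrt (a x) * D u x / sqrt (a x) = D u x"
    using I01_ae_pos by eventually_elim simp
qed

text \<open>For \<open>\<mu> \<ge> 1\<close> the coefficient is at most \<open>K x\<close>, so
  \<open>p^2 / x\<close> is integrable and \<open>p\<close> cannot have a nonzero limit. The
  boundary condition that the flux vanishes at 0 is therefore contained in
  \<open>W2\<close>.\<close>

lemma flux_zero:
  assumes p: "abs_cont_on 0 1 p" and L: "L2 (\<lambda>x. p x / sqrt (a x))" and mu: "\<mu> \<ge> 1"
  shows "p 0 = 0"
proof -
  obtain K where K: "K > 0" "\<forall>x\<in>{0<..1}. a x \<le> K * x" using a_upper_linear[OF mu] by blast
  have "p 0 * p 0 = 0"
  proof (rule limit_zero_dominated)
    show "AC01 (\<lambda>x. p x * p x)" using abs_cont_on_imp_AC01[OF p] by (intro AC01_mult)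
    show "((\<lambda>x. p x * p x) \<longlongrightarrow> p 0 * p 0) (at_right 0)"
      by (intro tendsto_intros abs_cont_on_at_right_0 p)
    show "integrable I01 (\<lambda>x. K * (p x / sqrt (a x))\<^sup>2)" using L by (simp add: L2_def)
    show "\<bar>p x * p x\<bar> \<le> x * (K * (p x / sqrt (a x))\<^sup>2)" if x: "0 < x" "x < 1" for x
    proof -
      have ax: "0 < a x" "a x \<le> K * x" using a_pos[of x] K x by auto
      have "p x * p x = a x * (p x / sqrt (a x))\<^sup>2" using ax by (simp add: power_divide power2_eq_square)
      also have "\<dots> \<le> (K * x) * (p x / sqrt (a x))\<^sup>2" using ax by (intro mult_right_mono) auto
      finally show ?thesis by (simp add: mult_ac abs_mult)
    qed
  qed
  then show ?thesis by simp
qed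

text \<open>Integration by parts with the flux \<open>p\<close>. The boundary term at 0 is killed by
  \<open>v\<close> when \<open>\<mu> < 1\<close> and by \<open>p\<close> when
  \<open>\<mu> \<ge> 1\<close>. It is stated for an abstract flux so as to cover both
  \<open>a u'\<close> and the constant flux of the profile.\<close>

lemma flux_test:
  assumes p: "abs_cont_on 0 1 p" and L: "L2 (\<lambda>x. p x / sqrt (a x))" and g: "L2 g"
    and dp: "AE x in I01. (p has_real_derivative g x) (at x)"
    and pg: "\<forall>x. p x = p 0 + integral {0..x} g" and v: "v \<in> W1 a"
  shows "integrable I01 (\<lambda>x. p x * D v x)" "(LINT x|I01. g x * v x) + (LINT x|I01. p x * D v x) = p 1 * v 1"
proof -
  note v' = V1_D[OF W1_V1[OF v]]
  have "integrable I01 (\<lambda>x. (p x / sqrt (a x)) * (sqrt (a x) * D v x))" by (rule L2_mult[OF L v'(3)])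
  then show i2: "integrable I01 (\<lambda>x. p x * D v x)"
  proof (rule integrable_cong_AE_imp)
    have "p \<in> borel_measurable I01"
      by (rule L2_measurable[OF L2_continuous[OF abs_cont_on_continuous[OF p]]])
    then show "(\<lambda>x. p x * D v x) \<in> borel_measurable I01"
      using V1_D_measurable[OF W1_V1[OF v]] by (rule borel_measurable_times)
    show "AE x in I01. (p x / sqrt (a x)) * (sqrt (a x) * D v x) = p x * D v x"
      using I01_ae_pos by eventually_elim simp
  qed
  have i1: "integrable I01 (\<lambda>x. g x * v x)" by (rule L2_mult[OF g v'(1)])
  let ?I = "LINT x|I01. g x * v x + p x * D v x"
  have AC: "AC01 (\<lambda>x. p x * v x)" using abs_cont_on_imp_AC01[OF p] v'(2) by (rule AC01_mult)
  have lim: "((\<lambda>x. p x * v x) \<longlongrightarrow> p 1 * v 1 - ?I) (at_right 0)"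
  proof (rule AC01_FTC_limit[OF AC])
    show "AE x in I01. ((\<lambda>x. p x * v x) has_real_derivative (g x * v x + p x * D v x)) (at x)"
      using dp v'(4)
    proof eventually_elim
      case (elim x)
      from DERIV_mult[OF this] show ?case by (rule DERIV_cong) (simp add: algebra_simps)
    qed
  qed (use i1 i2 in simp)
  have "p 1 * v 1 - ?I = 0"
  proof (cases "\<mu> < 1")
    case True
    then have "(v \<longlongrightarrow> 0) (at_right 0)" using v by (simp add: W1_def)
    then have "((\<lambda>x. p x * v x) \<longlongrightarrow> p 0 * 0) (at_right 0)"
      by (intro tendsto_mult abs_cont_on_at_right_0 p)
    then show ?thesis using tendsto_unique[OF _ lim] by simp
  next
    case False
    then have p0: "p 0 = 0" using flux_zero[OF p L] by simp
    define B where "B = (LINT x|I01. (g x)\<^sup>2) + 1"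
    \<comment> \<open>In this case \<open>v\<close> may be unbounded at 0. Since
      \<open>p = O(sqrt x)\<close>, the square of \<open>p v\<close> is at most \<open>x\<close>
      times an integrable function, so the square of the limit is 0.\<close>
    have "(p 1 * v 1 - ?I) * (p 1 * v 1 - ?I) = 0"
    proof (rule limit_zero_dominated)
      show "AC01 (\<lambda>x. p x * v x * (p x * v x))" by (rule AC01_mult[OF AC AC])
      show "((\<lambda>x. p x * v x * (p x * v x)) \<longlongrightarrow> (p 1 * v 1 - ?I) * (p 1 * v 1 - ?I)) (at_right 0)"
        by (rule tendsto_mult[OF lim lim])
      show "integrable I01 (\<lambda>x. B\<^sup>2 * (v x)\<^sup>2)" using v'(1) by (simp add: L2_def)
      show "\<bar>p x * v x * (p x * v x)\<bar> \<le> x * (B\<^sup>2 * (v x)\<^sup>2)" if x: "0 < x" "x < 1" for x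
      proof -
        have "\<bar>p x\<bar> \<le> B * sqrt x"
          using pg[rule_format, of x] p0 indefinite_integral_sqrt_bound[OF g, of x] x by (simp add: B_def)
        then have "\<bar>p x\<bar>\<^sup>2 \<le> (B * sqrt x)\<^sup>2" by (intro power_mono) auto
        then have "(p x)\<^sup>2 \<le> B\<^sup>2 * x" using x by (simp add: power_mult_distrib)
        then have "(p x)\<^sup>2 * (v x)\<^sup>2 \<le> B\<^sup>2 * x * (v x)\<^sup>2" by (intro mult_right_mono) auto
        then show ?thesis by (simp add: power2_eq_square abs_mult mult_ac)
      qed
    qed
    then show ?thesis by simp
  qed
  then show "(LINT x|I01. g x * v x) + (LINT x|I01. p x * D v x) = p 1 * v 1" using i1 i2 by simp
qed

text \<open>Replaces the weak derivative by a continuous representative \<open>p\<close> of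
  \<open>a u'\<close>. As \<open>u\<close> is locally the integral of the continuous function
  \<open>p / a\<close>, it is continuously differentiable on ]0,1], and \<open>a * D u = p\<close>
  holds at every point of ]0,1]. In particular \<open>D u 1\<close>, which occurs in the boundary
  condition, is a genuine one-sided derivative.\<close>

lemma W2_flux:
  assumes u: "u \<in> W2 a"
  obtains p where "abs_cont_on 0 1 p" "L2 (\<lambda>x. p x / sqrt (a x))" "L2 (wD (\<lambda>x. a x * D u x))"
    "AE x in I01. (p has_real_derivative wD (\<lambda>x. a x * D u x) x) (at x)"
    "\<forall>x. p x = p 0 + integral {0..x} (wD (\<lambda>x. a x * D u x))"
    "\<forall>x\<in>{0<..1}. (u has_real_derivative p x / a x) (at x within {0<..1})"
    "\<forall>x\<in>{0<..1}. a x * D u x = p x"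
proof -
  let ?w = "\<lambda>x. a x * D u x"
  have uW: "u \<in> W1 a" and H: "?w \<in> H1" using u by (auto simp: W2_def)
  note uV = V1_D[OF W1_V1[OF uW]]
  have w: "L2 ?w" using H by (simp add: H1_def)
  have "\<exists>g. weak_deriv ?w g" using H by (simp add: H1_def)
  then have wd: "weak_deriv ?w (wD ?w)" unfolding wD_def by (rule someI_ex)
  then have g: "L2 (wD ?w)" by (simp add: weak_deriv_def)
  obtain p where p: "abs_cont_on 0 1 p" "AE x in I01. a x * D u x = p x"
    "AE x in I01. (p has_real_derivative wD ?w x) (at x)" "\<forall>x. p x = p 0 + integral {0..x} (wD ?w)"
    by (rule weak_deriv_absolutely_continuous[OF w wd])
  have L: "L2 (\<lambda>x. p x / sqrt (a x))"
  proof (rule L2_cong_AE[OF uV(3)])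
    show "AE x in I01. sqrt (a x) * D u x = p x / sqrt (a x)"
      using p(2) I01_ae_pos
    proof eventually_elim
      case (elim x)
      then show ?case using divide_sqrt_eq(1)[of "a x" "D u x"] by simp
    qed
  qed
  have pc: "continuous_on {0<..1} (\<lambda>x. p x / a x)"
  proof (intro continuous_intros)
    show "continuous_on {0<..1} p" by (rule continuous_on_subset[OF abs_cont_on_continuous[OF p(1)]]) auto
    show "continuous_on {0<..1} a" by (rule continuous_on_subset[OF a_continuous]) auto
    show "\<forall>x\<in>{0<..1}. a x \<noteq> 0" using a_pos by (metis less_irrefl)
  qed
  have du: "(u has_real_derivative p x / a x) (at x within {0<..1})" if x: "x \<in> {0<..1}" for x
  proof -
    define c where "c = x / 2"
    have c: "0 < c" "c < x" "x \<le> 1" using x by (auto simp: c_def)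
    have dae: "AE x in I01. (u has_real_derivative p x / a x) (at x)"
      using uV(4) p(2) I01_ae_pos
    proof eventually_elim
      case (elim x)
      have "p x / a x = D u x" using elim(2)[symmetric] elim(3) by simp
      then show ?case using elim(1) by simp
    qed
    have eq: "u c + integral {c..y} (\<lambda>x. p x / a x) = u y" if "y \<in> {c..1}" for y
      using integral_unique[OF AC01_FTC[OF uV(2) dae, of c y]] c that by auto
    have "continuous_on {c..1} (\<lambda>x. p x / a x)" by (rule continuous_on_subset[OF pc]) (use c in auto)
    then have "((\<lambda>y. integral {c..y} (\<lambda>x. p x / a x)) has_real_derivative p x / a x) (at x within {c..1})"
      by (rule integral_has_real_derivative) (use c in auto)
    then have "((\<lambda>y. u c + integral {c..y} (\<lambda>x. p x / a x)) has_real_derivative p x / a x) (at x within {c..1})"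
      by (auto intro!: derivative_eq_intros)
    then have "(u has_real_derivative p x / a x) (at x within {c..1})"
      by (rule has_field_derivative_transform_within[of _ _ _ _ 1]) (use eq c in auto)
    moreover have "at x within {c..1} = at x within {0<..1}"
      by (rule at_within_nhd[of _ "{c<..}"]) (use c in auto)
    ultimately show ?thesis by simp
  qed
  have aD: "a x * D u x = p x" if "x \<in> {0<..1}" for x
    using D_eq[OF du[OF that] that] a_pos[OF that] by simp
  show ?thesis by (rule that[OF p(1) L g p(3,4)]) (intro ballI du aD, assumption)+
qed

text \<open>Green's formula; the only boundary term left is the one at 1.\<close>

lemma W2_test:
  assumes u: "u \<in> W2 a" and v: "v \<in> W1 a"
  shows "(LINT x|I01. wD (\<lambda>x. a x * D u x) x * v x) + (LINT x|I01. a x * D u x * D v x) = a 1 * D u 1 * v 1"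
proof -
  obtain p where p: "abs_cont_on 0 1 p" "L2 (\<lambda>x. p x / sqrt (a x))" "L2 (wD (\<lambda>x. a x * D u x))"
    "AE x in I01. (p has_real_derivative wD (\<lambda>x. a x * D u x) x) (at x)"
    "\<forall>x. p x = p 0 + integral {0..x} (wD (\<lambda>x. a x * D u x))"
    "\<forall>x\<in>{0<..1}. (u has_real_derivative p x / a x) (at x within {0<..1})"
    "\<forall>x\<in>{0<..1}. a x * D u x = p x"
    by (rule W2_flux[OF u])
  have "(LINT x|I01. a x * D u x * D v x) = (LINT x|I01. p x * D v x)"
    using p(7) by (intro Bochner_Integration.integral_cong) auto
  then show ?thesis using flux_test(2)[OF p(1-5) v] p(7)[rule_format, of 1] by simp
qed

lemma W2_L2: "u \<in> W2 a \<Longrightarrow> L2 (wD (\<lambda>x. a x * D u x))"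
  by (rule W2_flux)

lemma weighted_D_integrable:
  assumes "u \<in> V1 a"
  shows "integrable I01 (\<lambda>x. x * D a x * D u x * D u x)"
proof (rule Bochner_Integration.integrable_bound)
  show "integrable I01 (\<lambda>x. \<mu> * (a x * D u x * D u x))" using integrable_flux[OF assms assms] by simp
  show "(\<lambda>x. x * D a x * D u x * D u x) \<in> borel_measurable I01"
    using measurable_Da measurable_ident_I01 V1_D_measurable[OF assms] by simp
  show "AE x in I01. norm (x * D a x * D u x * D u x) \<le> norm (\<mu> * (a x * D u x * D u x))"
  proof (rule AE_I2)
    fix x assume "x \<in> space I01"
    then have x: "x \<in> {0<..1}" by auto
    have "x * \<bar>D a x\<bar> * (D u x)\<^sup>2 \<le> \<mu> * a x * (D u x)\<^sup>2" using mu_bound[OF x] by (intro mult_right_mono) auto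
    then show "norm (x * D a x * D u x * D u x) \<le> norm (\<mu> * (a x * D u x * D u x))"
      using x a_pos[OF x] mu_nonneg by (simp add: abs_mult power2_eq_square mult_ac)
  qed
qed

text \<open>With \<open>p = a u'\<close>, integrate \<open>(x p^2 / a)'\<close>. The boundary term
  at 0 vanishes because \<open>p^2 / a\<close> is integrable. The inequality enters only through
  \<open>x a' \<le> \<mu> a\<close>.\<close>

lemma W2_multiplier:
  assumes u: "u \<in> W2 a"
  shows "(LINT x|I01. (x * D u x) * wD (\<lambda>x. a x * D u x) x) \<le>
     a 1 * (D u 1)\<^sup>2 / 2 - (1 - \<mu>) / 2 * (LINT x|I01. a x * D u x * D u x)"
proof -
  let ?g = "wD (\<lambda>x. a x * D u x)"
  obtain p where p: "abs_cont_on 0 1 p" "L2 (\<lambda>x. p x / sqrt (a x))" "L2 ?g"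
    "AE x in I01. (p has_real_derivative ?g x) (at x)"
    "\<forall>x. p x = p 0 + integral {0..x} ?g"
    "\<forall>x\<in>{0<..1}. (u has_real_derivative p x / a x) (at x within {0<..1})"
    "\<forall>x\<in>{0<..1}. a x * D u x = p x"
    by (rule W2_flux[OF u])
  have uV: "u \<in> V1 a" using u by (simp add: W2_def W1_V1)
  have i1: "integrable I01 (\<lambda>x. (x * D u x) * ?g x)" by (rule L2_mult[OF L2_x_D[OF uV] p(3)])
  note i2 = integrable_flux[OF uV uV]
  note i3 = weighted_D_integrable[OF uV]
  let ?h = "\<lambda>x. a x * D u x * D u x - x * D a x * D u x * D u x + 2 * ((x * D u x) * ?g x)"
  have "(LINT x|I01. ?h x) = 1 * (1 / a 1) * (p 1 * p 1)"
  proof (rule AC01_integral_boundary[where F = "\<lambda>x. x * (1 / a x) * (p x * p x)"])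
    show "AC01 (\<lambda>x. x * (1 / a x) * (p x * p x))"
      using abs_cont_on_imp_AC01[OF p(1)] by (intro AC01_mult AC01_ident AC01_inverse_a)
    show "AE x in I01. ((\<lambda>x. x * (1 / a x) * (p x * p x)) has_real_derivative ?h x) (at x)"
    proof -
      have ia: "AE x in I01. ((\<lambda>x. 1 / a x) has_real_derivative (- D a x / (a x)\<^sup>2)) (at x)"
        using inverse_a_deriv within_01_interior by (intro AE_I2) force
      have "AE x in I01. x \<in> {0<..1}" by (rule AE_I2) auto
      then show ?thesis using p(4) ia I01_ae_pos
      proof eventually_elim
        case (elim x)
        have ax: "a x \<noteq> 0" using elim by simp
        have px: "p x = a x * D u x" using p(7) elim by simp
        from DERIV_mult[OF DERIV_mult[OF DERIV_ident elim(3)] DERIV_mult[OF elim(2) elim(2)]]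
        show ?case
          by (rule DERIV_cong) (use ax in \<open>simp add: px power2_eq_square field_simps\<close>)
      qed
    qed
    show "integrable I01 ?h"
      by (rule Bochner_Integration.integrable_add[OF Bochner_Integration.integrable_diff[OF i2 i3] integrable_mult_right[OF i1]])
    show "integrable I01 (\<lambda>x. (p x / sqrt (a x))\<^sup>2)" using p(2) by (simp add: L2_def)
    show "\<bar>x * (1 / a x) * (p x * p x)\<bar> \<le> x * (p x / sqrt (a x))\<^sup>2" if "0 < x" "x < 1" for x
      using that a_pos[of x] by (simp add: power_divide power2_eq_square abs_mult)
  qed
  also have "\<dots> = a 1 * (D u 1)\<^sup>2" using p(7)[rule_format, of 1, symmetric] a1_pos by (simp add: power2_eq_square)
  finally have eq: "(LINT x|I01. ?h x) = a 1 * (D u 1)\<^sup>2" .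
  have "(LINT x|I01. (1 - \<mu>) * (a x * D u x * D u x) + 2 * ((x * D u x) * ?g x)) \<le> (LINT x|I01. ?h x)"
  proof (rule integral_mono)
    show "integrable I01 ?h"
      by (rule Bochner_Integration.integrable_add[OF Bochner_Integration.integrable_diff[OF i2 i3] integrable_mult_right[OF i1]])
    show "integrable I01 (\<lambda>x. (1 - \<mu>) * (a x * D u x * D u x) + 2 * ((x * D u x) * ?g x))"
      by (rule Bochner_Integration.integrable_add[OF integrable_mult_right[OF i2] integrable_mult_right[OF i1]])
    fix x assume "x \<in> space I01"
    then have x: "x \<in> {0<..1}" "0 < x" by auto
    have "x * D a x \<le> x * \<bar>D a x\<bar>" using x by (intro mult_left_mono) auto
    then have "x * D a x \<le> \<mu> * a x" using mu_bound[OF x(1)] by simp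
    then have "x * D a x * (D u x)\<^sup>2 \<le> \<mu> * a x * (D u x)\<^sup>2" by (intro mult_right_mono) auto
    then show "(1 - \<mu>) * (a x * D u x * D u x) + 2 * ((x * D u x) * ?g x) \<le> ?h x"
      by (simp add: power2_eq_square algebra_simps)
  qed
  then show ?thesis unfolding eq using i1 i2 by simp
qed

text \<open>Comparison with \<open>x powr (- \<mu>)\<close>.\<close>

lemma inverse_a_integrable: "\<mu> < 1 \<Longrightarrow> integrable I01 (\<lambda>x. 1 / a x)"
proof -
  assume mu: "\<mu> < 1"
  have "(\<lambda>x. x powr (- \<mu>)) integrable_on {0..1}" using mu by (intro integrable_on_powr_from_0) auto
  then have "(\<lambda>x. x powr (- \<mu>)) absolutely_integrable_on {0..1}" by (rule nonnegative_absolutely_integrable_1) simp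
  then have "(\<lambda>x. x powr (- \<mu>)) absolutely_integrable_on {0<..<1}"
    by (simp add: absolutely_integrable_on_Icc_iff_Ioo[symmetric])
  then have i: "integrable I01 (\<lambda>x. x powr (- \<mu>))" by (rule absolutely_integrable_imp_integrable) auto
  show ?thesis
  proof (rule Bochner_Integration.integrable_bound)
    show "integrable I01 (\<lambda>x. 1 / a 1 * x powr (- \<mu>))" using i by simp
    show "(\<lambda>x. 1 / a x) \<in> borel_measurable I01" using measurable_a by simp
    show "AE x in I01. norm (1 / a x) \<le> norm (1 / a 1 * x powr (- \<mu>))"
    proof (rule AE_I2)
      fix x assume "x \<in> space I01"
      then have x: "x \<in> {0<..1}" "0 < x" by auto
      have "1 / a x \<le> 1 / (a 1 * x powr \<mu>)" using a_lower[OF x(1)] a_pos[OF x(1)] a1_pos x by (intro divide_left_mono) auto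
      then show "norm (1 / a x) \<le> norm (1 / a 1 * x powr (- \<mu>))"
        using a_pos[OF x(1)] a1_pos x by (simp add: powr_minus_divide)
    qed
  qed
qed

lemma continuous_inverse_a: "continuous_on {0<..1} (\<lambda>x. 1 / a x)"
  by (rule AC01_continuous[OF AC01_inverse_a])

end

subsection \<open>The energy space and the multiplier\<close>

locale damped_wave = degenerate_coefficient +
  fixes \<beta> :: real
  assumes beta: "\<beta> > 0"
begin

text \<open>\<open>(a \<zeta>')' = 0\<close> means a constant flux \<open>c\<close>. For
  \<open>\<mu> \<ge> 1\<close> the condition at 0 forces \<open>c = 0\<close> and
  \<open>\<zeta>\<close> is the constant \<open>1/\<beta>\<close>. For \<open>\<mu> < 1\<close> it
  is \<open>c\<close> times the primitive of \<open>1/a\<close>, which vanishes at 0. The relation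
  between \<open>c\<close> and \<open>\<zeta> 1\<close> is the normalisation
  \<open>\<zeta>'(1) + \<beta> \<zeta>(1) = 1\<close> multiplied by \<open>a(1)\<close>.\<close>

lemma elliptic_profile:
  obtains \<zeta> c where "\<zeta> \<in> W1 a" "\<forall>x\<in>{0<..<1}. a x * D \<zeta> x = c"
    "L2 (\<lambda>x. c / sqrt (a x))" "c = a 1 * (1 - \<beta> * \<zeta> 1)" "0 \<le> \<zeta> 1" "\<zeta> 1 \<le> 1 / \<beta>"
proof (cases "\<mu> < 1")
  case False
  have D0: "D (\<lambda>_. 1 / \<beta>) x = 0" if "x \<in> {0<..1}" for x
    using that by (intro D_eq) auto
  have "L2 (\<lambda>x. sqrt (a x) * D (\<lambda>_. 1 / \<beta>) x)"
    by (rule L2_cong_AE[OF L2_const[of 0]]) (use D0 in \<open>auto intro!: AE_I2\<close>)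
  then have "(\<lambda>_. 1 / \<beta>) \<in> W1 a"
    using False by (simp add: W1_def V1_iff L2_const AC01_const)
  then show ?thesis
    by (rule that[of _ 0]) (use D0 L2_const[of 0] beta in auto)
next
  case True
  define h where "h = (\<lambda>x. 1 / a x)"
  have h: "integrable I01 h" unfolding h_def by (rule inverse_a_integrable[OF True])
  define I where "I = integral {0..1} h"
  have I: "I \<ge> 0"
  proof -
    have "I = (LINT x|I01. h x)" unfolding I_def by (rule integral_unique[OF has_integral_I01[OF h]])
    also have "\<dots> \<ge> 0" by (rule integral_nonneg_AE) (use a_pos in \<open>auto intro!: AE_I2 simp: h_def less_imp_le\<close>)
    finally show ?thesis .
  qed
  \<comment> \<open>Solves \<open>c / a(1) + \<beta> c I = 1\<close>, the normalisation at
    1.\<close>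
  define c where "c = 1 / (1 / a 1 + \<beta> * I)"
  have den: "1 / a 1 + \<beta> * I > 0" using a1_pos beta I by (intro add_pos_nonneg) auto
  have c: "c > 0" using den by (simp add: c_def)
  define \<zeta> where "\<zeta> = (\<lambda>x. c * integral {0..x} h)"
  have dz: "(\<zeta> has_real_derivative c * h x) (at x within {0<..1})" if "x \<in> {0<..1}" for x
    unfolding \<zeta>_def using indefinite_integral_deriv[OF h _ that] continuous_inverse_a
    by (auto intro!: derivative_eq_intros simp: h_def)
  have Dz: "D \<zeta> x = c / a x" if "x \<in> {0<..1}" for x using D_eq[OF dz[OF that] that] by (simp add: h_def)
  have Lc: "L2 (\<lambda>x. c / sqrt (a x))"
  proof -
    have "integrable I01 (\<lambda>x. c\<^sup>2 * h x)" using h by simp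
    then have "integrable I01 (\<lambda>x. (c / sqrt (a x))\<^sup>2)"
      by (rule Bochner_Integration.integrable_cong[THEN iffD1, rotated 2]) (use a_pos in \<open>auto simp: h_def power_divide less_imp_le\<close>)
    then show ?thesis using measurable_a by (simp add: L2_def)
  qed
  have z1: "\<zeta> 1 = c * I" by (simp add: \<zeta>_def I_def)
  show ?thesis
  proof (rule that[of \<zeta> c])
    have "continuous_on {0..1} (\<lambda>x. integral {0..x} h)"
      by (intro indefinite_integral_continuous_1 integrable_on_I01_subinterval h) auto
    then have "continuous_on {0..1} \<zeta>" unfolding \<zeta>_def by (intro continuous_intros)
    then have "L2 \<zeta>" by (rule L2_continuous)
    moreover have "AC01 \<zeta>"
      by (rule AC01_C1[OF dz]) (use continuous_inverse_a in \<open>auto simp only: h_def intro!: continuous_on_mult_left\<close>)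
    moreover have "L2 (\<lambda>x. sqrt (a x) * D \<zeta> x)"
    proof (rule L2_cong_AE[OF Lc], rule AE_I2)
      fix x assume "x \<in> space I01"
      then have "x \<in> {0<..1}" by auto
      then show "c / sqrt (a x) = sqrt (a x) * D \<zeta> x" using Dz a_pos divide_sqrt_eq(2) by simp
    qed
    moreover have "(\<zeta> \<longlongrightarrow> 0) (at_right 0)"
      unfolding \<zeta>_def using tendsto_mult_right_zero[OF indefinite_integral_at_right_0[OF h]] by simp
    ultimately show "\<zeta> \<in> W1 a" by (simp add: W1_def V1_iff)
    show "\<forall>x\<in>{0<..<1}. a x * D \<zeta> x = c" using Dz a_pos by (simp add: less_imp_neq[symmetric])
    show "c = a 1 * (1 - \<beta> * \<zeta> 1)"
    proof -
      have "c * (1 / a 1 + \<beta> * I) = 1" using den by (simp add: c_def)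
      then have "c / a 1 = 1 - \<beta> * (c * I)" by (simp add: algebra_simps)
      then show ?thesis using a1_pos by (simp add: z1 field_simps)
    qed
    then have "a 1 * (1 - \<beta> * \<zeta> 1) > 0" using c by simp
    then have "\<beta> * \<zeta> 1 < 1" using a1_pos by (simp add: zero_less_mult_iff)
    then show "\<zeta> 1 \<le> 1 / \<beta>" using beta by (simp add: pos_le_divide_eq mult.commute)
    show "0 \<le> \<zeta> 1" using c I by (simp add: z1)
  qed (rule Lc)
qed

lemma alpha_pos: "alpha a \<beta> > 0"
  using C1_pos a1_pos beta by (simp add: alpha_def)

text \<open>Explains \<open>alpha\<close>: it is chosen with \<open>alpha * C1 \<le> 1\<close> and
  \<open>2 * alpha \<le> \<beta> a(1)\<close>, so both terms of the Poincare inequality fit under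
  the potential energy.\<close>

lemma L2_le_energy:
  assumes "u \<in> V1 a"
  shows "alpha a \<beta> * (LINT x|I01. (u x)\<^sup>2) \<le> (LINT x|I01. a x * D u x * D u x) + \<beta> * a 1 * (u 1)\<^sup>2"
proof -
  let ?Q = "LINT x|I01. a x * D u x * D u x"
  have "alpha a \<beta> * (LINT x|I01. (u x)\<^sup>2) \<le> alpha a \<beta> * (2 * (u 1)\<^sup>2 + C1 a * ?Q)"
    using Poincare[OF assms] alpha_pos by (intro mult_left_mono) auto
  also have "\<dots> = (alpha a \<beta> * C1 a) * ?Q + (alpha a \<beta> * 2) * (u 1)\<^sup>2" by (simp add: algebra_simps)
  also have "\<dots> \<le> 1 * ?Q + (\<beta> * a 1) * (u 1)\<^sup>2"
  proof (intro add_mono mult_right_mono flux_nonneg)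
    have "alpha a \<beta> \<le> 1 / C1 a" by (simp add: alpha_def)
    then show "alpha a \<beta> * C1 a \<le> 1" using C1_pos by (simp add: pos_le_divide_eq)
    have "alpha a \<beta> \<le> \<beta> * a 1 / 2" by (simp add: alpha_def)
    then show "alpha a \<beta> * 2 \<le> \<beta> * a 1" by simp
  qed auto
  finally show ?thesis by simp
qed

text \<open>Testing \<open>\<zeta>\<close> with itself gives potential energy
  \<open>c \<zeta>(1) + \<beta> a(1) \<zeta>(1)^2 = a(1) \<zeta>(1)\<close>, whence the L2 bound.
  For the identity, Green's formula is used once for \<open>u\<close> and once for
  \<open>\<zeta>\<close>. On the operator domain its right-hand side is
  \<open>- \<zeta>(1) a(1) v(1) - a(1) u(1)\<close>, and the last term is the purpose of the
  profile.\<close>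

lemma profile_properties:
  obtains \<zeta> where "\<zeta> \<in> W1 a" "0 \<le> \<zeta> 1" "\<zeta> 1 \<le> 1 / \<beta>"
    "(LINT x|I01. (\<zeta> x)\<^sup>2) \<le> a 1 / (alpha a \<beta> * \<beta>)"
    "\<forall>u\<in>W2 a. (LINT x|I01. \<zeta> x * wD (\<lambda>x. a x * D u x) x) =
        \<zeta> 1 * a 1 * (D u 1 + \<beta> * u 1) - a 1 * u 1"
proof -
  obtain \<zeta> c where z: "\<zeta> \<in> W1 a" "\<forall>x\<in>{0<..<1}. a x * D \<zeta> x = c"
    "L2 (\<lambda>x. c / sqrt (a x))" "c = a 1 * (1 - \<beta> * \<zeta> 1)" "0 \<le> \<zeta> 1" "\<zeta> 1 \<le> 1 / \<beta>"
    by (rule elliptic_profile)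
  have "abs_cont_on 0 1 (\<lambda>_. c)" by (rule abs_cont_on_Lipschitz[where K = 0]) simp
  note ft = flux_test[OF this z(3) L2_const[of 0]]
  have cD: "(LINT x|I01. c * D v x) = c * v 1" if "v \<in> W1 a" for v
    using ft(2)[OF _ _ that] by simp
  show ?thesis
  proof (rule that[of \<zeta>])
    have zV: "\<zeta> \<in> V1 a" using z(1) by (rule W1_V1)
    have "(LINT x|I01. a x * D \<zeta> x * D \<zeta> x) = (LINT x|I01. c * D \<zeta> x)"
      using z(2) by (intro Bochner_Integration.integral_cong) auto
    then have "alpha a \<beta> * (LINT x|I01. (\<zeta> x)\<^sup>2) \<le> c * \<zeta> 1 + \<beta> * a 1 * (\<zeta> 1)\<^sup>2"
      using L2_le_energy[OF zV] cD[OF z(1)] by linarith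
    also have "\<dots> = a 1 * \<zeta> 1" by (simp add: z(4) power2_eq_square algebra_simps)
    also have "\<dots> \<le> a 1 * (1 / \<beta>)" using z(6) a1_pos by (intro mult_left_mono) auto
    finally have "alpha a \<beta> * (LINT x|I01. (\<zeta> x)\<^sup>2) \<le> a 1 / \<beta>" by simp
    then have "(LINT x|I01. (\<zeta> x)\<^sup>2) \<le> a 1 / \<beta> / alpha a \<beta>" using alpha_pos by (subst pos_le_divide_eq) (auto simp: mult.commute)
    then show "(LINT x|I01. (\<zeta> x)\<^sup>2) \<le> a 1 / (alpha a \<beta> * \<beta>)" by (simp add: mult.commute)
  next
    show "\<forall>u\<in>W2 a. (LINT x|I01. \<zeta> x * wD (\<lambda>x. a x * D u x) x) = \<zeta> 1 * a 1 * (D u 1 + \<beta> * u 1) - a 1 * u 1"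
    proof
    fix u assume u: "u \<in> W2 a"
    have "(LINT x|I01. a x * D u x * D \<zeta> x) = (LINT x|I01. c * D u x)"
    proof (intro Bochner_Integration.integral_cong refl)
      fix x assume "x \<in> space I01"
      then have "a x * D \<zeta> x = c" using z(2) by auto
      then show "a x * D u x * D \<zeta> x = c * D u x" by (simp add: mult_ac)
    qed
    also have "\<dots> = c * u 1" using u by (intro cD) (simp add: W2_def)
    finally have 1: "(LINT x|I01. wD (\<lambda>x. a x * D u x) x * \<zeta> x) = a 1 * D u 1 * \<zeta> 1 - c * u 1"
      using W2_test[OF u z(1)] by linarith
    have 2: "(LINT x|I01. \<zeta> x * wD (\<lambda>x. a x * D u x) x) = (LINT x|I01. wD (\<lambda>x. a x * D u x) x * \<zeta> x)"
      by (simp only: mult.commute)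
    show "(LINT x|I01. \<zeta> x * wD (\<lambda>x. a x * D u x) x) = \<zeta> 1 * a 1 * (D u 1 + \<beta> * u 1) - a 1 * u 1"
      unfolding 2 1 z(4) by (simp add: algebra_simps)
    qed
  qed (use z in auto)
qed

end

context degenerate_coefficient
begin

section \<open>The energy space as an inner product space up to \<open>eqH\<close>\<close>

lemma Hsp_iff: "U \<in> Hsp a \<longleftrightarrow> fst U \<in> W1 a \<and> L2 (snd U)"
  by (cases U) (auto simp: Hsp_def)

lemma Hsp_V1: "U \<in> Hsp a \<Longrightarrow> fst U \<in> V1 a"
  by (simp add: Hsp_iff W1_V1)

lemma Hsp_lincomb: "U \<in> Hsp a \<Longrightarrow> W \<in> Hsp a \<Longrightarrow> lincomb r U s W \<in> Hsp a"
  by (simp add: Hsp_iff lincomb_def W1_lincomb L2_lincomb)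

lemma eqH_D: "eqH U W \<Longrightarrow> x \<in> {0<..1} \<Longrightarrow> D (fst U) x = D (fst W) x"
  by (rule D_cong) (auto simp: eqH_def)

lemma flux_lincomb:
  assumes "u \<in> V1 a" "v \<in> V1 a" "w \<in> V1 a"
  shows "(LINT x|I01. a x * D (\<lambda>x. r * u x + s * v x) x * D w x) =
    r * (LINT x|I01. a x * D u x * D w x) + s * (LINT x|I01. a x * D v x * D w x)"
proof -
  note i = integrable_flux[OF assms(1,3)] integrable_flux[OF assms(2,3)]
  have "(LINT x|I01. a x * D (\<lambda>x. r * u x + s * v x) x * D w x) =
      (LINT x|I01. r * (a x * D u x * D w x) + s * (a x * D v x * D w x))"
  proof (rule integral_cong_AE)
    show "AE x in I01. a x * D (\<lambda>x. r * u x + s * v x) x * D w x = r * (a x * D u x * D w x) + s * (a x * D v x * D w x)"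
      using D_lincomb_AE[OF assms(1,2), of r s] by eventually_elim (simp add: algebra_simps)
  qed (use measurable_a V1_D_measurable[OF V1_lincomb[OF assms(1,2)]] V1_D_measurable[OF assms(1)]
      V1_D_measurable[OF assms(2)] V1_D_measurable[OF assms(3)] in simp_all)
  then show ?thesis using i by simp
qed

lemma L2_integral_lincomb:
  assumes "L2 f" "L2 g" "L2 h"
  shows "(LINT x|I01. (r * f x + s * g x) * h x) = r * (LINT x|I01. f x * h x) + s * (LINT x|I01. g x * h x)"
proof -
  have "(LINT x|I01. (r * f x + s * g x) * h x) = (LINT x|I01. r * (f x * h x) + s * (g x * h x))"
    by (intro Bochner_Integration.integral_cong) (auto simp: algebra_simps)
  then show ?thesis using L2_mult[OF assms(1,3)] L2_mult[OF assms(2,3)] by simp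
qed

end

context damped_wave
begin

abbreviation ip where "ip \<equiv> ipH a \<beta>"
abbreviation nH where "nH \<equiv> normH a \<beta>"

lemma ip_split:
  assumes "U \<in> Hsp a" "W \<in> Hsp a"
  shows "ip U W = (LINT x|I01. snd U x * snd W x) + (LINT x|I01. a x * D (fst U) x * D (fst W) x)
     + a 1 * \<beta> * fst U 1 * fst W 1"
  using L2_mult[of "snd U" "snd W"] integrable_flux[of "fst U" "fst W"] assms
  by (simp add: ipH_def Hsp_iff W1_V1)

lemma ip_commute: "ip U W = ip W U"
  by (simp add: ipH_def mult_ac)

lemma ip_lincomb:
  assumes "U \<in> Hsp a" "V \<in> Hsp a" "W \<in> Hsp a"
  shows "ip (lincomb r U s V) W = r * ip U W + s * ip V W"
proof -
  have L: "L2 (snd U)" "L2 (snd V)" "L2 (snd W)" using assms by (auto simp: Hsp_iff)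
  show ?thesis
    unfolding ip_split[OF Hsp_lincomb[OF assms(1,2)] assms(3)] ip_split[OF assms(1,3)] ip_split[OF assms(2,3)]
    unfolding lincomb_def fst_conv snd_conv L2_integral_lincomb[OF L] flux_lincomb[OF Hsp_V1[OF assms(1)] Hsp_V1[OF assms(2)] Hsp_V1[OF assms(3)]]
    by (simp add: algebra_simps)
qed

lemma ip_nonneg: "0 \<le> ip U U"
proof -
  have "AE x in I01. 0 \<le> snd U x * snd U x + a x * D (fst U) x * D (fst U) x"
    using I01_ae_pos by eventually_elim (simp add: mult.assoc)
  then show ?thesis unfolding ipH_def using a1_pos beta by (intro add_nonneg_nonneg integral_nonneg_AE) (auto simp: mult.assoc)
qed

lemma normH_square: "(nH U)\<^sup>2 = ip U U"
  using ip_nonneg by (simp add: normH_def)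

lemma normH_nonneg: "0 \<le> nH U"
  using ip_nonneg by (simp add: normH_def)

lemma ip_eqH:
  assumes "U \<in> Hsp a" "U' \<in> Hsp a" "W \<in> Hsp a" "W' \<in> Hsp a" "eqH U U'" "eqH W W'"
  shows "ip U W = ip U' W'"
proof -
  have "(LINT x|I01. snd U x * snd W x) = (LINT x|I01. snd U' x * snd W' x)"
  proof (rule integral_cong_AE)
    show "AE x in I01. snd U x * snd W x = snd U' x * snd W' x"
    proof -
      have "AE x in I01. snd U x = snd U' x" "AE x in I01. snd W x = snd W' x"
        using assms(5,6) by (auto simp: eqH_def)
      then show ?thesis by eventually_elim simp
    qed
  qed (use assms(1-4) in \<open>auto simp: Hsp_iff L2_def\<close>)
  moreover have "(LINT x|I01. a x * D (fst U) x * D (fst W) x) = (LINT x|I01. a x * D (fst U') x * D (fst W') x)"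
    using eqH_D[OF assms(5)] eqH_D[OF assms(6)] by (intro Bochner_Integration.integral_cong) auto
  moreover have "fst U 1 = fst U' 1" "fst W 1 = fst W' 1" using assms(5,6) by (auto simp: eqH_def)
  ultimately show ?thesis using assms by (simp add: ip_split)
qed

lemma ip_Cauchy_Schwarz:
  assumes "U \<in> Hsp a" "W \<in> Hsp a"
  shows "\<bar>ip U W\<bar> \<le> nH U * nH W"
proof -
  have "(ip U W)\<^sup>2 \<le> ip U U * ip W W"
  proof (rule quadratic_nonneg_discriminant[OF ip_nonneg])
    fix t
    note H = Hsp_lincomb[OF assms, of 1 t]
    have "0 \<le> ip (lincomb 1 U t W) (lincomb 1 U t W)" by (rule ip_nonneg)
    also have "\<dots> = 1 * ip (lincomb 1 U t W) U + t * ip (lincomb 1 U t W) W"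
      using ip_lincomb[OF assms H, of 1 t] ip_commute by metis
    also have "\<dots> = ip U U + 2 * t * ip U W + t\<^sup>2 * ip W W"
      unfolding ip_lincomb[OF assms assms(1)] ip_lincomb[OF assms assms(2)]
      using ip_commute[of W U] by (simp add: power2_eq_square algebra_simps)
    finally show "0 \<le> ip U U + 2 * t * ip U W + t\<^sup>2 * ip W W" .
  qed
  also have "\<dots> = (nH U * nH W)\<^sup>2" by (simp add: power_mult_distrib normH_square)
  finally show ?thesis using normH_nonneg by (simp add: abs_le_square_iff[symmetric])
qed

text \<open>What is needed to expand a quadratic quantity along an orbit: bilinearity, compatibility
  with \<open>eqH\<close>, and continuity in the energy norm. Symmetry is not demanded, as the
  multiplier form is not symmetric.\<close>

definition bounded_form :: "(state \<Rightarrow> state \<Rightarrow> real) \<Rightarrow> real \<Rightarrow> bool" where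
  "bounded_form b K \<longleftrightarrow>
     (\<forall>U\<in>Hsp a. \<forall>V\<in>Hsp a. \<forall>W\<in>Hsp a. \<forall>r s. b (lincomb r U s V) W = r * b U W + s * b V W) \<and>
     (\<forall>U\<in>Hsp a. \<forall>V\<in>Hsp a. \<forall>W\<in>Hsp a. \<forall>r s. b W (lincomb r U s V) = r * b W U + s * b W V) \<and>
     (\<forall>U\<in>Hsp a. \<forall>U'\<in>Hsp a. \<forall>W\<in>Hsp a. \<forall>W'\<in>Hsp a. eqH U U' \<longrightarrow> eqH W W' \<longrightarrow> b U W = b U' W') \<and>
     (\<forall>U\<in>Hsp a. \<forall>W\<in>Hsp a. \<bar>b U W\<bar> \<le> K * nH U * nH W)"

lemma bounded_form_ip: "bounded_form ip 1"
  unfolding bounded_form_def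
proof (intro conjI ballI allI impI)
  fix U V W r s assume H: "U \<in> Hsp a" "V \<in> Hsp a" "W \<in> Hsp a"
  show "ip (lincomb r U s V) W = r * ip U W + s * ip V W" by (rule ip_lincomb[OF H])
  then show "ip W (lincomb r U s V) = r * ip W U + s * ip W V" by (simp add: ip_commute)
qed (use ip_eqH ip_Cauchy_Schwarz in auto)

definition multiplier :: "real \<Rightarrow> (real \<Rightarrow> real) \<Rightarrow> state \<Rightarrow> real \<Rightarrow> real" where
  "multiplier \<eta> \<zeta> U x = x * D (fst U) x + (\<mu> / 4 * fst U x + \<eta> / 2 * fst U 1 * \<zeta> x)"

definition multiplier_form :: "real \<Rightarrow> (real \<Rightarrow> real) \<Rightarrow> state \<Rightarrow> state \<Rightarrow> real" where
  "multiplier_form \<eta> \<zeta> U W = (LINT x|I01. multiplier \<eta> \<zeta> U x * snd W x)"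

lemma L2_multiplier:
  assumes "U \<in> Hsp a" "L2 \<zeta>"
  shows "L2 (multiplier \<eta> \<zeta> U)"
proof -
  have "L2 (fst U)" using V1_D(1)[OF Hsp_V1[OF assms(1)]] .
  then have "L2 (\<lambda>x. 1 * (x * D (fst U) x) + 1 * (\<mu> / 4 * fst U x + \<eta> / 2 * fst U 1 * \<zeta> x))"
    using L2_x_D[OF Hsp_V1[OF assms(1)]] assms(2) by (intro L2_lincomb)
  then show ?thesis unfolding multiplier_def[abs_def] by simp
qed

lemma multiplier_form_split:
  assumes "U \<in> Hsp a" "W \<in> Hsp a" "L2 \<zeta>"
  shows "multiplier_form \<eta> \<zeta> U W = (LINT x|I01. (x * D (fst U) x) * snd W x)
    + \<mu> / 4 * (LINT x|I01. fst U x * snd W x) + \<eta> / 2 * fst U 1 * (LINT x|I01. \<zeta> x * snd W x)"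
proof -
  have W: "L2 (snd W)" using assms(2) by (simp add: Hsp_iff)
  note u = V1_D(1)[OF Hsp_V1[OF assms(1)]]
  have "multiplier_form \<eta> \<zeta> U W = (LINT x|I01. (x * D (fst U) x) * snd W x +
      (\<mu> / 4 * (fst U x * snd W x) + (\<eta> / 2 * fst U 1) * (\<zeta> x * snd W x)))"
    unfolding multiplier_form_def multiplier_def
    by (intro Bochner_Integration.integral_cong) (auto simp: algebra_simps)
  then show ?thesis
    using L2_mult[OF L2_x_D[OF Hsp_V1[OF assms(1)]] W] L2_mult[OF u W] L2_mult[OF assms(3) W] by simp
qed

lemma energy_parts:
  assumes "U \<in> Hsp a"
  shows "ip U U = (LINT x|I01. (snd U x)\<^sup>2) + (LINT x|I01. a x * D (fst U) x * D (fst U) x) + \<beta> * a 1 * (fst U 1)\<^sup>2"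
  using ip_split[OF assms assms] by (simp add: power2_eq_square mult_ac)

text \<open>Continuity of the form in the energy norm; the bound enters only a remainder that tends
  to 0 with the time step. The sharp diagonal estimate that determines the constants is
  separate.\<close>

lemma multiplier_form_bounded:
  assumes z: "L2 \<zeta>"
  obtains K where "bounded_form (multiplier_form \<eta> \<zeta>) K"
proof -
  define Z where "Z = (LINT x|I01. (\<zeta> x)\<^sup>2)"
  have Z: "Z \<ge> 0" by (simp add: Z_def)
  define K where "K = 3 * (1 / a 1) + 3 * (\<mu> / 4)\<^sup>2 / alpha a \<beta> + 3 * (\<eta> / 2)\<^sup>2 * Z / (\<beta> * a 1)"
  have "K \<ge> 0" unfolding K_def using a1_pos alpha_pos beta Z by (intro add_nonneg_nonneg) auto
  have bound: "(LINT x|I01. (multiplier \<eta> \<zeta> U x)\<^sup>2) \<le> K * ip U U" if U: "U \<in> Hsp a" for U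
  proof -
    note uV = Hsp_V1[OF U]
    note u = V1_D(1)[OF uV]
    let ?Q = "LINT x|I01. a x * D (fst U) x * D (fst U) x"
    have i: "integrable I01 (\<lambda>x. (x * D (fst U) x)\<^sup>2)" "integrable I01 (\<lambda>x. (fst U x)\<^sup>2)" "integrable I01 (\<lambda>x. (\<zeta> x)\<^sup>2)"
      using L2_x_D[OF uV] u z by (auto simp: L2_def)
    have "(LINT x|I01. (multiplier \<eta> \<zeta> U x)\<^sup>2) \<le>
        (LINT x|I01. 3 * (x * D (fst U) x)\<^sup>2 + (3 * (\<mu> / 4)\<^sup>2 * (fst U x)\<^sup>2 + 3 * (\<eta> / 2 * fst U 1)\<^sup>2 * (\<zeta> x)\<^sup>2))"
    proof (rule integral_mono)
      show "integrable I01 (\<lambda>x. (multiplier \<eta> \<zeta> U x)\<^sup>2)" using L2_multiplier[OF U z] by (simp add: L2_def)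
      show "integrable I01 (\<lambda>x. 3 * (x * D (fst U) x)\<^sup>2 + (3 * (\<mu> / 4)\<^sup>2 * (fst U x)\<^sup>2 + 3 * (\<eta> / 2 * fst U 1)\<^sup>2 * (\<zeta> x)\<^sup>2))"
        by (intro Bochner_Integration.integrable_add integrable_mult_right i)
      fix x
      have sq: "(p + (q + r))\<^sup>2 \<le> 3 * p\<^sup>2 + (3 * q\<^sup>2 + 3 * r\<^sup>2)" for p q r :: real
      proof -
        have "0 \<le> (p - q)\<^sup>2 + (q - r)\<^sup>2 + (p - r)\<^sup>2" by simp
        then show ?thesis by (simp add: power2_eq_square algebra_simps)
      qed
      show "(multiplier \<eta> \<zeta> U x)\<^sup>2 \<le> 3 * (x * D (fst U) x)\<^sup>2 + (3 * (\<mu> / 4)\<^sup>2 * (fst U x)\<^sup>2 + 3 * (\<eta> / 2 * fst U 1)\<^sup>2 * (\<zeta> x)\<^sup>2)"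
        using sq[of "x * D (fst U) x" "\<mu> / 4 * fst U x" "\<eta> / 2 * fst U 1 * \<zeta> x"]
        unfolding multiplier_def by (simp only: power_mult_distrib mult.assoc)
    qed
    also have "\<dots> = 3 * (LINT x|I01. (x * D (fst U) x)\<^sup>2) + (3 * (\<mu> / 4)\<^sup>2 * (LINT x|I01. (fst U x)\<^sup>2) + 3 * (\<eta> / 2 * fst U 1)\<^sup>2 * Z)"
      using i unfolding Z_def by simp
    also have "\<dots> \<le> 3 * (1 / a 1) * ip U U + (3 * (\<mu> / 4)\<^sup>2 * (ip U U / alpha a \<beta>) + 3 * (\<eta> / 2)\<^sup>2 * Z * (ip U U / (\<beta> * a 1)))"
    proof (intro add_mono)
      have P: "0 \<le> (LINT x|I01. (snd U x)\<^sup>2)" by simp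
      have u1: "0 \<le> \<beta> * a 1 * (fst U 1)\<^sup>2" using beta a1_pos by simp
      have e: "?Q \<le> ip U U" "\<beta> * a 1 * (fst U 1)\<^sup>2 \<le> ip U U" "?Q + \<beta> * a 1 * (fst U 1)\<^sup>2 \<le> ip U U"
        unfolding energy_parts[OF U] using P u1 flux_nonneg[of "fst U"] by linarith+
      have "(LINT x|I01. (x * D (fst U) x)\<^sup>2) \<le> ?Q / a 1" by (rule x_D_norm_le[OF uV])
      also have "\<dots> \<le> ip U U / a 1" using e a1_pos by (intro divide_right_mono) auto
      finally show "3 * (LINT x|I01. (x * D (fst U) x)\<^sup>2) \<le> 3 * (1 / a 1) * ip U U" by simp
      have "alpha a \<beta> * (LINT x|I01. (fst U x)\<^sup>2) \<le> ip U U" using L2_le_energy[OF uV] e by linarith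
      then have "(LINT x|I01. (fst U x)\<^sup>2) \<le> ip U U / alpha a \<beta>" using alpha_pos by (simp add: pos_le_divide_eq mult.commute)
      then show "3 * (\<mu> / 4)\<^sup>2 * (LINT x|I01. (fst U x)\<^sup>2) \<le> 3 * (\<mu> / 4)\<^sup>2 * (ip U U / alpha a \<beta>)"
        by (intro mult_left_mono) auto
      have "(fst U 1)\<^sup>2 \<le> ip U U / (\<beta> * a 1)" using e beta a1_pos by (simp add: pos_le_divide_eq mult.commute)
      then have "3 * (\<eta> / 2)\<^sup>2 * Z * (fst U 1)\<^sup>2 \<le> 3 * (\<eta> / 2)\<^sup>2 * Z * (ip U U / (\<beta> * a 1))"
        using Z by (intro mult_left_mono) auto
      then show "3 * (\<eta> / 2 * fst U 1)\<^sup>2 * Z \<le> 3 * (\<eta> / 2)\<^sup>2 * Z * (ip U U / (\<beta> * a 1))"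
        by (simp only: power_mult_distrib mult_ac)
    qed
    also have "\<dots> = K * ip U U" by (simp add: K_def algebra_simps)
    finally show ?thesis .
  qed
  show ?thesis
  proof (rule that[of "sqrt K"], unfold bounded_form_def, intro conjI ballI allI impI)
    fix U V W r s assume H: "U \<in> Hsp a" "V \<in> Hsp a" "W \<in> Hsp a"
    have L: "L2 (snd U)" "L2 (snd V)" "L2 (snd W)" using H by (auto simp: Hsp_iff)
    show "multiplier_form \<eta> \<zeta> W (lincomb r U s V) = r * multiplier_form \<eta> \<zeta> W U + s * multiplier_form \<eta> \<zeta> W V"
      unfolding multiplier_form_def lincomb_def snd_conv
      using L2_integral_lincomb[OF L(1,2) L2_multiplier[OF H(3) z, of \<eta>], of r s] by (simp add: mult.commute)
    have "multiplier_form \<eta> \<zeta> (lincomb r U s V) W =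
        (LINT x|I01. (r * multiplier \<eta> \<zeta> U x + s * multiplier \<eta> \<zeta> V x) * snd W x)"
      unfolding multiplier_form_def
    proof (rule integral_cong_AE)
      show "(\<lambda>x. multiplier \<eta> \<zeta> (lincomb r U s V) x * snd W x) \<in> borel_measurable I01"
        using L2_multiplier[OF Hsp_lincomb[OF H(1,2), of r s] z] L(3) by (intro borel_measurable_times L2_measurable)
      show "(\<lambda>x. (r * multiplier \<eta> \<zeta> U x + s * multiplier \<eta> \<zeta> V x) * snd W x) \<in> borel_measurable I01"
        using L2_lincomb[OF L2_multiplier[OF H(1) z] L2_multiplier[OF H(2) z]] L(3) by (intro borel_measurable_times L2_measurable)
      show "AE x in I01. multiplier \<eta> \<zeta> (lincomb r U s V) x * snd W x = (r * multiplier \<eta> \<zeta> U x + s * multiplier \<eta> \<zeta> V x) * snd W x"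
        using D_lincomb_AE[OF Hsp_V1[OF H(1)] Hsp_V1[OF H(2)], of r s]
        by eventually_elim (simp add: multiplier_def lincomb_def algebra_simps)
    qed
    then show "multiplier_form \<eta> \<zeta> (lincomb r U s V) W = r * multiplier_form \<eta> \<zeta> U W + s * multiplier_form \<eta> \<zeta> V W"
      using L2_integral_lincomb[OF L2_multiplier[OF H(1) z] L2_multiplier[OF H(2) z] L(3)] by (simp add: multiplier_form_def)
  next
    fix U U' W W' assume H: "U \<in> Hsp a" "U' \<in> Hsp a" "W \<in> Hsp a" "W' \<in> Hsp a" and e: "eqH U U'" "eqH W W'"
    have L: "L2 (snd W)" "L2 (snd W')" using H by (auto simp: Hsp_iff)
    show "multiplier_form \<eta> \<zeta> U W = multiplier_form \<eta> \<zeta> U' W'"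
      unfolding multiplier_form_def
    proof (rule integral_cong_AE)
      have "AE x in I01. x \<in> {0<..1}" by (rule AE_I2) auto
      moreover have "AE x in I01. snd W x = snd W' x" using e(2) by (simp add: eqH_def)
      ultimately show "AE x in I01. multiplier \<eta> \<zeta> U x * snd W x = multiplier \<eta> \<zeta> U' x * snd W' x"
      proof eventually_elim
        case (elim x)
        then show ?case using eqH_D[OF e(1), of x] e(1) by (simp add: multiplier_def eqH_def)
      qed
    qed (intro borel_measurable_times L2_measurable[OF L2_multiplier[OF _ z]] L2_measurable[OF L(1)] L2_measurable[OF L(2)] H)+
  next
    fix U W assume H: "U \<in> Hsp a" "W \<in> Hsp a"
    have L: "L2 (snd W)" using H by (auto simp: Hsp_iff)
    have "(multiplier_form \<eta> \<zeta> U W)\<^sup>2 \<le> (LINT x|I01. (multiplier \<eta> \<zeta> U x)\<^sup>2) * (LINT x|I01. (snd W x)\<^sup>2)"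
      unfolding multiplier_form_def by (rule L2_Cauchy_Schwarz[OF L2_multiplier[OF H(1) z] L])
    also have "\<dots> \<le> (K * ip U U) * ip W W"
    proof (intro mult_mono bound H)
      have u1: "0 \<le> \<beta> * a 1 * (fst W 1)\<^sup>2" using beta a1_pos by simp
      show "(LINT x|I01. (snd W x)\<^sup>2) \<le> ip W W" unfolding energy_parts[OF H(2)] using u1 flux_nonneg[of "fst W"] by linarith
    qed (use \<open>K \<ge> 0\<close> ip_nonneg in auto)
    also have "\<dots> = (sqrt K * nH U * nH W)\<^sup>2" using \<open>K \<ge> 0\<close> by (simp add: power_mult_distrib normH_square)
    finally show "\<bar>multiplier_form \<eta> \<zeta> U W\<bar> \<le> sqrt K * nH U * nH W"
      using normH_nonneg \<open>K \<ge> 0\<close> by (simp add: abs_le_square_iff[symmetric])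
  qed
qed

section \<open>Dissipation and the multiplier inequality on the operator domain\<close>

lemma domA_iff: "U \<in> domA a \<beta> \<longleftrightarrow> fst U \<in> W2 a \<and> snd U \<in> W1 a \<and> D (fst U) 1 + snd U 1 + \<beta> * fst U 1 = 0"
  by (cases U) (auto simp: domA_def)

lemma domA_Hsp: "U \<in> domA a \<beta> \<Longrightarrow> U \<in> Hsp a"
  using V1_D(1)[OF W1_V1] by (auto simp: domA_iff Hsp_iff W2_def)

lemma opA_Hsp: "U \<in> domA a \<beta> \<Longrightarrow> opA a U \<in> Hsp a"
  by (auto simp: domA_iff Hsp_iff opA_def intro: W2_L2)

text \<open>Green's formula leaves \<open>a(1) u'(1) v(1)\<close>. Inserting the boundary condition
  cancels the \<open>\<beta>\<close>-term of the scalar product.\<close>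

lemma dissipation:
  assumes U: "U \<in> domA a \<beta>"
  shows "ip U (opA a U) = - a 1 * (snd U 1)\<^sup>2"
proof -
  let ?u = "fst U" and ?v = "snd U"
  have u: "?u \<in> W2 a" "?v \<in> W1 a" and bc: "D ?u 1 = - ?v 1 - \<beta> * ?u 1" using U by (auto simp: domA_iff)
  have "ip U (opA a U) = (LINT x|I01. ?v x * wD (\<lambda>x. a x * D ?u x) x) + (LINT x|I01. a x * D ?u x * D ?v x)
      + a 1 * \<beta> * ?u 1 * ?v 1"
    using ip_split[OF domA_Hsp[OF U] opA_Hsp[OF U]] by (simp add: opA_def)
  also have "(LINT x|I01. ?v x * wD (\<lambda>x. a x * D ?u x) x) = (LINT x|I01. wD (\<lambda>x. a x * D ?u x) x * ?v x)"
    by (simp only: mult.commute)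
  also have "\<dots> + (LINT x|I01. a x * D ?u x * D ?v x) = a 1 * D ?u 1 * ?v 1" by (rule W2_test[OF u])
  finally show ?thesis by (simp add: bc power2_eq_square algebra_simps)
qed

text \<open>The product of the two brackets in \<open>M\<close>. It exceeds
  \<open>1/(\<beta> alpha) + 1/\<beta>^3\<close>, the sum that the estimate of the cross terms
  actually produces.\<close>

definition "damping_factor = (1 + 1 / \<beta>^3) * (1 + 1 / (\<beta> * alpha a \<beta>))"

text \<open>Cauchy-Schwarz in the plane: the sum of the roots of \<open>s P\<close> and
  \<open>t r\<close> is at most the root of \<open>(s + t) (P + r)\<close>.\<close>

lemma square_sum_le:
  fixes z B s t P r A :: real
  assumes "z\<^sup>2 \<le> A * s * P" "B\<^sup>2 = A * t * r" "0 \<le> A" "0 \<le> s" "0 \<le> t" "0 \<le> P" "0 \<le> r"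
  shows "(\<bar>z\<bar> + B)\<^sup>2 \<le> A * (s + t) * (P + r)"
proof -
  have "(2 * (\<bar>z\<bar> * B))\<^sup>2 = 4 * (z\<^sup>2 * B\<^sup>2)" by (simp add: power_mult_distrib)
  also have "\<dots> \<le> 4 * ((A * s * P) * (A * t * r))"
    unfolding assms(2) using assms by (intro mult_left_mono mult_right_mono) auto
  also have "\<dots> = 4 * (A * (s * r)) * (A * (t * P))" by (simp add: algebra_simps)
  also have "\<dots> \<le> (A * (s * r) + A * (t * P))\<^sup>2"
  proof -
    have "0 \<le> (A * (s * r) - A * (t * P))\<^sup>2" by simp
    then show ?thesis by (simp add: power2_eq_square algebra_simps)
  qed
  finally have "2 * (\<bar>z\<bar> * B) \<le> A * (s * r) + A * (t * P)"
    by (rule power2_le_imp_le) (use assms in auto)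
  then show ?thesis using assms(1,2) by (simp add: power2_sum algebra_simps)
qed

text \<open>The left-hand side is the formal time derivative of the form. The part
  \<open>x u_x\<close> contributes \<open>-(1 - \<mu>)/2\<close> times the elastic and
  \<open>-1/2\<close> times the kinetic integral; adding \<open>\<mu>/4 u\<close> shifts both
  coefficients to \<open>-(2 - \<mu>)/4\<close>. \<open>R\<close> collects the factors of
  \<open>v(1)\<close> created by the profile. It is kept unevaluated, since the case
  \<open>\<eta> = 0\<close> does without Young's inequality.\<close>

lemma Lyapunov_inequality:
  assumes z: "\<zeta> \<in> W1 a" "0 \<le> \<zeta> 1" "\<zeta> 1 \<le> 1 / \<beta>"
    "(LINT x|I01. (\<zeta> x)\<^sup>2) \<le> a 1 / (alpha a \<beta> * \<beta>)"
    "\<forall>u\<in>W2 a. (LINT x|I01. \<zeta> x * wD (\<lambda>x. a x * D u x) x) =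
        \<zeta> 1 * a 1 * (D u 1 + \<beta> * u 1) - a 1 * u 1"
    and \<eta>: "\<eta> \<ge> 0" and U: "U \<in> domA a \<beta>"
  shows "\<exists>R\<ge>0. R\<^sup>2 \<le> a 1 * damping_factor * ip U U \<and>
    multiplier_form \<eta> \<zeta> U (opA a U) + multiplier_form \<eta> \<zeta> (opA a U) U \<le>
      - (2 - \<mu>) / 4 * ip U U + eta1 a / 2 * (snd U 1)\<^sup>2
      + a 1 * (eta2 a \<beta> - \<eta>) / 2 * (fst U 1)\<^sup>2 + \<eta> / 2 * \<bar>snd U 1\<bar> * R"
proof -
  let ?u = "fst U" and ?v = "snd U" and ?g = "wD (\<lambda>x. a x * D (fst U) x)"
  have u: "?u \<in> W2 a" "?v \<in> W1 a" and bc: "D ?u 1 = - ?v 1 - \<beta> * ?u 1" using U by (auto simp: domA_iff)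
  have H: "U \<in> Hsp a" "opA a U \<in> Hsp a" using domA_Hsp[OF U] opA_Hsp[OF U] .
  have uW: "?u \<in> W1 a" using u(1) by (simp add: W2_def)
  have zL: "L2 \<zeta>" and vL: "L2 ?v" using V1_D(1)[OF W1_V1] z(1) u(2) by auto
  define P where "P = (LINT x|I01. (?v x)\<^sup>2)"
  define Q where "Q = (LINT x|I01. a x * D ?u x * D ?u x)"
  define Z where "Z = (LINT x|I01. \<zeta> x * ?v x)"
  have P: "P \<ge> 0" by (simp add: P_def)
  have Q: "Q \<ge> 0" unfolding Q_def by (rule flux_nonneg)
  have ipU: "ip U U = P + Q + \<beta> * a 1 * (?u 1)\<^sup>2" unfolding P_def Q_def by (rule energy_parts[OF H(1)])
  have I1: "(LINT x|I01. (x * D ?u x) * ?g x) \<le> a 1 * (D ?u 1)\<^sup>2 / 2 - (1 - \<mu>) / 2 * Q"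
    unfolding Q_def by (rule W2_multiplier[OF u(1)])
  have I2: "(LINT x|I01. ?u x * ?g x) = a 1 * D ?u 1 * ?u 1 - Q"
  proof -
    have "(LINT x|I01. ?u x * ?g x) = (LINT x|I01. ?g x * ?u x)" by (simp only: mult.commute)
    then show ?thesis using W2_test[OF u(1) uW] unfolding Q_def by linarith
  qed
  have I3: "(LINT x|I01. \<zeta> x * ?g x) = \<zeta> 1 * a 1 * (D ?u 1 + \<beta> * ?u 1) - a 1 * ?u 1"
    using z(5) u(1) by blast
  have I4: "(LINT x|I01. (x * D ?v x) * ?v x) = (?v 1)\<^sup>2 / 2 - P / 2"
    unfolding P_def by (rule integral_x_D_self[OF W1_V1[OF u(2)]])
  have I5: "(LINT x|I01. ?v x * ?v x) = P" by (simp add: P_def power2_eq_square)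
  have F1: "multiplier_form \<eta> \<zeta> U (opA a U) = (LINT x|I01. (x * D ?u x) * ?g x)
    + \<mu> / 4 * (a 1 * D ?u 1 * ?u 1 - Q) + \<eta> / 2 * ?u 1 * (\<zeta> 1 * a 1 * (D ?u 1 + \<beta> * ?u 1) - a 1 * ?u 1)"
    using multiplier_form_split[OF H zL, of \<eta>] I2 I3 by (simp add: opA_def)
  have F2: "multiplier_form \<eta> \<zeta> (opA a U) U = (?v 1)\<^sup>2 / 2 - P / 2 + \<mu> / 4 * P + \<eta> / 2 * ?v 1 * Z"
    using multiplier_form_split[OF H(2,1) zL, of \<eta>] I4 I5 by (simp add: opA_def Z_def)
  define J where "J = (LINT x|I01. (x * D ?u x) * ?g x)"
  \<comment> \<open>Two products with \<open>v(1)\<close>: the pairing of the profile with the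
    velocity, and the term \<open>\<zeta>(1) a(1) u(1) v(1)\<close>, where
    \<open>\<zeta>(1) \<le> 1/\<beta>\<close>.\<close>
  define R where "R = \<bar>Z\<bar> + a 1 / \<beta> * \<bar>?u 1\<bar>"
  have R0: "R \<ge> 0" using a1_pos beta by (simp add: R_def)
  have Z2: "Z\<^sup>2 \<le> a 1 * (1 / (\<beta> * alpha a \<beta>)) * P"
  proof -
    have "Z\<^sup>2 \<le> (LINT x|I01. (\<zeta> x)\<^sup>2) * P" unfolding Z_def P_def by (rule L2_Cauchy_Schwarz[OF zL vL])
    also have "\<dots> \<le> a 1 / (alpha a \<beta> * \<beta>) * P" using z(4) P by (intro mult_right_mono)
    finally show ?thesis by (simp add: mult.commute)
  qed
  have "R\<^sup>2 \<le> a 1 * (1 / (\<beta> * alpha a \<beta>) + 1 / \<beta>^3) * (P + \<beta> * a 1 * (?u 1)\<^sup>2)"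
    unfolding R_def
  proof (rule square_sum_le[OF Z2])
    show "(a 1 / \<beta> * \<bar>?u 1\<bar>)\<^sup>2 = a 1 * (1 / \<beta>^3) * (\<beta> * a 1 * (?u 1)\<^sup>2)"
      using beta by (simp add: power2_eq_square power3_eq_cube field_simps)
  qed (use a1_pos beta alpha_pos P in auto)
  also have "\<dots> \<le> a 1 * damping_factor * ip U U"
  proof (intro mult_mono)
    have "0 \<le> 1 / \<beta>^3 * (1 / (\<beta> * alpha a \<beta>))" using beta alpha_pos by simp
    moreover have "damping_factor = 1 + 1 / \<beta>^3 + 1 / (\<beta> * alpha a \<beta>) + 1 / \<beta>^3 * (1 / (\<beta> * alpha a \<beta>))"
      unfolding damping_factor_def by (simp add: algebra_simps)
    ultimately show "1 / (\<beta> * alpha a \<beta>) + 1 / \<beta>^3 \<le> damping_factor" by linarith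
    show "P + \<beta> * a 1 * (?u 1)\<^sup>2 \<le> ip U U" unfolding ipU using Q by simp
    show "0 \<le> a 1 * damping_factor" unfolding damping_factor_def using a1_pos beta alpha_pos by (intro mult_nonneg_nonneg add_nonneg_nonneg) auto
    have "0 \<le> 1 / (\<beta> * alpha a \<beta>) + 1 / \<beta>^3" using beta alpha_pos by simp
    then show "0 \<le> P + \<beta> * a 1 * (?u 1)\<^sup>2" using a1_pos beta P by simp
  qed (use a1_pos beta alpha_pos in auto)
  finally have R2: "R\<^sup>2 \<le> a 1 * damping_factor * ip U U" .
  have cross: "?v 1 * Z - \<zeta> 1 * a 1 * ?u 1 * ?v 1 \<le> \<bar>?v 1\<bar> * R"
  proof -
    have "?v 1 * Z \<le> \<bar>?v 1\<bar> * \<bar>Z\<bar>" using abs_ge_self[of "?v 1 * Z"] by (simp add: abs_mult)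
    moreover have "- (\<zeta> 1 * a 1 * ?u 1 * ?v 1) \<le> \<bar>?v 1\<bar> * (a 1 / \<beta> * \<bar>?u 1\<bar>)"
    proof -
      have "- (\<zeta> 1 * a 1 * ?u 1 * ?v 1) \<le> \<bar>\<zeta> 1 * a 1 * ?u 1 * ?v 1\<bar>" by (rule abs_ge_minus_self)
      also have "\<dots> = \<zeta> 1 * (a 1 * \<bar>?u 1\<bar> * \<bar>?v 1\<bar>)" using z(2) a1_pos by (simp add: abs_mult)
      also have "\<dots> \<le> 1 / \<beta> * (a 1 * \<bar>?u 1\<bar> * \<bar>?v 1\<bar>)" using z(3) a1_pos by (intro mult_right_mono) auto
      finally show ?thesis by (simp add: mult_ac)
    qed
    ultimately show ?thesis unfolding R_def by (simp add: distrib_left)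
  qed
  \<comment> \<open>Origin of \<open>eta1\<close> and \<open>eta2\<close>: after inserting the
    boundary condition, the mixed term \<open>a(1)/2 (2 \<beta> - \<mu>/2) u(1) v(1)\<close> is
    split by completing the square.\<close>
  have key: "a 1 * (D ?u 1)\<^sup>2 / 2 + \<mu> / 4 * (a 1 * D ?u 1 * ?u 1) + (?v 1)\<^sup>2 / 2 + (2 - \<mu>) / 4 * (\<beta> * a 1 * (?u 1)\<^sup>2)
      \<le> eta1 a / 2 * (?v 1)\<^sup>2 + a 1 * eta2 a \<beta> / 2 * (?u 1)\<^sup>2"
  proof -
    have "0 \<le> a 1 / 4 * (?v 1 - (2 * \<beta> - \<mu> / 2) * ?u 1)\<^sup>2" using a1_pos by simp
    also have "\<dots> = eta1 a / 2 * (?v 1)\<^sup>2 + a 1 * eta2 a \<beta> / 2 * (?u 1)\<^sup>2 -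
        (a 1 * (D ?u 1)\<^sup>2 / 2 + \<mu> / 4 * (a 1 * D ?u 1 * ?u 1) + (?v 1)\<^sup>2 / 2 + (2 - \<mu>) / 4 * (\<beta> * a 1 * (?u 1)\<^sup>2))"
      unfolding bc eta1_def eta2_def by (simp add: power2_eq_square field_simps)
    finally show ?thesis by simp
  qed
  have "multiplier_form \<eta> \<zeta> U (opA a U) + multiplier_form \<eta> \<zeta> (opA a U) U \<le>
      (a 1 * (D ?u 1)\<^sup>2 / 2 + \<mu> / 4 * (a 1 * D ?u 1 * ?u 1) + (?v 1)\<^sup>2 / 2) - (2 - \<mu>) / 4 * (P + Q)
      - \<eta> / 2 * (a 1 * (?u 1)\<^sup>2) + \<eta> / 2 * (?v 1 * Z - \<zeta> 1 * a 1 * ?u 1 * ?v 1)"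
  proof -
    have "(a 1 * (D ?u 1)\<^sup>2 / 2 + \<mu> / 4 * (a 1 * D ?u 1 * ?u 1) + (?v 1)\<^sup>2 / 2) - (2 - \<mu>) / 4 * (P + Q)
        - \<eta> / 2 * (a 1 * (?u 1)\<^sup>2) + \<eta> / 2 * (?v 1 * Z - \<zeta> 1 * a 1 * ?u 1 * ?v 1)
      = (a 1 * (D ?u 1)\<^sup>2 / 2 - (1 - \<mu>) / 2 * Q) - J
        + (multiplier_form \<eta> \<zeta> U (opA a U) + multiplier_form \<eta> \<zeta> (opA a U) U)"
      unfolding F1 F2 J_def[symmetric] bc by (simp add: power2_eq_square field_simps)
    then show ?thesis using I1 unfolding J_def by linarith
  qed
  also have "\<dots> \<le> (eta1 a / 2 * (?v 1)\<^sup>2 + a 1 * eta2 a \<beta> / 2 * (?u 1)\<^sup>2 - (2 - \<mu>) / 4 * (\<beta> * a 1 * (?u 1)\<^sup>2))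
      - (2 - \<mu>) / 4 * (P + Q) - \<eta> / 2 * (a 1 * (?u 1)\<^sup>2) + \<eta> / 2 * (\<bar>?v 1\<bar> * R)"
    using key mult_left_mono[OF cross, of "\<eta> / 2"] \<eta> by linarith
  also have "\<dots> = - (2 - \<mu>) / 4 * ip U U + eta1 a / 2 * (?v 1)\<^sup>2
      + a 1 * (eta2 a \<beta> - \<eta>) / 2 * (?u 1)\<^sup>2 + \<eta> / 2 * \<bar>?v 1\<bar> * R"
    unfolding ipU by (simp add: field_simps)
  finally show ?thesis using R0 R2 by blast
qed

text \<open>The three entries of the maximum in \<open>C2\<close> are the coefficients of kinetic
  energy, elastic energy and boundary energy once the Poincare inequality has been inserted for the
  term \<open>\<mu>/4 u\<close>.\<close>

lemma multiplier_form_energy_bound: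
  assumes z: "L2 \<zeta>" "(LINT x|I01. (\<zeta> x)\<^sup>2) \<le> a 1 / (alpha a \<beta> * \<beta>)"
    and \<eta>: "\<eta> \<ge> 0" and U: "U \<in> Hsp a"
  shows "\<bar>multiplier_form \<eta> \<zeta> U U\<bar> \<le> (C2 a \<beta> / 2 + \<eta> / (2 * \<beta> * sqrt (alpha a \<beta>))) * (ip U U / 2)"
proof -
  let ?u = "fst U" and ?v = "snd U"
  note uV = Hsp_V1[OF U]
  note uL = V1_D(1)[OF uV]
  have vL: "L2 ?v" using U by (simp add: Hsp_iff)
  define P where "P = (LINT x|I01. (?v x)\<^sup>2)"
  define Q where "Q = (LINT x|I01. a x * D ?u x * D ?u x)"
  define N where "N = (LINT x|I01. (?u x)\<^sup>2)"
  define r where "r = \<beta> * a 1 * (?u 1)\<^sup>2"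
  define Z where "Z = (LINT x|I01. \<zeta> x * ?v x)"
  have nn: "P \<ge> 0" "Q \<ge> 0" "r \<ge> 0" unfolding P_def Q_def r_def using flux_nonneg beta a1_pos by auto
  have ipU: "ip U U = P + Q + r" unfolding P_def Q_def r_def by (rule energy_parts[OF U])
  have young: "\<bar>LINT x|I01. f x * h x\<bar> \<le> (LINT x|I01. (f x)\<^sup>2) / 2 + (LINT x|I01. (h x)\<^sup>2) / 2" if "L2 f" "L2 h" for f h
  proof -
    have i: "integrable I01 (\<lambda>x. (f x)\<^sup>2)" "integrable I01 (\<lambda>x. (h x)\<^sup>2)" using that by (auto simp: L2_def)
    have "\<bar>LINT x|I01. f x * h x\<bar> \<le> (LINT x|I01. \<bar>f x * h x\<bar>)" by (rule integral_abs_bound)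
    also have "\<dots> \<le> (LINT x|I01. (f x)\<^sup>2 / 2 + (h x)\<^sup>2 / 2)"
    proof (rule integral_mono)
      show "integrable I01 (\<lambda>x. \<bar>f x * h x\<bar>)" using L2_mult[OF that] by simp
      fix x
      have "0 \<le> (\<bar>f x\<bar> - \<bar>h x\<bar>)\<^sup>2" by simp
      then show "\<bar>f x * h x\<bar> \<le> (f x)\<^sup>2 / 2 + (h x)\<^sup>2 / 2" by (simp add: power2_diff abs_mult)
    qed (use i in auto)
    finally show ?thesis using i by simp
  qed
  have B1: "\<bar>LINT x|I01. (x * D ?u x) * ?v x\<bar> \<le> Q / a 1 / 2 + P / 2"
    unfolding P_def Q_def
    by (rule order_trans[OF young[OF L2_x_D[OF uV] vL] add_right_mono[OF divide_right_mono[OF x_D_norm_le[OF uV]]]]) simp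
  have N: "N \<le> 2 * (?u 1)\<^sup>2 + C1 a * Q" unfolding N_def Q_def by (rule Poincare[OF uV])
  have B2: "\<bar>LINT x|I01. ?u x * ?v x\<bar> \<le> N / 2 + P / 2" unfolding N_def P_def by (rule young[OF uL vL])
  \<comment> \<open>By the L2 bound of the profile, the squared product is a multiple of
    \<open>r * P\<close>, and \<open>r * P\<close> is at most the square of half the energy norm
    squared.\<close>
  have B3: "\<bar>?u 1\<bar> * \<bar>Z\<bar> \<le> 1 / (\<beta> * sqrt (alpha a \<beta>)) * (ip U U / 2)"
  proof (rule power2_le_imp_le)
    have "Z\<^sup>2 \<le> (LINT x|I01. (\<zeta> x)\<^sup>2) * P" unfolding Z_def P_def by (rule L2_Cauchy_Schwarz[OF z(1) vL])
    also have "\<dots> \<le> a 1 / (alpha a \<beta> * \<beta>) * P" using z(2) nn(1) by (intro mult_right_mono)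
    finally have "(?u 1)\<^sup>2 * Z\<^sup>2 \<le> (?u 1)\<^sup>2 * (a 1 / (alpha a \<beta> * \<beta>) * P)" by (intro mult_left_mono) auto
    also have "\<dots> = 1 / (\<beta>\<^sup>2 * alpha a \<beta>) * (r * P)" using beta unfolding r_def by (simp add: power2_eq_square field_simps)
    also have "\<dots> \<le> 1 / (\<beta>\<^sup>2 * alpha a \<beta>) * (ip U U / 2)\<^sup>2"
    proof (intro mult_left_mono)
      have "0 \<le> (r - P)\<^sup>2" by simp
      then have "r * P \<le> ((P + r) / 2)\<^sup>2" by (simp add: power2_eq_square field_simps)
      also have "\<dots> \<le> (ip U U / 2)\<^sup>2" unfolding ipU using nn by (intro power_mono) auto
      finally show "r * P \<le> (ip U U / 2)\<^sup>2" .
    qed (use alpha_pos in auto)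
    finally show "(\<bar>?u 1\<bar> * \<bar>Z\<bar>)\<^sup>2 \<le> (1 / (\<beta> * sqrt (alpha a \<beta>)) * (ip U U / 2))\<^sup>2"
      using alpha_pos by (simp add: power_mult_distrib power_divide)
    show "0 \<le> 1 / (\<beta> * sqrt (alpha a \<beta>)) * (ip U U / 2)" using beta alpha_pos ip_nonneg by simp
  qed
  define X where "X = C2 a \<beta> / 2"
  have X: "1 + \<mu> / 4 \<le> X" "1 / a 1 + \<mu> / 4 * C1 a \<le> X" "\<mu> / (2 * \<beta> * a 1) \<le> X"
    unfolding X_def C2_def by (auto intro: Max_ge)
  have main: "(Q / a 1 / 2 + P / 2) + \<mu> / 4 * (N / 2 + P / 2) \<le> X * (ip U U / 2)"
  proof -
    have "(Q / a 1 / 2 + P / 2) + \<mu> / 4 * (N / 2 + P / 2) \<le> (Q / a 1 / 2 + P / 2) + \<mu> / 4 * ((2 * (?u 1)\<^sup>2 + C1 a * Q) / 2 + P / 2)"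
      using N mu_nonneg by (intro add_left_mono mult_left_mono) auto
    also have "\<dots> = ((1 + \<mu> / 4) * P + (1 / a 1 + \<mu> / 4 * C1 a) * Q + \<mu> / (2 * \<beta> * a 1) * r) / 2"
      using beta a1_pos unfolding r_def by (simp add: field_simps)
    also have "\<dots> \<le> (X * P + X * Q + X * r) / 2"
      using X nn by (intro divide_right_mono add_mono mult_right_mono) auto
    also have "\<dots> = X * (ip U U / 2)" unfolding ipU by (simp add: algebra_simps)
    finally show ?thesis .
  qed
  have "\<bar>multiplier_form \<eta> \<zeta> U U\<bar> \<le> \<bar>LINT x|I01. (x * D ?u x) * ?v x\<bar> + \<bar>\<mu> / 4 * (LINT x|I01. ?u x * ?v x)\<bar> + \<bar>\<eta> / 2 * ?u 1 * Z\<bar>"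
    unfolding multiplier_form_split[OF U U z(1)] Z_def by linarith
  also have "\<dots> \<le> (Q / a 1 / 2 + P / 2) + \<mu> / 4 * (N / 2 + P / 2) + \<eta> / 2 * (1 / (\<beta> * sqrt (alpha a \<beta>)) * (ip U U / 2))"
  proof (intro add_mono B1)
    show "\<bar>\<mu> / 4 * (LINT x|I01. ?u x * ?v x)\<bar> \<le> \<mu> / 4 * (N / 2 + P / 2)"
      using B2 mu_nonneg by (simp only: abs_mult) (intro mult_mono, auto)
    show "\<bar>\<eta> / 2 * ?u 1 * Z\<bar> \<le> \<eta> / 2 * (1 / (\<beta> * sqrt (alpha a \<beta>)) * (ip U U / 2))"
      using mult_left_mono[OF B3, of "\<eta> / 2"] \<eta> by (simp only: abs_mult mult.assoc) simp
  qed
  also have "\<dots> \<le> X * (ip U U / 2) + \<eta> / (2 * \<beta> * sqrt (alpha a \<beta>)) * (ip U U / 2)"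
    using main by simp
  finally show ?thesis unfolding X_def by (simp add: distrib_right)
qed

end

subsection \<open>Decay along orbits of the semigroup\<close>

text \<open>Replaces integration of a differential inequality. With \<open>n + 1\<close> equal steps
  the errors sum to \<open>(T - S)\<close> times the value of \<open>R\<close> at the step length,
  which tends to 0 because \<open>R\<close> is the same function for all \<open>t\<close>.\<close>

lemma integral_inequality_of_increments:
  fixes E \<psi> R :: "real \<Rightarrow> real"
  assumes cont: "continuous_on {0..} E" and dec: "\<And>s t. \<lbrakk>0 \<le> s; s \<le> t\<rbrakk> \<Longrightarrow> E t \<le> E s"
    and inc: "\<And>t h. \<lbrakk>0 \<le> t; 0 < h\<rbrakk> \<Longrightarrow> \<psi> (t + h) \<le> \<psi> t - h * (\<kappa> * E t) + h * R h"
    and R: "(R \<longlongrightarrow> 0) (at_right 0)" and \<kappa>: "\<kappa> \<ge> 0" and ST: "0 \<le> S" "S \<le> T"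
  shows "\<kappa> * integral {S..T} E \<le> \<psi> S - \<psi> T"
proof (cases "S = T")
  case False
  then have lt: "S < T" using ST by simp
  have int: "E integrable_on {s..t}" if "0 \<le> s" for s t
    by (rule integrable_continuous_real, rule continuous_on_subset[OF cont]) (use that in auto)
  define G where "G = (\<lambda>t. \<psi> t + \<kappa> * integral {S..t} E)"
  have step: "G (t + h) \<le> G t + h * R h" if t: "S \<le> t" "0 < h" for t h
  proof -
    have eq: "integral {S..t} E + integral {t..t + h} E = integral {S..t + h} E"
      using t ST int by (intro Henstock_Kurzweil_Integration.integral_combine) auto
    \<comment> \<open>Monotonicity of \<open>E\<close> allows the value at the left end of the step
      to stand for the integral.\<close>
    have "integral {t..t + h} E \<le> integral {t..t + h} (\<lambda>_. E t)"
      using t ST int dec by (intro integral_le) auto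
    then have "integral {t..t + h} E \<le> h * E t" using t by simp
    from mult_left_mono[OF this \<kappa>] have "\<kappa> * integral {t..t + h} E \<le> \<kappa> * (h * E t)" .
    moreover have "\<psi> (t + h) \<le> \<psi> t - h * (\<kappa> * E t) + h * R h" using t ST by (intro inc) auto
    moreover have "\<kappa> * integral {S..t + h} E = \<kappa> * integral {S..t} E + \<kappa> * integral {t..t + h} E"
      unfolding eq[symmetric] by (rule distrib_left)
    moreover have "h * (\<kappa> * E t) = \<kappa> * (h * E t)" by simp
    ultimately show ?thesis unfolding G_def by linarith
  qed
  have steps: "G (S + real k * h) \<le> G S + real k * (h * R h)" if "0 < h" for k h
  proof (induction k)
    case (Suc k)
    have "G (S + real k * h + h) \<le> G (S + real k * h) + h * R h" using that by (intro step) auto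
    then show ?case using Suc by (simp add: algebra_simps)
  qed simp
  have "G T \<le> G S + (T - S) * R ((T - S) / real (Suc n))" for n
  proof -
    define h where "h = (T - S) / real (Suc n)"
    have h: "0 < h" "real (Suc n) * h = T - S" using lt by (simp_all add: h_def)
    have nR: "real (Suc n) * (h * R h) = (T - S) * R h" using h(2) by (simp only: mult.assoc[symmetric])
    show ?thesis using steps[OF h(1), of "Suc n"] unfolding nR h(2) h_def[symmetric] by simp
  qed
  moreover have "(\<lambda>n. G S + (T - S) * R ((T - S) / real (Suc n))) \<longlonglongrightarrow> G S + (T - S) * 0"
  proof (intro tendsto_intros)
    have "filterlim (\<lambda>n. (T - S) / real (Suc n)) (at_right 0) sequentially"
      unfolding filterlim_at
    proof
      show "(\<lambda>n. (T - S) / real (Suc n)) \<longlonglongrightarrow> 0"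
        using LIMSEQ_Suc[OF tendsto_divide_0[OF tendsto_const filterlim_real_at_infinity_sequentially]] .
    qed (use lt in \<open>auto intro!: always_eventually\<close>)
    then show "(\<lambda>n. R ((T - S) / real (Suc n))) \<longlonglongrightarrow> 0" by (rule filterlim_compose[OF R])
  qed
  ultimately have "G T \<le> G S" using LIMSEQ_le_const by fastforce
  then show ?thesis by (simp add: G_def)
qed simp

text \<open>The tail integral \<open>J\<close> satisfies \<open>J \<le> - m J'\<close>, so
  \<open>exp (s / m) * J s\<close> is nonincreasing. Evaluating at \<open>t - m\<close> and using
  that \<open>J (t - m)\<close> is at least \<open>m * E t\<close> explains the additional 1 in the
  exponent and the restriction \<open>t \<ge> m\<close>.\<close>

lemma exponential_decay_of_integral_bound:
  fixes E :: "real \<Rightarrow> real"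
  assumes cont: "continuous_on {0..} E" and dec: "\<And>s t. \<lbrakk>0 \<le> s; s \<le> t\<rbrakk> \<Longrightarrow> E t \<le> E s"
    and bound: "\<And>S T. \<lbrakk>0 \<le> S; S \<le> T\<rbrakk> \<Longrightarrow> integral {S..T} E \<le> m * E S" and m: "m > 0" and t: "t \<ge> m"
  shows "E t \<le> E 0 * exp (1 - t / m)"
proof -
  have int: "E integrable_on {s..t}" if "0 \<le> s" for s t
    by (rule integrable_continuous_real, rule continuous_on_subset[OF cont]) (use that in auto)
  \<comment> \<open>The tail ends at the fixed time \<open>t\<close> instead of infinity, so no
    integrability on the half-line is involved.\<close>
  define J where "J = (\<lambda>s. integral {0..t} E - integral {0..s} E)"
  have J: "J s = integral {s..t} E" if "0 \<le> s" "s \<le> t" for s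
    using Henstock_Kurzweil_Integration.integral_combine[OF that int[of 0 t]] unfolding J_def by simp
  define H where "H = (\<lambda>s. exp (s / m) * J s)"
  have "H (t - m) \<le> H 0"
  proof (rule DERIV_nonpos_imp_decreasing_open[where f = H and a = 0 and b = "t - m"])
    show "0 \<le> t - m" using t by simp
    have dJ: "(J has_real_derivative (- E s)) (at s within {0..t})" if "s \<in> {0..t}" for s
    proof -
      have "((\<lambda>s. integral {0..s} E) has_real_derivative E s) (at s within {0..t})"
        by (rule integral_has_real_derivative[OF continuous_on_subset[OF cont] that]) auto
      then show ?thesis unfolding J_def by (auto intro!: derivative_eq_intros)
    qed
    have dH: "(H has_real_derivative (exp (s / m) / m * J s + exp (s / m) * (- E s))) (at s within {0..t})" if "s \<in> {0..t}" for s
    proof -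
      have "((\<lambda>s. exp (s / m)) has_real_derivative exp (s / m) / m) (at s within {0..t})"
        using m by (auto intro!: derivative_eq_intros)
      from DERIV_mult[OF this dJ[OF that]] show ?thesis
        unfolding H_def by (rule DERIV_cong) (simp add: mult_ac)
    qed
    then have "continuous_on {0..t} H"
      by (intro DERIV_continuous_on) auto
    then show "continuous_on {0..t - m} H" by (rule continuous_on_subset) (use m in auto)
    fix s assume s: "0 < s" "s < t - m"
    then have "at s within {0..t} = at s" using m by (intro at_within_interior) (auto simp: interior_atLeastAtMost_real)
    then have "(H has_real_derivative (exp (s / m) / m * J s + exp (s / m) * (- E s))) (at s)"
      using dH[of s] s m by auto
    moreover have "exp (s / m) / m * J s + exp (s / m) * (- E s) \<le> 0"
    proof -
      have "J s \<le> m * E s" using J[of s] bound[of s t] s m by simp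
      then have "J s / m \<le> E s" using m by (simp add: pos_divide_le_eq mult.commute)
      then have "exp (s / m) * (J s / m) \<le> exp (s / m) * E s" by (rule mult_left_mono) simp
      then show ?thesis by simp
    qed
    ultimately show "\<exists>y. (H has_real_derivative y) (at s) \<and> y \<le> 0" by blast
  qed
  moreover have "H 0 \<le> m * E 0" using J[of 0] bound[of 0 t] t m by (simp add: H_def)
  moreover have "m * E t \<le> J (t - m)"
  proof -
    have "integral {t - m..t} (\<lambda>_. E t) \<le> integral {t - m..t} E"
      using t m int dec by (intro integral_le) auto
    then show ?thesis using J[of "t - m"] t m by simp
  qed
  then have "exp ((t - m) / m) * (m * E t) \<le> H (t - m)" unfolding H_def by (intro mult_left_mono) auto
  ultimately have "exp ((t - m) / m) * (m * E t) \<le> m * E 0" by simp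
  then have "m * (exp ((t - m) / m) * E t) \<le> m * E 0" by (simp add: mult_ac)
  then have "exp ((t - m) / m) * E t \<le> E 0" using m by simp
  then have "exp (1 - t / m) * (exp ((t - m) / m) * E t) \<le> exp (1 - t / m) * E 0" by (rule mult_left_mono) simp
  moreover have e1: "exp (1 - t / m) * exp ((t - m) / m) = 1" using m by (simp add: exp_add[symmetric] field_simps)
  have "exp (1 - t / m) * (exp ((t - m) / m) * E t) = E t" by (simp only: mult.assoc[symmetric] e1 mult_1)
  ultimately show ?thesis by (metis mult.commute)
qed

section \<open>Calculus of \<open>eqH\<close> and of the energy norm\<close>

lemma eqH_trans: "eqH U V \<Longrightarrow> eqH V W \<Longrightarrow> eqH U W"
proof -
  assume "eqH U V" "eqH V W"
  moreover from this have "AE x in I01. snd U x = snd V x" "AE x in I01. snd V x = snd W x" by (auto simp: eqH_def)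
  then have "AE x in I01. snd U x = snd W x" by eventually_elim simp
  ultimately show ?thesis by (simp add: eqH_def)
qed

lemma eqH_refl: "eqH U U" by (simp add: eqH_def)

lemma eqH_sym: "eqH U V \<Longrightarrow> eqH V U"
proof -
  assume e: "eqH U V"
  then have "AE x in I01. snd U x = snd V x" by (simp add: eqH_def)
  then have "AE x in I01. snd V x = snd U x" by eventually_elim simp
  then show ?thesis using e by (simp add: eqH_def)
qed

lemma eqH_lincomb:
  assumes "eqH U U'" "eqH W W'"
  shows "eqH (lincomb r U s W) (lincomb r U' s W')"
proof -
  have "AE x in I01. snd U x = snd U' x" "AE x in I01. snd W x = snd W' x" using assms by (auto simp: eqH_def)
  then have "AE x in I01. r * snd U x + s * snd W x = r * snd U' x + s * snd W' x" by eventually_elim simp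
  then show ?thesis using assms by (simp add: eqH_def lincomb_def)
qed

context damped_wave
begin

lemma normH_eqH: "U \<in> Hsp a \<Longrightarrow> W \<in> Hsp a \<Longrightarrow> eqH U W \<Longrightarrow> nH U = nH W"
  using ip_eqH[of U W U W] by (simp add: normH_def)

lemma ip_lincomb_square:
  assumes "U \<in> Hsp a" "W \<in> Hsp a"
  shows "ip (lincomb r U s W) (lincomb r U s W) = r\<^sup>2 * ip U U + 2 * r * s * ip U W + s\<^sup>2 * ip W W"
proof -
  note H = Hsp_lincomb[OF assms, of r s]
  have "ip (lincomb r U s W) (lincomb r U s W) = r * ip (lincomb r U s W) U + s * ip (lincomb r U s W) W"
    using ip_lincomb[OF assms H, of r s] ip_commute by metis
  then show ?thesis
    unfolding ip_lincomb[OF assms assms(1)] ip_lincomb[OF assms assms(2)]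
    using ip_commute[of W U] by (simp add: power2_eq_square algebra_simps)
qed

lemma normH_triangle:
  assumes "U \<in> Hsp a" "W \<in> Hsp a"
  shows "nH U \<le> nH W + nH (lincomb 1 U (-1) W)"
proof (rule power2_le_imp_le)
  let ?D = "lincomb 1 U (-1) W"
  have D: "?D \<in> Hsp a" by (rule Hsp_lincomb[OF assms])
  have U: "U = lincomb 1 W 1 ?D" by (cases U) (simp add: lincomb_def)
  have "(nH U)\<^sup>2 = ip W W + 2 * ip W ?D + ip ?D ?D"
    using ip_lincomb_square[OF assms(2) D, of 1 1] U by (simp add: normH_square)
  also have "\<dots> \<le> (nH W + nH ?D)\<^sup>2"
    using ip_Cauchy_Schwarz[OF assms(2) D] by (simp add: power2_sum normH_square abs_le_iff)
  finally show "(nH U)\<^sup>2 \<le> (nH W + nH ?D)\<^sup>2" .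
  show "0 \<le> nH W + nH ?D" using normH_nonneg by simp
qed

lemma normH_diff_commute:
  assumes "U \<in> Hsp a" "W \<in> Hsp a"
  shows "nH (lincomb 1 U (-1) W) = nH (lincomb 1 W (-1) U)"
  unfolding normH_def ip_lincomb_square[OF assms] ip_lincomb_square[OF assms(2,1)]
  using ip_commute[of U W] by simp

end

section \<open>Orbits of the semigroup\<close>

locale damped_wave_semigroup = damped_wave +
  fixes S :: "real \<Rightarrow> state \<Rightarrow> state"
  assumes cs: "contraction_semigroup a \<beta> S" and gen: "generated_by_A a \<beta> S"
begin

lemma S_Hsp: "t \<ge> 0 \<Longrightarrow> U \<in> Hsp a \<Longrightarrow> S t U \<in> Hsp a"
  and S_linear: "t \<ge> 0 \<Longrightarrow> U \<in> Hsp a \<Longrightarrow> W \<in> Hsp a \<Longrightarrow> eqH (S t (lincomb r U s W)) (lincomb r (S t U) s (S t W))"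
  and S_contraction: "t \<ge> 0 \<Longrightarrow> U \<in> Hsp a \<Longrightarrow> nH (S t U) \<le> nH U"
  and S_zero: "U \<in> Hsp a \<Longrightarrow> eqH (S 0 U) U"
  and S_add: "t \<ge> 0 \<Longrightarrow> s \<ge> 0 \<Longrightarrow> U \<in> Hsp a \<Longrightarrow> eqH (S (t + s) U) (S t (S s U))"
  and S_continuous: "U \<in> Hsp a \<Longrightarrow> ((\<lambda>t. nH (lincomb 1 (S t U) (-1) U)) \<longlongrightarrow> 0) (at_right 0)"
  using cs unfolding contraction_semigroup_def by blast+

text \<open>The quantity whose limit characterises the generator, with \<open>F\<close> in the role
  of the image of \<open>U\<close>.\<close>

definition quotient_error :: "state \<Rightarrow> state \<Rightarrow> real \<Rightarrow> real" where
  "quotient_error U F h = nH (lincomb 1 (lincomb (1/h) (S h U) (-1/h) U) (-1) F)"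

lemma S_diff:
  assumes "t \<ge> 0" "U \<in> Hsp a" "W \<in> Hsp a"
  shows "nH (lincomb 1 (S t U) (-1) (S t W)) \<le> nH (lincomb 1 U (-1) W)"
proof -
  have "nH (lincomb 1 (S t U) (-1) (S t W)) = nH (S t (lincomb 1 U (-1) W))"
    using assms by (intro normH_eqH Hsp_lincomb S_Hsp eqH_sym[OF S_linear])
  then show ?thesis using S_contraction[OF assms(1) Hsp_lincomb[OF assms(2,3)]] by simp
qed

lemma S_antimono:
  assumes "U \<in> Hsp a" "0 \<le> s" "s \<le> t"
  shows "nH (S t U) \<le> nH (S s U)"
proof -
  have "nH (S t U) = nH (S ((t - s) + s) U)" by simp
  also have "\<dots> = nH (S (t - s) (S s U))"
    using assms by (intro normH_eqH S_Hsp S_add) auto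
  also have "\<dots> \<le> nH (S s U)" using assms by (intro S_contraction S_Hsp) auto
  finally show ?thesis .
qed

lemma orbit_diff:
  assumes "U \<in> Hsp a" "0 \<le> t" "0 < h"
  shows "nH (lincomb 1 (S (t + h) U) (-1) (S t U)) \<le> nH (lincomb 1 (S h U) (-1) U)"
proof -
  have "nH (lincomb 1 (S (t + h) U) (-1) (S t U)) = nH (lincomb 1 (S t (S h U)) (-1) (S t U))"
    using assms by (intro normH_eqH Hsp_lincomb S_Hsp eqH_lincomb S_add eqH_refl) auto
  also have "\<dots> \<le> nH (lincomb 1 (S h U) (-1) U)" using assms by (intro S_diff S_Hsp) auto
  finally show ?thesis .
qed

text \<open>Only continuity from the right at time 0 is given. The contraction property transports
  it to all times and to both sides, since the distance of two points of an orbit depends at most on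
  the time difference.\<close>

lemma orbit_norm_continuous:
  assumes U: "U \<in> Hsp a"
  shows "continuous_on {0..} (\<lambda>t. nH (S t U))"
  unfolding continuous_on_iff
proof (intro ballI allI impI)
  fix t e :: real assume t: "t \<in> {0..}" and e: "0 < e"
  have "\<forall>\<^sub>F h in at_right 0. nH (lincomb 1 (S h U) (-1) U) < e"
    using order_tendstoD(2)[OF S_continuous[OF U] e] .
  then obtain d where d: "d > 0" "\<And>h. 0 < h \<Longrightarrow> h < d \<Longrightarrow> nH (lincomb 1 (S h U) (-1) U) < e"
    unfolding eventually_at_right_field by blast
  have close: "\<bar>nH (S q U) - nH (S p U)\<bar> < e" if pq: "0 \<le> p" "p < q" "q - p < d" for p q
  proof -
    have H: "S q U \<in> Hsp a" "S p U \<in> Hsp a" using pq U by (auto intro: S_Hsp)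
    have "nH (lincomb 1 (S q U) (-1) (S p U)) < e"
      using orbit_diff[OF U pq(1), of "q - p"] d(2)[of "q - p"] pq by simp
    then show ?thesis
      using normH_triangle[OF H] normH_triangle[OF H(2,1)] normH_diff_commute[OF H] by linarith
  qed
  have "dist (nH (S s U)) (nH (S t U)) < e" if "s \<in> {0..}" "dist s t < d" for s
  proof (cases s t rule: linorder_cases)
    case less
    then show ?thesis using close[of s t] that t by (auto simp: dist_real_def abs_minus_commute)
  next
    case equal
    then show ?thesis using e by simp
  next
    case greater
    then show ?thesis using close[of t s] that t by (auto simp: dist_real_def)
  qed
  then show "\<exists>d>0. \<forall>s\<in>{0..}. dist s t < d \<longrightarrow> dist (nH (S s U)) (nH (S t U)) < e" using d(1) by blast
qed

text \<open>Up to \<open>eqH\<close>, the semigroup commutes with difference quotients, and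
  contractions do not enlarge the error. This gives the uniformity in \<open>t\<close> on which the
  summation of increments rests.\<close>

lemma orbit_quotient_error:
  assumes "U \<in> Hsp a" "F \<in> Hsp a" "0 \<le> t" "0 < h"
  shows "nH (lincomb 1 (lincomb (1/h) (S (t + h) U) (-1/h) (S t U)) (-1) (S t F)) \<le> quotient_error U F h"
    and "quotient_error (S t U) (S t F) h \<le> quotient_error U F h"
proof -
  let ?q = "lincomb (1/h) (S h U) (-1/h) U"
  have H: "S h U \<in> Hsp a" "?q \<in> Hsp a" "lincomb 1 ?q (-1) F \<in> Hsp a"
    using assms by (auto intro!: S_Hsp Hsp_lincomb)
  have e1: "eqH (S t (lincomb 1 ?q (-1) F)) (lincomb 1 (S t ?q) (-1) (S t F))"
    using assms H by (intro S_linear) auto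
  have e2: "eqH (S t ?q) (lincomb (1/h) (S t (S h U)) (-1/h) (S t U))"
    using assms H by (intro S_linear) auto
  have e3: "eqH (S t (S h U)) (S (t + h) U)" using assms by (intro eqH_sym[OF S_add]) auto
  have e4: "eqH (S t (lincomb 1 ?q (-1) F)) (lincomb 1 (lincomb (1/h) (S (t + h) U) (-1/h) (S t U)) (-1) (S t F))"
    by (rule eqH_trans[OF e1 eqH_lincomb[OF eqH_trans[OF e2 eqH_lincomb[OF e3 eqH_refl]] eqH_refl]])
  have H': "lincomb 1 (lincomb (1/h) (S (t + h) U) (-1/h) (S t U)) (-1) (S t F) \<in> Hsp a"
    using assms by (intro Hsp_lincomb S_Hsp) auto
  have "nH (lincomb 1 (lincomb (1/h) (S (t + h) U) (-1/h) (S t U)) (-1) (S t F)) = nH (S t (lincomb 1 ?q (-1) F))"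
    using assms H by (intro normH_eqH H' S_Hsp eqH_sym[OF e4]) auto
  also have "\<dots> \<le> quotient_error U F h" unfolding quotient_error_def using assms H by (intro S_contraction) auto
  finally show 1: "nH (lincomb 1 (lincomb (1/h) (S (t + h) U) (-1/h) (S t U)) (-1) (S t F)) \<le> quotient_error U F h" .
  have e5: "eqH (S h (S t U)) (S (t + h) U)"
    using eqH_sym[OF S_add[of h t U]] assms by (simp add: add.commute)
  have "quotient_error (S t U) (S t F) h = nH (lincomb 1 (lincomb (1/h) (S (t + h) U) (-1/h) (S t U)) (-1) (S t F))"
    unfolding quotient_error_def using assms
    by (intro normH_eqH H' Hsp_lincomb S_Hsp eqH_lincomb e5 eqH_refl) auto
  then show "quotient_error (S t U) (S t F) h \<le> quotient_error U F h" using 1 by simp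
qed

text \<open>The orbit of a domain element stays in the domain and the generator commutes with the
  semigroup. Since \<open>domA\<close> is a set of representatives, a fresh representative
  \<open>W\<close> is needed at every time.\<close>

lemma orbit_in_domain:
  assumes "U \<in> Hsp a" "F \<in> Hsp a" "(quotient_error U F \<longlongrightarrow> 0) (at_right 0)" "0 \<le> t"
  shows "\<exists>W\<in>domA a \<beta>. eqH W (S t U) \<and> eqH (opA a W) (S t F)"
proof -
  have "(quotient_error (S t U) (S t F) \<longlongrightarrow> 0) (at_right 0)"
  proof (rule tendsto_sandwich[OF _ _ tendsto_const assms(3)])
    show "\<forall>\<^sub>F h in at_right 0. 0 \<le> quotient_error (S t U) (S t F) h"
      by (intro always_eventually allI) (simp add: quotient_error_def normH_nonneg)
    show "\<forall>\<^sub>F h in at_right 0. quotient_error (S t U) (S t F) h \<le> quotient_error U F h"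
      unfolding eventually_at_right_field using orbit_quotient_error(2)[OF assms(1,2,4)] by (intro exI[of _ 1]) auto
  qed
  then show ?thesis
    using gen S_Hsp[OF assms(4,1)] S_Hsp[OF assms(4,2)] unfolding generated_by_A_def quotient_error_def[abs_def] by blast
qed

text \<open>Insert \<open>u' = u + h f + h e\<close>, where \<open>e\<close> is the error of the
  difference quotient, and expand bilinearly. The bound of the remainder involves only the data at
  time 0.\<close>

lemma form_increment:
  assumes b: "bounded_form b K" and U: "U \<in> Hsp a" and F: "F \<in> Hsp a" and t: "0 \<le> t" and h: "0 < h"
  shows "b (S (t + h) U) (S (t + h) U) \<le> b (S t U) (S t U) + h * (b (S t F) (S t U) + b (S t U) (S t F))
    + h * (\<bar>K\<bar> * (2 * (quotient_error U F h * nH U) + h * (nH F + quotient_error U F h)\<^sup>2))"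
proof -
  define u where "u = S t U"
  define u' where "u' = S (t + h) U"
  define f where "f = S t F"
  define e where "e = lincomb 1 (lincomb (1/h) u' (-1/h) u) (-1) f"
  define Q where "Q = quotient_error U F h"
  have H: "u \<in> Hsp a" "u' \<in> Hsp a" "f \<in> Hsp a" "lincomb (1/h) u' (-1/h) u \<in> Hsp a" "e \<in> Hsp a"
    using U F t h by (auto simp: u_def u'_def f_def e_def intro!: S_Hsp Hsp_lincomb)
  have n: "nH u \<le> nH U" "nH f \<le> nH F" "nH e \<le> Q" "0 \<le> nH u" "0 \<le> nH f" "0 \<le> nH e"
    using S_contraction[OF t U] S_contraction[OF t F] orbit_quotient_error(1)[OF U F t h] normH_nonneg
    by (auto simp: u_def f_def e_def u'_def Q_def)
  have left: "b u' X = b u X + h * b f X + h * b e X" if "X \<in> Hsp a" for X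
  proof -
    have "b e X = 1 * ((1/h) * b u' X + (-1/h) * b u X) + (-1) * b f X"
      using b H that unfolding e_def bounded_form_def by (metis (no_types, lifting))
    then show ?thesis using h by (simp add: field_simps)
  qed
  have right: "b X u' = b X u + h * b X f + h * b X e" if "X \<in> Hsp a" for X
  proof -
    have "b X e = 1 * ((1/h) * b X u' + (-1/h) * b X u) + (-1) * b X f"
      using b H that unfolding e_def bounded_form_def by (metis (no_types, lifting))
    then show ?thesis using h by (simp add: field_simps)
  qed
  have bd: "b X Y \<le> \<bar>K\<bar> * (nH X * nH Y)" if "X \<in> Hsp a" "Y \<in> Hsp a" for X Y
  proof -
    have "\<bar>b X Y\<bar> \<le> K * nH X * nH Y" using b that unfolding bounded_form_def by blast
    also have "\<dots> \<le> \<bar>K\<bar> * (nH X * nH Y)" using normH_nonneg by (simp add: mult.assoc mult_right_mono)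
    finally show ?thesis by simp
  qed
  have "b u' u' = b u u + h * (b f u + b u f) + h * ((b u e + b e u) + h * (b f f + b f e + b e f + b e e))"
    unfolding left[OF H(2)] right[OF H(1)] right[OF H(3)] right[OF H(5)] by (simp add: algebra_simps)
  also have "\<dots> \<le> b u u + h * (b f u + b u f) + h * (\<bar>K\<bar> * (2 * (Q * nH U) + h * (nH F + Q)\<^sup>2))"
  proof (intro add_left_mono mult_left_mono)
    have "b u e + b e u \<le> \<bar>K\<bar> * (nH u * nH e) + \<bar>K\<bar> * (nH e * nH u)" using bd H by (intro add_mono) auto
    also have "\<dots> \<le> \<bar>K\<bar> * (nH U * Q) + \<bar>K\<bar> * (Q * nH U)" using n by (intro add_mono mult_left_mono mult_mono) auto
    finally have 1: "b u e + b e u \<le> \<bar>K\<bar> * (2 * (Q * nH U))" by (simp add: algebra_simps)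
    have "b f f + b f e + b e f + b e e \<le> \<bar>K\<bar> * (nH f * nH f) + \<bar>K\<bar> * (nH f * nH e) + \<bar>K\<bar> * (nH e * nH f) + \<bar>K\<bar> * (nH e * nH e)"
      using bd H by (intro add_mono) auto
    also have "\<dots> = \<bar>K\<bar> * (nH f + nH e)\<^sup>2" by (simp add: power2_eq_square algebra_simps)
    also have "\<dots> \<le> \<bar>K\<bar> * (nH F + Q)\<^sup>2" using n by (intro mult_left_mono power_mono) auto
    finally have 2: "h * (b f f + b f e + b e f + b e e) \<le> h * (\<bar>K\<bar> * (nH F + Q)\<^sup>2)" using h by (intro mult_left_mono) auto
    show "b u e + b e u + h * (b f f + b f e + b e f + b e e) \<le> \<bar>K\<bar> * (2 * (Q * nH U) + h * (nH F + Q)\<^sup>2)"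
      using add_mono[OF 1 2] by (simp add: algebra_simps)
  qed (use h in auto)
  finally show ?thesis unfolding u_def u'_def f_def Q_def .
qed

lemma bounded_form_D:
  assumes "bounded_form b K" "U \<in> Hsp a" "V \<in> Hsp a"
  shows "\<lbrakk>W \<in> Hsp a\<rbrakk> \<Longrightarrow> b (lincomb r U s V) W = r * b U W + s * b V W"
    "\<lbrakk>W \<in> Hsp a\<rbrakk> \<Longrightarrow> b W (lincomb r U s V) = r * b W U + s * b W V"
    "\<lbrakk>W \<in> Hsp a; W' \<in> Hsp a; eqH U V; eqH W W'\<rbrakk> \<Longrightarrow> b U W = b V W'"
    "\<bar>b U V\<bar> \<le> K * nH U * nH V"
  using assms unfolding bounded_form_def by blast+

text \<open>A multiple of the energy is added to the multiplier form to compensate for the boundary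
  term \<open>v(1)^2\<close>.\<close>

lemma bounded_form_add_ip:
  assumes "bounded_form b K"
  shows "bounded_form (\<lambda>U W. b U W + c * ip U W) (\<bar>K\<bar> + \<bar>c\<bar>)"
  unfolding bounded_form_def
proof (intro conjI ballI allI impI)
  fix U V W r s assume H: "U \<in> Hsp a" "V \<in> Hsp a" "W \<in> Hsp a"
  have "b (lincomb r U s V) W = r * b U W + s * b V W" "b W (lincomb r U s V) = r * b W U + s * b W V"
    "ip (lincomb r U s V) W = r * ip U W + s * ip V W" "ip W (lincomb r U s V) = r * ip W U + s * ip W V"
    using bounded_form_D(1,2)[OF assms H(1,2,3)] bounded_form_D(1,2)[OF bounded_form_ip H(1,2,3)] by auto
  then show "b (lincomb r U s V) W + c * ip (lincomb r U s V) W = r * (b U W + c * ip U W) + s * (b V W + c * ip V W)"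
    "b W (lincomb r U s V) + c * ip W (lincomb r U s V) = r * (b W U + c * ip W U) + s * (b W V + c * ip W V)"
    by (simp_all add: algebra_simps)
next
  fix U U' W W' assume H: "U \<in> Hsp a" "U' \<in> Hsp a" "W \<in> Hsp a" "W' \<in> Hsp a" "eqH U U'" "eqH W W'"
  have "b U W = b U' W'" "ip U W = ip U' W'"
    by (rule bounded_form_D(3)[OF assms H(1,2,3,4,5,6)] bounded_form_D(3)[OF bounded_form_ip H(1,2,3,4,5,6)])+
  then show "b U W + c * ip U W = b U' W' + c * ip U' W'" by simp
next
  fix U W assume H: "U \<in> Hsp a" "W \<in> Hsp a"
  have n: "0 \<le> nH U * nH W" using normH_nonneg by simp
  have "\<bar>b U W\<bar> \<le> K * nH U * nH W" by (rule bounded_form_D(4)[OF assms H])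
  also have "\<dots> \<le> \<bar>K\<bar> * (nH U * nH W)" using n by (simp add: mult.assoc mult_right_mono)
  finally have "\<bar>b U W\<bar> \<le> \<bar>K\<bar> * (nH U * nH W)" .
  moreover have "\<bar>c * ip U W\<bar> \<le> \<bar>c\<bar> * (nH U * nH W)"
    using ip_Cauchy_Schwarz[OF H] by (simp add: abs_mult mult_left_mono)
  ultimately show "\<bar>b U W + c * ip U W\<bar> \<le> (\<bar>K\<bar> + \<bar>c\<bar>) * nH U * nH W"
    using abs_triangle_ineq[of "b U W" "c * ip U W"] by (simp add: algebra_simps)
qed

text \<open>Abstract conclusion for a form \<open>b\<close> with rate \<open>\<kappa>\<close>,
  diagonal bound \<open>B\<close> and a dissipation-controlled defect \<open>c\<close>. The two end
  point values of \<open>b\<close> cost \<open>2 * B\<close>, and the energy lost costs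
  \<open>c\<close>, all measured by \<open>E s\<close>; hence the condition on
  \<open>m\<close>.\<close>

lemma Lyapunov_decay:
  assumes b: "bounded_form b K"
    and bb: "\<And>V. V \<in> Hsp a \<Longrightarrow> \<bar>b V V\<bar> \<le> B * (ip V V / 2)"
    and diss: "\<And>V. V \<in> domA a \<beta> \<Longrightarrow>
      b V (opA a V) + b (opA a V) V \<le> - \<kappa> * (ip V V / 2) + c * (a 1 * (snd V 1)\<^sup>2)"
    and pos: "\<kappa> > 0" "c \<ge> 0" and m: "m > 0" "2 * B + c \<le> \<kappa> * m"
    and W: "W \<in> domA a \<beta>" and t: "t \<ge> m"
  shows "ip (S t W) (S t W) \<le> ip W W * exp (1 - t / m)"
proof -
  define F where "F = opA a W"
  have WH: "W \<in> Hsp a" "F \<in> Hsp a" unfolding F_def using W by (auto intro: domA_Hsp opA_Hsp)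
  have q: "(quotient_error W F \<longlongrightarrow> 0) (at_right 0)"
    using gen WH W eqH_refl unfolding generated_by_A_def quotient_error_def[abs_def] F_def by blast
  define E where "E = (\<lambda>t. ip (S t W) (S t W) / 2)"
  \<comment> \<open>Along the orbit the scalar product has derivative \<open>-2 a(1) v(1)^2\<close>,
    so the factor \<open>c / 2\<close> cancels the defect term exactly.\<close>
  define b' where "b' = (\<lambda>U V. b U V + c / 2 * ip U V)"
  have b': "bounded_form b' (\<bar>K\<bar> + \<bar>c / 2\<bar>)" unfolding b'_def by (rule bounded_form_add_ip[OF b])
  have Eeq: "E = (\<lambda>t. (nH (S t W))\<^sup>2 / 2)" by (simp add: E_def normH_square)
  have cont: "continuous_on {0..} E" unfolding Eeq by (intro continuous_intros orbit_norm_continuous WH) auto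
  have dec: "E t \<le> E s" if "0 \<le> s" "s \<le> t" for s t
    unfolding Eeq using S_antimono[OF WH(1) that] normH_nonneg by (simp add: power_mono)
  define K' where "K' = \<bar>\<bar>K\<bar> + \<bar>c / 2\<bar>\<bar>"
  define R where "R = (\<lambda>h. K' * (2 * (quotient_error W F h * nH W) + h * (nH F + quotient_error W F h)\<^sup>2))"
  have R: "(R \<longlongrightarrow> 0) (at_right 0)"
  proof -
    have "(R \<longlongrightarrow> K' * (2 * (0 * nH W) + 0 * (nH F + 0)\<^sup>2)) (at_right 0)"
      unfolding R_def by (intro tendsto_intros q)
    then show ?thesis by simp
  qed
  have inc: "b' (S (t + h) W) (S (t + h) W) \<le> b' (S t W) (S t W) - h * (\<kappa> * E t) + h * R h" if "0 \<le> t" "0 < h" for t h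
  proof -
    obtain V where V: "V \<in> domA a \<beta>" "eqH V (S t W)" "eqH (opA a V) (S t F)"
      using orbit_in_domain[OF WH q \<open>0 \<le> t\<close>] by blast
    have H: "V \<in> Hsp a" "opA a V \<in> Hsp a" "S t W \<in> Hsp a" "S t F \<in> Hsp a"
      using V(1) WH \<open>0 \<le> t\<close> by (auto intro: domA_Hsp opA_Hsp S_Hsp)
    have "b' (S t F) (S t W) = b' (opA a V) V" "b' (S t W) (S t F) = b' V (opA a V)"
      by (rule bounded_form_D(3)[OF b' H(4,2,3,1) eqH_sym[OF V(3)] eqH_sym[OF V(2)]]
          bounded_form_D(3)[OF b' H(3,1,4,2) eqH_sym[OF V(2)] eqH_sym[OF V(3)]])+
    then have "b' (S t F) (S t W) + b' (S t W) (S t F) = b V (opA a V) + b (opA a V) V + c * ip V (opA a V)"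
      using ip_commute[of V "opA a V"] by (simp add: b'_def)
    also have "\<dots> \<le> - \<kappa> * (ip V V / 2)" using diss[OF V(1)] dissipation[OF V(1)] by simp
    also have "ip V V = ip (S t W) (S t W)" using H V(2) by (intro ip_eqH)
    finally have "h * (b' (S t F) (S t W) + b' (S t W) (S t F)) \<le> h * (- \<kappa> * E t)"
      unfolding E_def using that by (intro mult_left_mono) auto
    then show ?thesis using form_increment[OF b' WH that] unfolding R_def K'_def by simp
  qed
  have "integral {s..t} E \<le> m * E s" if st: "0 \<le> s" "s \<le> t" for s t
  proof -
    have H: "S s W \<in> Hsp a" "S t W \<in> Hsp a" using st WH by (auto intro: S_Hsp)
    have Et: "0 \<le> E t" "E t \<le> E s" using dec[OF st] ip_nonneg by (auto simp: E_def)
    have bs: "\<bar>b (S s W) (S s W)\<bar> \<le> B * E s" "\<bar>b (S t W) (S t W)\<bar> \<le> B * E t"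
      using bb[OF H(1)] bb[OF H(2)] by (auto simp: E_def)
    \<comment> \<open>The sign of \<open>B\<close> is deduced here: a positive energy at
      \<open>t\<close> forces \<open>0 \<le> B\<close> through the diagonal bound.\<close>
    have "B * E t \<le> B * E s"
    proof (cases "E t = 0")
      case True
      then show ?thesis using bs Et by (simp add: abs_le_iff)
    next
      case False
      then have "0 \<le> B" using bs(2) Et by (metis abs_ge_zero order_trans less_eq_real_def zero_le_mult_iff not_le)
      then show ?thesis using Et by (intro mult_left_mono)
    qed
    have "\<kappa> * integral {s..t} E \<le> b' (S s W) (S s W) - b' (S t W) (S t W)"
      by (rule integral_inequality_of_increments[OF cont dec inc R less_imp_le[OF pos(1)] st])
    also have "\<dots> = b (S s W) (S s W) - b (S t W) (S t W) + c * E s - c * E t"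
      by (simp add: b'_def E_def)
    also have "\<dots> \<le> (2 * B + c) * E s"
    proof -
      have "0 \<le> c * E t" using pos Et by simp
      then show ?thesis using bs \<open>B * E t \<le> B * E s\<close> by (simp add: abs_le_iff algebra_simps)
    qed
    also have "\<dots> \<le> \<kappa> * m * E s" using m(2) Et by (intro mult_right_mono) auto
    finally show ?thesis using pos(1) by (simp add: mult.assoc)
  qed
  from exponential_decay_of_integral_bound[OF cont dec this m(1) t]
  have "E t \<le> E 0 * exp (1 - t / m)" .
  moreover have "ip (S 0 W) (S 0 W) = ip W W" using WH by (intro ip_eqH S_Hsp S_zero) auto
  ultimately show ?thesis by (simp add: E_def)
qed

end

subsection \<open>Density of the domain\<close>

lemma abs_derivative_le_Lipschitz:
  fixes w :: "real \<Rightarrow> real"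
  assumes "(w has_real_derivative d) (at x)" "x \<in> {0<..<1}"
    and lip: "\<And>x y. \<lbrakk>x \<in> {0..1}; y \<in> {0..1}\<rbrakk> \<Longrightarrow> \<bar>w y - w x\<bar> \<le> L * \<bar>y - x\<bar>"
  shows "\<bar>d\<bar> \<le> L"
proof -
  have "((\<lambda>y. \<bar>(w y - w x) / (y - x)\<bar>) \<longlongrightarrow> \<bar>d\<bar>) (at x)"
    using assms(1) unfolding has_field_derivative_iff by (rule tendsto_rabs)
  moreover have "\<forall>\<^sub>F y in at x. \<bar>(w y - w x) / (y - x)\<bar> \<le> L"
    unfolding eventually_at_topological
  proof (intro exI[of _ "{0<..<1}"] conjI ballI impI)
    fix y assume y: "y \<in> {0<..<1}" "y \<noteq> x"
    then have "\<bar>w y - w x\<bar> \<le> L * \<bar>y - x\<bar>" using assms(2) by (intro lip) auto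
    then show "\<bar>(w y - w x) / (y - x)\<bar> \<le> L" using y(2) by (simp add: abs_divide pos_divide_le_eq)
  qed (use assms(2) in auto)
  ultimately show ?thesis by (intro tendsto_upperbound) auto
qed

lemma Lipschitz_abs_cont_on:
  assumes "\<And>x y. \<lbrakk>x \<in> {0..1}; y \<in> {0..1}\<rbrakk> \<Longrightarrow> \<bar>w y - w x\<bar> \<le> L * \<bar>y - x\<bar>"
  shows "abs_cont_on 0 1 w"
proof (rule abs_cont_on_Lipschitz[where K = L])
  fix x y :: real assume "0 \<le> x" "x \<le> y" "y \<le> 1"
  then show "\<bar>w y - w x\<bar> \<le> L * (y - x)" using assms[of x y] by auto
qed

lemma Lipschitz_L2_D:
  assumes lip: "\<And>x y. \<lbrakk>x \<in> {0..1}; y \<in> {0..1}\<rbrakk> \<Longrightarrow> \<bar>w y - w x\<bar> \<le> L * \<bar>y - x\<bar>"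
  shows "L2 (D w)"
proof -
  have ac: "abs_cont_on 0 1 w" using lip by (rule Lipschitz_abs_cont_on)
  have ae: "AE x in I01. (w has_real_derivative D w x) (at x)" by (rule AC01_AE_D[OF abs_cont_on_imp_AC01[OF ac]])
  then obtain N where N: "negligible N" "\<forall>x\<in>{0<..<1} - N. (w has_real_derivative D w x) (at x)"
    unfolding AE_I01_iff by blast
  have "(D w has_integral (w 1 - w 0)) {0..1}"
    by (rule abs_cont_on_FTC[OF ac _ N(1)]) (use N(2) in auto)
  then have "D w integrable_on {0<..<1}"
    using has_integral_Icc_iff_Ioo by blast
  then have m: "D w \<in> borel_measurable I01" by (rule integrable_imp_measurable)
  have "AE x in I01. x \<in> {0<..<1}" by (rule AE_I2) auto
  with ae have "AE x in I01. \<bar>D w x\<bar> \<le> L"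
    by eventually_elim (rule abs_derivative_le_Lipschitz[OF _ _ lip])
  from L2_bounded_mult[OF L2_const[of 1] m this] show ?thesis by simp
qed

text \<open>Integration by parts without boundary terms, since test functions vanish at 0 and 1. It
  provides membership in \<open>H1\<close> for the fluxes constructed below.\<close>

lemma Lipschitz_weak_deriv:
  assumes lip: "\<And>x y. \<lbrakk>x \<in> {0..1}; y \<in> {0..1}\<rbrakk> \<Longrightarrow> \<bar>w y - w x\<bar> \<le> L * \<bar>y - x\<bar>"
  shows "weak_deriv w (D w)"
  unfolding weak_deriv_def
proof (intro conjI allI impI)
  show L: "L2 (D w)" by (rule Lipschitz_L2_D[OF lip])
  have ac: "abs_cont_on 0 1 w" using lip by (rule Lipschitz_abs_cont_on)
  fix \<phi> assume t: "test_fun \<phi>"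
  then obtain \<phi>' where \<phi>': "\<forall>x. (\<phi> has_real_derivative \<phi>' x) (at x)" "continuous_on UNIV \<phi>'"
    by (auto simp: test_fun_def)
  have "deriv \<phi> = \<phi>'" using \<phi>'(1) by (intro ext DERIV_imp_deriv) blast
  have z: "\<phi> x = 0" if "x \<notin> {0<..<1}" for x
    using t that closure_subset[of "{x. \<phi> x \<noteq> 0}"] unfolding test_fun_def by blast
  have c: "continuous_on {0..1} \<phi>'" "continuous_on {0..1} \<phi>"
  proof -
    show "continuous_on {0..1} \<phi>'" by (rule continuous_on_subset[OF \<phi>'(2)]) simp
    show "continuous_on {0..1} \<phi>"
      using \<phi>'(1) by (intro continuous_at_imp_continuous_on ballI DERIV_isCont) blast
  qed
  have L\<phi>: "L2 \<phi>" "L2 \<phi>'" using c by (auto intro: L2_continuous)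
  have "abs_cont_on 0 1 \<phi>"
    by (rule abs_cont_on_C1[where f' = \<phi>']) (use \<phi>'(1) c in \<open>auto intro: has_field_derivative_at_within\<close>)
  then have AC: "abs_cont_on 0 1 (\<lambda>x. w x * \<phi> x)" by (intro abs_cont_on_mult ac)
  have wL: "L2 w" by (rule L2_continuous[OF abs_cont_on_continuous[OF ac]])
  have i: "integrable I01 (\<lambda>x. D w x * \<phi> x)" "integrable I01 (\<lambda>x. w x * \<phi>' x)"
    using L L\<phi> wL by (auto intro: L2_mult)
  have "((\<lambda>x. w x * \<phi> x) \<longlongrightarrow> w 1 * \<phi> 1 - (LINT x|I01. D w x * \<phi> x + w x * \<phi>' x)) (at_right 0)"
  proof (rule AC01_FTC_limit[OF abs_cont_on_imp_AC01[OF AC]])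
    show "AE x in I01. ((\<lambda>x. w x * \<phi> x) has_real_derivative (D w x * \<phi> x + w x * \<phi>' x)) (at x)"
      using AC01_AE_D[OF abs_cont_on_imp_AC01[OF ac]]
    proof eventually_elim
      case (elim x)
      from DERIV_mult[OF elim \<phi>'(1)[rule_format, of x]]
      show ?case by (rule DERIV_cong) (simp add: mult.commute)
    qed
  qed (use i in simp)
  moreover have "((\<lambda>x. w x * \<phi> x) \<longlongrightarrow> w 0 * \<phi> 0) (at_right 0)" by (rule abs_cont_on_at_right_0[OF AC])
  ultimately have "w 1 * \<phi> 1 - (LINT x|I01. D w x * \<phi> x + w x * \<phi>' x) = w 0 * \<phi> 0"
    by (rule tendsto_unique[rotated]) simp
  then show "(LINT x|I01. w x * deriv \<phi> x) = - (LINT x|I01. D w x * \<phi> x)"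
    using z[of 0] z[of 1] i unfolding \<open>deriv \<phi> = \<phi>'\<close> by simp
qed

section \<open>Approximation in L2 by Lipschitz functions vanishing near the end points\<close>

lemma L2_sum_square_le:
  assumes "L2 f" "L2 g"
  shows "(LINT x|I01. (f x + g x)\<^sup>2) \<le> 2 * (LINT x|I01. (f x)\<^sup>2) + 2 * (LINT x|I01. (g x)\<^sup>2)"
proof -
  have i: "integrable I01 (\<lambda>x. (f x)\<^sup>2)" "integrable I01 (\<lambda>x. (g x)\<^sup>2)" using assms by (auto simp: L2_def)
  have "(LINT x|I01. (f x + g x)\<^sup>2) \<le> (LINT x|I01. 2 * (f x)\<^sup>2 + 2 * (g x)\<^sup>2)"
  proof (rule integral_mono)
    show "integrable I01 (\<lambda>x. (f x + g x)\<^sup>2)" using L2_lincomb[OF assms, of 1 1] by (simp add: L2_def)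
    fix x
    have "0 \<le> (f x - g x)\<^sup>2" by simp
    then show "(f x + g x)\<^sup>2 \<le> 2 * (f x)\<^sup>2 + 2 * (g x)\<^sup>2" by (simp add: power2_eq_square algebra_simps)
  qed (use i in auto)
  then show ?thesis using i by simp
qed

text \<open>Cutting off large values and neighbourhoods of the end points; the errors are dominated
  by the square of \<open>f\<close>.\<close>

lemma L2_truncation:
  assumes f: "L2 f" and e: "\<epsilon> > 0"
  shows "\<exists>f0 B d. L2 f0 \<and> 0 < d \<and> (\<forall>x. \<bar>f0 x\<bar> \<le> B) \<and> (\<forall>x. x \<notin> {d..1 - d} \<longrightarrow> f0 x = 0) \<and>
    (LINT x|I01. (f0 x - f x)\<^sup>2) < \<epsilon>"
proof -
  define F where "F = (\<lambda>n x. if \<bar>f x\<bar> \<le> real (Suc n) \<and> 1 / real (Suc n) \<le> x \<and> x \<le> 1 - 1 / real (Suc n) then f x else 0)"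
  have fm: "f \<in> borel_measurable I01" by (rule L2_measurable[OF f])
  have Fm: "F n \<in> borel_measurable I01" for n
    unfolding F_def using fm continuous_measurable_I01[OF continuous_on_id] by measurable
  have dom: "(F n x - f x)\<^sup>2 \<le> (f x)\<^sup>2" "(F n x)\<^sup>2 \<le> (f x)\<^sup>2" for n x by (auto simp: F_def)
  have f2: "integrable I01 (\<lambda>x. (f x)\<^sup>2)" using f by (simp add: L2_def)
  have lim: "(\<lambda>n. (F n x - f x)\<^sup>2) \<longlonglongrightarrow> 0" if x: "x \<in> {0<..<1}" for x
  proof -
    have "\<forall>\<^sub>F n in sequentially. \<bar>f x\<bar> \<le> real (Suc n) \<and> 1 / real (Suc n) \<le> x \<and> 1 / real (Suc n) \<le> 1 - x"
    proof (intro eventually_conj)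
      have L: "(\<lambda>n. 1 / real (Suc n)) \<longlonglongrightarrow> 0" using LIMSEQ_inverse_real_of_nat by (simp add: inverse_eq_divide)
      show "\<forall>\<^sub>F n in sequentially. 1 / real (Suc n) \<le> x" "\<forall>\<^sub>F n in sequentially. 1 / real (Suc n) \<le> 1 - x"
        using order_tendstoD(2)[OF L, of x] order_tendstoD(2)[OF L, of "1 - x"] x by (auto elim: eventually_mono)
      obtain N where "\<bar>f x\<bar> \<le> real N" using real_arch_simple by blast
      then show "\<forall>\<^sub>F n in sequentially. \<bar>f x\<bar> \<le> real (Suc n)"
        unfolding eventually_sequentially by (intro exI[of _ N]) auto
    qed
    then have "\<forall>\<^sub>F n in sequentially. (F n x - f x)\<^sup>2 = 0"
      by eventually_elim (simp add: F_def)
    then show ?thesis by (rule tendsto_eventually)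
  qed
  have "(\<lambda>n. LINT x|I01. (F n x - f x)\<^sup>2) \<longlonglongrightarrow> (LINT x|I01. 0)"
  proof (rule integral_dominated_convergence[where w = "\<lambda>x. (f x)\<^sup>2"])
    show "AE x in I01. (\<lambda>n. (F n x - f x)\<^sup>2) \<longlonglongrightarrow> 0" by (rule AE_I2) (use lim in auto)
    show "AE x in I01. norm ((F n x - f x)\<^sup>2) \<le> (f x)\<^sup>2" for n using dom by (intro AE_I2) simp
  qed (use Fm fm f2 in auto)
  then have "\<forall>\<^sub>F n in sequentially. (LINT x|I01. (F n x - f x)\<^sup>2) < \<epsilon>"
    using order_tendstoD(2) e by fastforce
  then obtain n where n: "(LINT x|I01. (F n x - f x)\<^sup>2) < \<epsilon>"
    unfolding eventually_sequentially by blast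
  have "integrable I01 (\<lambda>x. (F n x)\<^sup>2)"
    by (rule Bochner_Integration.integrable_bound[OF f2]) (use Fm dom in auto)
  then have "L2 (F n)" using Fm by (simp add: L2_def)
  moreover have "\<bar>F n x\<bar> \<le> real (Suc n)" for x by (auto simp: F_def)
  moreover have "F n x = 0" if "x \<notin> {1 / real (Suc n)..1 - 1 / real (Suc n)}" for x using that by (auto simp: F_def)
  ultimately show ?thesis using n by (intro exI[of _ "F n"] exI[of _ "real (Suc n)"] exI[of _ "1 / real (Suc n)"]) auto
qed

text \<open>Steklov averages of the truncated function: difference quotients of its primitive are
  Lipschitz, bounded by \<open>B\<close>, and converge almost everywhere because the primitive has
  derivative \<open>f0\<close> there.\<close>

lemma L2_approx_Lipschitz:
  assumes f: "L2 f" and e: "\<epsilon> > 0"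
  shows "\<exists>\<phi> L d. 0 < d \<and> (\<forall>x\<in>{0..1}. \<forall>y\<in>{0..1}. \<bar>\<phi> y - \<phi> x\<bar> \<le> L * \<bar>y - x\<bar>) \<and>
    (\<forall>x\<in>{0..1}. x \<notin> {d..1 - d} \<longrightarrow> \<phi> x = 0) \<and> (LINT x|I01. (\<phi> x - f x)\<^sup>2) < \<epsilon>"
proof -
  have "\<epsilon> / 4 > 0" using e by simp
  then obtain f0 B d where f0: "L2 f0" "0 < d" "\<forall>x. \<bar>f0 x\<bar> \<le> B" "\<forall>x. x \<notin> {d..1 - d} \<longrightarrow> f0 x = 0"
    and close: "(LINT x|I01. (f0 x - f x)\<^sup>2) < \<epsilon> / 4"
    using L2_truncation[OF f] by meson
  have B: "B \<ge> 0" using f0(3) by (meson abs_ge_zero order_trans)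
  have f0i: "integrable I01 f0" by (rule L2_integrable[OF f0(1)])
  \<comment> \<open>The minimum continues the primitive as a constant beyond 1, since the quotients
    evaluate it at \<open>x + h n\<close>.\<close>
  define G where "G = (\<lambda>x. integral {0..min 1 x} f0)"
  have Glip: "\<bar>G y - G x\<bar> \<le> B * \<bar>y - x\<bar>" if "0 \<le> x" "0 \<le> y" for x y
  proof -
    have *: "\<bar>G y - G x\<bar> \<le> B * (y - x)" if "0 \<le> x" "x \<le> y" for x y
    proof -
      have b: "0 \<le> min 1 x" "min 1 x \<le> min 1 y" "min 1 y \<le> 1" using that by auto
      have "norm (integral {min 1 x..min 1 y} f0) \<le> integral {min 1 x..min 1 y} (\<lambda>_. B)"
        using f0(3) by (intro integral_norm_bound_integral integrable_on_I01_subinterval[OF f0i b(1,3)]) auto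
      also have "\<dots> = B * (min 1 y - min 1 x)" using b by simp
      also have "\<dots> \<le> B * (y - x)" using that B by (intro mult_left_mono) auto
      finally show ?thesis using indefinite_integral_diff[OF f0i b] unfolding G_def by simp
    qed
    show ?thesis using *[of x y] *[of y x] that by (cases "x \<le> y") (auto simp: abs_minus_commute)
  qed
  have Glow: "G x = 0" if "x < d" for x
  proof -
    have "integral {0..min 1 x} f0 = integral {0..min 1 x} (\<lambda>_. 0)"
      using f0(4) that by (intro Henstock_Kurzweil_Integration.integral_cong) auto
    then show ?thesis by (simp add: G_def)
  qed
  have Ghigh: "G x = G 1" if "x > 1 - d" "0 \<le> x" for x
  proof (cases "x \<le> 1")
    case True
    have "integral {x..1} f0 = integral {x..1} (\<lambda>_. 0)"
      using f0(4) that by (intro Henstock_Kurzweil_Integration.integral_cong) auto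
    then show ?thesis using indefinite_integral_diff[OF f0i, of x 1] that True by (simp add: G_def min_absorb2)
  qed (simp add: G_def)
  \<comment> \<open>Steps of at most \<open>d / 2\<close> widen the support by no more than
    \<open>d / 2\<close>, so the averages still vanish near both end points.\<close>
  define h where "h = (\<lambda>n. d / 2 / real (Suc n))"
  have h: "0 < h n" "h n \<le> d / 2" for n
  proof -
    show "0 < h n" using f0(2) by (simp add: h_def)
    have "d / 2 / real (Suc n) \<le> d / 2 / 1" using f0(2) by (intro divide_left_mono) auto
    then show "h n \<le> d / 2" by (simp add: h_def)
  qed
  define \<phi> where "\<phi> = (\<lambda>n x. (G (x + h n) - G x) / h n)"
  have \<phi>lip: "\<bar>\<phi> n y - \<phi> n x\<bar> \<le> 2 * B / h n * \<bar>y - x\<bar>" if "x \<in> {0..1}" "y \<in> {0..1}" for n x y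
  proof -
    have "\<phi> n y - \<phi> n x = ((G (y + h n) - G (x + h n)) - (G y - G x)) / h n"
      by (simp add: \<phi>_def diff_divide_distrib)
    also have "\<bar>\<dots>\<bar> = \<bar>(G (y + h n) - G (x + h n)) - (G y - G x)\<bar> / h n" using h(1)[of n] by (simp add: abs_divide)
    also have "\<dots> \<le> (B * \<bar>y - x\<bar> + B * \<bar>y - x\<bar>) / h n"
    proof (intro divide_right_mono)
      have "\<bar>G (y + h n) - G (x + h n)\<bar> \<le> B * \<bar>y - x\<bar>" "\<bar>G y - G x\<bar> \<le> B * \<bar>y - x\<bar>"
        using Glip[of "x + h n" "y + h n"] Glip[of x y] that h(1)[of n] by auto
      then show "\<bar>(G (y + h n) - G (x + h n)) - (G y - G x)\<bar> \<le> B * \<bar>y - x\<bar> + B * \<bar>y - x\<bar>" by linarith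
    qed (use h(1)[of n] in simp)
    finally show ?thesis by simp
  qed
  have \<phi>supp: "\<phi> n x = 0" if "x \<in> {0..1}" "x \<notin> {d/2..1 - d/2}" for n x
  proof -
    have "x < d / 2 \<or> x > 1 - d" using that f0(2) by auto
    then show ?thesis
    proof
      assume "x < d / 2"
      then show ?thesis using Glow[of x] Glow[of "x + h n"] h(2)[of n] f0(2) by (simp add: \<phi>_def)
    next
      assume "x > 1 - d"
      then show ?thesis using Ghigh[of x] Ghigh[of "x + h n"] h(1)[of n] that by (simp add: \<phi>_def)
    qed
  qed
  have \<phi>B: "\<bar>\<phi> n x\<bar> \<le> B" if "x \<in> {0..1}" for n x
    using Glip[of x "x + h n"] h(1)[of n] that by (simp add: \<phi>_def abs_divide pos_divide_le_eq)
  have \<phi>L2: "L2 (\<phi> n)" for n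
    by (rule L2_continuous[OF abs_cont_on_continuous[OF Lipschitz_abs_cont_on[OF \<phi>lip]]])
  have ae: "AE x in I01. (\<lambda>n. \<phi> n x) \<longlonglongrightarrow> f0 x"
  proof -
    have "AE x in I01. x \<in> {0<..<1}" by (rule AE_I2) auto
    with indefinite_integral_AE_derivative[OF f0(1)] show ?thesis
    proof eventually_elim
      case (elim x)
      have "(G has_real_derivative f0 x) (at x)"
        by (rule has_field_derivative_transform_within_open[OF elim(1), of "{0<..<1}"]) (use elim(2) in \<open>auto simp: G_def min_absorb2\<close>)
      then have "((\<lambda>k. (G (x + k) - G x) / k) \<longlongrightarrow> f0 x) (at 0)" by (simp add: DERIV_def)
      moreover have "filterlim h (at 0) sequentially"
        unfolding filterlim_at
      proof
        have "(\<lambda>n. d / 2 / real (Suc n)) \<longlonglongrightarrow> 0"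
          using LIMSEQ_Suc[OF tendsto_divide_0[OF tendsto_const filterlim_real_at_infinity_sequentially]] .
        then show "h \<longlonglongrightarrow> 0" by (simp add: h_def[abs_def])
      qed (use h(1) in \<open>auto intro!: always_eventually simp: less_imp_neq[symmetric]\<close>)
      ultimately show ?case unfolding \<phi>_def by (rule filterlim_compose)
    qed
  qed
  have "(\<lambda>n. LINT x|I01. (\<phi> n x - f0 x)\<^sup>2) \<longlonglongrightarrow> (LINT x|I01. 0)"
  proof (rule integral_dominated_convergence[where w = "\<lambda>x. (2 * B)\<^sup>2"])
    show "AE x in I01. (\<lambda>n. (\<phi> n x - f0 x)\<^sup>2) \<longlonglongrightarrow> 0"
      using ae
    proof eventually_elim
      case (elim x)
      have "(\<lambda>n. (\<phi> n x - f0 x)\<^sup>2) \<longlonglongrightarrow> (f0 x - f0 x)\<^sup>2" by (intro tendsto_intros elim)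
      then show ?case by simp
    qed
    show "AE x in I01. norm ((\<phi> n x - f0 x)\<^sup>2) \<le> (2 * B)\<^sup>2" for n
    proof (rule AE_I2)
      fix x assume "x \<in> space I01"
      then have "\<bar>\<phi> n x - f0 x\<bar> \<le> 2 * B" using \<phi>B[of x n] f0(3)[rule_format, of x] by auto
      then have "\<bar>\<phi> n x - f0 x\<bar>\<^sup>2 \<le> (2 * B)\<^sup>2" by (intro power_mono) auto
      then show "norm ((\<phi> n x - f0 x)\<^sup>2) \<le> (2 * B)\<^sup>2" by simp
    qed
    show "integrable I01 (\<lambda>x. (2 * B)\<^sup>2)" using finite_measure.integrable_const[OF finite_measure_I01] .
    show "(\<lambda>x. (\<phi> n x - f0 x)\<^sup>2) \<in> borel_measurable I01" for n
      using L2_measurable[OF \<phi>L2[of n]] L2_measurable[OF f0(1)] by simp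
  qed simp
  then have "\<forall>\<^sub>F n in sequentially. (LINT x|I01. (\<phi> n x - f0 x)\<^sup>2) < \<epsilon> / 4"
    using order_tendstoD(2)[of _ "LINT x|I01. 0" sequentially "\<epsilon> / 4"] e by simp
  then obtain n where n: "(LINT x|I01. (\<phi> n x - f0 x)\<^sup>2) < \<epsilon> / 4"
    unfolding eventually_sequentially by blast
  have "(LINT x|I01. (\<phi> n x - f x)\<^sup>2) = (LINT x|I01. ((\<phi> n x - f0 x) + (f0 x - f x))\<^sup>2)" by simp
  also have "\<dots> \<le> 2 * (LINT x|I01. (\<phi> n x - f0 x)\<^sup>2) + 2 * (LINT x|I01. (f0 x - f x)\<^sup>2)"
    using L2_lincomb[OF \<phi>L2[of n] f0(1), of 1 "-1"] L2_lincomb[OF f0(1) f, of 1 "-1"] by (intro L2_sum_square_le) auto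
  also have "\<dots> < \<epsilon>" using n close by simp
  finally have "(LINT x|I01. (\<phi> n x - f x)\<^sup>2) < \<epsilon>" .
  then show ?thesis using \<phi>lip[of _ _ n] \<phi>supp[of _ n] f0(2)
    by (intro exI[of _ "\<phi> n"] exI[of _ "2 * B / h n"] exI[of _ "d / 2"]) auto
qed

section \<open>Building elements of the operator domain\<close>

context degenerate_coefficient
begin

text \<open>For \<open>\<mu> < 1\<close> the value at 0 is fixed, so the trace at 1 is the integral
  of \<open>D w\<close> and Cauchy-Schwarz applies with the integrable weight \<open>1/a\<close>.
  Closeness of the fluxes then controls the boundary part of the energy norm.\<close>

lemma trace_bound:
  assumes mu: "\<mu> < 1" and w: "w \<in> W1 a"
  shows "(w 1)\<^sup>2 \<le> (LINT x|I01. 1 / a x) * (LINT x|I01. a x * D w x * D w x)"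
proof -
  note wV = V1_D[OF W1_V1[OF w]]
  have ia: "integrable I01 (\<lambda>x. 1 / a x)" by (rule inverse_a_integrable[OF mu])
  have sq: "(1 / sqrt (a x))\<^sup>2 = 1 / a x" "(sqrt (a x) * D w x)\<^sup>2 = a x * D w x * D w x" if "x \<in> space I01" for x
    using a_pos[of x] that by (auto simp: power_divide power_mult_distrib less_imp_le) (auto simp: power2_eq_square)
  have L: "L2 (\<lambda>x. 1 / sqrt (a x))"
    unfolding L2_def
  proof
    have "(\<lambda>x. sqrt (a x)) \<in> borel_measurable I01" using measurable_a by measurable
    then show "(\<lambda>x. 1 / sqrt (a x)) \<in> borel_measurable I01" by simp
    show "integrable I01 (\<lambda>x. (1 / sqrt (a x))\<^sup>2)"
      using ia by (rule Bochner_Integration.integrable_cong[THEN iffD1, rotated 2]) (use sq in auto)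
  qed
  have ae: "AE x in I01. (1 / sqrt (a x)) * (sqrt (a x) * D w x) = D w x"
    using I01_ae_pos by eventually_elim simp
  have i: "integrable I01 (D w)"
    by (rule integrable_cong_AE_imp[OF L2_mult[OF L wV(3)] V1_D_measurable[OF W1_V1[OF w]] ae])
  have "(w \<longlongrightarrow> w 1 - (LINT x|I01. D w x)) (at_right 0)"
    by (rule AC01_FTC_limit[OF wV(2,4) i])
  moreover have "(w \<longlongrightarrow> 0) (at_right 0)" using w mu by (simp add: W1_def)
  ultimately have "w 1 - (LINT x|I01. D w x) = 0" by (rule tendsto_unique[rotated]) simp
  then have "w 1 = (LINT x|I01. D w x)" by simp
  also have "\<dots> = (LINT x|I01. (1 / sqrt (a x)) * (sqrt (a x) * D w x))"
  proof (rule integral_cong_AE)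
    show "AE x in I01. D w x = (1 / sqrt (a x)) * (sqrt (a x) * D w x)" using ae by eventually_elim simp
    show "(\<lambda>x. (1 / sqrt (a x)) * (sqrt (a x) * D w x)) \<in> borel_measurable I01"
      by (rule borel_measurable_integrable[OF L2_mult[OF L wV(3)]])
  qed (rule V1_D_measurable[OF W1_V1[OF w]])
  finally have "(w 1)\<^sup>2 \<le> (LINT x|I01. (1 / sqrt (a x))\<^sup>2) * (LINT x|I01. (sqrt (a x) * D w x)\<^sup>2)"
    using L2_Cauchy_Schwarz[OF L wV(3)] by simp
  also have "(LINT x|I01. (1 / sqrt (a x))\<^sup>2) = (LINT x|I01. 1 / a x)"
    by (rule Bochner_Integration.integral_cong[OF refl]) (use sq in auto)
  also have "(LINT x|I01. (sqrt (a x) * D w x)\<^sup>2) = (LINT x|I01. a x * D w x * D w x)"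
    by (rule Bochner_Integration.integral_cong[OF refl]) (use sq in auto)
  finally show ?thesis .
qed

lemma sqrt_a_deriv:
  "x \<in> {0<..1} \<Longrightarrow> ((\<lambda>x. sqrt (a x)) has_real_derivative (D a x / (2 * sqrt (a x)))) (at x within {0<..1})"
  using a_pos[of x] by (auto intro!: derivative_eq_intros a_deriv simp: field_simps)

lemma sqrt_a_Lipschitz:
  assumes "0 < c"
  shows "\<exists>L\<ge>0. \<forall>x\<in>{c..1}. \<forall>y\<in>{c..1}. \<bar>sqrt (a y) - sqrt (a x)\<bar> \<le> L * \<bar>y - x\<bar>"
proof -
  have sub: "{c..1} \<subseteq> {0<..1}" using assms by auto
  have "continuous_on {0<..1} (\<lambda>x. D a x / (2 * sqrt (a x)))"
  proof (intro continuous_intros Da_continuous)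
    show "continuous_on {0<..1} a" by (rule continuous_on_subset[OF a_continuous]) auto
    show "\<forall>x\<in>{0<..1}. 2 * sqrt (a x) \<noteq> 0" using a_pos by (metis less_irrefl mult_eq_0_iff real_sqrt_eq_zero_cancel_iff zero_neq_numeral)
  qed
  then have "compact ((\<lambda>x. D a x / (2 * sqrt (a x))) ` {c..1})"
    by (intro compact_continuous_image continuous_on_subset[OF _ sub]) auto
  from compact_imp_bounded[OF this] obtain B where B: "\<forall>x\<in>{c..1}. \<bar>D a x / (2 * sqrt (a x))\<bar> \<le> B"
    by (auto simp: bounded_iff)
  have "\<bar>sqrt (a y) - sqrt (a x)\<bar> \<le> \<bar>B\<bar> * \<bar>y - x\<bar>" if "x \<in> {c..1}" "y \<in> {c..1}" for x y
  proof -
    have "norm (sqrt (a y) - sqrt (a x)) \<le> \<bar>B\<bar> * norm (y - x)"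
    proof (rule field_differentiable_bound[of "{c..1}" "\<lambda>x. sqrt (a x)" "\<lambda>x. D a x / (2 * sqrt (a x))"])
      show "((\<lambda>x. sqrt (a x)) has_real_derivative (D a z / (2 * sqrt (a z)))) (at z within {c..1})" if "z \<in> {c..1}" for z
        by (rule has_field_derivative_subset[OF sqrt_a_deriv sub]) (use that sub in auto)
      show "norm (D a z / (2 * sqrt (a z))) \<le> \<bar>B\<bar>" if "z \<in> {c..1}" for z
        using B[rule_format, OF that] by simp
    qed (use that in auto)
    then show ?thesis by simp
  qed
  then show ?thesis by (intro exI[of _ "\<bar>B\<bar>"]) auto
qed

text \<open>The root of \<open>a\<close> need not be Lipschitz at 0, but \<open>\<phi>\<close>
  vanishes there; on \<open>[d/2, 1]\<close> both factors are Lipschitz and bounded.\<close>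

lemma weighted_Lipschitz:
  assumes d: "0 < d" and \<phi>: "\<forall>x\<in>{0..1}. \<forall>y\<in>{0..1}. \<bar>\<phi> y - \<phi> x\<bar> \<le> L * \<bar>y - x\<bar>"
    and supp: "\<forall>x\<in>{0..1}. x \<notin> {d..1 - d} \<longrightarrow> \<phi> x = 0"
  shows "\<exists>K. \<forall>x\<in>{0..1}. \<forall>y\<in>{0..1}. \<bar>sqrt (a y) * \<phi> y - sqrt (a x) * \<phi> x\<bar> \<le> K * \<bar>y - x\<bar>"
proof -
  obtain L1 where L1: "L1 \<ge> 0" "\<forall>x\<in>{d/2..1}. \<forall>y\<in>{d/2..1}. \<bar>sqrt (a y) - sqrt (a x)\<bar> \<le> L1 * \<bar>y - x\<bar>"
    using sqrt_a_Lipschitz[of "d/2"] d by auto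
  have bd: "\<exists>B\<ge>0. \<forall>x\<in>{0..1}. \<bar>f x\<bar> \<le> B" if "continuous_on {0..1} f" for f :: "real \<Rightarrow> real"
  proof -
    have "compact (f ` {0..1})" using that by (intro compact_continuous_image) auto
    from compact_imp_bounded[OF this] obtain B where "\<forall>x\<in>{0..1}. \<bar>f x\<bar> \<le> B" by (auto simp: bounded_iff)
    then show ?thesis by (intro exI[of _ "\<bar>B\<bar>"]) force
  qed
  have "continuous_on {0..1} \<phi>"
    by (rule abs_cont_on_continuous[OF Lipschitz_abs_cont_on[of \<phi> L]]) (use \<phi> in blast)
  then obtain B1 where B1: "B1 \<ge> 0" "\<forall>x\<in>{0..1}. \<bar>\<phi> x\<bar> \<le> B1" using bd by blast
  have "continuous_on {0..1} (\<lambda>x. sqrt (a x))" by (intro continuous_intros a_continuous)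
  then obtain B2 where B2: "B2 \<ge> 0" "\<forall>x\<in>{0..1}. \<bar>sqrt (a x)\<bar> \<le> B2" using bd by blast
  define K where "K = L1 * B1 + B2 * \<bar>L\<bar>"
  have ordered: "\<bar>sqrt (a y) * \<phi> y - sqrt (a x) * \<phi> x\<bar> \<le> K * \<bar>y - x\<bar>" if xy: "x \<in> {0..1}" "y \<in> {0..1}" "x \<le> y" for x y
  proof (cases "x < d / 2")
    case False
    then have r: "x \<in> {d/2..1}" "y \<in> {d/2..1}" using xy by auto
    have "sqrt (a y) * \<phi> y - sqrt (a x) * \<phi> x = (sqrt (a y) - sqrt (a x)) * \<phi> y + sqrt (a x) * (\<phi> y - \<phi> x)"
      by (simp add: algebra_simps)
    then have "\<bar>sqrt (a y) * \<phi> y - sqrt (a x) * \<phi> x\<bar> \<le> \<bar>sqrt (a y) - sqrt (a x)\<bar> * \<bar>\<phi> y\<bar> + \<bar>sqrt (a x)\<bar> * \<bar>\<phi> y - \<phi> x\<bar>"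
      by (metis abs_mult abs_triangle_ineq)
    also have "\<dots> \<le> (L1 * \<bar>y - x\<bar>) * B1 + B2 * (\<bar>L\<bar> * \<bar>y - x\<bar>)"
    proof (intro add_mono mult_mono)
      show "\<bar>sqrt (a y) - sqrt (a x)\<bar> \<le> L1 * \<bar>y - x\<bar>" using L1(2) r by blast
      show "\<bar>\<phi> y\<bar> \<le> B1" "\<bar>sqrt (a x)\<bar> \<le> B2" using B1 B2 xy by blast+
      have "\<bar>\<phi> y - \<phi> x\<bar> \<le> L * \<bar>y - x\<bar>" using \<phi> xy by blast
      also have "\<dots> \<le> \<bar>L\<bar> * \<bar>y - x\<bar>" by (intro mult_right_mono) auto
      finally show "\<bar>\<phi> y - \<phi> x\<bar> \<le> \<bar>L\<bar> * \<bar>y - x\<bar>" .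
    qed (use L1(1) B2(1) in auto)
    finally show ?thesis by (simp add: K_def algebra_simps)
  next
    case True
    then have x0: "\<phi> x = 0" using supp xy d by auto
    have "\<bar>sqrt (a y) * \<phi> y\<bar> = \<bar>sqrt (a y)\<bar> * \<bar>\<phi> y - \<phi> x\<bar>" using x0 by (simp add: abs_mult)
    also have "\<dots> \<le> B2 * (\<bar>L\<bar> * \<bar>y - x\<bar>)"
    proof (intro mult_mono)
      show "\<bar>sqrt (a y)\<bar> \<le> B2" using B2 xy by blast
      have "\<bar>\<phi> y - \<phi> x\<bar> \<le> L * \<bar>y - x\<bar>" using \<phi> xy by blast
      also have "\<dots> \<le> \<bar>L\<bar> * \<bar>y - x\<bar>" by (intro mult_right_mono) auto
      finally show "\<bar>\<phi> y - \<phi> x\<bar> \<le> \<bar>L\<bar> * \<bar>y - x\<bar>" .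
    qed (use B2 in auto)
    also have "\<dots> \<le> K * \<bar>y - x\<bar>" using L1(1) B1(1) by (simp add: K_def distrib_right)
    finally show ?thesis using x0 by simp
  qed
  have "\<bar>sqrt (a y) * \<phi> y - sqrt (a x) * \<phi> x\<bar> \<le> K * \<bar>y - x\<bar>" if "x \<in> {0..1}" "y \<in> {0..1}" for x y
    using ordered[of x y] ordered[of y x] that by (cases "x \<le> y") (auto simp: abs_minus_commute)
  then show ?thesis by blast
qed

text \<open>Prescribing \<open>sqrt a * u' = \<phi>\<close> makes the flux
  \<open>sqrt a * \<phi>\<close> Lipschitz, hence an element of \<open>H1\<close>, and gives
  \<open>u'(1) = 0\<close>. The constant of integration is free for \<open>\<mu> \<ge> 1\<close>,
  where it matches the trace exactly; for \<open>\<mu> < 1\<close> the condition at 0 forces it to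
  be 0.\<close>

lemma domain_first_component:
  assumes d: "0 < d" and \<phi>: "\<forall>x\<in>{0..1}. \<forall>y\<in>{0..1}. \<bar>\<phi> y - \<phi> x\<bar> \<le> L * \<bar>y - x\<bar>"
    and supp: "\<forall>x\<in>{0..1}. x \<notin> {d..1 - d} \<longrightarrow> \<phi> x = 0"
  shows "\<exists>u\<in>W2 a. D u 1 = 0 \<and> (\<forall>x\<in>{0<..<1}. sqrt (a x) * D u x = \<phi> x) \<and> (1 \<le> \<mu> \<longrightarrow> u 1 = c)"
proof -
  define k where "k = (\<lambda>x. \<phi> x / sqrt (a x))"
  have \<phi>c: "continuous_on {0..1} \<phi>"
    by (rule abs_cont_on_continuous[OF Lipschitz_abs_cont_on[of \<phi> L]]) (use \<phi> in blast)
  have ac: "continuous_on {0<..1} a" by (rule continuous_on_subset[OF a_continuous]) auto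
  have kc': "continuous_on {0<..1} k"
    unfolding k_def
  proof (intro continuous_intros ac)
    show "continuous_on {0<..1} \<phi>" by (rule continuous_on_subset[OF \<phi>c]) auto
    show "\<forall>x\<in>{0<..1}. sqrt (a x) \<noteq> 0" using a_pos by (metis less_irrefl real_sqrt_eq_zero_cancel_iff)
  qed
  define e where "e = min (d / 2) 1"
  have e: "0 < e" "e < d" "e \<le> 1" using d by (auto simp: e_def)
  have "continuous_on ({0..e} \<union> {e..1}) k"
  proof (rule continuous_on_closed_Un)
    have "k x = 0" if "x \<in> {0..e}" for x using supp that e by (auto simp: k_def)
    then show "continuous_on {0..e} k"
      by (intro continuous_on_eq[OF continuous_on_const[of _ 0]]) simp
    show "continuous_on {e..1} k" by (rule continuous_on_subset[OF kc']) (use e in auto)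
  qed auto
  moreover have "{0..e} \<union> {e..1} = {0..1}" using e by auto
  ultimately have kc: "continuous_on {0..1} k" by simp
  have ki: "integrable I01 k" by (rule L2_integrable[OF L2_continuous[OF kc]])
  define C where "C = (if 1 \<le> \<mu> then c - integral {0..1} k else 0)"
  define u where "u = (\<lambda>x. C + integral {0..x} k)"
  have du: "(u has_real_derivative k x) (at x within {0<..1})" if "x \<in> {0<..1}" for x
    unfolding u_def using indefinite_integral_deriv[OF ki kc' that] by (auto intro!: derivative_eq_intros)
  have Du: "D u x = k x" if "x \<in> {0<..1}" for x using D_eq[OF du[OF that] that] .
  have sD: "sqrt (a x) * D u x = \<phi> x" if "x \<in> {0<..1}" for x
    using Du[OF that] a_pos[OF that] by (simp add: k_def)
  have "continuous_on {0..1} u" unfolding u_def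
    by (intro continuous_intros indefinite_integral_continuous_1 integrable_on_I01_subinterval ki) auto
  then have uL: "L2 u" by (rule L2_continuous)
  have uV: "u \<in> V1 a"
    unfolding V1_iff
  proof (intro conjI uL)
    show "AC01 u" by (rule AC01_C1[OF du kc'])
    show "L2 (\<lambda>x. sqrt (a x) * D u x)"
      by (rule L2_cong_AE[OF L2_continuous[OF \<phi>c]]) (use sD in \<open>auto intro!: AE_I2\<close>)
  qed
  have lim: "(u \<longlongrightarrow> C + 0) (at_right 0)"
    unfolding u_def by (intro tendsto_intros indefinite_integral_at_right_0 ki)
  have uW: "u \<in> W1 a" using uV lim by (auto simp: W1_def C_def)
  obtain K where K: "\<forall>x\<in>{0..1}. \<forall>y\<in>{0..1}. \<bar>sqrt (a y) * \<phi> y - sqrt (a x) * \<phi> x\<bar> \<le> K * \<bar>y - x\<bar>"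
    using weighted_Lipschitz[OF d \<phi> supp] by blast
  have wd: "weak_deriv (\<lambda>x. sqrt (a x) * \<phi> x) (D (\<lambda>x. sqrt (a x) * \<phi> x))"
    by (rule Lipschitz_weak_deriv) (use K in blast)
  have wL: "L2 (\<lambda>x. sqrt (a x) * \<phi> x)"
    by (rule L2_continuous) (intro continuous_intros a_continuous \<phi>c)
  have eq: "a x * D u x = sqrt (a x) * \<phi> x" if "x \<in> {0<..<1}" for x
  proof -
    have x: "x \<in> {0<..1}" using that by auto
    have "a x * D u x = sqrt (a x) * (sqrt (a x) * D u x)" using a_pos[OF x] by (simp add: mult.assoc[symmetric])
    then show ?thesis using sD[OF x] by simp
  qed
  have "weak_deriv (\<lambda>x. a x * D u x) (D (\<lambda>x. sqrt (a x) * \<phi> x))"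
    unfolding weak_deriv_def
  proof (intro conjI allI impI)
    show "L2 (D (\<lambda>x. sqrt (a x) * \<phi> x))" using wd by (simp add: weak_deriv_def)
    fix \<psi> assume t: "test_fun \<psi>"
    have "(LINT x|I01. a x * D u x * deriv \<psi> x) = (LINT x|I01. sqrt (a x) * \<phi> x * deriv \<psi> x)"
      by (intro Bochner_Integration.integral_cong refl) (use eq in simp)
    then show "(LINT x|I01. a x * D u x * deriv \<psi> x) = - (LINT x|I01. D (\<lambda>x. sqrt (a x) * \<phi> x) x * \<psi> x)"
      using wd t unfolding weak_deriv_def by simp
  qed
  moreover have "L2 (\<lambda>x. a x * D u x)"
    by (rule L2_cong_AE[OF wL]) (use eq in \<open>auto intro!: AE_I2\<close>)
  ultimately have "u \<in> W2 a" using uW by (auto simp: W2_def H1_def)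
  moreover have "D u 1 = 0" using Du[of 1] supp d by (auto simp: k_def)
  moreover have "u 1 = c" if "1 \<le> \<mu>" using that by (simp add: u_def C_def)
  ultimately show ?thesis using sD by (intro bexI[of _ u]) auto
qed

text \<open>The power carries the value at 1 that the boundary condition prescribes. Its exponent is
  positive, so that the sum also vanishes at 0.\<close>

lemma domain_second_component:
  assumes d: "0 < d" and \<phi>: "\<forall>x\<in>{0..1}. \<forall>y\<in>{0..1}. \<bar>\<phi> y - \<phi> x\<bar> \<le> L * \<bar>y - x\<bar>"
    and supp: "\<forall>x\<in>{0..1}. x \<notin> {d..1 - d} \<longrightarrow> \<phi> x = 0"
  shows "(\<lambda>x. \<phi> x + c * x ^ Suc n) \<in> W1 a"
proof -
  let ?v = "\<lambda>x. \<phi> x + c * x ^ Suc n"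
  have "abs_cont_on 0 1 \<phi>" by (rule Lipschitz_abs_cont_on[of \<phi> L]) (use \<phi> in blast)
  moreover have pw: "abs_cont_on 0 1 (\<lambda>x. c * x ^ Suc n)"
    by (rule abs_cont_on_C1[where f' = "\<lambda>x. c * (real (Suc n) * x ^ n)"])
       (auto intro!: derivative_eq_intros continuous_intros simp del: power_Suc of_nat_Suc)
  ultimately have ac: "abs_cont_on 0 1 ?v" by (rule abs_cont_on_add)
  have D1: "L2 (D \<phi>)" by (rule Lipschitz_L2_D[of \<phi> L]) (use \<phi> in blast)
  have D2: "L2 (\<lambda>x. c * (real (Suc n) * x ^ n))" by (rule L2_continuous) (intro continuous_intros)
  have "AE x in I01. D \<phi> x + c * (real (Suc n) * x ^ n) = D ?v x"
    using AC01_AE_D[OF abs_cont_on_imp_AC01[OF \<open>abs_cont_on 0 1 \<phi>\<close>]] I01_ae_pos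
  proof eventually_elim
    case (elim x)
    have "((\<lambda>x. c * x ^ Suc n) has_real_derivative (c * (real (Suc n) * x ^ n))) (at x)"
      by (auto intro!: derivative_eq_intros simp del: power_Suc of_nat_Suc)
    from DERIV_add[OF elim(1) this] show ?case using elim(2) by (intro D_eq_at[symmetric]) auto
  qed
  then have Dv: "L2 (D ?v)" using L2_cong_AE[OF L2_lincomb[OF D1 D2, of 1 1]] by simp
  have "compact (a ` {0..1})" using a_continuous by (intro compact_continuous_image) auto
  from compact_imp_bounded[OF this] obtain B where B: "\<forall>x\<in>{0..1}. \<bar>a x\<bar> \<le> B" by (auto simp: bounded_iff)
  have "(\<lambda>x. sqrt (a x)) \<in> borel_measurable I01" using measurable_a by measurable
  then have "L2 (\<lambda>x. sqrt (a x) * D ?v x)"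
  proof (rule L2_bounded_mult[OF Dv])
    show "AE x in I01. \<bar>sqrt (a x)\<bar> \<le> sqrt B"
    proof (rule AE_I2)
      fix x assume "x \<in> space I01"
      then have x: "x \<in> {0<..1}" "x \<in> {0..1}" by auto
      have "\<bar>a x\<bar> \<le> B" using B x(2) by blast
      then show "\<bar>sqrt (a x)\<bar> \<le> sqrt B" using a_pos[OF x(1)] by simp
    qed
  qed
  then have "?v \<in> V1 a"
    unfolding V1_iff using abs_cont_on_imp_AC01[OF ac] L2_continuous[OF abs_cont_on_continuous[OF ac]] by simp
  moreover have "?v 0 = 0" using supp d by simp
  then have "(?v \<longlongrightarrow> 0) (at_right 0)" using abs_cont_on_at_right_0[OF ac] by simp
  ultimately show ?thesis by (simp add: W1_def)
qed

text \<open>High powers have a fixed value at 1 but a small L2 norm: prescribing \<open>v(1)\<close>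
  costs nothing in the energy norm.\<close>

lemma power_L2_small:
  assumes "\<epsilon> > 0"
  shows "\<exists>n. (LINT x|I01. (c * x ^ Suc n)\<^sup>2) < \<epsilon>"
proof -
  have "(\<lambda>n. LINT x|I01. (c * x ^ Suc n)\<^sup>2) \<longlonglongrightarrow> (LINT x|I01. 0)"
  proof (rule integral_dominated_convergence[where w = "\<lambda>x. c\<^sup>2"])
    show "(\<lambda>x. (c * x ^ Suc n)\<^sup>2) \<in> borel_measurable I01" for n
      by (rule continuous_measurable_I01) (intro continuous_intros)
    show "integrable I01 (\<lambda>x. c\<^sup>2)" using finite_measure.integrable_const[OF finite_measure_I01] .
    show "AE x in I01. (\<lambda>n. (c * x ^ Suc n)\<^sup>2) \<longlonglongrightarrow> 0"
    proof (rule AE_I2)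
      fix x assume "x \<in> space I01"
      then have "norm x < 1" by auto
      from LIMSEQ_Suc[OF LIMSEQ_power_zero[OF this]] have "(\<lambda>n. (c * x ^ Suc n)\<^sup>2) \<longlonglongrightarrow> (c * 0)\<^sup>2"
        by (intro tendsto_intros)
      then show "(\<lambda>n. (c * x ^ Suc n)\<^sup>2) \<longlonglongrightarrow> 0" by simp
    qed
    show "AE x in I01. norm ((c * x ^ Suc n)\<^sup>2) \<le> c\<^sup>2" for n
    proof (rule AE_I2)
      fix x assume "x \<in> space I01"
      then have x: "0 \<le> x" "x \<le> 1" by auto
      have "(x ^ Suc n)\<^sup>2 \<le> 1" using power_le_one[OF x, of "Suc n"] x by (intro power_le_one) auto
      then show "norm ((c * x ^ Suc n)\<^sup>2) \<le> c\<^sup>2" by (simp add: power_mult_distrib mult_left_le del: power_Suc)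
    qed
  qed simp
  then have "\<forall>\<^sub>F n in sequentially. (LINT x|I01. (c * x ^ Suc n)\<^sup>2) < \<epsilon>"
    using order_tendstoD(2)[of _ "LINT x|I01. 0" sequentially \<epsilon>] assms by simp
  then show ?thesis unfolding eventually_sequentially by blast
qed

end

context damped_wave
begin

text \<open>The two components are approximated independently, the first through its weighted
  derivative. Since \<open>u'(1) = 0\<close>, the coupling condition becomes
  \<open>v(1) = - \<beta> u(1)\<close>, which the power term supplies.\<close>

theorem domain_dense:
  assumes U: "U \<in> Hsp a" and e: "\<epsilon> > 0"
  shows "\<exists>W\<in>domA a \<beta>. nH (lincomb 1 W (-1) U) < \<epsilon>"
proof -
  \<comment> \<open>The constant of the trace estimate; it is 0 for \<open>\<mu> \<ge> 1\<close>,
    where the traces are made equal.\<close>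
  define T where "T = (if \<mu> < 1 then (LINT x|I01. 1 / a x) else 0)"
  have T: "T \<ge> 0"
  proof -
    have "0 \<le> (LINT x|I01. 1 / a x)" by (rule integral_nonneg_AE) (use I01_ae_pos in eventually_elim, simp)
    then show ?thesis by (simp add: T_def)
  qed
  \<comment> \<open>The elastic error and the boundary error together are at most
    \<open>(1 + \<beta> a(1) T) \<delta>\<close>, which is half of the square of
    \<open>\<epsilon>\<close>. The other half is left to the velocity: two errors of one eighth
    each, doubled by the estimate of the squared sum.\<close>
  define \<delta> where "\<delta> = \<epsilon>\<^sup>2 / (2 * (1 + \<beta> * a 1 * T))"
  have den: "1 + \<beta> * a 1 * T > 0" using beta a1_pos T by (intro add_pos_nonneg) auto
  have \<delta>: "\<delta> > 0" using den e by (simp add: \<delta>_def)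
  have uL: "L2 (\<lambda>x. sqrt (a x) * D (fst U) x)" and vL: "L2 (snd U)"
    using V1_D(3)[OF Hsp_V1[OF U]] U by (auto simp: Hsp_iff)
  obtain \<phi> L d where \<phi>: "0 < d" "\<forall>x\<in>{0..1}. \<forall>y\<in>{0..1}. \<bar>\<phi> y - \<phi> x\<bar> \<le> L * \<bar>y - x\<bar>"
    "\<forall>x\<in>{0..1}. x \<notin> {d..1 - d} \<longrightarrow> \<phi> x = 0" "(LINT x|I01. (\<phi> x - sqrt (a x) * D (fst U) x)\<^sup>2) < \<delta>"
    using L2_approx_Lipschitz[OF uL \<delta>] by (elim exE conjE) (rule that)
  have "\<epsilon>\<^sup>2 / 8 > 0" using e by simp
  obtain \<psi> L' d' where \<psi>: "0 < d'" "\<forall>x\<in>{0..1}. \<forall>y\<in>{0..1}. \<bar>\<psi> y - \<psi> x\<bar> \<le> L' * \<bar>y - x\<bar>"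
    "\<forall>x\<in>{0..1}. x \<notin> {d'..1 - d'} \<longrightarrow> \<psi> x = 0" "(LINT x|I01. (\<psi> x - snd U x)\<^sup>2) < \<epsilon>\<^sup>2 / 8"
    using L2_approx_Lipschitz[OF vL \<open>\<epsilon>\<^sup>2 / 8 > 0\<close>] by (elim exE conjE) (rule that)
  obtain u where u: "u \<in> W2 a" "D u 1 = 0" "\<forall>x\<in>{0<..<1}. sqrt (a x) * D u x = \<phi> x" "1 \<le> \<mu> \<longrightarrow> u 1 = fst U 1"
    using domain_first_component[OF \<phi>(1-3), of "fst U 1"] by blast
  define c where "c = - \<beta> * u 1"
  obtain n where n: "(LINT x|I01. (c * x ^ Suc n)\<^sup>2) < \<epsilon>\<^sup>2 / 8" using power_L2_small[OF \<open>\<epsilon>\<^sup>2 / 8 > 0\<close>] by blast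
  define v where "v = (\<lambda>x. \<psi> x + c * x ^ Suc n)"
  have v: "v \<in> W1 a" unfolding v_def by (rule domain_second_component[OF \<psi>(1-3)])
  have "\<psi> 1 = 0" using \<psi>(1,3) by auto
  then have "(u, v) \<in> domA a \<beta>" using u v by (simp add: domA_def v_def c_def)
  moreover have "nH (lincomb 1 (u, v) (-1) U) < \<epsilon>"
  proof -
    let ?W = "lincomb 1 (u, v) (-1) U"
    have WH: "?W \<in> Hsp a" using domA_Hsp[OF \<open>(u, v) \<in> domA a \<beta>\<close>] U by (rule Hsp_lincomb)
    let ?w = "fst ?W"
    have wW: "?w \<in> W1 a" using WH by (simp add: Hsp_iff)
    have uV: "u \<in> V1 a" using u(1) by (simp add: W2_def W1_V1)
    have Q: "(LINT x|I01. a x * D ?w x * D ?w x) < \<delta>"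
    proof -
      have "AE x in I01. x \<in> {0<..<1}" by (rule AE_I2) auto
      then have "AE x in I01. a x * D ?w x * D ?w x = (\<phi> x - sqrt (a x) * D (fst U) x)\<^sup>2"
        using D_lincomb_AE[OF uV Hsp_V1[OF U], of 1 "-1"] I01_ae_pos
      proof eventually_elim
        case (elim x)
        then have "\<phi> x - sqrt (a x) * D (fst U) x = sqrt (a x) * D ?w x"
          using u(3)[rule_format, of x, symmetric] by (simp add: lincomb_def flip: right_diff_distrib)
        then show ?case using elim(3) by (simp add: power_mult_distrib) (simp add: power2_eq_square)
      qed
      then have "(LINT x|I01. a x * D ?w x * D ?w x) = (LINT x|I01. (\<phi> x - sqrt (a x) * D (fst U) x)\<^sup>2)"
      proof (rule integral_cong_AE[rotated 2])
        show "(\<lambda>x. a x * D ?w x * D ?w x) \<in> borel_measurable I01"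
          using measurable_a V1_D_measurable[OF W1_V1[OF wW]] by simp
        have "\<phi> \<in> borel_measurable I01"
          by (rule L2_measurable[OF L2_continuous[OF abs_cont_on_continuous[OF Lipschitz_abs_cont_on[of \<phi> L]]]]) (use \<phi>(2) in blast)
        then show "(\<lambda>x. (\<phi> x - sqrt (a x) * D (fst U) x)\<^sup>2) \<in> borel_measurable I01"
          using L2_measurable[OF uL] by simp
      qed
      then show ?thesis using \<phi>(4) by simp
    qed
    have W1: "(?w 1)\<^sup>2 \<le> T * \<delta>"
    proof (cases "\<mu> < 1")
      case True
      then have "(?w 1)\<^sup>2 \<le> T * (LINT x|I01. a x * D ?w x * D ?w x)" using trace_bound[OF True wW] by (simp add: T_def)
      also have "\<dots> \<le> T * \<delta>" using Q T by (intro mult_left_mono) auto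
      finally show ?thesis .
    next
      case False
      then show ?thesis using u(4) by (simp add: lincomb_def T_def)
    qed
    have P: "(LINT x|I01. (snd ?W x)\<^sup>2) < \<epsilon>\<^sup>2 / 2"
    proof -
      have "continuous_on {0..1} \<psi>"
        by (rule abs_cont_on_continuous[OF Lipschitz_abs_cont_on[of \<psi> L']]) (use \<psi>(2) in blast)
      then have "L2 (\<lambda>x. \<psi> x - snd U x)" using L2_lincomb[OF L2_continuous vL, of \<psi> 1 "-1"] by simp
      moreover have "L2 (\<lambda>x. c * x ^ Suc n)" by (rule L2_continuous) (intro continuous_intros)
      ultimately have "(LINT x|I01. ((\<psi> x - snd U x) + c * x ^ Suc n)\<^sup>2) \<le>
          2 * (LINT x|I01. (\<psi> x - snd U x)\<^sup>2) + 2 * (LINT x|I01. (c * x ^ Suc n)\<^sup>2)" by (rule L2_sum_square_le)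
      also have "\<dots> < \<epsilon>\<^sup>2 / 2" using \<psi>(4) n by simp
      also have "(\<lambda>x. ((\<psi> x - snd U x) + c * x ^ Suc n)\<^sup>2) = (\<lambda>x. (snd ?W x)\<^sup>2)"
        by (simp add: lincomb_def v_def algebra_simps)
      finally show ?thesis .
    qed
    have "\<beta> * a 1 * (?w 1)\<^sup>2 \<le> \<beta> * a 1 * (T * \<delta>)" using W1 beta a1_pos by (intro mult_left_mono) auto
    then have "ip ?W ?W < \<epsilon>\<^sup>2 / 2 + \<delta> + \<beta> * a 1 * (T * \<delta>)" using energy_parts[OF WH] P Q by linarith
    also have "\<dots> = \<epsilon>\<^sup>2 / 2 + (1 + \<beta> * a 1 * T) * \<delta>" by (simp add: algebra_simps)
    also have "(1 + \<beta> * a 1 * T) * \<delta> = \<epsilon>\<^sup>2 / 2"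
      unfolding \<delta>_def using den by (simp add: field_simps)
    finally have "(nH ?W)\<^sup>2 < \<epsilon>\<^sup>2" by (simp add: normH_square)
    then show ?thesis using e by (rule power2_less_imp_less[OF _ less_imp_le])
  qed
  ultimately show ?thesis by blast
qed

end

subsection \<open>Exponential decay\<close>

text \<open>Young's inequality with the weight that spends \<open>d / 8\<close> of the energy form,
  half of the available rate \<open>d / 4\<close>.\<close>

lemma weighted_product_bound:
  fixes d A P R y :: real
  assumes "d > 0" "A > 0" "R\<^sup>2 \<le> A * P"
  shows "\<eta> / 2 * y * R \<le> d / 8 * P + A * \<eta>\<^sup>2 / (2 * d) * y\<^sup>2"
proof -
  have "d / (8 * A) * (R - 2 * A * \<eta> * y / d)\<^sup>2 = d / (8 * A) * R\<^sup>2 + A * \<eta>\<^sup>2 / (2 * d) * y\<^sup>2 - \<eta> / 2 * y * R"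
    using assms(1,2) by (simp add: field_simps power2_eq_square)
  moreover have "0 \<le> d / (8 * A) * (R - 2 * A * \<eta> * y / d)\<^sup>2" using assms(1,2) by simp
  moreover have "d / (8 * A) * R\<^sup>2 \<le> d / (8 * A) * (A * P)" using assms by (intro mult_left_mono) auto
  moreover have "d / (8 * A) * (A * P) = d / 8 * P" using assms(2) by simp
  ultimately show ?thesis by linarith
qed

lemma exp_half_square: "(exp (x / 2))\<^sup>2 = exp x" for x :: real
  by (simp flip: exp_double)

text \<open>Makes the constant \<open>M\<close> large enough also for negative \<open>eta2\<close>, whose last summand lowers \<open>M\<close>.\<close>

lemma decay_constant_nonneg:
  fixes e d \<alpha> \<beta> :: real
  assumes "0 < d" "d \<le> 2" "0 < \<alpha>" "0 < \<beta>"
  shows "0 \<le> 2 + e\<^sup>2 * (1 + 1 / \<beta>^3) / d * (1 + 1 / (\<beta> * \<alpha>)) + 2 * e / (\<beta> * sqrt \<alpha>)"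
proof -
  define p where "p = 1 + 1 / \<beta>^3"
  define w where "w = e / sqrt \<alpha>"
  have p: "p > 1" using assms by (simp add: p_def)
  \<comment> \<open>Either factor may be the small one: for \<open>\<beta> < 1\<close> it is the
    term \<open>1/\<beta>^3\<close> in \<open>p\<close> that helps.\<close>
  have bp: "\<beta> * p \<ge> 1"
  proof (cases "\<beta> \<ge> 1")
    case True
    then show ?thesis using mult_mono[of 1 \<beta> 1 p] p by simp
  next
    case False
    then have "\<beta>\<^sup>2 \<le> 1" using assms by (intro power_le_one) auto
    then have "1 \<le> 1 / \<beta>\<^sup>2" using assms by simp
    moreover have "\<beta> * p = \<beta> + 1 / \<beta>\<^sup>2" using assms by (simp add: p_def field_simps power2_eq_square power3_eq_cube)
    ultimately show ?thesis using assms by linarith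
  qed
  \<comment> \<open>Completing the square in \<open>w\<close> leaves the defect
    \<open>d / (\<beta> p)\<close>, which is at most \<open>d \<le> 2\<close> and is paid by the
    summand 2.\<close>
  have "p / d * (w + d / p)\<^sup>2 / \<beta> = w\<^sup>2 * p / d / \<beta> + 2 * w / \<beta> + d / (\<beta> * p)"
    using assms p by (simp add: field_simps power2_eq_square)
  moreover have "0 \<le> p / d * (w + d / p)\<^sup>2 / \<beta>" using assms p by simp
  moreover have "d / (\<beta> * p) \<le> d / 1" using assms p bp by (intro divide_left_mono) auto
  ultimately have "0 \<le> 2 + w\<^sup>2 * p / d / \<beta> + 2 * w / \<beta>" using assms by linarith
  moreover have "w\<^sup>2 * p / d / \<beta> = e\<^sup>2 * p / d * (1 / (\<beta> * \<alpha>))"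
    using assms by (simp add: w_def power_divide mult_ac)
  moreover have "e\<^sup>2 * p / d * (1 / (\<beta> * \<alpha>)) \<le> e\<^sup>2 * p / d * (1 + 1 / (\<beta> * \<alpha>))"
    using assms p by (intro mult_left_mono) auto
  moreover have "2 * w / \<beta> = 2 * e / (\<beta> * sqrt \<alpha>)" by (simp add: w_def mult_ac)
  ultimately show ?thesis unfolding p_def by linarith
qed

context damped_wave
begin

section \<open>The size of the constant \<open>M\<close>\<close>

lemma C2_ge_2: "C2 a \<beta> \<ge> 2"
proof -
  have "1 + \<mu> / 4 \<le> Max {1 + \<mu> / 4, 1 / a 1 + \<mu> / 4 * C1 a, \<mu> / (2 * \<beta> * a 1)}" by (rule Max_ge) auto
  then show ?thesis using mu_nonneg by (simp add: C2_def)
qed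

lemma eta1_pos: "eta1 a / a 1 > 0"
  using a1_pos by (simp add: eta1_def)

lemma M_eq:
  "(2 - \<mu>) / 2 * M a \<beta> = 2 * C2 a \<beta> + eta1 a / a 1 + (eta2 a \<beta>)\<^sup>2 * damping_factor / (2 - \<mu>)
      + 2 * eta2 a \<beta> / (\<beta> * sqrt (alpha a \<beta>))"
proof -
  have "(2 - \<mu>) / 2 * (2 / (2 - \<mu>) * X) = X" for X using mu_less_2 by simp
  then show ?thesis unfolding M_def damping_factor_def by (simp only: mult.assoc times_divide_eq_left)
qed

text \<open>One of the two copies of \<open>C2\<close> in \<open>M\<close> is at least 2 and
  compensates for the possibly negative last summand.\<close>

lemma M_lower_bound: "C2 a \<beta> + eta1 a / (2 * a 1) \<le> (2 - \<mu>) / 2 * M a \<beta>"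
proof -
  have "0 \<le> 2 + (eta2 a \<beta>)\<^sup>2 * damping_factor / (2 - \<mu>) + 2 * eta2 a \<beta> / (\<beta> * sqrt (alpha a \<beta>))"
    using decay_constant_nonneg[of "2 - \<mu>" "alpha a \<beta>" \<beta> "eta2 a \<beta>"] mu_less_2 mu_nonneg alpha_pos beta
    by (simp add: damping_factor_def mult.assoc)
  moreover have "eta1 a / (2 * a 1) \<le> eta1 a / a 1" using eta1_pos by simp
  ultimately show ?thesis unfolding M_eq using C2_ge_2 by linarith
qed

lemma M_pos: "M a \<beta> > 0"
proof -
  have "0 < (2 - \<mu>) / 2 * M a \<beta>" using M_lower_bound C2_ge_2 eta1_pos by simp
  then show ?thesis using mu_less_2 by (simp add: zero_less_mult_iff)
qed

lemma damping_factor_pos: "damping_factor > 0"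
  unfolding damping_factor_def using beta alpha_pos by (intro mult_pos_pos add_pos_pos) auto

end

context damped_wave_semigroup
begin

text \<open>Choice of \<open>\<eta>\<close> according to the sign of \<open>eta2\<close>. For
  \<open>eta2 \<ge> 0\<close> the trace term vanishes and half of the rate goes to Young's
  inequality, so \<open>\<kappa> = d / 4\<close>. For \<open>eta2 < 0\<close> the trace term has the
  right sign with \<open>\<eta> = 0\<close>, no product is to be split, and the full rate
  \<open>\<kappa> = d / 2\<close> remains.\<close>

lemma domain_decay:
  assumes W: "W \<in> domA a \<beta>" and t: "t \<ge> M a \<beta>"
  shows "ip (S t W) (S t W) \<le> ip W W * exp (1 - t / M a \<beta>)"
proof -
  obtain \<zeta> where z: "\<zeta> \<in> W1 a" "0 \<le> \<zeta> 1" "\<zeta> 1 \<le> 1 / \<beta>"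
    "(LINT x|I01. (\<zeta> x)\<^sup>2) \<le> a 1 / (alpha a \<beta> * \<beta>)"
    "\<forall>u\<in>W2 a. (LINT x|I01. \<zeta> x * wD (\<lambda>x. a x * D u x) x) = \<zeta> 1 * a 1 * (D u 1 + \<beta> * u 1) - a 1 * u 1"
    by (rule profile_properties)
  have zL: "L2 \<zeta>" by (rule V1_D(1)[OF W1_V1[OF z(1)]])
  note inequality = Lyapunov_inequality[OF z]
  define d where "d = 2 - \<mu>"
  have d: "d > 0" using mu_less_2 by (simp add: d_def)
  show ?thesis
  proof (cases "eta2 a \<beta> \<ge> 0")
    case True
    define \<eta> where "\<eta> = eta2 a \<beta>"
    define A where "A = a 1 * damping_factor"
    have A: "A > 0" using a1_pos damping_factor_pos by (simp add: A_def)
    obtain K where K: "bounded_form (multiplier_form \<eta> \<zeta>) K" using multiplier_form_bounded[OF zL] .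
    \<comment> \<open>Coefficient of \<open>a(1) v(1)^2\<close>: the part from \<open>eta1\<close>
      and the price of Young's inequality.\<close>
    let ?c = "eta1 a / (2 * a 1) + \<eta>\<^sup>2 * damping_factor / (2 * d)"
    let ?B = "C2 a \<beta> / 2 + \<eta> / (2 * \<beta> * sqrt (alpha a \<beta>))"
    show ?thesis
    proof (rule Lyapunov_decay[OF K _ _ _ _ M_pos _ W t])
      show "\<bar>multiplier_form \<eta> \<zeta> V V\<bar> \<le> ?B * (ip V V / 2)" if "V \<in> Hsp a" for V
        using True that by (intro multiplier_form_energy_bound zL z(4)) (simp add: \<eta>_def)
      show "multiplier_form \<eta> \<zeta> V (opA a V) + multiplier_form \<eta> \<zeta> (opA a V) V \<le>
          - (d / 4) * (ip V V / 2) + ?c * (a 1 * (snd V 1)\<^sup>2)" if V: "V \<in> domA a \<beta>" for V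
      proof -
        have "0 \<le> \<eta>" using True by (simp add: \<eta>_def)
        from inequality[OF this V] obtain R where R: "R\<^sup>2 \<le> A * ip V V"
          "multiplier_form \<eta> \<zeta> V (opA a V) + multiplier_form \<eta> \<zeta> (opA a V) V \<le>
            - d / 4 * ip V V + eta1 a / 2 * (snd V 1)\<^sup>2
            + a 1 * (eta2 a \<beta> - \<eta>) / 2 * (fst V 1)\<^sup>2 + \<eta> / 2 * \<bar>snd V 1\<bar> * R"
          unfolding A_def d_def by blast
        have "\<eta> / 2 * \<bar>snd V 1\<bar> * R \<le> d / 8 * ip V V + A * \<eta>\<^sup>2 / (2 * d) * (snd V 1)\<^sup>2"
          using weighted_product_bound[OF d A R(1), of \<eta> "\<bar>snd V 1\<bar>"] by simp
        moreover have "?c * (a 1 * (snd V 1)\<^sup>2) = eta1 a / 2 * (snd V 1)\<^sup>2 + A * \<eta>\<^sup>2 / (2 * d) * (snd V 1)\<^sup>2"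
          using a1_pos by (simp add: A_def field_simps)
        ultimately show ?thesis using R(2) by (simp add: \<eta>_def)
      qed
      show "d / 4 > 0" using d by simp
      show "?c \<ge> 0" using eta1_pos damping_factor_pos d by (intro add_nonneg_nonneg) auto
      \<comment> \<open>Here the formula for \<open>M\<close> is matched exactly:
        \<open>2 * ?B + ?c\<close> equals \<open>\<kappa> * M\<close>.\<close>
      have "d / 4 * M a \<beta> = (d / 2 * M a \<beta>) / 2" by simp
      also have "\<dots> = 2 * ?B + ?c"
        unfolding M_eq[folded d_def] \<eta>_def[symmetric] by (simp add: field_simps)
      finally show "2 * ?B + ?c \<le> d / 4 * M a \<beta>" by simp
    qed
  next
    case False
    obtain K where K: "bounded_form (multiplier_form 0 \<zeta>) K" using multiplier_form_bounded[OF zL] .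
    let ?c = "eta1 a / (2 * a 1)"
    show ?thesis
    proof (rule Lyapunov_decay[OF K _ _ _ _ M_pos _ W t])
      show "\<bar>multiplier_form 0 \<zeta> V V\<bar> \<le> C2 a \<beta> / 2 * (ip V V / 2)" if "V \<in> Hsp a" for V
        using multiplier_form_energy_bound[OF zL z(4) _ that, of 0] by simp
      show "multiplier_form 0 \<zeta> V (opA a V) + multiplier_form 0 \<zeta> (opA a V) V \<le>
          - (d / 2) * (ip V V / 2) + ?c * (a 1 * (snd V 1)\<^sup>2)" if V: "V \<in> domA a \<beta>" for V
      proof -
        have "a 1 * (eta2 a \<beta> - 0) / 2 * (fst V 1)\<^sup>2 \<le> 0"
          using False a1_pos by (intro mult_nonpos_nonneg divide_nonpos_pos mult_nonneg_nonpos) auto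
        moreover have "?c * (a 1 * (snd V 1)\<^sup>2) = eta1 a / 2 * (snd V 1)\<^sup>2" using a1_pos by simp
        moreover obtain R where "multiplier_form 0 \<zeta> V (opA a V) + multiplier_form 0 \<zeta> (opA a V) V \<le>
            - d / 4 * ip V V + eta1 a / 2 * (snd V 1)\<^sup>2
            + a 1 * (eta2 a \<beta> - 0) / 2 * (fst V 1)\<^sup>2 + 0 / 2 * \<bar>snd V 1\<bar> * R"
          using inequality[OF order_refl V] unfolding d_def by blast
        ultimately show ?thesis by simp
      qed
      show "d / 2 > 0" using d by simp
      show "?c \<ge> 0" using a1_pos by (simp add: eta1_def)
      show "2 * (C2 a \<beta> / 2) + ?c \<le> d / 2 * M a \<beta>" using M_lower_bound by (simp add: d_def)
    qed
  qed
qed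

text \<open>The density argument is carried out for the norm, where the triangle inequality and the
  contraction property transfer errors linearly. One \<open>\<epsilon> / 2\<close> is lost between
  the orbits of \<open>U\<close> and \<open>W\<close>, another in replacing the norm of
  \<open>W\<close> by that of \<open>U\<close>.\<close>

lemma norm_decay:
  assumes U: "U \<in> Hsp a" and t: "t \<ge> M a \<beta>"
  shows "nH (S t U) \<le> nH U * exp ((1 - t / M a \<beta>) / 2)"
proof (rule field_le_epsilon)
  fix \<epsilon> :: real assume e: "\<epsilon> > 0"
  let ?q = "exp ((1 - t / M a \<beta>) / 2)"
  have q: "0 \<le> ?q" "?q \<le> 1" using t M_pos by auto
  have t0: "t \<ge> 0" using t M_pos by simp
  obtain W where W: "W \<in> domA a \<beta>" "nH (lincomb 1 W (-1) U) < \<epsilon> / 2"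
    using domain_dense[OF U, of "\<epsilon> / 2"] e by auto
  note H = domA_Hsp[OF W(1)]
  have "(nH (S t W))\<^sup>2 \<le> (nH W * ?q)\<^sup>2"
    using domain_decay[OF W(1) t] unfolding normH_square power_mult_distrib exp_half_square by simp
  then have dW: "nH (S t W) \<le> nH W * ?q" by (rule power2_le_imp_le) (use normH_nonneg q in simp)
  have "nH (S t U) \<le> nH (S t W) + nH (lincomb 1 (S t U) (-1) (S t W))"
    using U H t0 by (intro normH_triangle S_Hsp)
  also have "nH (lincomb 1 (S t U) (-1) (S t W)) \<le> nH (lincomb 1 U (-1) W)" using t0 U H by (rule S_diff)
  also have "\<dots> = nH (lincomb 1 W (-1) U)" using U H by (rule normH_diff_commute)
  finally have "nH (S t U) \<le> nH W * ?q + \<epsilon> / 2" using dW W(2) by linarith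
  also have "nH W * ?q \<le> (nH U + \<epsilon> / 2) * ?q"
    using normH_triangle[OF H U] W(2) q by (intro mult_right_mono) auto
  also have "(nH U + \<epsilon> / 2) * ?q + \<epsilon> / 2 \<le> nH U * ?q + \<epsilon>"
    using mult_left_mono[OF q(2), of "\<epsilon> / 2"] e unfolding distrib_right by linarith
  finally show "nH (S t U) \<le> nH U * ?q + \<epsilon>" by simp
qed

lemma energy_decay:
  assumes U: "U \<in> Hsp a" and t: "t \<ge> M a \<beta>"
  shows "ip (S t U) (S t U) \<le> ip (S 0 U) (S 0 U) * exp (1 - t / M a \<beta>)"
proof -
  have "(nH (S t U))\<^sup>2 \<le> (nH U * exp ((1 - t / M a \<beta>) / 2))\<^sup>2"
    by (rule power_mono[OF norm_decay[OF U t] normH_nonneg])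
  moreover have "nH (S 0 U) = nH U" using U by (intro normH_eqH S_Hsp S_zero) auto
  ultimately show ?thesis
    unfolding normH_square[symmetric] power_mult_distrib exp_half_square by simp
qed

end

lemma energy_ipH: "energy a \<beta> u v t = ipH a \<beta> (u t, v t) (u t, v t) / 2"
  by (simp add: energy_def ipH_def power2_eq_square mult_ac)

theorem theorem4p5:
  fixes a :: "real \<Rightarrow> real" and \<beta> :: real
  assumes "admissible a" and "\<beta> > 0"
  shows "M a \<beta> > 0 \<and>
    (\<forall>u0 u1 u v. (u0, u1) \<in> Hsp a \<longrightarrow> is_solution a \<beta> u0 u1 u v \<longrightarrow>
       (\<forall>t\<ge>M a \<beta>. energy a \<beta> u v t \<le> energy a \<beta> u v 0 * exp (1 - t / M a \<beta>)))"
proof (intro conjI allI impI)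
  interpret damped_wave a \<beta> using assms by unfold_locales
  show "M a \<beta> > 0" by (rule M_pos)
  fix u0 u1 u v t
  assume U: "(u0, u1) \<in> Hsp a" and sol: "is_solution a \<beta> u0 u1 u v" and t: "t \<ge> M a \<beta>"
  obtain S where S: "contraction_semigroup a \<beta> S" "generated_by_A a \<beta> S" "\<forall>t\<ge>0. (u t, v t) = S t (u0, u1)"
    using sol by (auto simp: is_solution_def)
  interpret damped_wave_semigroup a \<beta> S using S(1,2) by unfold_locales
  have "t \<ge> 0" using t M_pos by simp
  then show "energy a \<beta> u v t \<le> energy a \<beta> u v 0 * exp (1 - t / M a \<beta>)"
    using energy_decay[OF U t] S(3) unfolding energy_ipH by simp
qed

end
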